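(* Let $n\ge1$, $k\ge0$, $\mu_0=k(n-1)$, $\nu\in\mathbb{C}$ with $\Re\nu>2\mu_0+1$, $w\in\mathbb{C}^n$ and $x\in\mathbb{R}_+^n$. Then for every $s>0$, \[ \mathscr{E}_\nu(w,x)\Delta(x)^{\nu-\mu_0-1}=\frac{\Gamma_n(\nu)}{c_A^2\,i^n}\int_{\Re\zeta=\underline s}E^A(x,\zeta)\,E^A(w,-\tfrac1\zeta)\,\Delta(\zeta)^{-\nu}\,\omega^A(\zeta)\,d\zeta, \] \[ \mathscr{J}_\nu(w,x)\Delta(x)^{\nu-\mu_0-1}=\frac{\Gamma_n(\nu)}{c_A^2\,i^n}\int_{\Re\zeta=\underline s}J^A(x,\zeta)\,J^A(w,-\tfrac1\zeta)\,\Delta(\zeta)^{-\nu}\,\omega^A(\zeta)\,d\zeta, \] where the integrals are $n$-fold line integrals over $\zeta\in\underline s+i\mathbb{R}^n$, $\underline s=(s,\dots,s)$.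
   Context: $\mathbb{R}_+^n=]0,\infty[^n$, $\Delta(x)=x_1\cdots x_n$, $\tfrac1\zeta$ componentwise, principal complex powers. Type $A$ Dunkl operators with multiplicity $k$: $T_i^Af(x)=\partial_if(x)+k\sum_{j\ne i}\frac{f(x)-f(s_{ij}x)}{x_i-x_j}$. $E^A(\lambda,\cdot)$ is the unique holomorphic function with $T_i^AE^A(\lambda,\cdot)=\lambda_iE^A(\lambda,\cdot)$, $E^A(\lambda,0)=1$; $J^A(\lambda,z)=\frac1{n!}\sum_{\sigma\in\mathcal S_n}E^A(\lambda,\sigma z)$. $\omega^A(z)=\prod_{i<j}|z_i-z_j|^{2k}$ for $z\in\mathbb{C}^n$, $c_A=\int_{\mathbb{R}^n}e^{-|x|^2/2}\omega^A(x)dx$, $\Gamma_n(z)=c_A(2\pi)^{-n/2}\prod_{j}\Gamma(z_j-k(j-1))$, $\Gamma_n(\alpha)=\Gamma_n(\alpha,\dots,\alpha)$. With $L_\eta$, $C_\lambda$ the non-symmetric/symmetric Jack polynomials of index $1/k$ normalized by $\sum_{|\eta|=p}L_\eta=\sum_{|\lambda|=p}C_\lambda=(x_1+\dots+x_n)^p$, $\eta_+$ the partition in the orbit of $\eta$, $[\alpha]_\lambda=\Gamma_n(\underline\alpha+\lambda)/\Gamma_n(\underline\alpha)$: $\mathscr{E}_\nu(w,z)=\sum_{\eta\in\mathbb{N}_0^n}\frac{(-1)^{|\eta|}}{[\nu]_{\eta_+}}\frac{L_\eta(w)L_\eta(z)}{|\eta|!L_\eta(\underline1)}$ and $\mathscr{J}_\nu(w,z)=\sum_{\lambda}\frac{(-1)^{|\lambda|}}{[\nu]_{\lambda}}\frac{C_\lambda(w)C_\lambda(z)}{|\lambda|!C_\lambda(\underline1)}$.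 *)

theory Defs
  imports "HOL-Analysis.Analysis"
begin

text \<open>Vectors in C^n / R^n are modelled with a finite, linearly ordered index type 'n
  (the order gives the numbering 1..n of the coordinates).\<close>

definition swapv :: "'n::finite \<Rightarrow> 'n \<Rightarrow> ('a, 'n) vec \<Rightarrow> ('a, 'n) vec" where
  "swapv i j z = (\<chi> l. if l = i then z $ j else if l = j then z $ i else z $ l)"

definition permv :: "('n::finite \<Rightarrow> 'n) \<Rightarrow> ('a, 'n) vec \<Rightarrow> ('a, 'n) vec" where
  "permv \<sigma> z = (\<chi> l. z $ (inv \<sigma> l))"

definition distinct_coords :: "(complex, 'n::finite) vec \<Rightarrow> bool" where
  "distinct_coords z \<longleftrightarrow> (\<forall>i j. i \<noteq> j \<longrightarrow> z $ i \<noteq> z $ j)"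

definition cvec :: "(real, 'n::finite) vec \<Rightarrow> (complex, 'n) vec" where
  "cvec x = (\<chi> i. complex_of_real (x $ i))"

definition constv :: "'a \<Rightarrow> ('a, 'n::finite) vec" where
  "constv a = (\<chi> i. a)"

definition holo_n :: "((complex, 'n::finite) vec \<Rightarrow> complex) \<Rightarrow> bool" where
  "holo_n f \<longleftrightarrow> (\<forall>z. \<exists>A. (f has_derivative A) (at z) \<and> (\<forall>c h. A (c *s h) = c * A h))"

definition dpart :: "'n::finite \<Rightarrow> ((complex, 'n) vec \<Rightarrow> complex) \<Rightarrow> (complex, 'n) vec \<Rightarrow> complex" where
  "dpart i f z = deriv (\<lambda>t. f (\<chi> l. if l = i then t else z $ l)) (z $ i)"

text \<open>Type A Dunkl operator (at points with pairwise distinct coordinates).\<close>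
definition dunklA :: "real \<Rightarrow> 'n::finite \<Rightarrow> ((complex, 'n) vec \<Rightarrow> complex) \<Rightarrow> (complex, 'n) vec \<Rightarrow> complex" where
  "dunklA k i f z = dpart i f z
     + complex_of_real k * (\<Sum>j\<in>UNIV - {i}. (f z - f (swapv i j z)) / (z $ i - z $ j))"

definition dunkl_kernel_A :: "real \<Rightarrow> (complex, 'n::finite) vec \<Rightarrow> (complex, 'n) vec \<Rightarrow> complex" where
  "dunkl_kernel_A k lam = (THE f. holo_n f \<and> f 0 = 1 \<and>
      (\<forall>i z. distinct_coords z \<longrightarrow> dunklA k i f z = lam $ i * f z))"

definition bessel_A :: "real \<Rightarrow> (complex, 'n::finite) vec \<Rightarrow> (complex, 'n) vec \<Rightarrow> complex" where
  "bessel_A k lam z = (\<Sum>\<sigma>\<in>{\<sigma>. \<sigma> permutes (UNIV :: 'n set)}. dunkl_kernel_A k lam (permv \<sigma> z))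
      / of_nat (fact CARD('n))"

text \<open>Cherednik operators D_i = x_i T_i + k(1-i) + k sum_{j<i} s_ij, index i counted from 1.\<close>
definition cherednik :: "real \<Rightarrow> 'n::{finite,linorder} \<Rightarrow> ((complex, 'n) vec \<Rightarrow> complex) \<Rightarrow> (complex, 'n) vec \<Rightarrow> complex" where
  "cherednik k i f z = z $ i * dunklA k i f z
     - complex_of_real k * of_nat (card {j. j < i}) * f z
     + complex_of_real k * (\<Sum>j\<in>{j. j < i}. f (swapv i j z))"

definition mdeg :: "('n::finite \<Rightarrow> nat) \<Rightarrow> nat" where
  "mdeg \<eta> = (\<Sum>i\<in>UNIV. \<eta> i)"

definition multi_of_deg :: "nat \<Rightarrow> ('n::finite \<Rightarrow> nat) set" where
  "multi_of_deg p = {\<eta>. mdeg \<eta> = p}"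

text \<open>Spectral vector: eigenvalue of the Cherednik operator D_i on the
  non-symmetric Jack polynomial with leading monomial x^eta.\<close>
definition spec :: "real \<Rightarrow> ('n::{finite,linorder} \<Rightarrow> nat) \<Rightarrow> 'n \<Rightarrow> complex" where
  "spec k \<eta> i = of_nat (\<eta> i) + complex_of_real k *
      (of_nat (card {j. i < j \<and> \<eta> j < \<eta> i}) - of_nat (card {j. j < i \<and> \<eta> i < \<eta> j}))"

definition homog_poly :: "nat \<Rightarrow> ((complex, 'n::finite) vec \<Rightarrow> complex) \<Rightarrow> bool" where
  "homog_poly p f \<longleftrightarrow> (\<exists>c. f = (\<lambda>z. \<Sum>\<alpha>\<in>multi_of_deg p. c \<alpha> * (\<Prod>i\<in>UNIV. z $ i ^ \<alpha> i)))"

text \<open>Non-symmetric Jack polynomials L_eta of index 1/k: joint eigenfunctions of the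
  Cherednik operators, normalized by sum_{|eta|=p} L_eta = (x_1+...+x_n)^p.\<close>
definition nsjack :: "real \<Rightarrow> ('n::{finite,linorder} \<Rightarrow> nat) \<Rightarrow> (complex, 'n) vec \<Rightarrow> complex" where
  "nsjack k = (THE L. (\<forall>\<eta>. homog_poly (mdeg \<eta>) (L \<eta>) \<and>
        (\<forall>i z. distinct_coords z \<longrightarrow> cherednik k i (L \<eta>) z = spec k \<eta> i * L \<eta> z)) \<and>
      (\<forall>p z. (\<Sum>\<eta>\<in>multi_of_deg p. L \<eta> z) = (\<Sum>i\<in>UNIV. z $ i) ^ p))"

definition part :: "('n::{finite,linorder} \<Rightarrow> nat) \<Rightarrow> nat list" where
  "part \<eta> = rev (sort (map \<eta> (sorted_list_of_set (UNIV :: 'n set))))"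

definition partitions_of :: "'n::{finite,linorder} itself \<Rightarrow> nat \<Rightarrow> nat list set" where
  "partitions_of _ p = part ` (multi_of_deg p :: ('n \<Rightarrow> nat) set)"

definition sjack :: "real \<Rightarrow> 'n::{finite,linorder} itself \<Rightarrow> nat list \<Rightarrow> (complex, 'n) vec \<Rightarrow> complex" where
  "sjack k T = (THE C. (\<forall>lm. (\<forall>\<sigma> z. \<sigma> permutes (UNIV :: 'n set) \<longrightarrow>
              C lm (permv \<sigma> z) = C lm z) \<and>
          (\<exists>a. C lm = (\<lambda>z. \<Sum>\<eta>\<in>{\<eta>. part \<eta> = lm}. a \<eta> * nsjack k \<eta> z))) \<and>
      (\<forall>p z. (\<Sum>lm\<in>partitions_of T p. C lm z) = (\<Sum>i\<in>UNIV. z $ i) ^ p))"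

definition omegaA :: "real \<Rightarrow> (complex, 'n::{finite,linorder}) vec \<Rightarrow> real" where
  "omegaA k z = (\<Prod>(i,j)\<in>{(i,j). i < j}. cmod (z $ i - z $ j) powr (2 * k))"

definition cA :: "real \<Rightarrow> 'n::{finite,linorder} itself \<Rightarrow> real" where
  "cA k _ = integral\<^sup>L lborel (\<lambda>x::(real, 'n) vec. exp (- (norm x)\<^sup>2 / 2) * omegaA k (cvec x))"

text \<open>Gamma_n(z_1,...,z_n) = c_A (2 pi)^(-n/2) prod_j Gamma(z_j - k(j-1)); argument as a list
  of length n, entry j (0-based) corresponds to z_{j+1}.\<close>
definition gamma_n :: "real \<Rightarrow> 'n::{finite,linorder} itself \<Rightarrow> complex list \<Rightarrow> complex" where
  "gamma_n k T zs = complex_of_real (cA k T * (2 * pi) powr (- real CARD('n) / 2)) *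
      (\<Prod>j<CARD('n). Gamma (zs ! j - complex_of_real (k * real j)))"

definition gamma_n1 :: "real \<Rightarrow> 'n::{finite,linorder} itself \<Rightarrow> complex \<Rightarrow> complex" where
  "gamma_n1 k T a = gamma_n k T (replicate CARD('n) a)"

definition gpoch :: "real \<Rightarrow> 'n::{finite,linorder} itself \<Rightarrow> complex \<Rightarrow> nat list \<Rightarrow> complex" where
  "gpoch k T a lm = gamma_n k T (map (\<lambda>l. a + of_nat l) lm) / gamma_n1 k T a"

definition scrE :: "real \<Rightarrow> complex \<Rightarrow> (complex, 'n::{finite,linorder}) vec \<Rightarrow> (complex, 'n) vec \<Rightarrow> complex" where
  "scrE k \<nu> w z = (\<Sum>p. \<Sum>\<eta>\<in>multi_of_deg p.
      (-1) ^ p / gpoch k TYPE('n) \<nu> (part \<eta>) *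
      (nsjack k \<eta> w * nsjack k \<eta> z / (of_nat (fact p) * nsjack k \<eta> (constv 1))))"

definition scrJ :: "real \<Rightarrow> complex \<Rightarrow> (complex, 'n::{finite,linorder}) vec \<Rightarrow> (complex, 'n) vec \<Rightarrow> complex" where
  "scrJ k \<nu> w z = (\<Sum>p. \<Sum>lm\<in>partitions_of TYPE('n) p.
      (-1) ^ p / gpoch k TYPE('n) \<nu> lm *
      (sjack k TYPE('n) lm w * sjack k TYPE('n) lm z /
         (of_nat (fact p) * sjack k TYPE('n) lm (constv 1))))"

definition Delta_pow :: "(complex, 'n::finite) vec \<Rightarrow> complex \<Rightarrow> complex" where
  "Delta_pow z a = (\<Prod>i\<in>UNIV. z $ i powr a)"

text \<open>n-fold line integral over Re zeta = (s,...,s): zeta = s + i t, d zeta = i^n dt.\<close>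
definition line_integral_n :: "real \<Rightarrow> ((complex, 'n::finite) vec \<Rightarrow> complex) \<Rightarrow> complex" where
  "line_integral_n s F = \<i> ^ CARD('n) *
      integral\<^sup>L lborel (\<lambda>t::(real, 'n) vec. F (\<chi> i. complex_of_real s + \<i> * complex_of_real (t $ i)))"

definition cinvv :: "(complex, 'n::finite) vec \<Rightarrow> (complex, 'n) vec" where
  "cinvv z = (\<chi> i. 1 / z $ i)"

end

theory Submission
  imports Defs "HOL-Complex_Analysis.Cauchy_Integral_Formula" "HOL-Library.Function_Algebras" "HOL-Real_Asymp.Real_Asymp"
begin

text \<open>
  Put \<open>\<Phi>\<^sub>q(x) = \<integral> E\<^sup>A(x, \<zeta>) q(1/\<zeta>) \<Delta>(\<zeta>)\<^bsup>-\<nu>\<^esup> \<omega>\<^sup>A(\<zeta>) d\<zeta>\<close>. Since \<open>x\<^sub>i E\<^sup>A(x, \<zeta>) = T\<^sub>i E\<^sup>A(x, \<zeta>)\<close> as a function of \<open>\<zeta>\<close>,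
  integration by parts for the Dunkl operators gives \<open>x\<^sub>i \<Phi>\<^sub>q = (\<nu> + e\<^sub>i) \<Phi>\<^bsub>z\<^sub>i q\<^esub>\<close> for the last index \<open>i\<close> and a
  non-symmetric Jack polynomial \<open>q\<close> with spectral value \<open>e\<^sub>i\<close>. Together with the equivariance
  of \<open>\<Phi>\<close> under permutations and the raising operator this yields
  \<open>\<Phi>\<^sub>q(x) = q(x) \<Phi>\<^sub>1(x) / [\<nu>]\<^sub>\<eta>\<close> for \<open>q = L\<^sub>\<eta>\<close>, and the expansion of \<open>E\<^sup>A(w, -1/\<zeta>)\<close> into Jack polynomials can be integrated
  term by term. The same relation for \<open>q = 1\<close>, combined with \<open>T\<^sub>i \<Phi>\<^bsub>z\<^sub>i\<^esub> = \<Phi>\<^sub>1\<close>, shows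
  \<open>\<Phi>\<^sub>1(x) = a \<Delta>(x)\<^bsup>\<nu>-\<mu>\<^sub>0-1\<^esup>\<close>.

  The constant is \<open>a = (2\<pi>)\<^bsup>n/2\<^esup> c\<^sub>A / \<Prod>\<^sub>j \<Gamma>(\<nu> - k(j-1))\<close>: the quantity \<open>a \<Prod>\<^sub>j \<Gamma>(\<nu> - k(j-1))\<close> does not depend on \<open>s\<close> and is
  invariant under \<open>\<nu> \<mapsto> \<nu> + 1\<close>; for \<open>\<nu> + m\<close> in place of \<open>\<nu>\<close>, \<open>s = m\<close> and \<open>\<zeta> = m + i \<surd>m u\<close> the integrand
  converges, after division by the asymptotics of the Gamma function, to \<open>exp(-|u|\<^sup>2/2) \<omega>\<^sup>A(u)\<close>. The symmetric formula follows from the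
  non-symmetric one by averaging over permutations of both arguments.
\<close>


subsection \<open>Permuted and updated coordinates\<close>

text \<open>The kernel and both families of Jack polynomials are given by \<open>THE\<close>, so
  their existence and uniqueness must be supplied too. One construction serves for all: Jack
  polynomials with value 1 at (1,...,1) are built by raising operator and intertwiners, and the
  kernel is their generating series. The induction for \<Phi> retraces this construction, so its
  Gamma product grows factor by factor.

  The last index is singled out because only there do the reflections in the Cherednik operator run
  over all other coordinates, as the substitution 1/\<zeta> in the Dunkl operator requires.

  The series bound exp(|w| |\<zeta>|) of the kernel is useless on a vertical plane; an energy
  estimate gives, for real x, a bound by Re \<zeta> alone. The weight grows like
  |\<zeta>_i|^(2k(n-1)) in each coordinate, whence Re \<nu> > 2\<mu>_0 + 1, and it can fail to be
  differentiable where coordinates coincide.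

  Independence of s needs no contour shift: scaling the plane amounts to scaling x, and \<Phi>_1 is
  a power of \<Delta>. The shift \<nu> -> \<nu> + 1 comes from \<Delta> being the Jack polynomial of
  (1,...,1).\<close>

definition pv :: "('n \<Rightarrow> 'n) \<Rightarrow> ('a, 'n::finite) vec \<Rightarrow> ('a, 'n) vec" where
  "pv \<sigma> z = (\<chi> l. z $ \<sigma> l)"

definition cu :: "'n \<Rightarrow> 'a \<Rightarrow> ('a, 'n::finite) vec \<Rightarrow> ('a, 'n) vec" where
  "cu i t z = (\<chi> l. if l = i then t else z $ l)"

abbreviation tr :: "'a \<Rightarrow> 'a \<Rightarrow> 'a \<Rightarrow> 'a" where "tr \<equiv> Transposition.transpose"

lemma pv_nth [simp]: "pv \<sigma> z $ l = z $ \<sigma> l"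
  by (simp add: pv_def)

lemma cu_nth [simp]: "cu i t z $ l = (if l = i then t else z $ l)"
  by (simp add: cu_def)

lemma cu_same [simp]: "cu i (z $ i) z = z"
  by (simp add: vec_eq_iff)

lemma cu_cu [simp]: "cu i s (cu i t z) = cu i s z"
  by (simp add: vec_eq_iff)

lemma pv_id [simp]: "pv id z = z" "pv (\<lambda>x. x) z = z"
  by (simp_all add: vec_eq_iff)

lemma pv_pv: "pv \<sigma> (pv \<tau> z) = pv (\<tau> \<circ> \<sigma>) z"
  by (simp add: vec_eq_iff)

lemma swapv_pv: "swapv i j z = pv (tr i j) z"
  by (simp add: vec_eq_iff swapv_def Transposition.transpose_def)

lemma permv_pv: "permv \<sigma> z = pv (inv \<sigma>) z"
  by (simp add: vec_eq_iff permv_def)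

lemma pv_constv [simp]: "pv \<sigma> (constv c) = constv c"
  by (simp add: vec_eq_iff constv_def)

lemma pv_scaleR: "pv \<sigma> (c *\<^sub>R z) = c *\<^sub>R pv \<sigma> z"
  by (simp add: vec_eq_iff)

lemma swapv_swapv [simp]: "swapv i j (swapv i j z) = z"
  by (simp add: vec_eq_iff swapv_def)

lemma swapv_commute: "swapv i j z = swapv j i z"
  by (auto simp: vec_eq_iff swapv_def)

lemma swapv_nth [simp]: "swapv i j z $ i = z $ j" "swapv i j z $ j = z $ i"
  by (auto simp: swapv_def)

lemma pv_cu:
  assumes "inj \<sigma>"
  shows "pv \<sigma> (cu (\<sigma> l) t z) = cu l t (pv \<sigma> z)"
  using assms by (auto simp: vec_eq_iff inj_eq)

lemma pv_swapv:
  assumes "inj \<sigma>"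
  shows "pv \<sigma> (swapv (\<sigma> l) (\<sigma> m) z) = swapv l m (pv \<sigma> z)"
  using assms by (auto simp: vec_eq_iff swapv_def inj_eq)

lemma distinct_coords_pv:
  assumes "bij \<sigma>"
  shows "distinct_coords (pv \<sigma> z) \<longleftrightarrow> distinct_coords z"
proof
  assume a: "distinct_coords (pv \<sigma> z)"
  show "distinct_coords z"
    unfolding distinct_coords_def
  proof (intro allI impI)
    fix i j :: 'a assume "i \<noteq> j"
    obtain a b where ab: "i = \<sigma> a" "j = \<sigma> b" using assms by (meson bij_pointE)
    have "a \<noteq> b" using \<open>i \<noteq> j\<close> ab by auto
    thus "z $ i \<noteq> z $ j" using a unfolding ab distinct_coords_def by auto
  qed
next
  assume "distinct_coords z"
  thus "distinct_coords (pv \<sigma> z)" using assms unfolding distinct_coords_def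
    by (simp add: bij_is_inj inj_eq)
qed

lemma distinct_coords_swapv [simp]: "distinct_coords (swapv i j z) \<longleftrightarrow> distinct_coords z"
  unfolding swapv_pv by (rule distinct_coords_pv) simp

lemma distinct_coords_scaleR:
  "distinct_coords z \<Longrightarrow> t \<noteq> 0 \<Longrightarrow> distinct_coords (t *\<^sub>R z)"
  by (simp add: distinct_coords_def)

lemma bounded_linear_pv: "bounded_linear (pv \<sigma> :: (complex,'n::finite) vec \<Rightarrow> _)"
  by (intro linear_conv_bounded_linear[THEN iffD1] linearI) (auto simp: vec_eq_iff)

lemma continuous_on_pv [continuous_intros]:
  "continuous_on S f \<Longrightarrow> continuous_on S (\<lambda>x. pv \<sigma> (f x :: ('a::topological_space,'n::finite) vec))"
  unfolding pv_def by (intro continuous_intros)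

lemma cu_conv: "cu i t z = z + (t - z $ i) *s axis i (1::complex)"
  by (auto simp: vec_eq_iff axis_def)

subsection \<open>Entire functions of several variables\<close>

text \<open>Complex homogeneity of the total derivative \<open>A\<close> makes its restriction to a
  coordinate line multiplication by \<open>A (axis i 1)\<close>, that is, a complex derivative in
  this coordinate.\<close>

lemma holo_n_dpart_aux:
  fixes f :: "(complex,'n::finite) vec \<Rightarrow> complex"
  assumes "(f has_derivative A) (at z)" "\<forall>c h. A (c *s h) = c * A h"
  shows "((\<lambda>t. f (cu i t z)) has_field_derivative A (axis i 1)) (at (z $ i))"
proof -
  have bl: "bounded_linear (\<lambda>h::complex. h *s axis i (1::complex) :: (complex,'n::finite) vec)"
    by (intro linear_conv_bounded_linear[THEN iffD1] linearI)
       (auto simp: vec_eq_iff axis_def algebra_simps)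
  have "((\<lambda>t. cu i t z) has_derivative (\<lambda>h. h *s axis i (1::complex))) (at (z $ i))"
    unfolding cu_conv vector_sub_rdistrib add_diff_eq
    using bounded_linear_imp_has_derivative[OF bl, of "at (z $ i)"]
    by (auto intro!: derivative_eq_intros)
  moreover have "(f has_derivative A) (at (cu i (z $ i) z))" using assms by simp
  ultimately have "((\<lambda>t. f (cu i t z)) has_derivative (\<lambda>h. A (h *s axis i 1))) (at (z $ i))"
    by (rule has_derivative_compose)
  thus ?thesis unfolding has_field_derivative_def
    by (rule has_derivative_eq_rhs) (use assms(2) in \<open>auto simp: fun_eq_iff\<close>)
qed

lemma dpart_eqI:
  assumes "(f has_derivative A) (at z)" "\<forall>c h. A (c *s h) = c * A h"
  shows "dpart i f z = A (axis i 1)"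
  unfolding dpart_def cu_def[symmetric]
  by (rule DERIV_imp_deriv[OF holo_n_dpart_aux[OF assms]])

lemma holo_n_has_derivative:
  fixes f :: "(complex,'n::finite) vec \<Rightarrow> complex"
  assumes "holo_n f"
  shows "(f has_derivative (\<lambda>h. \<Sum>i\<in>UNIV. h $ i * dpart i f z)) (at z)"
proof -
  obtain A where A: "(f has_derivative A) (at z)" "\<forall>c h. A (c *s h) = c * A h"
    using assms unfolding holo_n_def by blast
  have lin: "linear A" using A(1) has_derivative_linear by blast
  have "A h = (\<Sum>i\<in>UNIV. h $ i * dpart i f z)" for h
  proof -
    have "A h = A (\<Sum>i\<in>UNIV. h $ i *s axis i 1)" by (simp add: basis_expansion)
    also have "\<dots> = (\<Sum>i\<in>UNIV. A (h $ i *s axis i 1))" by (rule linear_sum[OF lin])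
    also have "\<dots> = (\<Sum>i\<in>UNIV. h $ i * dpart i f z)"
      using A(2) dpart_eqI[OF A] by simp
    finally show ?thesis .
  qed
  thus ?thesis using A(1) by (metis (no_types, lifting) ext)
qed

lemma holo_n_partial:
  assumes "holo_n f"
  shows "((\<lambda>t. f (cu i t z)) has_field_derivative dpart i f (cu i u z)) (at u)"
proof -
  obtain A where A: "(f has_derivative A) (at (cu i u z))" "\<forall>c h. A (c *s h) = c * A h"
    using assms unfolding holo_n_def by blast
  show ?thesis using holo_n_dpart_aux[OF A, of i] dpart_eqI[OF A] by simp
qed

lemma holo_nI:
  assumes "\<And>z. (f has_derivative A z) (at z)" "\<And>z c h. A z (c *s h) = c * A z h"
  shows "holo_n f"
  using assms unfolding holo_n_def by blast

lemma holo_n_const [intro]: "holo_n (\<lambda>z. c)"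
  by (rule holo_nI[where A="\<lambda>_ _. 0"]) auto

lemma holo_n_nth [intro]: "holo_n (\<lambda>z. z $ i)"
  by (rule holo_nI[where A="\<lambda>_ h. h $ i"])
     (auto intro!: bounded_linear_imp_has_derivative bounded_linear_vec_nth)

lemma holo_n_add [intro]:
  assumes "holo_n f" "holo_n g"
  shows "holo_n (\<lambda>z. f z + g z)"
  by (rule holo_nI, rule has_derivative_add[OF holo_n_has_derivative[OF assms(1)] holo_n_has_derivative[OF assms(2)]])
     (simp add: sum_distrib_left algebra_simps)

lemma holo_n_mult [intro]:
  assumes "holo_n f" "holo_n g"
  shows "holo_n (\<lambda>z. f z * g z)"
  by (rule holo_nI, rule has_derivative_mult[OF holo_n_has_derivative[OF assms(1)] holo_n_has_derivative[OF assms(2)]])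
     (simp add: sum_distrib_left sum_distrib_right algebra_simps)

lemma holo_n_diff [intro]:
  assumes "holo_n f" "holo_n g"
  shows "holo_n (\<lambda>z. f z - g z)"
  using holo_n_add[OF assms(1) holo_n_mult[OF holo_n_const[of "-1"] assms(2)]] by simp

lemma holo_n_sum [intro]:
  assumes "\<And>i. i \<in> I \<Longrightarrow> holo_n (f i)"
  shows "holo_n (\<lambda>z. \<Sum>i\<in>I. f i z)"
  using assms by (induction I rule: infinite_finite_induct) auto

lemma holo_n_prod [intro]:
  assumes "\<And>i. i \<in> I \<Longrightarrow> holo_n (f i)"
  shows "holo_n (\<lambda>z. \<Prod>i\<in>I. f i z)"
  using assms by (induction I rule: infinite_finite_induct) auto

lemma holo_n_power [intro]: "holo_n f \<Longrightarrow> holo_n (\<lambda>z. f z ^ m)"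
  by (induction m) auto

lemma holo_n_pv [intro]:
  assumes "holo_n f"
  shows "holo_n (\<lambda>z. f (pv \<sigma> z))"
  by (rule holo_nI, rule has_derivative_compose[OF bounded_linear_imp_has_derivative[OF bounded_linear_pv]
        holo_n_has_derivative[OF assms]])
     (simp add: sum_distrib_left mult.assoc)

lemma holo_n_continuous: "holo_n f \<Longrightarrow> continuous_on S f"
  by (meson holo_n_has_derivative has_derivative_continuous continuous_at_imp_continuous_on)

lemma dpart_add:
  assumes "holo_n f" "holo_n g"
  shows "dpart i (\<lambda>z. f z + g z) z = dpart i f z + dpart i g z"
  using DERIV_add[OF holo_n_partial[OF assms(1), of i z "z $ i"] holo_n_partial[OF assms(2), of i z "z $ i"]]
  unfolding dpart_def[of i "\<lambda>z. f z + g z"] cu_def[symmetric] by (simp add: DERIV_imp_deriv)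

lemma dpart_mult:
  assumes "holo_n f" "holo_n g"
  shows "dpart i (\<lambda>z. f z * g z) z = dpart i f z * g z + f z * dpart i g z"
  using DERIV_mult[OF holo_n_partial[OF assms(1), of i z "z $ i"] holo_n_partial[OF assms(2), of i z "z $ i"]]
  unfolding dpart_def[of i "\<lambda>z. f z * g z"] cu_def[symmetric] by (simp add: DERIV_imp_deriv algebra_simps)

lemma dpart_const [simp]: "dpart i (\<lambda>z. c) z = 0"
  by (simp add: dpart_def)

lemma dpart_nth: "dpart i (\<lambda>z. z $ j) z = (if i = j then 1 else 0)"
  by (auto simp: dpart_def)

lemma dpart_cmult:
  assumes "holo_n f"
  shows "dpart i (\<lambda>z. c * f z) z = c * dpart i f z"
  using dpart_mult[OF holo_n_const assms, of i c z] by simp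

lemma dunklA_const [simp]: "dunklA k i (\<lambda>z. c) z = 0"
  by (simp add: dunklA_def)

lemma dunklA_add:
  assumes "holo_n f" "holo_n g"
  shows "dunklA k i (\<lambda>z. f z + g z) z = dunklA k i f z + dunklA k i g z"
proof -
  have "(f z + g z - (f (swapv i j z) + g (swapv i j z))) / (z $ i - z $ j)
      = (f z - f (swapv i j z)) / (z $ i - z $ j) + (g z - g (swapv i j z)) / (z $ i - z $ j)" for j
    by (simp add: add_divide_distrib[symmetric])
  thus ?thesis unfolding dunklA_def dpart_add[OF assms] by (simp add: sum.distrib algebra_simps)
qed

lemma dunklA_cmult:
  assumes "holo_n f"
  shows "dunklA k i (\<lambda>z. c * f z) z = c * dunklA k i f z"
proof -
  have "(c * f z - c * f (swapv i j z)) / (z $ i - z $ j)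
      = c * ((f z - f (swapv i j z)) / (z $ i - z $ j))" for j
    by (simp add: right_diff_distrib)
  thus ?thesis unfolding dunklA_def dpart_cmult[OF assms]
    by (simp only: sum_distrib_left[symmetric] distrib_left mult.left_commute)
qed

lemma dunklA_sum:
  assumes "\<And>x. x \<in> I \<Longrightarrow> holo_n (f x)"
  shows "dunklA k i (\<lambda>z. \<Sum>x\<in>I. c x * f x z) z = (\<Sum>x\<in>I. c x * dunklA k i (f x) z)"
  using assms
proof (induction I rule: infinite_finite_induct)
  case (insert x I)
  have h: "holo_n (\<lambda>z. c x * f x z)" "holo_n (\<lambda>z. \<Sum>x\<in>I. c x * f x z)"
    using insert by (auto intro!: holo_n_sum)
  show ?case using insert dunklA_add[OF h, of k i z] dunklA_cmult[of "f x" k i "c x" z] by simp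
qed auto

text \<open>Equivariance: the permutation carries the coordinate line and the reflections of index
  \<open>l\<close> to those of index \<open>\<sigma> l\<close>.\<close>

lemma dunklA_pv:
  assumes "bij \<sigma>"
  shows "dunklA k (\<sigma> l) (\<lambda>z. f (pv \<sigma> z)) z = dunklA k l f (pv \<sigma> z)"
proof -
  have inj: "inj \<sigma>" using assms bij_is_inj by blast
  have 1: "dpart (\<sigma> l) (\<lambda>z. f (pv \<sigma> z)) z = dpart l f (pv \<sigma> z)"
    unfolding dpart_def cu_def[symmetric] pv_cu[OF inj] by simp
  have "(\<Sum>j\<in>UNIV - {\<sigma> l}. (f (pv \<sigma> z) - f (pv \<sigma> (swapv (\<sigma> l) j z))) / (z $ \<sigma> l - z $ j))
     = (\<Sum>m\<in>UNIV - {l}. (f (pv \<sigma> z) - f (pv \<sigma> (swapv (\<sigma> l) (\<sigma> m) z))) / (z $ \<sigma> l - z $ \<sigma> m))"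
  proof (rule sum.reindex_bij_betw[symmetric])
    show "bij_betw \<sigma> (UNIV - {l}) (UNIV - {\<sigma> l})"
      using assms by (metis bij_betw_DiffI bij_betw_singletonI singletonI bij_betw_def image_insert image_empty bij_is_inj inj_on_subset subset_UNIV empty_subsetI insert_subset)
  qed
  also have "\<dots> = (\<Sum>j\<in>UNIV - {l}. (f (pv \<sigma> z) - f (swapv l j (pv \<sigma> z))) / (pv \<sigma> z $ l - pv \<sigma> z $ j))"
    unfolding pv_swapv[OF inj] by simp
  finally show ?thesis unfolding dunklA_def 1 by simp
qed

text \<open>The commutator [T_i, z_i] = 1 + k sum_{j \<noteq> i} s_ij. Its constant 1 is the source
  of the increment by one under the raising operator.\<close>

lemma dunklA_nth_mult_same:
  assumes "holo_n f" "distinct_coords z"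
  shows "dunklA k i (\<lambda>z. z $ i * f z) z
     = f z + z $ i * dunklA k i f z + k * (\<Sum>j\<in>UNIV-{i}. f (swapv i j z))"
proof -
  have "(z $ i * f z - swapv i j z $ i * f (swapv i j z)) / (z $ i - z $ j)
      = z $ i * ((f z - f (swapv i j z)) / (z $ i - z $ j)) + f (swapv i j z)" if "j \<in> UNIV - {i}" for j
  proof -
    have "z $ i - z $ j \<noteq> 0" using that assms(2) unfolding distinct_coords_def by auto
    thus ?thesis by (simp add: divide_simps) (simp add: algebra_simps)
  qed
  hence "(\<Sum>j\<in>UNIV-{i}. (z $ i * f z - swapv i j z $ i * f (swapv i j z)) / (z $ i - z $ j))
       = z $ i * (\<Sum>j\<in>UNIV-{i}. (f z - f (swapv i j z)) / (z $ i - z $ j)) + (\<Sum>j\<in>UNIV-{i}. f (swapv i j z))"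
    by (simp add: sum.distrib sum_distrib_left)
  thus ?thesis unfolding dunklA_def dpart_mult[OF holo_n_nth assms(1)] dpart_nth
    by (simp add: algebra_simps)
qed

text \<open>The commutator [T_i, z_a] = -k s_ia: among the reflections occurring in T_i, only the
  one exchanging i and a moves the factor z_a.\<close>

lemma dunklA_nth_mult_diff:
  assumes "holo_n f" "distinct_coords z" "a \<noteq> i"
  shows "dunklA k i (\<lambda>z. z $ a * f z) z = z $ a * dunklA k i f z - k * f (swapv i a z)"
proof -
  have "(z $ a * f z - swapv i j z $ a * f (swapv i j z)) / (z $ i - z $ j)
      = z $ a * ((f z - f (swapv i j z)) / (z $ i - z $ j)) + (if j = a then - f (swapv i j z) else 0)"
    if "j \<in> UNIV - {i}" for j
  proof -
    have "z $ i - z $ j \<noteq> 0" using that assms(2) unfolding distinct_coords_def by auto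
    moreover have "swapv i j z $ a = (if j = a then z $ i else z $ a)" using assms(3) by (auto simp: swapv_def)
    ultimately show ?thesis by (simp add: divide_simps) (simp add: algebra_simps)
  qed
  hence "(\<Sum>j\<in>UNIV-{i}. (z $ a * f z - swapv i j z $ a * f (swapv i j z)) / (z $ i - z $ j))
       = z $ a * (\<Sum>j\<in>UNIV-{i}. (f z - f (swapv i j z)) / (z $ i - z $ j))
         + (\<Sum>j\<in>UNIV-{i}. if j = a then - f (swapv i j z) else 0)"
    by (simp add: sum.distrib sum_distrib_left)
  also have "(\<Sum>j\<in>UNIV-{i}. if j = a then - f (swapv i j z) else 0) = - f (swapv i a z)"
    using assms(3) by (subst sum.delta) auto
  finally have 2: "(\<Sum>j\<in>UNIV-{i}. (z $ a * f z - swapv i j z $ a * f (swapv i j z)) / (z $ i - z $ j))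
       = z $ a * (\<Sum>j\<in>UNIV-{i}. (f z - f (swapv i j z)) / (z $ i - z $ j)) - f (swapv i a z)" by simp
  show ?thesis unfolding dunklA_def dpart_mult[OF holo_n_nth assms(1)] dpart_nth 2 using assms(3)
    by (simp add: algebra_simps)
qed

subsection \<open>The energy estimate\<close>

lemma sum_off_diag_swap:
  fixes g :: "'n::finite \<Rightarrow> 'n \<Rightarrow> 'b::comm_monoid_add"
  shows "(\<Sum>i\<in>UNIV. \<Sum>j\<in>UNIV-{i}. g i j) = (\<Sum>i\<in>UNIV. \<Sum>j\<in>UNIV-{i}. g j i)"
proof -
  have e: "(\<Sum>i\<in>UNIV. \<Sum>j\<in>UNIV-{i}. h i j) = (\<Sum>i\<in>UNIV. \<Sum>j\<in>UNIV. if i \<noteq> j then h i j else 0)"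
    for h :: "'n \<Rightarrow> 'n \<Rightarrow> 'b"
    by (intro sum.cong refl sum.mono_neutral_cong_left) auto
  show ?thesis unfolding e by (subst sum.swap) (auto intro!: sum.cong)
qed

text \<open>Symmetrising the reflection part in (i,j): y_i/(y_i - y_j) + y_j/(y_j - y_i) = 1, so the
  denominators disappear from the Euler operator.\<close>

lemma euler_dunkl:
  fixes f :: "(complex,'n::finite) vec \<Rightarrow> complex"
  assumes "distinct_coords y"
  shows "(\<Sum>i\<in>UNIV. y $ i * dpart i f y) = (\<Sum>i\<in>UNIV. y $ i * dunklA k i f y)
      - of_real k / 2 * (\<Sum>i\<in>UNIV. \<Sum>j\<in>UNIV-{i}. f y - f (swapv i j y))"
proof -
  define a where "a = (\<lambda>(i::'n) j. f y - f (swapv i j y))"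
  have asym: "a i j = a j i" for i j by (simp add: a_def swapv_commute)
  define S where "S = (\<Sum>i\<in>UNIV. \<Sum>j\<in>UNIV-{i}. y $ i * a i j / (y $ i - y $ j))"
  have "S = (\<Sum>i\<in>UNIV. \<Sum>j\<in>UNIV-{i}. y $ j * a i j / (y $ j - y $ i))"
    unfolding S_def by (subst sum_off_diag_swap) (use asym in \<open>auto intro!: sum.cong\<close>)
  hence "2 * S = (\<Sum>i\<in>UNIV. \<Sum>j\<in>UNIV-{i}. y $ i * a i j / (y $ i - y $ j) + y $ j * a i j / (y $ j - y $ i))"
    unfolding S_def by (simp add: sum.distrib)
  also have "\<dots> = (\<Sum>i\<in>UNIV. \<Sum>j\<in>UNIV-{i}. a i j)"
  proof (intro sum.cong refl)
    fix i j :: 'n assume "j \<in> UNIV - {i}"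
    hence "y $ i - y $ j \<noteq> 0" "y $ j - y $ i \<noteq> 0" using assms unfolding distinct_coords_def by auto
    thus "y $ i * a i j / (y $ i - y $ j) + y $ j * a i j / (y $ j - y $ i) = a i j"
      by (simp add: divide_simps) (simp add: algebra_simps)
  qed
  finally have S: "S = (\<Sum>i\<in>UNIV. \<Sum>j\<in>UNIV-{i}. a i j) / 2"
    by (metis nonzero_mult_div_cancel_left zero_neq_numeral)
  have "(\<Sum>i\<in>UNIV. y $ i * dunklA k i f y) = (\<Sum>i\<in>UNIV. y $ i * dpart i f y) + k * S"
    unfolding S_def dunklA_def a_def
    by (simp add: sum.distrib algebra_simps sum_distrib_left)
  thus ?thesis unfolding S a_def by (simp add: algebra_simps)
qed

text \<open>The derivative of the orbit sum of \<open>|f|\<^sup>2\<close> along the ray through \<open>z\<close> is at most \<open>2 M\<close> times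
  that sum: by \<open>k \<ge> 0\<close> the reflection terms have a favourable sign.\<close>
lemma dunkl_energy:
  fixes f :: "(complex,'n::finite) vec \<Rightarrow> complex"
  assumes k: "k \<ge> 0" and f: "holo_n f"
    and eig: "\<And>i z. distinct_coords z \<Longrightarrow> dunklA k i f z = lam $ i * f z"
    and z: "distinct_coords z"
    and M: "\<And>\<sigma>. \<sigma> permutes UNIV \<Longrightarrow> Re (\<Sum>i\<in>UNIV. lam $ i * z $ \<sigma> i) \<le> M"
  shows "(\<Sum>\<sigma> | \<sigma> permutes UNIV. (cmod (f (pv \<sigma> z)))\<^sup>2)
         \<le> fact CARD('n) * (cmod (f 0))\<^sup>2 * exp (2 * M)"
proof -
  define P where "P = {\<sigma>::'n \<Rightarrow> 'n. \<sigma> permutes UNIV}"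
  have finP: "finite P" unfolding P_def by (rule finite_permutations) simp
  define G where "G = (\<lambda>\<sigma> t. f (t *\<^sub>R pv \<sigma> z))"
  define G' where "G' = (\<lambda>\<sigma> t. \<Sum>i\<in>UNIV. pv \<sigma> z $ i * dpart i f (t *\<^sub>R pv \<sigma> z))"
  have dG: "(G \<sigma> has_vector_derivative G' \<sigma> t) (at t)" for \<sigma> t
  proof -
    have "((\<lambda>t. t *\<^sub>R pv \<sigma> z) has_derivative (\<lambda>h. h *\<^sub>R pv \<sigma> z)) (at t)"
      by (auto intro!: derivative_eq_intros)
    from has_derivative_compose[OF this holo_n_has_derivative[OF f]]
    show ?thesis unfolding G_def G'_def has_vector_derivative_def
      by (rule has_derivative_eq_rhs) (simp add: fun_eq_iff scaleR_sum_right)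
  qed
  define N where "N = (\<lambda>t. \<Sum>\<sigma>\<in>P. G \<sigma> t \<bullet> G \<sigma> t)"
  have dN: "(N has_real_derivative (\<Sum>\<sigma>\<in>P. 2 * (G \<sigma> t \<bullet> G' \<sigma> t))) (at t)" for t
    unfolding N_def
  proof (rule DERIV_sum)
    fix \<sigma>
    have "((\<lambda>t. G \<sigma> t \<bullet> G \<sigma> t) has_derivative (\<lambda>h. G \<sigma> t \<bullet> (h *\<^sub>R G' \<sigma> t) + (h *\<^sub>R G' \<sigma> t) \<bullet> G \<sigma> t)) (at t)"
      using dG[of \<sigma> t] unfolding has_vector_derivative_def by (intro has_derivative_inner)
    thus "((\<lambda>t. G \<sigma> t \<bullet> G \<sigma> t) has_real_derivative 2 * (G \<sigma> t \<bullet> G' \<sigma> t)) (at t)"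
      unfolding has_field_derivative_def
      by (rule has_derivative_eq_rhs) (simp add: fun_eq_iff inner_commute)
  qed
  have bd: "(\<Sum>\<sigma>\<in>P. G \<sigma> t \<bullet> G' \<sigma> t) \<le> M * N t" if t: "t > 0" for t
  proof -
    have summand: "t * (G \<sigma> t \<bullet> G' \<sigma> t) \<le> t * M * (G \<sigma> t \<bullet> G \<sigma> t)
        - k / 4 * (\<Sum>i\<in>UNIV. \<Sum>j\<in>UNIV-{i}. G \<sigma> t \<bullet> G \<sigma> t - G (\<sigma> \<circ> tr i j) t \<bullet> G (\<sigma> \<circ> tr i j) t)"
      if s: "\<sigma> \<in> P" for \<sigma>
    proof -
      define y where "y = t *\<^sub>R pv \<sigma> z"
      have bij: "bij \<sigma>" using s unfolding P_def by (auto intro: permutes_bij)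
      have y: "distinct_coords y" unfolding y_def using t z
        by (intro distinct_coords_scaleR) (simp_all add: distinct_coords_pv[OF bij])
      define S where "S = (\<Sum>i\<in>UNIV. \<Sum>j\<in>UNIV-{i}. G \<sigma> t - G (\<sigma> \<circ> tr i j) t)"
      have "of_real t * G' \<sigma> t = (\<Sum>i\<in>UNIV. y $ i * dpart i f y)"
        unfolding G'_def y_def by (simp add: sum_distrib_left scaleR_conv_of_real[where 'a=complex] algebra_simps)
      also have "\<dots> = (\<Sum>i\<in>UNIV. y $ i * (lam $ i * f y))
          - of_real k / 2 * (\<Sum>i\<in>UNIV. \<Sum>j\<in>UNIV-{i}. f y - f (swapv i j y))"
        unfolding euler_dunkl[OF y, of f k] eig[OF y] ..
      also have "(\<Sum>i\<in>UNIV. \<Sum>j\<in>UNIV-{i}. f y - f (swapv i j y)) = S"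
        unfolding S_def G_def y_def swapv_pv by (simp add: pv_scaleR pv_pv)
      also have "(\<Sum>i\<in>UNIV. y $ i * (lam $ i * f y)) = of_real t * (\<Sum>i\<in>UNIV. lam $ i * z $ \<sigma> i) * G \<sigma> t"
        unfolding G_def y_def by (simp add: sum_distrib_left sum_distrib_right scaleR_conv_of_real[where 'a=complex] algebra_simps)
      finally have e: "of_real t * G' \<sigma> t = of_real t * (\<Sum>i\<in>UNIV. lam $ i * z $ \<sigma> i) * G \<sigma> t - of_real k / 2 * S" .
      have in1: "a \<bullet> (c * a) = Re c * (a \<bullet> a)" for a c :: complex
        by (simp add: inner_complex_def algebra_simps)
      have in2: "a \<bullet> (of_real r * b) = r * (a \<bullet> b)" for a b :: complex and r
        by (simp add: inner_complex_def algebra_simps)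
      have "t * (G \<sigma> t \<bullet> G' \<sigma> t) = G \<sigma> t \<bullet> (of_real t * G' \<sigma> t)" by (simp add: in2)
      also have "\<dots> = t * Re (\<Sum>i\<in>UNIV. lam $ i * z $ \<sigma> i) * (G \<sigma> t \<bullet> G \<sigma> t) - k / 2 * (G \<sigma> t \<bullet> S)"
        unfolding e inner_diff_right in1 using in2[of "G \<sigma> t" "k/2" S] by simp
      also have "\<dots> \<le> t * M * (G \<sigma> t \<bullet> G \<sigma> t) - k / 2 * (G \<sigma> t \<bullet> S)"
        using M[of \<sigma>] s t by (auto simp: P_def intro!: mult_right_mono mult_left_mono)
      finally have 1: "t * (G \<sigma> t \<bullet> G' \<sigma> t) \<le> t * M * (G \<sigma> t \<bullet> G \<sigma> t) - k / 2 * (G \<sigma> t \<bullet> S)" .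
      \<comment> \<open>This is |a - b|^2 \<ge> 0 rearranged. It replaces the mixed product of two
        values of f by a difference of squares, which telescopes over the group.\<close>
      have in3: "a \<bullet> (a - b) \<ge> (a \<bullet> a - b \<bullet> b) / 2" for a b :: complex
        using inner_ge_zero[of "a - b"] by (simp add: inner_diff_left inner_diff_right inner_commute)
      have "G \<sigma> t \<bullet> S \<ge> (\<Sum>i\<in>UNIV. \<Sum>j\<in>UNIV-{i}. (G \<sigma> t \<bullet> G \<sigma> t - G (\<sigma> \<circ> tr i j) t \<bullet> G (\<sigma> \<circ> tr i j) t) / 2)"
        unfolding S_def inner_sum_right by (intro sum_mono in3)
      hence "k / 2 * (G \<sigma> t \<bullet> S) \<ge> k / 2 * (\<Sum>i\<in>UNIV. \<Sum>j\<in>UNIV-{i}. (G \<sigma> t \<bullet> G \<sigma> t - G (\<sigma> \<circ> tr i j) t \<bullet> G (\<sigma> \<circ> tr i j) t) / 2)"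
        using k by (intro mult_left_mono) auto
      thus ?thesis using 1 by (simp add: sum_divide_distrib[symmetric])
    qed
    \<comment> \<open>Composition with \<open>tr i j\<close> permutes the group, so each reflection
      term cancels in the sum over the orbit; no single summand need have a sign.\<close>
    have zero: "(\<Sum>\<sigma>\<in>P. \<Sum>i\<in>UNIV. \<Sum>j\<in>UNIV-{i}. G \<sigma> t \<bullet> G \<sigma> t - G (\<sigma> \<circ> tr i j) t \<bullet> G (\<sigma> \<circ> tr i j) t) = 0"
    proof -
      have "(\<Sum>\<sigma>\<in>P. G \<sigma> t \<bullet> G \<sigma> t - G (\<sigma> \<circ> tr i j) t \<bullet> G (\<sigma> \<circ> tr i j) t) = 0" for i j
      proof -
        have "(\<Sum>\<sigma>\<in>P. G (\<sigma> \<circ> tr i j) t \<bullet> G (\<sigma> \<circ> tr i j) t) = (\<Sum>\<sigma>\<in>P. G \<sigma> t \<bullet> G \<sigma> t)"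
        proof (rule sum.reindex_bij_witness[where j="\<lambda>\<sigma>. \<sigma> \<circ> tr i j" and i="\<lambda>\<sigma>. \<sigma> \<circ> tr i j"])
          fix \<sigma> assume "\<sigma> \<in> P"
          thus "\<sigma> \<circ> tr i j \<circ> tr i j = \<sigma>" "\<sigma> \<circ> tr i j \<circ> tr i j = \<sigma>"
               "\<sigma> \<circ> tr i j \<in> P" "\<sigma> \<circ> tr i j \<in> P"
            unfolding P_def by (auto simp: comp_assoc intro!: permutes_compose permutes_swap_id)
        qed auto
        thus ?thesis by (simp add: sum_subtractf)
      qed
      moreover have "(\<Sum>\<sigma>\<in>P. \<Sum>i\<in>UNIV. \<Sum>j\<in>UNIV-{i}. h i j \<sigma>)
          = (\<Sum>i\<in>UNIV. \<Sum>j\<in>UNIV-{i}. \<Sum>\<sigma>\<in>P. h i j \<sigma>)" for h :: "'n \<Rightarrow> 'n \<Rightarrow> _ \<Rightarrow> real"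
        by (subst sum.swap, rule sum.cong[OF refl], rule sum.swap)
      ultimately show ?thesis by simp
    qed
    have "t * (\<Sum>\<sigma>\<in>P. G \<sigma> t \<bullet> G' \<sigma> t) \<le> (\<Sum>\<sigma>\<in>P. t * M * (G \<sigma> t \<bullet> G \<sigma> t)
        - k / 4 * (\<Sum>i\<in>UNIV. \<Sum>j\<in>UNIV-{i}. G \<sigma> t \<bullet> G \<sigma> t - G (\<sigma> \<circ> tr i j) t \<bullet> G (\<sigma> \<circ> tr i j) t))"
      by (subst sum_distrib_left, rule sum_mono, rule summand)
    also have "\<dots> = t * M * N t"
    proof -
      have "(\<Sum>\<sigma>\<in>P. t * M * (G \<sigma> t \<bullet> G \<sigma> t)) = t * M * N t" unfolding N_def by (rule sum_distrib_left[symmetric])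
      moreover have "(\<Sum>\<sigma>\<in>P. k / 4 * (\<Sum>i\<in>UNIV. \<Sum>j\<in>UNIV-{i}. G \<sigma> t \<bullet> G \<sigma> t - G (\<sigma> \<circ> tr i j) t \<bullet> G (\<sigma> \<circ> tr i j) t)) = k / 4 * 0"
        by (subst zero[symmetric]) (rule sum_distrib_left[symmetric])
      ultimately show ?thesis by (subst sum_subtractf) linarith
    qed
    finally show ?thesis using t by (simp add: mult.assoc)
  qed
  \<comment> \<open>Gronwall argument on [0,1]. The derivative bound is available only for t > 0,
    since at t = 0 all coordinates coincide; continuity covers the endpoint.\<close>
  have "N 1 * exp (- 2 * M * 1) \<le> N 0 * exp (- 2 * M * 0)"
  proof (rule DERIV_nonpos_imp_decreasing_open[where f="\<lambda>t. N t * exp (- 2 * M * t)"])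
    fix t :: real assume t: "0 < t" "t < 1"
    define D where "D = (\<Sum>\<sigma>\<in>P. G \<sigma> t \<bullet> G' \<sigma> t)"
    have "(N has_real_derivative 2 * D) (at t)" using dN[of t] unfolding D_def sum_distrib_left .
    hence "((\<lambda>t. N t * exp (- 2 * M * t)) has_real_derivative
       2 * D * exp (- 2 * M * t) + (exp (- 2 * M * t) * (- 2 * M)) * N t) (at t)"
      by (rule DERIV_mult) (auto intro!: derivative_eq_intros)
    moreover have "2 * D * exp (- 2 * M * t) + (exp (- 2 * M * t) * (- 2 * M)) * N t
        = exp (- 2 * M * t) * 2 * (D - M * N t)"
      by (simp add: algebra_simps)
    moreover have "\<dots> \<le> 0" using bd[OF t(1)] unfolding D_def by (simp add: mult_le_0_iff)
    ultimately show "\<exists>y. ((\<lambda>t. N t * exp (- 2 * M * t)) has_real_derivative y) (at t) \<and> y \<le> 0"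
      by (intro exI conjI) (assumption, linarith)
  next
    have "continuous_on {0..1} N"
      using dN by (meson DERIV_isCont continuous_at_imp_continuous_on)
    thus "continuous_on {0..1} (\<lambda>t. N t * exp (- 2 * M * t))" by (intro continuous_intros)
  qed auto
  hence "N 1 \<le> N 0 * exp (2 * M)" by (simp add: exp_minus field_simps)
  moreover have "N 1 = (\<Sum>\<sigma>\<in>P. (cmod (f (pv \<sigma> z)))\<^sup>2)"
    unfolding N_def G_def by (simp add: power2_norm_eq_inner)
  moreover have "N 0 = fact CARD('n) * (cmod (f 0))\<^sup>2"
    unfolding N_def G_def P_def by (simp add: power2_norm_eq_inner card_permutations)
  ultimately show ?thesis unfolding P_def by simp
qed

text \<open>Perturb along a vector \<open>v\<close> with distinct entries: two coordinates of z + t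
  v agree for at most one t, so 1/(m+1) is admissible for all large m.\<close>

lemma distinct_dense:
  fixes z :: "('a::real_normed_field,'n::finite) vec"
  shows "\<exists>s. s \<longlonglongrightarrow> z \<and> (\<forall>m i j. i \<noteq> j \<longrightarrow> s m $ i \<noteq> s m $ j)"
proof -
  obtain r :: "'n \<Rightarrow> nat" where r: "inj r"
    using finite_imp_inj_to_nat_seg[of "UNIV :: 'n set"] by auto
  define v :: "('a,'n) vec" where "v = (\<chi> i. of_nat (r i))"
  define B where "B = (\<Union>i. \<Union>j. {t::real. i \<noteq> j \<and> (z + t *\<^sub>R v) $ i = (z + t *\<^sub>R v) $ j})"
  have "finite {t::real. i \<noteq> j \<and> (z + t *\<^sub>R v) $ i = (z + t *\<^sub>R v) $ j}" for i j
  proof (cases "i = j")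
    case False
    hence ne: "(of_nat (r i) :: 'a) - of_nat (r j) \<noteq> 0" using r by (simp add: inj_eq)
    have "{t::real. i \<noteq> j \<and> (z + t *\<^sub>R v) $ i = (z + t *\<^sub>R v) $ j}
       \<subseteq> of_real -` {(z $ j - z $ i) / (of_nat (r i) - of_nat (r j))}"
    proof
      fix t :: real assume "t \<in> {t::real. i \<noteq> j \<and> (z + t *\<^sub>R v) $ i = (z + t *\<^sub>R v) $ j}"
      hence "of_real t * (of_nat (r i) - of_nat (r j)) = z $ j - z $ i"
        by (simp add: v_def) (simp add: scaleR_conv_of_real[where 'a='a] algebra_simps)
      hence "of_real t = (z $ j - z $ i) / (of_nat (r i) - of_nat (r j))"
        using ne by (simp add: eq_divide_eq)
      thus "t \<in> of_real -` {(z $ j - z $ i) / (of_nat (r i) - of_nat (r j))}" by simp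
    qed
    moreover have "finite ((of_real :: real \<Rightarrow> 'a) -` {(z $ j - z $ i) / (of_nat (r i) - of_nat (r j))})"
      by (rule finite_vimageI) (auto simp: inj_of_real)
    ultimately show ?thesis using finite_subset by blast
  qed auto
  hence "finite B" unfolding B_def by simp
  hence "\<exists>N. \<forall>m\<ge>N. 1 / real (Suc m) \<notin> B"
  proof -
    have "finite ((\<lambda>m. 1 / real (Suc m)) -` B)"
      by (rule finite_vimageI[OF \<open>finite B\<close>]) (auto simp: inj_def)
    then obtain N where "\<forall>m \<in> (\<lambda>m. 1 / real (Suc m)) -` B. m < N"
      using finite_nat_set_iff_bounded by blast
    thus ?thesis by (meson not_le vimageI2)
  qed
  then obtain N where N: "\<And>m. m \<ge> N \<Longrightarrow> 1 / real (Suc m) \<notin> B" by blast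
  define s where "s = (\<lambda>m. z + (1 / real (Suc (m + N))) *\<^sub>R v)"
  have "(\<lambda>m. 1 / real (Suc (m + N))) \<longlonglongrightarrow> 0"
    using LIMSEQ_ignore_initial_segment[OF LIMSEQ_Suc[OF lim_inverse_n'], of N]
    by (simp add: inverse_eq_divide)
  hence "s \<longlonglongrightarrow> z + 0 *\<^sub>R v" unfolding s_def by (intro tendsto_intros)
  moreover have "i \<noteq> j \<longrightarrow> s m $ i \<noteq> s m $ j" for m i j
    using N[of "m + N"] unfolding B_def s_def by auto
  ultimately show ?thesis by (metis add_0_right scale_zero_left)
qed

lemma distinct_coords_dense:
  fixes z :: "(complex,'n::finite) vec"
  shows "\<exists>s. s \<longlonglongrightarrow> z \<and> (\<forall>m. distinct_coords (s m))"
  using distinct_dense[of z] unfolding distinct_coords_def by blast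

lemma distinct_coords_le:
  fixes F G :: "(complex,'n::finite) vec \<Rightarrow> real"
  assumes "continuous_on UNIV F" "continuous_on UNIV G"
    and "\<And>z. distinct_coords z \<Longrightarrow> F z \<le> G z"
  shows "F z \<le> G z"
proof -
  obtain s where s: "s \<longlonglongrightarrow> z" "\<And>m. distinct_coords (s m)" using distinct_coords_dense by blast
  have "(\<lambda>m. F (s m)) \<longlonglongrightarrow> F z" "(\<lambda>m. G (s m)) \<longlonglongrightarrow> G z"
    using continuous_on_tendsto_compose[OF assms(1) s(1)] continuous_on_tendsto_compose[OF assms(2) s(1)] by auto
  thus ?thesis using assms(3) s(2) by (intro LIMSEQ_le) auto
qed

lemma distinct_coords_eq:
  fixes F G :: "(complex,'n::finite) vec \<Rightarrow> complex"
  assumes "continuous_on UNIV F" "continuous_on UNIV G"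
    and "\<And>z. distinct_coords z \<Longrightarrow> F z = G z"
  shows "F z = G z"
proof -
  have "cmod (F z - G z) \<le> 0"
    by (rule distinct_coords_le[of "\<lambda>z. cmod (F z - G z)" "\<lambda>_. 0"])
       (use assms in \<open>auto intro!: continuous_intros\<close>)
  thus ?thesis by simp
qed

text \<open>Only the identity permutation is kept in the orbit sum of
  \<open>dunkl_energy\<close>.\<close>

lemma dunkl_eigenfunction_bound:
  fixes f :: "(complex,'n::finite) vec \<Rightarrow> complex"
  assumes k: "k \<ge> 0" and f: "holo_n f"
    and eig: "\<And>i z. distinct_coords z \<Longrightarrow> dunklA k i f z = lam $ i * f z"
    and z: "distinct_coords z"
    and M: "\<And>\<sigma>. \<sigma> permutes UNIV \<Longrightarrow> Re (\<Sum>i\<in>UNIV. lam $ i * z $ \<sigma> i) \<le> M"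
  shows "cmod (f z) \<le> sqrt (fact CARD('n)) * cmod (f 0) * exp M"
proof -
  have "(cmod (f z))\<^sup>2 = (\<Sum>\<sigma>\<in>{id}. (cmod (f (pv \<sigma> z)))\<^sup>2)" by simp
  also have "\<dots> \<le> (\<Sum>\<sigma> | \<sigma> permutes UNIV. (cmod (f (pv \<sigma> z)))\<^sup>2)"
    by (intro sum_mono2) (auto simp: permutes_id finite_permutations)
  also have "\<dots> \<le> fact CARD('n) * (cmod (f 0))\<^sup>2 * exp (2 * M)"
    by (rule dunkl_energy[OF assms])
  also have "\<dots> = (sqrt (fact CARD('n)) * cmod (f 0) * exp M)\<^sup>2"
    by (simp add: power_mult_distrib exp_double)
  finally show ?thesis by (rule power2_le_imp_le) simp
qed

text \<open>The difference is an eigenfunction vanishing at 0, and the energy bound is proportional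
  to the value at 0.\<close>

lemma dunkl_eigenfunction_unique:
  fixes f :: "(complex,'n::finite) vec \<Rightarrow> complex"
  assumes k: "k \<ge> 0" and f: "holo_n f" and g: "holo_n g"
    and eigf: "\<And>i z. distinct_coords z \<Longrightarrow> dunklA k i f z = lam $ i * f z"
    and eigg: "\<And>i z. distinct_coords z \<Longrightarrow> dunklA k i g z = lam $ i * g z"
    and 0: "f 0 = g 0"
  shows "f = g"
proof
  fix z
  define h where "h = (\<lambda>z. f z + (-1) * g z)"
  have h: "holo_n h" unfolding h_def using f g by auto
  have eig: "dunklA k i h z = lam $ i * h z" if "distinct_coords z" for i z
    using dunklA_add[OF f holo_n_mult[OF holo_n_const[of "-1"] g], of k i z] dunklA_cmult[OF g, of k i "-1" z]
      eigf[OF that] eigg[OF that] unfolding h_def by (simp add: algebra_simps)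
  have "h z = 0" if z: "distinct_coords z" for z
  proof -
    define M where "M = Max ((\<lambda>\<sigma>. Re (\<Sum>i\<in>UNIV. lam $ i * z $ \<sigma> i)) ` {\<sigma>. \<sigma> permutes UNIV})"
    have "cmod (h z) \<le> sqrt (fact CARD('n)) * cmod (h 0) * exp M"
      by (rule dunkl_eigenfunction_bound[OF k h eig z])
         (auto simp: M_def finite_permutations intro!: Max_ge)
    thus ?thesis using 0 by (simp add: h_def)
  qed
  hence "h z = 0"
    by (rule distinct_coords_eq[OF holo_n_continuous[OF h] continuous_on_const])
  thus "f z = g z" by (simp add: h_def)
qed

subsection \<open>Homogeneous polynomials\<close>

definition mono_n :: "('n::finite \<Rightarrow> nat) \<Rightarrow> (complex,'n) vec \<Rightarrow> complex" where
  "mono_n \<alpha> z = (\<Prod>i\<in>UNIV. z $ i ^ \<alpha> i)"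

lemma homog_poly_alt: "homog_poly p f \<longleftrightarrow> (\<exists>c. f = (\<lambda>z. \<Sum>\<alpha>\<in>multi_of_deg p. c \<alpha> * mono_n \<alpha> z))"
  by (simp add: homog_poly_def mono_n_def)

lemma finite_multi_of_deg [simp]: "finite (multi_of_deg p :: ('n::finite \<Rightarrow> nat) set)"
proof -
  have "multi_of_deg p \<subseteq> (PiE UNIV (\<lambda>_. {..p}) :: ('n \<Rightarrow> nat) set)"
  proof
    fix \<eta> :: "'n \<Rightarrow> nat" assume "\<eta> \<in> multi_of_deg p"
    hence "p = (\<Sum>i\<in>UNIV. \<eta> i)" by (simp add: multi_of_deg_def mdeg_def)
    thus "\<eta> \<in> PiE UNIV (\<lambda>_. {..p})" by (auto intro: member_le_sum)
  qed
  thus ?thesis by (rule finite_subset) (auto intro: finite_PiE)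
qed

lemma homog_poly_add:
  assumes "homog_poly p f" "homog_poly p g"
  shows "homog_poly p (\<lambda>z. f z + g z)"
proof -
  obtain a b where "f = (\<lambda>z. \<Sum>\<alpha>\<in>multi_of_deg p. a \<alpha> * mono_n \<alpha> z)"
     "g = (\<lambda>z. \<Sum>\<alpha>\<in>multi_of_deg p. b \<alpha> * mono_n \<alpha> z)"
    using assms unfolding homog_poly_alt by blast
  thus ?thesis unfolding homog_poly_alt
    by (intro exI[of _ "\<lambda>\<alpha>. a \<alpha> + b \<alpha>"]) (simp add: sum.distrib algebra_simps)
qed

lemma homog_poly_cmult:
  assumes "homog_poly p f"
  shows "homog_poly p (\<lambda>z. c * f z)"
proof -
  obtain a where "f = (\<lambda>z. \<Sum>\<alpha>\<in>multi_of_deg p. a \<alpha> * mono_n \<alpha> z)"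
    using assms unfolding homog_poly_alt by blast
  thus ?thesis unfolding homog_poly_alt
    by (intro exI[of _ "\<lambda>\<alpha>. c * a \<alpha>"]) (simp add: sum_distrib_left algebra_simps)
qed

lemma homog_poly_0: "homog_poly p (\<lambda>z. 0)"
  unfolding homog_poly_alt by (intro exI[of _ "\<lambda>_. 0"]) simp

lemma homog_poly_sum:
  assumes "\<And>i. i \<in> I \<Longrightarrow> homog_poly p (f i)"
  shows "homog_poly p (\<lambda>z. \<Sum>i\<in>I. f i z)"
  using assms by (induction I rule: infinite_finite_induct) (auto intro: homog_poly_0 homog_poly_add)

lemma homog_poly_mono: "homog_poly (mdeg \<alpha>) (mono_n \<alpha>)"
  unfolding homog_poly_alt
proof (intro exI[of _ "\<lambda>\<beta>. if \<beta> = \<alpha> then 1 else 0"] ext)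
  fix z :: "(complex,'a) vec"
  have "(\<Sum>\<beta>\<in>multi_of_deg (mdeg \<alpha>). (if \<beta> = \<alpha> then 1 else 0) * mono_n \<beta> z)
    = (\<Sum>\<beta>\<in>multi_of_deg (mdeg \<alpha>). if \<beta> = \<alpha> then mono_n \<beta> z else 0)"
    by (intro sum.cong) auto
  also have "\<dots> = mono_n \<alpha> z" by (subst sum.delta[OF finite_multi_of_deg]) (simp add: multi_of_deg_def)
  finally show "mono_n \<alpha> z = (\<Sum>\<beta>\<in>multi_of_deg (mdeg \<alpha>). (if \<beta> = \<alpha> then 1 else 0) * mono_n \<beta> z)" ..
qed

lemma homog_polyE:
  assumes "homog_poly p f"
    and "\<And>\<alpha>. mdeg \<alpha> = p \<Longrightarrow> homog_poly q (\<lambda>z. mono_n \<alpha> (g z) * h z)"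
  shows "homog_poly q (\<lambda>z. f (g z) * h z)"
proof -
  obtain a where a: "f = (\<lambda>z. \<Sum>\<alpha>\<in>multi_of_deg p. a \<alpha> * mono_n \<alpha> z)"
    using assms(1) unfolding homog_poly_alt by blast
  have "homog_poly q (\<lambda>z. \<Sum>\<alpha>\<in>multi_of_deg p. a \<alpha> * (mono_n \<alpha> (g z) * h z))"
    by (intro homog_poly_sum homog_poly_cmult assms(2)) (simp add: multi_of_deg_def)
  thus ?thesis unfolding a by (simp add: sum_distrib_right mult.assoc)
qed

lemma mdeg_perm:
  assumes "bij \<sigma>"
  shows "mdeg (\<eta> \<circ> \<sigma>) = mdeg \<eta>"
  unfolding mdeg_def o_def by (rule sum.reindex_bij_betw[OF assms])

lemma mono_n_pv:
  assumes "bij \<sigma>"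
  shows "mono_n \<alpha> (pv \<sigma> z) = mono_n (\<alpha> \<circ> inv \<sigma>) z"
proof -
  have "mono_n \<alpha> (pv \<sigma> z) = (\<Prod>i\<in>UNIV. (\<lambda>j. z $ j ^ (\<alpha> \<circ> inv \<sigma>) j) (\<sigma> i))"
    unfolding mono_n_def using assms by (simp add: bij_is_inj)
  also have "\<dots> = mono_n (\<alpha> \<circ> inv \<sigma>) z"
    unfolding mono_n_def by (rule prod.reindex_bij_betw[OF assms])
  finally show ?thesis .
qed

lemma homog_poly_pv:
  assumes "bij \<sigma>" "homog_poly p f"
  shows "homog_poly p (\<lambda>z. f (pv \<sigma> z))"
proof -
  have "homog_poly p (\<lambda>z. f (pv \<sigma> z) * 1)"
  proof (rule homog_polyE[OF assms(2)])
    fix \<alpha> :: "'a \<Rightarrow> nat" assume "mdeg \<alpha> = p"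
    thus "homog_poly p (\<lambda>z. mono_n \<alpha> (pv \<sigma> z) * 1)"
      using homog_poly_mono[of "\<alpha> \<circ> inv \<sigma>"] mdeg_perm[OF bij_imp_bij_inv[OF assms(1)], of \<alpha>]
      by (simp add: mono_n_pv[OF assms(1)])
  qed
  thus ?thesis by simp
qed

lemma mdeg_upd: "mdeg (\<alpha>(i := Suc (\<alpha> i))) = Suc (mdeg \<alpha>)"
proof -
  have "mdeg (\<alpha>(i := Suc (\<alpha> i))) = (\<Sum>j\<in>UNIV. \<alpha> j + (if j = i then 1 else 0))"
    unfolding mdeg_def by (intro sum.cong) auto
  thus ?thesis by (simp add: sum.distrib mdeg_def)
qed

lemma homog_poly_nth_mult:
  assumes "homog_poly p f"
  shows "homog_poly (Suc p) (\<lambda>z. z $ i * f z)"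
proof -
  have "homog_poly (Suc p) (\<lambda>z. f z * z $ i)"
  proof (rule homog_polyE[OF assms])
    fix \<alpha> :: "'a \<Rightarrow> nat" assume *: "mdeg \<alpha> = p"
    have "mono_n \<alpha> z * z $ i = mono_n (\<alpha>(i := Suc (\<alpha> i))) z" for z :: "(complex,'a) vec"
      unfolding mono_n_def by (simp add: prod.remove[of UNIV i] mult_ac)
    thus "homog_poly (Suc p) (\<lambda>z. mono_n \<alpha> z * z $ i)"
      using homog_poly_mono[of "\<alpha>(i := Suc (\<alpha> i))"] * by (simp add: mdeg_upd)
  qed
  thus ?thesis by (simp add: mult.commute)
qed

lemma homog_poly_1: "homog_poly 0 (\<lambda>z. c)"
proof -
  have "homog_poly 0 (\<lambda>z::(complex,'a::finite) vec. c * mono_n (\<lambda>_. 0) z)"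
    using homog_poly_mono[of "\<lambda>_::'a. 0"] by (intro homog_poly_cmult) (simp add: mdeg_def)
  thus ?thesis by (simp add: mono_n_def)
qed

lemma homog_poly_sum_power: "homog_poly p (\<lambda>z::(complex,'n::finite) vec. (\<Sum>i\<in>UNIV. z $ i) ^ p)"
proof (induction p)
  case 0 thus ?case using homog_poly_1[of 1] by simp
next
  case (Suc p)
  have "homog_poly (Suc p) (\<lambda>z::(complex,'n) vec. \<Sum>i\<in>UNIV. z $ i * (\<Sum>i\<in>UNIV. z $ i) ^ p)"
    by (intro homog_poly_sum homog_poly_nth_mult Suc)
  thus ?case by (simp add: sum_distrib_right)
qed

lemma homog_poly_holo: "homog_poly p f \<Longrightarrow> holo_n f"
  unfolding homog_poly_alt mono_n_def
  by (auto intro!: holo_n_sum holo_n_mult holo_n_prod holo_n_power holo_n_nth)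

lemma homog_poly_scale:
  assumes "homog_poly p f"
  shows "f (c *s z) = c ^ p * f z"
proof -
  obtain a where a: "f = (\<lambda>z. \<Sum>\<alpha>\<in>multi_of_deg p. a \<alpha> * mono_n \<alpha> z)"
    using assms(1) unfolding homog_poly_alt by blast
  have "mono_n \<alpha> (c *s z) = c ^ p * mono_n \<alpha> z" if "\<alpha> \<in> multi_of_deg p" for \<alpha>
    using that unfolding mono_n_def multi_of_deg_def mdeg_def
    by (simp add: power_mult_distrib prod.distrib power_sum[symmetric])
  thus ?thesis unfolding a by (simp add: sum_distrib_left mult_ac)
qed

lemma homog_poly_euler:
  assumes "homog_poly p f"
  shows "(\<Sum>i\<in>UNIV. z $ i * dpart i f z) = of_nat p * f z"
proof -
  have bl: "((\<lambda>c. c *s z) has_derivative (\<lambda>h. h *s z)) (at (1::complex))"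
    by (intro bounded_linear_imp_has_derivative linear_conv_bounded_linear[THEN iffD1] linearI)
       (auto simp: vec_eq_iff algebra_simps)
  have "(f has_derivative (\<lambda>h. \<Sum>i\<in>UNIV. h $ i * dpart i f z)) (at (1 *s z))"
    using holo_n_has_derivative[OF homog_poly_holo[OF assms]] by simp
  from has_derivative_compose[OF bl this]
  have "((\<lambda>c. f (c *s z)) has_derivative (\<lambda>h. \<Sum>i\<in>UNIV. (h *s z) $ i * dpart i f z)) (at 1)" .
  hence "((\<lambda>c. f (c *s z)) has_field_derivative (\<Sum>i\<in>UNIV. z $ i * dpart i f z)) (at 1)"
    unfolding has_field_derivative_def
    by (rule has_derivative_eq_rhs) (auto simp: fun_eq_iff sum_distrib_left sum_distrib_right mult_ac)
  moreover have "((\<lambda>c. f (c *s z)) has_field_derivative (of_nat p * f z)) (at 1)"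
    unfolding homog_poly_scale[OF assms] by (auto intro!: derivative_eq_intros)
  ultimately show ?thesis by (rule DERIV_unique)
qed

subsection \<open>Spectral vectors\<close>

text \<open>\<open>prec \<eta> j i\<close>: position \<open>j\<close> comes before \<open>i\<close> when the entries of \<open>\<eta>\<close> are sorted decreasingly,
  where the larger index wins a tie.\<close>
definition prec :: "('n::linorder \<Rightarrow> nat) \<Rightarrow> 'n \<Rightarrow> 'n \<Rightarrow> bool" where
  "prec \<eta> j i \<longleftrightarrow> \<eta> i < \<eta> j \<or> (\<eta> j = \<eta> i \<and> i < j)"

text \<open>Unlike the spectral vector, from which it differs by a shift independent of \<open>\<eta>\<close> (see below), this
  vector is merely permuted when adjacent entries of \<open>\<eta>\<close> are exchanged.\<close>
definition ev :: "real \<Rightarrow> ('n::{finite,linorder} \<Rightarrow> nat) \<Rightarrow> 'n \<Rightarrow> real" where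
  "ev k \<eta> i = real (\<eta> i) - k * real (card {j. prec \<eta> j i})"

lemma card_less_greater:
  "card {j. j < i} + card {j. i < j} + 1 = CARD('n)" for i :: "'n::{finite,linorder}"
proof -
  have "CARD('n) = card (insert i ({j. j < i} \<union> {j. i < j}))"
    by (rule arg_cong[of _ _ card]) auto
  also have "\<dots> = Suc (card ({j. j < i} \<union> {j. i < j}))" by (subst card_insert_disjoint) auto
  also have "card ({j. j < i} \<union> {j. i < j}) = card {j. j < i} + card {j. i < j}"
    by (rule card_Un_disjoint) auto
  finally show ?thesis by simp
qed

text \<open>Both {j > i} together with {j < i, \<eta>_i < \<eta>_j}, and the predecessors of i
  together with {j > i, \<eta>_j < \<eta>_i}, decompose the same set; comparing cardinalities gives
  the shift k #{j > i}.\<close>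

lemma spec_ev: "spec k \<eta> i = of_real (ev k \<eta> i + k * real (card {j. i < j}))"
proof -
  have "card {j. i < j} + card {j. j < i \<and> \<eta> i < \<eta> j} = card ({j. i < j} \<union> {j. j < i \<and> \<eta> i < \<eta> j})"
    by (rule card_Un_disjoint[symmetric]) auto
  also have "{j. i < j} \<union> {j. j < i \<and> \<eta> i < \<eta> j} = {j. prec \<eta> j i} \<union> {j. i < j \<and> \<eta> j < \<eta> i}"
    unfolding prec_def by (auto, metis neqE order_less_irrefl)
  also have "card \<dots> = card {j. prec \<eta> j i} + card {j. i < j \<and> \<eta> j < \<eta> i}"
    by (rule card_Un_disjoint) (auto simp: prec_def)
  finally have "real (card {j. i < j} + card {j. j < i \<and> \<eta> i < \<eta> j})
     = real (card {j. prec \<eta> j i} + card {j. i < j \<and> \<eta> j < \<eta> i})" by (rule arg_cong)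
  hence "real (card {j. i < j \<and> \<eta> j < \<eta> i}) - real (card {j. j < i \<and> \<eta> i < \<eta> j})
     = real (card {j. i < j}) - real (card {j. prec \<eta> j i})" by (simp only: of_nat_add)
  moreover have "spec k \<eta> i = of_real (real (\<eta> i) + k * (real (card {j. i < j \<and> \<eta> j < \<eta> i}) - real (card {j. j < i \<and> \<eta> i < \<eta> j})))"
    unfolding spec_def by simp
  ultimately have "spec k \<eta> i = of_real (real (\<eta> i) + k * (real (card {j. i < j}) - real (card {j. prec \<eta> j i})))"
    by (simp only:)
  thus ?thesis unfolding ev_def by (simp add: algebra_simps)
qed

lemma prec_trans: "prec \<eta> a b \<Longrightarrow> prec \<eta> b c \<Longrightarrow> prec \<eta> a c"
  unfolding prec_def by auto

lemma prec_irrefl [simp]: "\<not> prec \<eta> a a"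
  unfolding prec_def by auto

lemma prec_total: "a \<noteq> b \<Longrightarrow> prec \<eta> a b \<or> prec \<eta> b a"
  unfolding prec_def by auto

lemma prec_card:
  fixes a b :: "'n::{finite,linorder}"
  assumes "prec \<eta> a b"
  shows "card {j. prec \<eta> j a} < card {j. prec \<eta> j b}"
proof (rule psubset_card_mono)
  show "{j. prec \<eta> j a} \<subset> {j. prec \<eta> j b}" using assms prec_trans prec_irrefl by blast
qed simp

text \<open>A predecessor has rank smaller by at least 1, which adds at least k to the difference of
  the entries.\<close>

lemma prec_ev:
  fixes a b :: "'n::{finite,linorder}"
  assumes k: "k \<ge> 0" and "prec \<eta> a b"
  shows "ev k \<eta> a - ev k \<eta> b \<ge> real (\<eta> a) - real (\<eta> b) + k"
proof -
  have "real (card {j. prec \<eta> j b}) \<ge> real (card {j. prec \<eta> j a}) + 1"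
    using prec_card[OF assms(2)] by linarith
  hence "k * real (card {j. prec \<eta> j b}) \<ge> k * (real (card {j. prec \<eta> j a}) + 1)"
    using k by (intro mult_left_mono)
  thus ?thesis unfolding ev_def by (simp add: algebra_simps)
qed

lemma prec_iff_ev:
  fixes a b :: "'n::{finite,linorder}"
  assumes k: "k > 0"
  shows "prec \<eta> a b \<longleftrightarrow> ev k \<eta> b < ev k \<eta> a"
proof -
  have *: "ev k \<eta> b < ev k \<eta> a" if "prec \<eta> a b" for a b
    using prec_ev[OF _ that, of k] k that unfolding prec_def by auto
  show ?thesis
  proof (cases "a = b")
    case False
    thus ?thesis using *[of a b] *[of b a] prec_total[of a b \<eta>] by fastforce
  qed simp
qed

text \<open>For k > 0 the order \<open>prec\<close> is the decreasing order of the values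
  \<open>ev\<close>, so a permutation of the values transports the ranks; adding k times the rank
  back recovers the composition.\<close>

lemma ev_perm_imp:
  fixes \<eta> \<xi> :: "'n::{finite,linorder} \<Rightarrow> nat"
  assumes k: "k > 0" and \<sigma>: "bij \<sigma>" and e: "\<And>i. ev k \<xi> i = ev k \<eta> (\<sigma> i)"
  shows "\<xi> = \<eta> \<circ> \<sigma>"
proof
  fix i
  have "card {j. prec \<xi> j i} = card {j. prec \<eta> (\<sigma> j) (\<sigma> i)}"
    unfolding prec_iff_ev[OF k] e ..
  also have "\<dots> = card (\<sigma> ` {j. prec \<eta> (\<sigma> j) (\<sigma> i)})"
    by (rule card_image[symmetric]) (use \<sigma> in \<open>meson bij_is_inj inj_on_subset subset_UNIV\<close>)
  also have "\<sigma> ` {j. prec \<eta> (\<sigma> j) (\<sigma> i)} = {j. prec \<eta> j (\<sigma> i)}"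
  proof safe
    fix j assume "prec \<eta> j (\<sigma> i)"
    moreover obtain l where "j = \<sigma> l" using \<sigma> by (meson bij_pointE)
    ultimately show "j \<in> \<sigma> ` {j. prec \<eta> (\<sigma> j) (\<sigma> i)}" by auto
  qed
  finally have "real (\<xi> i) = real (\<eta> (\<sigma> i))" using e[of i] unfolding ev_def by simp
  thus "\<xi> i = (\<eta> \<circ> \<sigma>) i" by simp
qed

lemma ev_inj:
  fixes \<eta> \<xi> :: "'n::{finite,linorder} \<Rightarrow> nat"
  assumes k: "k \<ge> 0" and e: "\<And>i. ev k \<xi> i = ev k \<eta> i"
  shows "\<xi> = \<eta>"
proof (cases "k = 0")
  case True
  thus ?thesis using e unfolding ev_def by auto
next
  case False
  thus ?thesis using ev_perm_imp[of k id \<xi> \<eta>] k e by simp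
qed

definition adj :: "'n::linorder \<Rightarrow> 'n \<Rightarrow> bool" where
  "adj a b \<longleftrightarrow> a < b \<and> (\<forall>c. a < c \<longrightarrow> \<not> c < b)"

lemma tr_simps [simp]: "tr a b a = b" "tr a b b = a" "c \<noteq> a \<Longrightarrow> c \<noteq> b \<Longrightarrow> tr a b c = c"
  by (auto simp: Transposition.transpose_def)

text \<open>Nothing lies between a and b, so exchanging them disturbs the order of no other
  pair.\<close>

lemma adj_tr_less:
  assumes "adj a b" "{i, j} \<noteq> {a, b}" "i \<noteq> j"
  shows "tr a b i < tr a b j \<longleftrightarrow> i < j"
proof -
  have ord: "a < b" "\<And>c. c \<noteq> a \<Longrightarrow> c \<noteq> b \<Longrightarrow> c < a \<longleftrightarrow> c < b" "\<And>c. c \<noteq> a \<Longrightarrow> c \<noteq> b \<Longrightarrow> a < c \<longleftrightarrow> b < c"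
    using assms(1) unfolding adj_def by (auto, (metis less_trans neqE)+)
  show ?thesis
  proof (cases "i = a"; cases "i = b"; cases "j = a"; cases "j = b")
  qed (use assms(2,3) ord in auto)
qed

lemma prec_tr:
  fixes \<eta> :: "'n::{finite,linorder} \<Rightarrow> nat"
  assumes "adj a b" "\<eta> a \<noteq> \<eta> b"
  shows "prec (\<eta> \<circ> tr a b) j i \<longleftrightarrow> prec \<eta> (tr a b j) (tr a b i)"
proof (cases "i = j")
  case False
  show ?thesis
  proof (cases "{i, j} = {a, b}")
    case True
    hence "(\<eta> \<circ> tr a b) i \<noteq> (\<eta> \<circ> tr a b) j" using assms(2) by (auto simp: doubleton_eq_iff)
    thus ?thesis unfolding prec_def by auto
  next
    case F: False
    show ?thesis unfolding prec_def using adj_tr_less[OF assms(1) F False] by auto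
  qed
qed simp

lemma ev_tr:
  fixes \<eta> :: "'n::{finite,linorder} \<Rightarrow> nat"
  assumes "adj a b" "\<eta> a \<noteq> \<eta> b"
  shows "ev k (\<eta> \<circ> tr a b) i = ev k \<eta> (tr a b i)"
proof -
  have "card {j. prec (\<eta> \<circ> tr a b) j i} = card {j. prec \<eta> (tr a b j) (tr a b i)}"
    unfolding prec_tr[of _ _ \<eta>, OF assms] ..
  also have "\<dots> = card (tr a b ` {j. prec \<eta> (tr a b j) (tr a b i)})"
    by (rule card_image[symmetric]) (metis Transposition.transpose_involutory inj_onI)
  also have "tr a b ` {j. prec \<eta> (tr a b j) (tr a b i)} = {j. prec \<eta> j (tr a b i)}"
    by (auto simp: image_iff) (metis Transposition.transpose_involutory)
  finally have c: "card {j. prec (\<eta> \<circ> tr a b) j i} = card {j. prec \<eta> j (tr a b i)}" .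
  show ?thesis unfolding ev_def c by simp
qed

text \<open>These are the two quantities that must not vanish in the intertwiner: the denominator of
  \<gamma> = k/(e_a - e_b) and the numerator of 1 + \<gamma>. By \<open>prec_ev\<close> the
  difference is at least 1 or at most -1 - k.\<close>

lemma ev_tr_gap:
  fixes \<eta> :: "'n::{finite,linorder} \<Rightarrow> nat"
  assumes k: "k \<ge> 0" and "\<eta> a \<noteq> \<eta> b" "a < b"
  shows "ev k \<eta> a - ev k \<eta> b \<noteq> 0" "ev k \<eta> a - ev k \<eta> b + k \<noteq> 0"
proof -
  have "ev k \<eta> a - ev k \<eta> b \<ge> 1 \<or> ev k \<eta> a - ev k \<eta> b \<le> -1 - k"
  proof (cases "\<eta> b < \<eta> a")
    case True
    hence "prec \<eta> a b" by (simp add: prec_def)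
    from prec_ev[OF k this] True k show ?thesis by linarith
  next
    case False
    hence *: "\<eta> a < \<eta> b" using assms(2) by simp
    hence "prec \<eta> b a" by (simp add: prec_def)
    from prec_ev[OF k this] * k show ?thesis by linarith
  qed
  thus "ev k \<eta> a - ev k \<eta> b \<noteq> 0" "ev k \<eta> a - ev k \<eta> b + k \<noteq> 0" using k by auto
qed

text \<open>Since the larger index wins a tie, b is the immediate predecessor of a. For k > 0 this
  is the degenerate value \<gamma> = -1 of the intertwiner.\<close>

lemma ev_adj_eq:
  fixes \<eta> :: "'n::{finite,linorder} \<Rightarrow> nat"
  assumes "adj a b" "\<eta> a = \<eta> b"
  shows "ev k \<eta> a - ev k \<eta> b = - k"
proof -
  have ord: "a < b" using assms(1) by (simp add: adj_def)
  have ord2: "a < c \<longleftrightarrow> c = b \<or> b < c" for c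
    using assms(1) unfolding adj_def by (metis less_trans neqE)
  have "{j. prec \<eta> j a} = insert b {j. prec \<eta> j b}"
    unfolding prec_def assms(2) ord2 by auto
  hence "card {j. prec \<eta> j a} = Suc (card {j. prec \<eta> j b})" by simp
  thus ?thesis unfolding ev_def assms(2) by (simp add: algebra_simps)
qed

definition mn :: "'n::{finite,linorder}" where "mn = Min UNIV"
definition mx :: "'n::{finite,linorder}" where "mx = Max UNIV"

definition cyc :: "'n::{finite,linorder} \<Rightarrow> 'n" where
  "cyc i = (if i = mx then mn else Min {j. i < j})"

lemma mn_le [simp]: "mn \<le> i" by (simp add: mn_def)
lemma le_mx [simp]: "i \<le> mx" by (simp add: mx_def)
lemma not_less_mn [simp]: "\<not> i < mn" by (simp add: not_less)
lemma not_mx_less [simp]: "\<not> mx < i" by (simp add: not_less)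

lemma cyc_mx [simp]: "cyc mx = mn" by (simp add: cyc_def)

lemma cyc_succ:
  assumes "i \<noteq> mx"
  shows "i < cyc i" "i < j \<Longrightarrow> cyc i \<le> j"
proof -
  have ne: "{j. i < j} \<noteq> {}" using assms le_mx[of i] by (auto simp: order_less_le intro!: exI[of _ mx])
  show "i < cyc i" using Min_in[OF _ ne] assms by (simp add: cyc_def)
  show "i < j \<Longrightarrow> cyc i \<le> j" using assms by (simp add: cyc_def)
qed

lemma cyc_mono: "i \<noteq> mx \<Longrightarrow> j \<noteq> mx \<Longrightarrow> cyc i < cyc j \<longleftrightarrow> i < j"
  by (metis cyc_succ le_less_trans neqE order_less_asym)

lemma cyc_eq_mn [simp]: "cyc i = mn \<longleftrightarrow> i = mx"
  by (metis cyc_mx cyc_succ(1) not_less_mn)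

lemma mn_eq_cyc [simp]: "mn = cyc i \<longleftrightarrow> i = mx"
  by (metis cyc_eq_mn)

lemma bij_cyc: "bij (cyc :: 'n::{finite,linorder} \<Rightarrow> 'n)"
proof -
  have "inj (cyc :: 'n \<Rightarrow> 'n)"
  proof (rule injI)
    fix x y :: 'n assume "cyc x = cyc y"
    thus "x = y" by (metis cyc_eq_mn cyc_mono less_irrefl neqE)
  qed
  thus ?thesis by (simp add: bij_def finite_UNIV_inj_surj)
qed

text \<open>The affine move (\<eta>_1,...,\<eta>_n) to (\<eta>_n + 1, \<eta>_1,...,\<eta>_(n-1)) on
  compositions that belongs to the raising operator.\<close>

definition up :: "('n::{finite,linorder} \<Rightarrow> nat) \<Rightarrow> 'n \<Rightarrow> nat" where
  "up \<eta> i = \<eta> (inv cyc i) + (if i = mn then 1 else 0)"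

lemma up_cyc: "up \<eta> (cyc l) = \<eta> l + (if l = mx then 1 else 0)"
  by (simp add: up_def inv_f_f[OF bij_is_inj[OF bij_cyc]])

lemma inj_up: "inj (up :: ('n::{finite,linorder} \<Rightarrow> nat) \<Rightarrow> _)"
proof (rule injI)
  fix x y :: "'n \<Rightarrow> nat" assume "up x = up y"
  hence "up x (cyc l) = up y (cyc l)" for l by simp
  thus "x = y" unfolding up_cyc by (auto simp: fun_eq_iff)
qed

lemma mdeg_up: "mdeg (up \<eta>) = Suc (mdeg \<eta>)"
proof -
  have "mdeg (up \<eta>) = (\<Sum>l\<in>UNIV. up \<eta> (cyc l))"
    unfolding mdeg_def by (rule sum.reindex_bij_betw[OF bij_cyc, symmetric])
  thus ?thesis unfolding up_cyc mdeg_def by (simp add: sum.distrib)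
qed

lemma up_surj:
  fixes \<eta> :: "'n::{finite,linorder} \<Rightarrow> nat"
  assumes "\<eta> mn \<noteq> 0"
  obtains \<xi> where "\<eta> = up \<xi>"
proof
  show "\<eta> = up (\<lambda>l. \<eta> (cyc l) - (if l = mx then 1 else 0))"
  proof
    fix i :: 'n
    obtain l where l: "i = cyc l" using bij_cyc by (meson bij_pointE)
    show "\<eta> i = up (\<lambda>l. \<eta> (cyc l) - (if l = mx then 1 else 0)) i"
      unfolding l up_cyc using assms by auto
  qed
qed

text \<open>The cyclic shift preserves \<open>prec\<close>: the last entry used to win all ties, and
  as first entry it loses them, but it has been increased by one. Thus ranks are carried along and
  only the entry itself changes.\<close>

lemma ev_up: "ev k (up \<eta>) (cyc l) = ev k \<eta> l + (if l = mx then 1 else 0)"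
proof -
  have p: "prec (up \<eta>) (cyc j) (cyc l) \<longleftrightarrow> prec \<eta> j l" for j
  proof (cases "j = l")
    case False
    consider "j \<noteq> mx" "l \<noteq> mx" | "j = mx" "l \<noteq> mx" | "j \<noteq> mx" "l = mx" using False by auto
    thus ?thesis
    proof cases
      case 1 thus ?thesis unfolding prec_def up_cyc by (simp add: cyc_mono)
    next
      case 2 
      hence "l < mx" using le_mx[of l] by (simp add: order_less_le)
      thus ?thesis using 2 unfolding prec_def up_cyc by auto
    next
      case 3
      hence "mn < cyc j" using mn_le[of "cyc j"] cyc_eq_mn[of j] by (metis order_le_less)
      thus ?thesis using 3 unfolding prec_def up_cyc by auto
    qed
  qed simp
  have "{j. prec (up \<eta>) j (cyc l)} = cyc ` {j. prec \<eta> j l}"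
  proof safe
    fix j assume *: "prec (up \<eta>) j (cyc l)"
    obtain m where m: "j = cyc m" using bij_cyc by (meson bij_pointE)
    show "j \<in> cyc ` {j. prec \<eta> j l}" using * unfolding m p by auto
  qed (use p in auto)
  hence "card {j. prec (up \<eta>) j (cyc l)} = card {j. prec \<eta> j l}"
    by (simp only: card_image[OF inj_on_subset[OF bij_is_inj[OF bij_cyc] subset_UNIV]])
  thus ?thesis unfolding ev_def up_cyc by simp
qed

subsection \<open>Joint eigenfunctions of the Cherednik operators\<close>

text \<open>The Cherednik operator without its constant. The two index-dependent shifts, k #{j > i}
  in \<open>spec_ev\<close> and k #{j < i} in \<open>cherednik\<close>, then add up to k(n - 1) for
  every i.\<close>

definition Yop :: "real \<Rightarrow> 'n::{finite,linorder} \<Rightarrow> ((complex,'n) vec \<Rightarrow> complex) \<Rightarrow> (complex,'n) vec \<Rightarrow> complex" where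
  "Yop k i f z = z $ i * dunklA k i f z + of_real k * (\<Sum>j\<in>{j. j < i}. f (swapv i j z))"

definition eigf :: "real \<Rightarrow> ('n::{finite,linorder} \<Rightarrow> real) \<Rightarrow> ((complex,'n) vec \<Rightarrow> complex) \<Rightarrow> bool" where
  "eigf k e f \<longleftrightarrow> holo_n f \<and> (\<forall>i z. distinct_coords z \<longrightarrow>
     Yop k i f z = of_real (e i + k * (real CARD('n) - 1)) * f z)"

lemma cherednik_iff_eigf:
  assumes "holo_n f"
  shows "(\<forall>i z. distinct_coords z \<longrightarrow> cherednik k i f z = spec k \<eta> i * f z) \<longleftrightarrow> eigf k (ev k \<eta>) f"
proof -
  have "cherednik k i f z = spec k \<eta> i * f z \<longleftrightarrow>
     Yop k i f z = of_real (ev k \<eta> i + k * (real CARD('a) - 1)) * f z" for i z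
  proof -
    have "real CARD('a) - 1 = real (card {j. j < i}) + real (card {j. i < j})"
      using arg_cong[OF card_less_greater[of i], of real] by simp
    thus ?thesis unfolding cherednik_def spec_ev Yop_def
      by (simp add: algebra_simps)
  qed
  thus ?thesis unfolding eigf_def using assms by simp
qed

lemma Yop_sum:
  assumes "\<And>x. x \<in> I \<Longrightarrow> holo_n (f x)"
  shows "Yop k i (\<lambda>z. \<Sum>x\<in>I. c x * f x z) z = (\<Sum>x\<in>I. c x * Yop k i (f x) z)"
proof -
  have "(\<Sum>j\<in>{j. j < i}. \<Sum>x\<in>I. c x * f x (swapv i j z)) = (\<Sum>x\<in>I. \<Sum>j\<in>{j. j < i}. c x * f x (swapv i j z))"
    by (rule sum.swap)
  moreover have "dunklA k i (\<lambda>z. \<Sum>x\<in>I. c x * f x z) z = (\<Sum>x\<in>I. c x * dunklA k i (f x) z)"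
    by (rule dunklA_sum[OF assms])
  ultimately show ?thesis unfolding Yop_def
    by (simp add: sum_distrib_left sum.distrib distrib_left mult.left_commute)
qed

lemma Yop_add_cmult:
  assumes "holo_n f" "holo_n g"
  shows "Yop k i (\<lambda>z. f z + c * g z) z = Yop k i f z + c * Yop k i g z"
  using dunklA_add[OF assms(1) holo_n_mult[OF holo_n_const assms(2)], of k i c z]
    dunklA_cmult[OF assms(2), of k i c z]
  unfolding Yop_def by (simp add: sum.distrib sum_distrib_left algebra_simps)

lemma eigf_cmult:
  assumes "eigf k e f"
  shows "eigf k e (\<lambda>z. c * f z)"
proof -
  have h: "holo_n f" using assms by (simp add: eigf_def)
  show ?thesis using assms Yop_sum[of "{()}" "\<lambda>_. f" k _ "\<lambda>_. c"] h unfolding eigf_def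
    by (auto intro: holo_n_mult)
qed

lemma Yop_pv:
  fixes f :: "(complex,'n::{finite,linorder}) vec \<Rightarrow> complex"
  assumes "bij \<sigma>"
  shows "Yop k (\<sigma> l) (\<lambda>z. f (pv \<sigma> z)) z = pv \<sigma> z $ l * dunklA k l f (pv \<sigma> z)
     + of_real k * (\<Sum>m\<in>{m. \<sigma> m < \<sigma> l}. f (swapv l m (pv \<sigma> z)))"
proof -
  have inj: "inj \<sigma>" using assms bij_is_inj by blast
  have "(\<Sum>j\<in>{j. j < \<sigma> l}. f (pv \<sigma> (swapv (\<sigma> l) j z)))
     = (\<Sum>m\<in>{m. \<sigma> m < \<sigma> l}. f (pv \<sigma> (swapv (\<sigma> l) (\<sigma> m) z)))"
    by (rule sum.reindex_bij_witness[of _ \<sigma> "inv \<sigma>"])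
       (use assms in \<open>auto simp: bij_is_surj surj_f_inv_f inj\<close>)
  thus ?thesis unfolding Yop_def dunklA_pv[OF assms] pv_swapv[OF inj] by simp
qed

text \<open>The intertwiner of the graded Hecke algebra. With s = s_ab the relations are Y_a s = s
  Y_b - k and Y_b s = s Y_a + k, while s commutes past the remaining Y_i; the extra multiples of f
  cancel exactly if k = \<gamma> (e_a - e_b). Writing the condition without division keeps the case
  k = 0, e_a = e_b.\<close>

lemma eigf_swap:
  assumes ab: "adj a b" and f: "eigf k e f" and g: "k = \<gamma> * (e a - e b)"
  shows "eigf k (e \<circ> tr a b) (\<lambda>z. f (swapv a b z) + of_real \<gamma> * f z)"
  unfolding eigf_def
proof (intro conjI allI impI)
  have hf: "holo_n f" using f by (simp add: eigf_def)
  have hs: "holo_n (\<lambda>z. f (swapv a b z))" unfolding swapv_pv by (intro holo_n_pv hf)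
  show "holo_n (\<lambda>z. f (swapv a b z) + of_real \<gamma> * f z)" by (intro holo_n_add holo_n_mult holo_n_const hf hs)
  fix i :: 'a and z :: "(complex,'a) vec" assume z: "distinct_coords z"
  define y where "y = swapv a b z"
  have y: "distinct_coords y" using z by (simp add: y_def)
  have pvy: "pv (tr a b) z = y" by (simp add: y_def swapv_pv)
  have zy: "swapv a b y = z" "swapv b a y = z" by (simp_all add: y_def swapv_commute)
  have ord: "a < b" "\<And>c. c \<noteq> a \<Longrightarrow> c \<noteq> b \<Longrightarrow> c < a \<longleftrightarrow> c < b" "\<And>c. c \<noteq> a \<Longrightarrow> c \<noteq> b \<Longrightarrow> a < c \<longleftrightarrow> b < c"
    using ab unfolding adj_def by (auto, (metis less_trans neqE)+)
  have eq: "Yop k i f z = of_real (e i + k * (real CARD('a) - 1)) * f z" if "distinct_coords z" for i z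
    using f that unfolding eigf_def by blast
  have Yp: "Yop k (tr a b l) (\<lambda>z. f (swapv a b z)) z = y $ l * dunklA k l f y
     + of_real k * (\<Sum>m\<in>{m. tr a b m < tr a b l}. f (swapv l m y))" for l
    using Yop_pv[of "tr a b" k l f z] unfolding swapv_pv[of a b] pvy by simp
  have main: "Yop k i (\<lambda>z. f (swapv a b z)) z
     = of_real (e (tr a b i) + k * (real CARD('a) - 1)) * f y
       + (if i = a then - of_real k * f z else if i = b then of_real k * f z else 0)"
  proof -
    consider "i = a" | "i = b" | "i \<noteq> a" "i \<noteq> b" by auto
    thus ?thesis
    proof cases
      case 1
      have s: "{m. tr a b m < a} = {m. m < a}"
      proof safe
        fix m assume "tr a b m < a" thus "m < a" using ord(1) ord(2)[of m] by (cases "m = a"; cases "m = b") auto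
      next
        fix m assume "m < a" thus "tr a b m < a" using ord(1) ord(2)[of m] by (cases "m = a"; cases "m = b") auto
      qed
      have s2: "{m. m < b} = insert a {m. m < a}"
      proof (rule set_eqI)
        fix m show "m \<in> {m. m < b} \<longleftrightarrow> m \<in> insert a {m. m < a}"
          using ord(1) ord(2)[of m] by (cases "m = a"; cases "m = b") auto
      qed
      have "Yop k a (\<lambda>z. f (swapv a b z)) z = Yop k b f y - of_real k * f z"
        using Yp[of b] unfolding Yop_def[of k b] s2 by (simp add: s zy algebra_simps)
      thus ?thesis using 1 eq[OF y, of b] by simp
    next
      case 2
      have s: "{m. tr a b m < b} = insert b {m. m < a}"
      proof (rule set_eqI)
        fix m show "m \<in> {m. tr a b m < b} \<longleftrightarrow> m \<in> insert b {m. m < a}"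
          using ord(1) ord(2)[of m] by (cases "m = a"; cases "m = b") auto
      qed
      have "b \<notin> {m. m < a}" using ord by auto
      hence "Yop k b (\<lambda>z. f (swapv a b z)) z = Yop k a f y + of_real k * f z"
        using Yp[of a] unfolding Yop_def[of k a] by (simp add: s zy algebra_simps)
      thus ?thesis using 2 eq[OF y, of a] ord(1) by simp
    next
      case 3
      have "tr a b m < i \<longleftrightarrow> m < i" for m
      proof -
        consider "m = a" | "m = b" | "m \<noteq> a" "m \<noteq> b" by auto
        thus ?thesis
        proof cases
          case 1 show ?thesis unfolding 1 tr_simps by (rule ord(3)[OF 3, symmetric])
        next
          case 2 show ?thesis unfolding 2 tr_simps by (rule ord(3)[OF 3])
        next
          case 3 show ?thesis unfolding tr_simps(3)[OF 3] ..
        qed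
      qed
      hence s: "{m. tr a b m < i} = {m. m < i}" by blast
      have "Yop k i (\<lambda>z. f (swapv a b z)) z = Yop k i f y"
        using Yp[of i] 3 unfolding Yop_def[of k i f] by (simp add: s)
      thus ?thesis using 3 eq[OF y, of i] by simp
    qed
  qed
  have "Yop k i (\<lambda>z. f (swapv a b z) + of_real \<gamma> * f z) z
     = Yop k i (\<lambda>z. f (swapv a b z)) z + of_real \<gamma> * Yop k i f z"
    by (rule Yop_add_cmult[OF hs hf])
  also have "\<dots> = of_real ((e \<circ> tr a b) i + k * (real CARD('a) - 1)) * (f y + of_real \<gamma> * f z)
      + of_real (\<gamma> * (e i - e (tr a b i)) - (if i = a then k else if i = b then - k else 0)) * f z"
    unfolding main eq[OF z] by (simp add: algebra_simps)
  also have "\<gamma> * (e i - e (tr a b i)) - (if i = a then k else if i = b then - k else 0) = 0"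
    using g ord(1) by (auto simp: algebra_simps)
  finally show "Yop k i (\<lambda>z. f (swapv a b z) + of_real \<gamma> * f z) z
     = of_real ((e \<circ> tr a b) i + k * (real CARD('a) - 1)) * (f (swapv a b z) + of_real \<gamma> * f z)"
    by (simp add: y_def)
qed

text \<open>The raising operator of Knop and Sahi.\<close>
lemma eigf_raise:
  assumes f: "eigf k e f" and e': "\<And>l. e' (cyc l) = e l + (if l = mx then 1 else 0)"
  shows "eigf k e' (\<lambda>z. z $ mn * f (pv cyc z))"
  unfolding eigf_def
proof (intro conjI allI impI)
  have hf: "holo_n f" using f by (simp add: eigf_def)
  define q where "q = (\<lambda>z. f (pv cyc z))"
  have hq: "holo_n q" unfolding q_def by (intro holo_n_pv hf)
  show "holo_n (\<lambda>z. z $ mn * f (pv cyc z))" by (intro holo_n_mult holo_n_nth holo_n_pv hf)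
  fix i :: 'a and z :: "(complex,'a) vec" assume z: "distinct_coords z"
  define y where "y = pv cyc z"
  have y: "distinct_coords y" using z unfolding y_def distinct_coords_pv[OF bij_cyc] .
  have inj: "inj (cyc :: 'a \<Rightarrow> 'a)" using bij_cyc bij_is_inj by blast
  obtain l where i: "i = cyc l" using bij_cyc by (meson bij_pointE)
  have eq: "Yop k l f y = of_real (e l + k * (real CARD('a) - 1)) * f y"
    using f y unfolding eigf_def by blast
  have T: "dunklA k i q z = dunklA k l f y" unfolding i q_def y_def by (rule dunklA_pv[OF bij_cyc])
  have zi: "z $ i = y $ l" by (simp add: i y_def)
  have qs: "q (swapv i (cyc m) z) = f (swapv l m y)" for m
    unfolding q_def i y_def pv_swapv[OF inj] ..
  have "Yop k i (\<lambda>z. z $ mn * q z) z = z $ mn * (Yop k l f y + (if l = mx then f y else 0))"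
  proof (cases "l = mx")
    case True
    hence imn: "i = mn" by (simp add: i)
    \<comment> \<open>At the first index \<open>Yop\<close> has no reflection sum of its own; the
      commutator with z_mn supplies all reflections, which become those below \<open>mx\<close>, and
      in addition the term q z that raises the eigenvalue by 1.\<close>
    have "(\<Sum>j\<in>UNIV-{i}. q (swapv i j z)) = (\<Sum>m\<in>{m. m < l}. q (swapv i (cyc m) z))"
    proof (rule sum.reindex_bij_witness[of _ cyc "inv cyc"])
      fix j assume j: "j \<in> UNIV - {i}"
      obtain m where m: "j = cyc m" using bij_cyc by (meson bij_pointE)
      have "m \<noteq> mx" using j m imn by auto
      thus "inv cyc j \<in> {m. m < l}" using m inj True le_mx[of m] by (simp add: order_less_le)
      show "cyc (inv cyc j) = j" using m inj by simp
      show "q (swapv i (cyc (inv cyc j)) z) = q (swapv i j z)" using m inj by simp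
    next
      fix m assume "m \<in> {m. m < l}"
      thus "cyc m \<in> UNIV - {i}" using imn by auto
      show "inv cyc (cyc m) = m" using inj by simp
    qed
    hence "Yop k i (\<lambda>z. z $ mn * q z) z
      = z $ mn * (q z + z $ i * dunklA k i q z + of_real k * (\<Sum>m\<in>{m. m < l}. f (swapv l m y)))"
      unfolding Yop_def imn dunklA_nth_mult_same[OF hq z] using qs unfolding imn by simp
    thus ?thesis using True unfolding T zi Yop_def by (simp add: q_def y_def algebra_simps)
  next
    case False
    hence "i \<noteq> mn" by (simp add: i)
    hence imn: "mn \<noteq> i" "mn < i" using mn_le[of i] by (auto simp: order_less_le)
    define S where "S = (\<Sum>j\<in>{j. mn < j \<and> j < i}. q (swapv i j z))"
    have "{j. j < i} = insert mn {j. mn < j \<and> j < i}" using imn mn_le by (auto simp: order_less_le)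
    hence "(\<Sum>j\<in>{j. j < i}. swapv i j z $ mn * q (swapv i j z))
       = z $ i * q (swapv i mn z) + (\<Sum>j\<in>{j. mn < j \<and> j < i}. swapv i j z $ mn * q (swapv i j z))"
      by simp
    also have "(\<Sum>j\<in>{j. mn < j \<and> j < i}. swapv i j z $ mn * q (swapv i j z)) = z $ mn * S"
      unfolding S_def sum_distrib_left using imn by (intro sum.cong) (auto simp: swapv_def)
    \<comment> \<open>The term with j = mn yields z_i q(s z), which cancels against the commutator
      of T_i with z_mn; the rest is z_mn times the reflections belonging to l.\<close>
    finally have 1: "(\<Sum>j\<in>{j. j < i}. swapv i j z $ mn * q (swapv i j z)) = z $ i * q (swapv i mn z) + z $ mn * S" .
    have nm: "m \<noteq> mx" if "m < l" for m using that by auto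
    have "S = (\<Sum>m\<in>{m. m < l}. q (swapv i (cyc m) z))" unfolding S_def
    proof (rule sum.reindex_bij_witness[of _ cyc "inv cyc"])
      fix j assume j: "j \<in> {j. mn < j \<and> j < i}"
      obtain m where m: "j = cyc m" using bij_cyc by (meson bij_pointE)
      have "m \<noteq> mx" using j m by auto
      hence "m < l" using j m False by (simp add: i cyc_mono)
      thus "inv cyc j \<in> {m. m < l}" using m inj by simp
      show "cyc (inv cyc j) = j" using m inj by simp
      show "q (swapv i (cyc (inv cyc j)) z) = q (swapv i j z)" using m inj by simp
    next
      fix m assume "m \<in> {m. m < l}"
      hence "m < l" "m \<noteq> mx" using nm by auto
      hence "cyc m < i" "cyc m \<noteq> mn" using False cyc_mono[of m l] by (simp_all add: i)
      hence "cyc m < i" "mn < cyc m" using mn_le[of "cyc m"] by (auto simp: order_less_le)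
      thus "cyc m \<in> {j. mn < j \<and> j < i}" by simp
      show "inv cyc (cyc m) = m" using inj by simp
    qed
    hence S: "S = (\<Sum>m\<in>{m. m < l}. f (swapv l m y))" using qs by simp
    show ?thesis unfolding Yop_def dunklA_nth_mult_diff[OF hq z imn(1)] 1 T zi S using False
      by (simp add: algebra_simps)
  qed
  thus "Yop k i (\<lambda>z. z $ mn * f (pv cyc z)) z
      = of_real (e' i + k * (real CARD('a) - 1)) * (z $ mn * f (pv cyc z))"
    unfolding q_def eq y_def[symmetric] i e' by (simp add: algebra_simps)
qed

subsection \<open>Existence of the non-symmetric Jack polynomials\<close>

lemma eigf_const: "eigf k (ev k (\<lambda>_. 0)) (\<lambda>z. 1 :: complex)"
  unfolding eigf_def
proof (intro conjI allI impI holo_n_const)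
  fix i :: 'a and z :: "(complex,'a) vec"
  have "real CARD('a) - 1 = real (card {j. j < i}) + real (card {j. i < j})"
    using arg_cong[OF card_less_greater[of i], of real] by simp
  thus "Yop k i (\<lambda>z. 1) z = of_real (ev k (\<lambda>_. 0) i + k * (real CARD('a) - 1)) * 1"
    unfolding Yop_def ev_def prec_def by (simp add: algebra_simps)
qed

lemma adj_pred:
  fixes i :: "'n::{finite,linorder}"
  assumes "i \<noteq> mn"
  obtains a where "adj a i"
proof
  have ne: "{j. j < i} \<noteq> {}" using assms mn_le[of i] by (auto simp: order_less_le intro!: exI[of _ mn])
  show "adj (Max {j. j < i}) i"
    unfolding adj_def using Max_in[OF _ ne] by (metis Max_ge finite mem_Collect_eq not_less)
qed

text \<open>The induction is on the degree and, for a fixed degree, on the position of the first nonzero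
  entry.\<close>
lemma composition_induct [case_names zero up swap]:
  fixes P :: "('n::{finite,linorder} \<Rightarrow> nat) \<Rightarrow> bool"
  assumes zero: "P (\<lambda>_. 0)"
    and up: "\<And>\<xi>. P \<xi> \<Longrightarrow> P (up \<xi>)"
    and swap: "\<And>a b \<xi>. adj a b \<Longrightarrow> \<xi> b < \<xi> a \<Longrightarrow> P \<xi> \<Longrightarrow> P (\<xi> \<circ> tr a b)"
  shows "P \<eta>"
proof (induction "mdeg \<eta>" arbitrary: \<eta> rule: less_induct)
  case less
  have inner: "\<lbrakk>mdeg \<xi> = mdeg \<eta>; \<xi> i \<noteq> 0; \<forall>j<i. \<xi> j = 0\<rbrakk> \<Longrightarrow> P \<xi>" for \<xi> i
  proof (induction "card {j. j < i}" arbitrary: i \<xi> rule: less_induct)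
    case (less i \<xi>)
    show ?case
    proof (cases "i = mn")
      case True
      then obtain \<zeta> where z: "\<xi> = up \<zeta>" using less.prems(2) up_surj by metis
      have "mdeg \<zeta> < mdeg \<eta>" using less.prems(1) unfolding z mdeg_up by simp
      hence "P \<zeta>" by (rule \<open>\<And>\<eta>'. mdeg \<eta>' < mdeg \<eta> \<Longrightarrow> P \<eta>'\<close>)
      thus ?thesis unfolding z by (rule up)
    next
      case False
      then obtain a where a: "adj a i" using adj_pred by blast
      have ai: "a < i" using a by (simp add: adj_def)
      define \<zeta> where "\<zeta> = \<xi> \<circ> tr a i"
      have "P \<zeta>"
      proof (rule less.hyps[of a])
        show "card {j. j < a} < card {j. j < i}"
          by (rule psubset_card_mono) (use ai in auto)
        show "mdeg \<zeta> = mdeg \<eta>" unfolding \<zeta>_def using less.prems(1) by (simp add: mdeg_perm)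
        show "\<zeta> a \<noteq> 0" using less.prems(2) by (simp add: \<zeta>_def)
        show "\<forall>j<a. \<zeta> j = 0" using less.prems(3) ai by (auto simp: \<zeta>_def)
      qed
      moreover have "\<zeta> i < \<zeta> a" using less.prems(2,3) ai by (simp add: \<zeta>_def)
      ultimately have "P (\<zeta> \<circ> tr a i)" using swap[OF a] by blast
      moreover have "\<zeta> \<circ> tr a i = \<xi>" by (simp add: \<zeta>_def comp_assoc)
      ultimately show ?thesis by simp
    qed
  qed
  show ?case
  proof (cases "\<eta> = (\<lambda>_. 0)")
    case False
    hence ne: "{i. \<eta> i \<noteq> 0} \<noteq> {}" by auto
    define i where "i = Min {i. \<eta> i \<noteq> 0}"
    have "\<eta> i \<noteq> 0" using Min_in[OF _ ne] by (simp add: i_def)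
    moreover have "\<forall>j<i. \<eta> j = 0" unfolding i_def using ne by auto
    ultimately show ?thesis using inner by blast
  qed (use zero in simp)
qed

text \<open>The value at (1,...,1) is carried through the construction: raising leaves it unchanged
  and the intertwiner multiplies it by 1 + \<gamma>, which is nonzero by \<open>ev_tr_gap\<close>.
  So the normalisation there is always possible.\<close>

lemma jack_exists:
  fixes \<eta> :: "'n::{finite,linorder} \<Rightarrow> nat"
  assumes k: "k \<ge> 0"
  shows "\<exists>f. homog_poly (mdeg \<eta>) f \<and> eigf k (ev k \<eta>) f \<and> f (constv 1) = 1"
proof (induction \<eta> rule: composition_induct)
  case zero
  show ?case using eigf_const[of k] homog_poly_1[of 1]
    by (intro exI[of _ "\<lambda>_. 1"]) (auto simp: mdeg_def)
next
  case (up \<xi>)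
  then obtain f where f: "homog_poly (mdeg \<xi>) f" "eigf k (ev k \<xi>) f" "f (constv 1) = 1" by blast
  show ?case
  proof (intro exI[of _ "\<lambda>z. z $ mn * f (pv cyc z)"] conjI)
    show "homog_poly (mdeg (up \<xi>)) (\<lambda>z. z $ mn * f (pv cyc z))"
      unfolding mdeg_up by (intro homog_poly_nth_mult homog_poly_pv bij_cyc f)
    show "eigf k (ev k (up \<xi>)) (\<lambda>z. z $ mn * f (pv cyc z))"
      by (rule eigf_raise[OF f(2) ev_up])
    show "(constv 1 :: (complex,'n) vec) $ mn * f (pv cyc (constv 1)) = 1"
      unfolding pv_constv f(3) by (simp add: constv_def)
  qed
next
  case (swap a b \<xi>)
  then obtain f where f: "homog_poly (mdeg \<xi>) f" "eigf k (ev k \<xi>) f" "f (constv 1) = 1" by blast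
  have ab: "a < b" using swap by (simp add: adj_def)
  have ne: "\<xi> a \<noteq> \<xi> b" using swap by simp
  note gap = ev_tr_gap[where \<eta>=\<xi>, OF k ne ab]
  define \<gamma> where "\<gamma> = k / (ev k \<xi> a - ev k \<xi> b)"
  have g: "k = \<gamma> * (ev k \<xi> a - ev k \<xi> b)" using gap by (simp add: \<gamma>_def)
  have g1: "1 + \<gamma> \<noteq> 0" using gap by (simp add: \<gamma>_def field_simps)
  define v where "v = (\<lambda>z. f (swapv a b z) + of_real \<gamma> * f z)"
  have "ev k \<xi> \<circ> tr a b = ev k (\<xi> \<circ> tr a b)" using ev_tr[where \<eta>=\<xi>, OF swap(1) ne] by (simp add: fun_eq_iff)
  hence ev: "eigf k (ev k (\<xi> \<circ> tr a b)) v" unfolding v_def using eigf_swap[OF swap(1) f(2) g] by simp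
  have hv: "homog_poly (mdeg (\<xi> \<circ> tr a b)) v"
    unfolding v_def swapv_pv using f(1)
    by (intro homog_poly_add homog_poly_cmult homog_poly_pv) (auto simp: mdeg_perm)
  have v1: "v (constv 1) = of_real (1 + \<gamma>)" unfolding v_def swapv_pv pv_constv f(3) by simp
  show ?case
  proof (intro exI[of _ "\<lambda>z. inverse (of_real (1+\<gamma>)) * v z"] conjI homog_poly_cmult hv eigf_cmult ev)
    show "inverse (of_real (1 + \<gamma>)) * v (constv 1) = 1"
      unfolding v1 using g1 by (metis left_inverse of_real_eq_0_iff)
  qed
qed

text \<open>The non-symmetric Jack polynomial with value 1 at (1,...,1). The choice is harmless:
  \<open>eigf_unique\<close> shows that these properties determine it.\<close>

definition jackE :: "real \<Rightarrow> ('n::{finite,linorder} \<Rightarrow> nat) \<Rightarrow> (complex,'n) vec \<Rightarrow> complex" where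
  "jackE k \<eta> = (SOME f. homog_poly (mdeg \<eta>) f \<and> eigf k (ev k \<eta>) f \<and> f (constv 1) = 1)"

section \<open>Uniqueness, basis property and permutation behaviour of the normalised Jack
  polynomials\<close>

locale dunkl_mult =
  fixes k :: real
  assumes k: "k \<ge> 0"
begin

lemma jackE:
  "homog_poly (mdeg \<eta>) (jackE k \<eta>)" "eigf k (ev k \<eta>) (jackE k \<eta>)" "jackE k \<eta> (constv 1) = 1"
  using someI_ex[OF jack_exists[OF k, of \<eta>]] unfolding jackE_def[symmetric] by auto

lemma jackE_holo: "holo_n (jackE k \<eta>)"
  using jackE(1) homog_poly_holo by blast

lemma jackE_Yop:
  fixes z :: "(complex,'n::{finite,linorder}) vec"
  shows "distinct_coords z \<Longrightarrow> Yop k i (jackE k \<eta>) z = of_real (ev k \<eta> i + k * (real CARD('n) - 1)) * jackE k \<eta> z"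
  using jackE(2)[of \<eta>] unfolding eigf_def by blast

text \<open>Independence of eigenvectors: applying Y_i minus its value on \<open>x\<close> removes
  \<open>x\<close> from the relation. Spectral vectors separate compositions, so some i leaves a
  given other term alive.\<close>

lemma jackE_independent:
  assumes "finite S" "\<And>z. (\<Sum>\<eta>\<in>S. c \<eta> * jackE k \<eta> z) = 0" "\<eta> \<in> S"
  shows "c \<eta> = 0"
  using assms
proof (induction S arbitrary: c \<eta> rule: finite_induct)
  case (insert x S)
  have IH: "c \<eta> * of_real (ev k \<eta> i - ev k x i) = 0" if "\<eta> \<in> S" for \<eta> i
  proof (rule insert.IH[where c="\<lambda>\<eta>. c \<eta> * of_real (ev k \<eta> i - ev k x i)", OF _ that])
    fix z
    have cont: "continuous_on UNIV (\<lambda>z. \<Sum>\<eta>\<in>S. c \<eta> * complex_of_real (ev k \<eta> i - ev k x i) * jackE k \<eta> z)"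
      by (intro holo_n_continuous holo_n_sum holo_n_mult holo_n_const jackE_holo)
    show "(\<Sum>\<eta>\<in>S. c \<eta> * complex_of_real (ev k \<eta> i - ev k x i) * jackE k \<eta> z) = 0"
    proof (rule distinct_coords_eq[OF cont continuous_on_const])
      fix z :: "(complex,'a) vec" assume z: "distinct_coords z"
      have "0 = Yop k i (\<lambda>z. \<Sum>\<eta>\<in>insert x S. c \<eta> * jackE k \<eta> z) z"
        unfolding insert.prems(1) Yop_def by simp
      also have "\<dots> = (\<Sum>\<eta>\<in>insert x S. c \<eta> * (of_real (ev k \<eta> i + k * (real CARD('a) - 1)) * jackE k \<eta> z))"
        unfolding Yop_sum[OF jackE_holo] jackE_Yop[OF z] ..
      also have "\<dots> = (\<Sum>\<eta>\<in>insert x S. c \<eta> * of_real (ev k \<eta> i - ev k x i) * jackE k \<eta> z)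
          + of_real (ev k x i + k * (real CARD('a) - 1)) * (\<Sum>\<eta>\<in>insert x S. c \<eta> * jackE k \<eta> z)"
        unfolding sum_distrib_left sum.distrib[symmetric] by (intro sum.cong) (auto simp: algebra_simps)
      also have "\<dots> = (\<Sum>\<eta>\<in>S. c \<eta> * of_real (ev k \<eta> i - ev k x i) * jackE k \<eta> z)"
        unfolding insert.prems(1) using insert.hyps by simp
      finally show "(\<Sum>\<eta>\<in>S. c \<eta> * complex_of_real (ev k \<eta> i - ev k x i) * jackE k \<eta> z) = 0" ..
    qed
  qed
  have S: "c \<eta> = 0" if "\<eta> \<in> S" for \<eta>
  proof (rule ccontr)
    assume "c \<eta> \<noteq> 0"
    hence "ev k \<eta> i = ev k x i" for i using IH[OF that, of i] by simp
    hence "\<eta> = x" by (rule ev_inj[OF k])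
    thus False using that insert.hyps by simp
  qed
  \<comment> \<open>Once the other coefficients vanish, evaluation at (1,...,1) isolates the last
    one.\<close>
  have "c x * jackE k x (constv 1) + (\<Sum>\<eta>\<in>S. c \<eta> * jackE k \<eta> (constv 1)) = 0"
    using insert.prems(1)[of "constv 1"] insert.hyps by simp
  hence "c x = 0" using S by (simp add: jackE(3))
  thus ?case using S insert.prems(2) by auto
qed simp

lemma jackE_coeff_unique:
  assumes "finite S" "\<And>z. (\<Sum>\<eta>\<in>S. c \<eta> * jackE k \<eta> z) = (\<Sum>\<eta>\<in>S. d \<eta> * jackE k \<eta> z)" "\<eta> \<in> S"
  shows "c \<eta> = d \<eta>"
  using jackE_independent[OF assms(1) _ assms(3), of "\<lambda>\<eta>. c \<eta> - d \<eta>"] assms(2)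
  by (simp add: left_diff_distrib sum_subtractf)

lemma jackE_inj: "jackE k \<eta> = jackE k \<xi> \<longleftrightarrow> \<eta> = \<xi>"
proof
  assume e: "jackE k \<eta> = jackE k \<xi>"
  show "\<eta> = \<xi>"
  proof (rule ccontr)
    assume ne: "\<eta> \<noteq> \<xi>"
    have "(if \<eta> = \<eta> then 1 else -1 :: complex) = 0"
      by (rule jackE_independent[of "{\<eta>, \<xi>}" "\<lambda>\<zeta>. if \<zeta> = \<eta> then 1 else -1"]) (use ne e in auto)
    thus False by simp
  qed
qed simp

text \<open>Dimension count inside the space of functions: the Jack polynomials of degree p are
  independent and lie in the span of the monomials of degree p, of which there are no more.
  Independence of the monomials does not enter.\<close>

lemma jackE_span:
  fixes f :: "(complex,'n::{finite,linorder}) vec \<Rightarrow> complex"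
  assumes "homog_poly p f"
  shows "\<exists>c. \<forall>z. f z = (\<Sum>\<eta>\<in>multi_of_deg p. c \<eta> * jackE k \<eta> z)"
proof -
  define sc where "sc = (\<lambda>(c::complex) (f::(complex,'n) vec \<Rightarrow> complex) z. c * f z)"
  interpret fs: vector_space sc
    by unfold_locales (auto simp: sc_def fun_eq_iff algebra_simps)
  have sum_app: "(\<Sum>x\<in>I. g x) z = (\<Sum>x\<in>I. g x z)" for I and g :: "'x \<Rightarrow> (complex,'n) vec \<Rightarrow> complex" and z
    by (induction I rule: infinite_finite_induct) auto
  define M :: "((complex,'n) vec \<Rightarrow> complex) set" where "M = mono_n ` multi_of_deg p"
  define E :: "((complex,'n) vec \<Rightarrow> complex) set" where "E = jackE k ` multi_of_deg p"
  have injE: "inj_on (jackE k) (multi_of_deg p :: ('n \<Rightarrow> nat) set)"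
    using jackE_inj by (auto intro!: inj_onI)
  have span: "g \<in> fs.span M" if hg: "homog_poly p g" for g
  proof -
    obtain a where a: "g = (\<lambda>z. \<Sum>\<alpha>\<in>multi_of_deg p. a \<alpha> * mono_n \<alpha> z)"
      using hg unfolding homog_poly_alt by blast
    have "g = (\<Sum>\<alpha>\<in>multi_of_deg p. sc (a \<alpha>) (mono_n \<alpha>))"
      unfolding a by (auto simp: fun_eq_iff sum_app sc_def)
    also have "\<dots> \<in> fs.span M"
      by (intro fs.span_sum fs.span_scale fs.span_base) (auto simp: M_def)
    finally show ?thesis .
  qed
  have ind: "\<not> fs.dependent E"
  proof
    assume "fs.dependent E"
    then obtain u v where uv: "v \<in> E" "u v \<noteq> 0" "(\<Sum>v\<in>E. sc (u v) v) = 0"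
      using fs.dependent_finite[of E] by (auto simp: E_def)
    obtain \<eta> where \<eta>: "\<eta> \<in> multi_of_deg p" "v = jackE k \<eta>" using uv(1) by (auto simp: E_def)
    have "u (jackE k \<eta>) = 0"
    proof (rule jackE_independent[OF finite_multi_of_deg _ \<eta>(1), of "\<lambda>\<eta>. u (jackE k \<eta>)"])
      fix z
      have "(\<Sum>v\<in>E. sc (u v) v) z = 0" using uv(3) by simp
      thus "(\<Sum>\<eta>\<in>multi_of_deg p. u (jackE k \<eta>) * jackE k \<eta> z) = 0"
        unfolding E_def sum.reindex[OF injE] sum_app by (simp add: sc_def)
    qed
    thus False using uv \<eta> by simp
  qed
  have EM: "E \<subseteq> fs.span M" using span jackE(1) by (auto simp: E_def multi_of_deg_def)
  have finM: "finite M" by (simp add: M_def)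
  have finE: "finite E" by (simp add: E_def)
  have "f \<in> fs.span E"
  proof (rule ccontr)
    assume nf: "f \<notin> fs.span E"
    hence "\<not> fs.dependent (insert f E)" using ind fs.independent_insert[of f E] by auto
    moreover have "insert f E \<subseteq> fs.span M" using EM span[OF assms] by simp
    ultimately have "card (insert f E) \<le> card M" using fs.independent_span_bound[OF finM] by blast
    moreover have "f \<notin> E" using nf fs.span_base by blast
    ultimately have "Suc (card E) \<le> card M" using finE by simp
    also have "card M \<le> card (multi_of_deg p :: ('n \<Rightarrow> nat) set)" unfolding M_def by (rule card_image_le) simp
    also have "\<dots> = card E" unfolding E_def by (simp add: card_image[OF injE])
    finally show False by simp
  qed
  then obtain u where u: "f = (\<Sum>v\<in>E. sc (u v) v)"
    unfolding fs.span_finite[OF finE] by auto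
  show ?thesis
  proof (intro exI allI)
    fix z
    show "f z = (\<Sum>\<eta>\<in>multi_of_deg p. u (jackE k \<eta>) * jackE k \<eta> z)"
      unfolding u E_def sum.reindex[OF injE] sum_app by (simp add: sc_def)
  qed
qed

text \<open>Apply Y_i to the expansion and compare coefficients: only compositions with the spectral
  vector \<open>e\<close> can occur.\<close>

lemma eigf_expand:
  assumes g: "homog_poly p g" "eigf k e g" and c: "\<And>z. g z = (\<Sum>\<eta>\<in>multi_of_deg p. c \<eta> * jackE k \<eta> z)"
    and \<eta>: "\<eta> \<in> multi_of_deg p" "c \<eta> \<noteq> 0"
  shows "e i = ev k \<eta> i"
proof -
  define K where "K = k * (real CARD('a) - 1)"
  have "c \<eta> * of_real (ev k \<eta> i + K) = c \<eta> * of_real (e i + K)"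
  proof (rule jackE_coeff_unique[OF finite_multi_of_deg _ \<eta>(1),
        of "\<lambda>\<eta>. c \<eta> * of_real (ev k \<eta> i + K)" "\<lambda>\<eta>. c \<eta> * of_real (e i + K)"])
    fix z
    show "(\<Sum>\<eta>\<in>multi_of_deg p. c \<eta> * of_real (ev k \<eta> i + K) * jackE k \<eta> z)
       = (\<Sum>\<eta>\<in>multi_of_deg p. c \<eta> * of_real (e i + K) * jackE k \<eta> z)"
    proof (rule distinct_coords_eq[of
        "\<lambda>z. \<Sum>\<eta>\<in>multi_of_deg p. c \<eta> * of_real (ev k \<eta> i + K) * jackE k \<eta> z"
        "\<lambda>z. \<Sum>\<eta>\<in>multi_of_deg p. c \<eta> * of_real (e i + K) * jackE k \<eta> z"])
      fix z :: "(complex,'a) vec" assume z: "distinct_coords z"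
      have "Yop k i g z = of_real (e i + K) * g z" using g(2) z unfolding eigf_def K_def by blast
      moreover have "Yop k i g z = (\<Sum>\<eta>\<in>multi_of_deg p. c \<eta> * of_real (ev k \<eta> i + K) * jackE k \<eta> z)"
      proof -
        have "g = (\<lambda>z. \<Sum>\<eta>\<in>multi_of_deg p. c \<eta> * jackE k \<eta> z)" using c by blast
        hence "Yop k i g z = (\<Sum>\<eta>\<in>multi_of_deg p. c \<eta> * Yop k i (jackE k \<eta>) z)"
          by (simp only: Yop_sum[OF jackE_holo])
        thus ?thesis unfolding jackE_Yop[OF z] K_def by (simp add: mult.assoc)
      qed
      ultimately show "(\<Sum>\<eta>\<in>multi_of_deg p. c \<eta> * of_real (ev k \<eta> i + K) * jackE k \<eta> z)
          = (\<Sum>\<eta>\<in>multi_of_deg p. c \<eta> * of_real (e i + K) * jackE k \<eta> z)"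
        unfolding c sum_distrib_left by (simp add: mult_ac)
    qed (intro holo_n_continuous holo_n_sum holo_n_mult holo_n_const jackE_holo)+
  qed
  hence "complex_of_real (ev k \<eta> i + K) = of_real (e i + K)" using \<eta>(2) by simp
  thus ?thesis by (simp only: of_real_eq_iff)
qed

lemma eigf_unique:
  assumes g: "homog_poly (mdeg \<eta>) g" "eigf k (ev k \<eta>) g"
  shows "g z = g (constv 1) * jackE k \<eta> z"
proof -
  obtain c where c: "\<And>z. g z = (\<Sum>\<xi>\<in>multi_of_deg (mdeg \<eta>). c \<xi> * jackE k \<xi> z)"
    using jackE_span[OF g(1)] by blast
  have z: "c \<xi> = 0" if "\<xi> \<in> multi_of_deg (mdeg \<eta>)" "\<xi> \<noteq> \<eta>" for \<xi>
  proof (rule ccontr)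
    assume "c \<xi> \<noteq> 0"
    hence "ev k \<eta> i = ev k \<xi> i" for i using eigf_expand[OF g c that(1)] by blast
    hence "\<eta> = \<xi>" by (rule ev_inj[OF k])
    thus False using that by simp
  qed
  have "g z = c \<eta> * jackE k \<eta> z" for z
  proof -
    have "g z = (\<Sum>\<xi>\<in>multi_of_deg (mdeg \<eta>). if \<xi> = \<eta> then c \<eta> * jackE k \<eta> z else 0)"
      unfolding c by (rule sum.cong) (use z in auto)
    thus ?thesis by (subst (asm) sum.delta[OF finite_multi_of_deg]) (simp add: multi_of_deg_def)
  qed
  thus ?thesis by (simp add: jackE(3))
qed

lemma jackE_0: "jackE k (\<lambda>_. 0) z = 1"
proof -
  have "homog_poly (mdeg (\<lambda>_::'a. 0)) (\<lambda>z::(complex,'a) vec. 1)"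
    using homog_poly_1[of 1] by (simp add: mdeg_def)
  from eigf_unique[OF this eigf_const, of z] show ?thesis by simp
qed

lemma jackE_up: "jackE k (up \<eta>) z = z $ mn * jackE k \<eta> (pv cyc z)"
proof -
  have "homog_poly (mdeg (up \<eta>)) (\<lambda>z. z $ mn * jackE k \<eta> (pv cyc z))"
    unfolding mdeg_up by (intro homog_poly_nth_mult homog_poly_pv bij_cyc jackE)
  from eigf_unique[OF this eigf_raise[OF jackE(2) ev_up], of z]
  show ?thesis unfolding pv_constv jackE(3) by (simp add: constv_def)
qed

text \<open>For k = 0 and equal entries the quotient is 0/0, which has the value 0; this is the
  value required in \<open>jackE_swap\<close>.\<close>

definition gam :: "'n::{finite,linorder} \<Rightarrow> 'n \<Rightarrow> ('n \<Rightarrow> nat) \<Rightarrow> complex" where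
  "gam a b \<eta> = of_real (k / (ev k \<eta> a - ev k \<eta> b))"

lemma gam_nz: "a < b \<Longrightarrow> \<eta> a \<noteq> \<eta> b \<Longrightarrow> 1 + gam a b \<eta> \<noteq> 0"
proof -
  assume a: "a < b" "\<eta> a \<noteq> \<eta> b"
  note gap = ev_tr_gap[OF k a(2) a(1)]
  have "1 + k / (ev k \<eta> a - ev k \<eta> b) \<noteq> 0" using gap by (simp add: field_simps)
  thus ?thesis unfolding gam_def by (metis of_real_1 of_real_add of_real_eq_0_iff)
qed

text \<open>The intertwiner sends \<open>jackE k \<eta>\<close> to an eigenfunction with spectral
  vector \<open>ev k \<eta> \<circ> tr a b\<close>. If k > 0 and the two entries agree, no
  composition has this vector, so the image is 0; as \<gamma> = -1 there, the same formula holds and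
  says that the polynomial is symmetric in a and b.\<close>

lemma jackE_swap:
  assumes ab: "adj a b"
  shows "jackE k \<eta> (swapv a b z) = - gam a b \<eta> * jackE k \<eta> z + (1 + gam a b \<eta>) * jackE k (\<eta> \<circ> tr a b) z"
proof -
  have lt: "a < b" using ab by (simp add: adj_def)
  define \<gamma> where "\<gamma> = k / (ev k \<eta> a - ev k \<eta> b)"
  have g: "k = \<gamma> * (ev k \<eta> a - ev k \<eta> b)"
    using ev_tr_gap(1)[of k \<eta> a b] k lt ev_adj_eq[OF ab, of \<eta> k] unfolding \<gamma>_def
    by (cases "\<eta> a = \<eta> b") auto
  define v where "v = (\<lambda>z. jackE k \<eta> (swapv a b z) + of_real \<gamma> * jackE k \<eta> z)"
  have e: "eigf k (ev k \<eta> \<circ> tr a b) v" unfolding v_def by (rule eigf_swap[OF ab jackE(2) g])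
  have hv: "homog_poly (mdeg \<eta>) v" unfolding v_def swapv_pv
    by (intro homog_poly_add homog_poly_cmult homog_poly_pv jackE) auto
  have v1: "v (constv 1) = 1 + of_real \<gamma>" unfolding v_def swapv_pv pv_constv jackE(3) by simp
  have "v z = (1 + of_real \<gamma>) * jackE k (\<eta> \<circ> tr a b) z"
  proof (cases "\<eta> a \<noteq> \<eta> b \<or> k = 0")
    case True
    have "ev k \<eta> \<circ> tr a b = ev k (\<eta> \<circ> tr a b)"
    proof (cases "\<eta> a = \<eta> b")
      case False thus ?thesis using ev_tr[OF ab, of \<eta> k] by (auto simp: fun_eq_iff)
    next
      case t: True
      thus ?thesis using True by (auto simp: fun_eq_iff ev_def)
    qed
    thus ?thesis using eigf_unique[of "\<eta> \<circ> tr a b" v z] e hv v1 by (simp add: mdeg_perm)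
  next
    case False
    hence kp: "k > 0" and eq: "\<eta> a = \<eta> b" using k by auto
    have gm: "\<gamma> = -1" unfolding \<gamma>_def ev_adj_eq[where \<eta>=\<eta>, OF ab eq] using kp by simp
    obtain c where c: "\<And>z. v z = (\<Sum>\<xi>\<in>multi_of_deg (mdeg \<eta>). c \<xi> * jackE k \<xi> z)"
      using jackE_span[OF hv] by blast
    have "c \<xi> = 0" if "\<xi> \<in> multi_of_deg (mdeg \<eta>)" for \<xi>
    proof (rule ccontr)
      assume nz: "c \<xi> \<noteq> 0"
      have ee: "ev k \<xi> i = ev k \<eta> (tr a b i)" for i using eigf_expand[OF hv e c that nz, of i] by simp
      have "\<xi> = \<eta> \<circ> tr a b" by (rule ev_perm_imp[OF kp _ ee]) simp
      also have "\<eta> \<circ> tr a b = \<eta>" using eq by (auto simp: fun_eq_iff Transposition.transpose_def)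
      finally have "ev k \<eta> a = ev k \<eta> b" using ee[of a] by simp
      thus False using ev_adj_eq[where \<eta>=\<eta>, OF ab eq, of k] kp by simp
    qed
    hence "v z = 0" unfolding c by simp
    thus ?thesis using gm by simp
  qed
  thus ?thesis unfolding v_def gam_def \<gamma>_def[symmetric] by (simp add: algebra_simps)
qed

end

section \<open>Generation by adjacent transpositions, the 1-norm, and cancelling a coordinate
  factor\<close>

lemma adj_generate [consumes 1, case_names id adj comp]:
  fixes \<sigma> :: "'n::{finite,linorder} \<Rightarrow> 'n"
  assumes "\<sigma> permutes UNIV" and "P id" and adj: "\<And>a b. adj a b \<Longrightarrow> P (tr a b)"
    and comp: "\<And>\<sigma> \<tau>. P \<sigma> \<Longrightarrow> P \<tau> \<Longrightarrow> P (\<sigma> \<circ> \<tau>)"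
  shows "P \<sigma>"
proof -
  have t: "P (tr a b)" if "a < b" for a b
    using that
  proof (induction "card {j. j < b}" arbitrary: b rule: less_induct)
    case less
    have "b \<noteq> mn" using less.prems by auto
    then obtain c where c: "adj c b" using adj_pred by blast
    have cb: "c < b" using c by (simp add: adj_def)
    show ?case
    proof (cases "c = a")
      case False
      hence ac: "a < c" using c less.prems unfolding adj_def by (meson neqE)
      have "card {j. j < c} < card {j. j < b}" by (rule psubset_card_mono) (use cb in auto)
      hence "P (tr a c)" using less.hyps ac by blast
      hence "P (tr c b \<circ> (tr a c \<circ> tr c b))" using adj[OF c] comp by blast
      \<comment> \<open>Conjugation by the adjacent transposition (c b) moves b one place down
        towards a.\<close>
      moreover have "tr c b \<circ> (tr a c \<circ> tr c b) = tr a b"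
        using ac cb less.prems by (auto simp: fun_eq_iff Transposition.transpose_def)
      ultimately show ?thesis by simp
    qed (use adj c in blast)
  qed
  show ?thesis using assms(1) finite_class.finite_UNIV
  proof (induction rule: permutes_induct)
    case (swap a b p)
    have "P (tr a b)" using t[of a b] t[of b a] swap(3) by (cases "a < b") (auto simp: transpose_commute)
    thus ?case using comp swap by blast
  next
    case id
    show ?case by (rule assms(2))
  qed
qed

lemma permutes_UNIV_iff_bij: "\<sigma> permutes UNIV \<longleftrightarrow> bij \<sigma>"
  by (auto intro: permutes_bij bij_imp_permutes)

text \<open>The 1-norm: permutation invariant, and its product bounds the bilinear pairing, so that
  estimates for the kernel hold with constant 1.\<close>

definition nrm :: "(complex,'n::finite) vec \<Rightarrow> real" where
  "nrm z = (\<Sum>i\<in>UNIV. cmod (z $ i))"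

lemma nrm_nonneg [simp]: "0 \<le> nrm z" by (simp add: nrm_def sum_nonneg)

lemma nrm_pv: "bij \<sigma> \<Longrightarrow> nrm (pv \<sigma> z) = nrm z"
  unfolding nrm_def pv_nth by (rule sum.reindex_bij_betw)

lemma nrm_cu: "nrm (cu i u z) \<le> nrm z + cmod (u - z $ i)"
proof -
  have "nrm (cu i u z) = cmod u + (\<Sum>j\<in>UNIV-{i}. cmod (z $ j))"
    unfolding nrm_def by (subst sum.remove[of _ i]) auto
  moreover have "nrm z = cmod (z $ i) + (\<Sum>j\<in>UNIV-{i}. cmod (z $ j))"
    unfolding nrm_def by (subst sum.remove[of _ i]) auto
  moreover have "cmod u \<le> cmod (z $ i) + cmod (u - z $ i)"
    using norm_triangle_ineq[of "z $ i" "u - z $ i"] by simp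
  ultimately show ?thesis by simp
qed

lemma nrm_le_norm: "nrm z \<le> real CARD('n) * norm z" for z :: "(complex,'n::finite) vec"
proof -
  have "nrm z \<le> (\<Sum>i\<in>(UNIV::'n set). norm z)"
    unfolding nrm_def by (intro sum_mono Finite_Cartesian_Product.norm_nth_le)
  thus ?thesis by simp
qed

lemma continuous_on_nrm: "continuous_on S nrm"
  unfolding nrm_def by (intro continuous_intros)

lemma pairing_le: "cmod (\<Sum>i\<in>UNIV. w $ i * z $ i) \<le> nrm w * nrm z"
proof -
  have "cmod (\<Sum>i\<in>UNIV. w $ i * z $ i) \<le> (\<Sum>i\<in>UNIV. cmod (w $ i) * cmod (z $ i))"
    by (rule order_trans[OF norm_sum]) (simp add: norm_mult)
  also have "\<dots> \<le> (\<Sum>i\<in>UNIV. cmod (w $ i) * nrm z)"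
    by (intro sum_mono mult_left_mono) (auto simp: nrm_def intro: member_le_sum[of _ UNIV "\<lambda>i. cmod (z $ i)"])
  finally show ?thesis by (simp add: nrm_def sum_distrib_right)
qed

text \<open>Division by z_i fails only on z_i = 0. Moving z_i alone, both sides are continuous at
  the given value and agree at all nearby values other than 0 that avoid the remaining
  coordinates.\<close>

lemma dunklA_cancel:
  assumes f: "holo_n f" and g: "holo_n g"
    and eq: "\<And>z. distinct_coords z \<Longrightarrow> z $ i * dunklA k i f z = z $ i * g z"
    and z: "distinct_coords z"
  shows "dunklA k i f z = g z"
proof -
  \<comment> \<open>The Dunkl operator along the coordinate line, written out so that its continuity
    in u can be read off.\<close>
  define \<phi> where "\<phi> = (\<lambda>u. deriv (\<lambda>t. f (cu i t z)) u + of_real k * (\<Sum>j\<in>UNIV-{i}.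
      (f (cu i u z) - f (swapv i j (cu i u z))) / (u - z $ j)))"
  have hd: "(\<lambda>t. f (cu i t z)) holomorphic_on UNIV"
    using holo_n_partial[OF f, of i z] holomorphic_on_open[of UNIV] by blast
  have cd: "isCont (deriv (\<lambda>t. f (cu i t z))) u" for u
    using holomorphic_on_imp_continuous_on[OF holomorphic_deriv[OF hd open_UNIV]]
    by (simp add: continuous_on_eq_continuous_at)
  have ccu: "isCont (\<lambda>u. cu i u z) u" for u
    unfolding cu_def isCont_def by (rule vec_tendstoI) auto
  have cf: "isCont (\<lambda>u. f (h (cu i u z))) u" if "continuous_on UNIV h" for h u
  proof -
    have "isCont h (cu i u z)" "isCont f (h (cu i u z))"
      using that holo_n_continuous[OF f, of UNIV] by (auto simp: continuous_on_eq_continuous_at)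
    thus ?thesis using isCont_o2[OF isCont_o2[OF ccu]] by blast
  qed
  have c\<phi>: "isCont \<phi> (z $ i)"
    unfolding \<phi>_def
  proof (intro continuous_intros cd)
    show "isCont (\<lambda>u. f (cu i u z)) (z $ i)" using cf[of "\<lambda>x. x"] by simp
    show "isCont (\<lambda>u. f (swapv i j (cu i u z))) (z $ i)" for j
      unfolding swapv_pv by (intro cf continuous_intros)
  next
    fix j assume "j \<in> UNIV - {i}"
    thus "z $ i - z $ j \<noteq> 0" using z unfolding distinct_coords_def by auto
  qed
  have cg: "isCont (\<lambda>u. g (cu i u z)) (z $ i)"
  proof -
    have "isCont g (cu i (z $ i) z)"
      using holo_n_continuous[OF g, of UNIV] by (auto simp: continuous_on_eq_continuous_at)
    thus ?thesis using isCont_o2[OF ccu] by blast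
  qed
  have \<phi>: "\<phi> u = dunklA k i f (cu i u z)" for u
  proof -
    have "dpart i f (cu i u z) = deriv (\<lambda>t. f (cu i t z)) u"
      unfolding dpart_def cu_def[symmetric] by simp
    thus ?thesis unfolding \<phi>_def dunklA_def by (auto intro!: arg_cong2[of _ _ _ _ "(+)"] sum.cong)
  qed
  have "eventually (\<lambda>u. u \<notin> insert 0 ((\<lambda>j. z $ j) ` (UNIV - {i}))) (at (z $ i))"
  proof -
    have "open (- (insert 0 ((\<lambda>j. z $ j) ` (UNIV - {i})) - {z $ i}))"
      by (intro open_Compl finite_imp_closed) simp
    thus ?thesis unfolding eventually_at_topological by blast
  qed
  hence ev: "eventually (\<lambda>u. \<phi> u = g (cu i u z)) (at (z $ i))"
  proof eventually_elim
    case (elim u)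
    hence d: "distinct_coords (cu i u z)" using z unfolding distinct_coords_def by auto
    show ?case using eq[OF d] elim unfolding \<phi> by simp
  qed
  have "\<phi> \<midarrow>z $ i\<rightarrow> \<phi> (z $ i)" "(\<lambda>u. g (cu i u z)) \<midarrow>z $ i\<rightarrow> g (cu i (z $ i) z)"
    using c\<phi> cg by (simp_all add: isCont_def)
  hence "\<phi> (z $ i) = g (cu i (z $ i) z)"
    using tendsto_cong[OF ev] LIM_unique by blast
  thus ?thesis unfolding \<phi> by simp
qed

subsection \<open>The homogeneous parts of the Dunkl kernel\<close>

context dunkl_mult
begin

definition sumc :: "nat \<Rightarrow> ('n::{finite,linorder} \<Rightarrow> nat) \<Rightarrow> complex" where
  "sumc p = (SOME c. \<forall>z::(complex,'n) vec. (\<Sum>i\<in>UNIV. z $ i) ^ p = (\<Sum>\<eta>\<in>multi_of_deg p. c \<eta> * jackE k \<eta> z))"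

text \<open>This is L_\<eta>(1,...,1): the coefficient of \<open>jackE k \<eta>\<close> in the power
  of the coordinate sum, by which \<open>jackE\<close> differs from \<open>nsjack\<close>.\<close>

definition jc :: "('n::{finite,linorder} \<Rightarrow> nat) \<Rightarrow> complex" where
  "jc \<eta> = sumc (mdeg \<eta>) \<eta>"

lemma jc_sum: "(\<Sum>i\<in>UNIV. z $ i) ^ p = (\<Sum>\<eta>\<in>multi_of_deg p. jc \<eta> * jackE k \<eta> z)"
proof -
  have "(\<Sum>i\<in>UNIV. z $ i) ^ p = (\<Sum>\<eta>\<in>multi_of_deg p. sumc p \<eta> * jackE k \<eta> z)"
    using someI_ex[OF jackE_span[OF homog_poly_sum_power[of p]]] unfolding sumc_def by blast
  also have "\<dots> = (\<Sum>\<eta>\<in>multi_of_deg p. jc \<eta> * jackE k \<eta> z)"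
    by (intro sum.cong) (auto simp: jc_def multi_of_deg_def)
  finally show ?thesis .
qed

lemma nsjack_eq: "nsjack k = (\<lambda>(\<eta>::'a::{finite,linorder} \<Rightarrow> nat) z. jc \<eta> * jackE k \<eta> z)"
  unfolding nsjack_def
proof (rule the_equality)
  have h: "homog_poly (mdeg \<eta>) (\<lambda>z. jc \<eta> * jackE k \<eta> z)" for \<eta> :: "'a \<Rightarrow> nat"
    by (intro homog_poly_cmult jackE)
  show "(\<forall>\<eta>::'a \<Rightarrow> nat. homog_poly (mdeg \<eta>) (\<lambda>z. jc \<eta> * jackE k \<eta> z) \<and>
         (\<forall>i z. distinct_coords z \<longrightarrow> cherednik k i (\<lambda>z. jc \<eta> * jackE k \<eta> z) z = spec k \<eta> i * (jc \<eta> * jackE k \<eta> z))) \<and>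
       (\<forall>p z. (\<Sum>\<eta>\<in>(multi_of_deg p :: ('a \<Rightarrow> nat) set). jc \<eta> * jackE k \<eta> z) = (\<Sum>i\<in>UNIV. z $ i) ^ p)"
    unfolding cherednik_iff_eigf[OF homog_poly_holo[OF h]] by (intro conjI allI h jc_sum[symmetric] eigf_cmult[OF jackE(2)])
next
  fix L :: "('a \<Rightarrow> nat) \<Rightarrow> (complex,'a) vec \<Rightarrow> complex"
  assume L: "(\<forall>\<eta>. homog_poly (mdeg \<eta>) (L \<eta>) \<and>
         (\<forall>i z. distinct_coords z \<longrightarrow> cherednik k i (L \<eta>) z = spec k \<eta> i * L \<eta> z)) \<and>
       (\<forall>p z. (\<Sum>\<eta>\<in>multi_of_deg p. L \<eta> z) = (\<Sum>i\<in>UNIV. z $ i) ^ p)"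
  have h: "homog_poly (mdeg \<eta>) (L \<eta>)" for \<eta> using L by blast
  have e: "eigf k (ev k \<eta>) (L \<eta>)" for \<eta>
    using L cherednik_iff_eigf[OF homog_poly_holo[OF h[of \<eta>]], of k \<eta>] by blast
  note u = eigf_unique[OF h e]
  have "L \<eta> (constv 1) = jc \<eta>" for \<eta>
  proof (rule jackE_coeff_unique[where S="multi_of_deg (mdeg \<eta>)" and c="\<lambda>\<eta>. L \<eta> (constv 1)"])
    fix z
    have "(\<Sum>\<eta>\<in>multi_of_deg (mdeg \<eta>). L \<eta> (constv 1) * jackE k \<eta> z) = (\<Sum>\<eta>\<in>multi_of_deg (mdeg \<eta>). L \<eta> z)"
      using u[of _ z] by simp
    thus "(\<Sum>\<eta>\<in>multi_of_deg (mdeg \<eta>). L \<eta> (constv 1) * jackE k \<eta> z) = (\<Sum>\<eta>\<in>multi_of_deg (mdeg \<eta>). jc \<eta> * jackE k \<eta> z)"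
      using L jc_sum[of z] by metis
  qed (auto simp: multi_of_deg_def finite_multi_of_deg[unfolded multi_of_deg_def])
  thus "L = (\<lambda>\<eta> z. jc \<eta> * jackE k \<eta> z)" using u by (intro ext) metis
qed

lemma sum_swap_reindex:
  "(\<Sum>\<eta>\<in>multi_of_deg p. g (\<eta> \<circ> tr a b) \<eta>) = (\<Sum>\<eta>\<in>multi_of_deg p. g \<eta> (\<eta> \<circ> tr a b))"
  by (rule sum.reindex_bij_witness[of _ "\<lambda>\<eta>. \<eta> \<circ> tr a b" "\<lambda>\<eta>. \<eta> \<circ> tr a b"])
     (auto simp: multi_of_deg_def mdeg_perm comp_assoc)

text \<open>The power of the coordinate sum is symmetric. Exchange two variables in its expansion by
  \<open>jackE_swap\<close> and compare coefficients.\<close>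

lemma jc_swap:
  fixes \<eta> :: "'n::{finite,linorder} \<Rightarrow> nat"
  assumes ab: "adj a b"
  shows "jc \<eta> * (1 + gam a b \<eta>) = jc (\<eta> \<circ> tr a b) * (1 + gam a b (\<eta> \<circ> tr a b))"
proof -
  define p where "p = mdeg \<eta>"
  have "- gam a b \<eta> * jc \<eta> + jc (\<eta> \<circ> tr a b) * (1 + gam a b (\<eta> \<circ> tr a b)) = jc \<eta>"
  proof (rule jackE_coeff_unique[where S="multi_of_deg p" and
        c="\<lambda>\<eta>. - gam a b \<eta> * jc \<eta> + jc (\<eta> \<circ> tr a b) * (1 + gam a b (\<eta> \<circ> tr a b))"])
    fix z :: "(complex,'n) vec"
    have "(\<Sum>\<eta>\<in>multi_of_deg p. jc \<eta> * jackE k \<eta> z) = (\<Sum>i\<in>UNIV. z $ i) ^ p" by (rule jc_sum[symmetric])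
    also have "\<dots> = (\<Sum>i\<in>UNIV. swapv a b z $ i) ^ p"
      unfolding swapv_pv pv_nth using sum.reindex_bij_betw[of "tr a b" UNIV UNIV "\<lambda>i. z $ i"] by simp
    also have "\<dots> = (\<Sum>\<eta>\<in>multi_of_deg p. jc \<eta> * jackE k \<eta> (swapv a b z))" by (rule jc_sum)
    also have "\<dots> = (\<Sum>\<eta>\<in>multi_of_deg p. - gam a b \<eta> * jc \<eta> * jackE k \<eta> z)
       + (\<Sum>\<eta>\<in>multi_of_deg p. jc \<eta> * (1 + gam a b \<eta>) * jackE k (\<eta> \<circ> tr a b) z)"
      unfolding jackE_swap[OF ab] sum.distrib[symmetric] by (intro sum.cong) (auto simp: algebra_simps)
    also have "(\<Sum>\<eta>\<in>multi_of_deg p. jc \<eta> * (1 + gam a b \<eta>) * jackE k (\<eta> \<circ> tr a b) z)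
        = (\<Sum>\<eta>\<in>multi_of_deg p. jc (\<eta> \<circ> tr a b) * (1 + gam a b (\<eta> \<circ> tr a b)) * jackE k \<eta> z)"
      by (rule sum_swap_reindex[where g="\<lambda>\<xi> \<eta>. jc \<xi> * (1 + gam a b \<xi>) * jackE k \<eta> z", symmetric])
    finally show "(\<Sum>\<eta>\<in>multi_of_deg p. (- gam a b \<eta> * jc \<eta> + jc (\<eta> \<circ> tr a b) * (1 + gam a b (\<eta> \<circ> tr a b))) * jackE k \<eta> z)
        = (\<Sum>\<eta>\<in>multi_of_deg p. jc \<eta> * jackE k \<eta> z)"
      by (simp only: sum.distrib[symmetric] distrib_right)
  qed (simp_all add: p_def multi_of_deg_def finite_multi_of_deg[unfolded multi_of_deg_def])
  thus ?thesis by (simp add: algebra_simps)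
qed

text \<open>The homogeneous part L_\<eta>(w) L_\<eta>(z)/(p! L_\<eta>(1)) of the kernel. With the
  normalised polynomials a single factor \<open>jc\<close> remains and nothing has to be divided by
  it.\<close>

definition Kp :: "nat \<Rightarrow> (complex,'n::{finite,linorder}) vec \<Rightarrow> (complex,'n) vec \<Rightarrow> complex" where
  "Kp p w z = (\<Sum>\<eta>\<in>multi_of_deg p. jc \<eta> / fact p * (jackE k \<eta> w * jackE k \<eta> z))"

lemma Kp_sym: "Kp p w z = Kp p z w"
  unfolding Kp_def by (simp add: mult.commute)

text \<open>After \<open>jackE_swap\<close> the diagonal terms are symmetric in w and z, and the
  off-diagonal coefficients are invariant under \<open>tr a b\<close> by
  \<open>jc_swap\<close>.\<close>

lemma Kp_swap:
  assumes ab: "adj a b"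
  shows "Kp p (swapv a b w) z = Kp p w (swapv a b z)"
proof -
  define h where "h = (\<lambda>\<eta>. jc \<eta> / fact p * (1 + gam a b \<eta>))"
  have h: "h (\<eta> \<circ> tr a b) = h \<eta>" for \<eta> using jc_swap[OF ab, of \<eta>] by (simp add: h_def)
  have "Kp p (swapv a b w) z = (\<Sum>\<eta>\<in>multi_of_deg p. - gam a b \<eta> * (jc \<eta> / fact p) * (jackE k \<eta> w * jackE k \<eta> z))
     + (\<Sum>\<eta>\<in>multi_of_deg p. h \<eta> * (jackE k (\<eta> \<circ> tr a b) w * jackE k \<eta> z))"
    unfolding Kp_def jackE_swap[OF ab] sum.distrib[symmetric] h_def
    by (intro sum.cong) (auto simp: algebra_simps)
  also have "(\<Sum>\<eta>\<in>multi_of_deg p. h \<eta> * (jackE k (\<eta> \<circ> tr a b) w * jackE k \<eta> z))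
     = (\<Sum>\<eta>\<in>multi_of_deg p. h (\<eta> \<circ> tr a b) * (jackE k (\<eta> \<circ> tr a b) w * jackE k \<eta> z))"
    unfolding h ..
  also have "\<dots> = (\<Sum>\<eta>\<in>multi_of_deg p. h \<eta> * (jackE k \<eta> w * jackE k (\<eta> \<circ> tr a b) z))"
    by (rule sum_swap_reindex[where g="\<lambda>\<xi> \<eta>. h \<xi> * (jackE k \<xi> w * jackE k \<eta> z)"])
  also have "(\<Sum>\<eta>\<in>multi_of_deg p. - gam a b \<eta> * (jc \<eta> / fact p) * (jackE k \<eta> w * jackE k \<eta> z)) + \<dots>
      = Kp p w (swapv a b z)"
    unfolding Kp_def jackE_swap[OF ab] sum.distrib[symmetric] h_def
    by (intro sum.cong) (auto simp: algebra_simps)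
  finally show ?thesis .
qed

lemma Kp_pv:
  assumes "bij \<sigma>"
  shows "Kp p (pv \<sigma> w) (pv \<sigma> z) = Kp p w z"
proof -
  have "\<sigma> permutes UNIV" using assms by (simp add: permutes_UNIV_iff_bij)
  hence "\<forall>w z. Kp p (pv \<sigma> w) (pv \<sigma> z) = Kp p w z"
  proof (induction rule: adj_generate)
    case (adj a b)
    show ?case
    proof (intro allI)
      fix w z
      have "Kp p (swapv a b w) (swapv a b z) = Kp p w (swapv a b (swapv a b z))" by (rule Kp_swap[OF adj])
      thus "Kp p (pv (tr a b) w) (pv (tr a b) z) = Kp p w z" by (simp add: swapv_pv[symmetric])
    qed
  next
    case (comp \<sigma> \<tau>)
    thus ?case unfolding pv_pv[symmetric] by simp
  qed simp
  thus ?thesis by blast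
qed

lemma Kp_homog: "homog_poly p (Kp p w)"
proof -
  have "homog_poly p (\<lambda>z. \<Sum>\<eta>\<in>multi_of_deg p. (jc \<eta> / fact p * jackE k \<eta> w) * jackE k \<eta> z)"
    by (intro homog_poly_sum homog_poly_cmult) (metis (mono_tags) jackE(1) mem_Collect_eq multi_of_deg_def)
  thus ?thesis unfolding Kp_def[abs_def] by (simp add: mult.assoc)
qed

lemma Kp_holo: "holo_n (Kp p w)"
  using Kp_homog homog_poly_holo by blast

lemma sum_up:
  fixes g :: "('n::{finite,linorder} \<Rightarrow> nat) \<Rightarrow> ('n \<Rightarrow> nat) \<Rightarrow> complex"
  shows "(\<Sum>\<xi>\<in>multi_of_deg p. g \<xi> (up \<xi>))
    = (\<Sum>\<eta>\<in>multi_of_deg (Suc p). if \<eta> \<in> range up then g (inv up \<eta>) \<eta> else 0)"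
proof -
  have "(\<Sum>\<eta>\<in>multi_of_deg (Suc p). if \<eta> \<in> range up then g (inv up \<eta>) \<eta> else 0)
     = (\<Sum>\<eta>\<in>up ` multi_of_deg p. if \<eta> \<in> range up then g (inv up \<eta>) \<eta> else 0)"
    by (rule sum.mono_neutral_right) (auto simp: multi_of_deg_def mdeg_up finite_multi_of_deg[unfolded multi_of_deg_def])
  also have "\<dots> = (\<Sum>\<xi>\<in>multi_of_deg p. g \<xi> (up \<xi>))"
    by (subst sum.reindex) (auto simp: inj_up inj_on_subset[OF inj_up])
  finally show ?thesis ..
qed

lemma Yop_mn: "Yop k mn f z = z $ mn * dunklA k mn f z"
  by (simp add: Yop_def)

text \<open>Comparing coefficients in \<open>T\<^sub>1 (z\<^sub>1 + \<dots> + z\<^sub>n)\<^bsup>p+1\<^esup> = (p + 1) (z\<^sub>1 + \<dots> + z\<^sub>n)\<^bsup>p\<^esup>\<close>.\<close>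
lemma jc_up:
  fixes \<eta> :: "'n::{finite,linorder} \<Rightarrow> nat"
  assumes "\<eta> \<in> multi_of_deg (Suc p)"
  shows "jc \<eta> * of_real (ev k \<eta> mn + k * (real CARD('n) - 1))
     = of_nat (Suc p) * (if \<eta> \<in> range up then jc (inv up \<eta>) else 0)"
proof (rule jackE_coeff_unique[OF finite_multi_of_deg _ assms, of
      "\<lambda>\<eta>. jc \<eta> * of_real (ev k \<eta> mn + k * (real CARD('n) - 1))"])
  fix z :: "(complex,'n) vec"
  show "(\<Sum>\<eta>\<in>multi_of_deg (Suc p). jc \<eta> * of_real (ev k \<eta> mn + k * (real CARD('n) - 1)) * jackE k \<eta> z)
     = (\<Sum>\<eta>\<in>multi_of_deg (Suc p). of_nat (Suc p) * (if \<eta> \<in> range up then jc (inv up \<eta>) else 0) * jackE k \<eta> z)"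
    (is "?L z = ?R z")
  proof (rule distinct_coords_eq[of ?L ?R])
    fix z :: "(complex,'n) vec" assume z: "distinct_coords z"
    have "?L z = Yop k mn (\<lambda>z. \<Sum>\<eta>\<in>multi_of_deg (Suc p). jc \<eta> * jackE k \<eta> z) z"
      unfolding Yop_sum[OF jackE_holo] jackE_Yop[OF z] by (simp add: mult.assoc)
    also have "\<dots> = Yop k mn (\<lambda>z. (\<Sum>i\<in>UNIV. z $ i) ^ Suc p) z"
      unfolding jc_sum ..
    also have "\<dots> = z $ mn * dpart mn (\<lambda>z. (\<Sum>i\<in>UNIV. z $ i) ^ Suc p) z"
    proof -
      have "(\<Sum>i\<in>UNIV. swapv mn j z $ i) = (\<Sum>i\<in>UNIV. z $ i)" for j
        unfolding swapv_pv pv_nth using sum.reindex_bij_betw[of "tr mn j" UNIV UNIV "\<lambda>i. z $ i"] by simp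
      thus ?thesis unfolding Yop_mn dunklA_def by simp
    qed
    also have "dpart mn (\<lambda>z. (\<Sum>i\<in>UNIV. z $ i) ^ Suc p) z = of_nat (Suc p) * (\<Sum>i\<in>UNIV. z $ i) ^ p"
    proof -
      have c: "(\<Sum>i\<in>UNIV. cu mn t z $ i) = t + (\<Sum>i\<in>UNIV-{mn}. z $ i)" for t
        by (subst sum.remove[of _ mn]) auto
      have s: "(\<Sum>i\<in>UNIV. z $ i) = z $ mn + (\<Sum>i\<in>UNIV-{mn}. z $ i)"
        by (subst sum.remove[of _ mn]) auto
      have "((\<lambda>t. (t + (\<Sum>i\<in>UNIV-{mn}. z $ i)) ^ Suc p) has_field_derivative
          of_nat (Suc p) * (z $ mn + (\<Sum>i\<in>UNIV-{mn}. z $ i)) ^ p) (at (z $ mn))"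
        by (auto intro!: derivative_eq_intros simp del: power_Suc)
      thus ?thesis unfolding dpart_def cu_def[symmetric] c s by (rule DERIV_imp_deriv)
    qed
    \<comment> \<open>By symmetry the power may be expanded at the cyclically shifted point; the
      free factor z_mn then completes each term to a raised Jack polynomial.\<close>
    also have "(\<Sum>i\<in>UNIV. z $ i) ^ p = (\<Sum>i\<in>UNIV. pv cyc z $ i) ^ p"
      unfolding pv_nth using sum.reindex_bij_betw[OF bij_cyc, of "\<lambda>i. z $ i"] by simp
    also have "\<dots> = (\<Sum>\<xi>\<in>multi_of_deg p. jc \<xi> * jackE k \<xi> (pv cyc z))" by (rule jc_sum)
    also have "z $ mn * (of_nat (Suc p) * \<dots>) = (\<Sum>\<xi>\<in>multi_of_deg p. of_nat (Suc p) * jc \<xi> * jackE k (up \<xi>) z)"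
      unfolding jackE_up sum_distrib_left by (intro sum.cong) (auto simp: algebra_simps)
    also have "\<dots> = (\<Sum>\<eta>\<in>multi_of_deg (Suc p). if \<eta> \<in> range up then of_nat (Suc p) * jc (inv up \<eta>) * jackE k \<eta> z else 0)"
      by (rule sum_up)
    also have "\<dots> = ?R z" by (intro sum.cong) auto
    finally show "?L z = ?R z" .
  qed (intro holo_n_continuous holo_n_sum holo_n_mult holo_n_const jackE_holo)+
qed

text \<open>At the first index z_mn T_mn equals \<open>Yop k mn\<close>, which is diagonal on the
  Jack polynomials. The coefficient recursion \<open>jc_up\<close> keeps only raised compositions,
  from which z_mn and w_mn factor out.\<close>

lemma Kp_T_mn:
  assumes z: "distinct_coords z"
  shows "z $ mn * dunklA k mn (Kp (Suc p) w) z = z $ mn * (w $ mn * Kp p w z)"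
proof -
  have "z $ mn * dunklA k mn (Kp (Suc p) w) z
     = Yop k mn (\<lambda>z. \<Sum>\<eta>\<in>multi_of_deg (Suc p). (jc \<eta> / fact (Suc p) * jackE k \<eta> w) * jackE k \<eta> z) z"
    unfolding Yop_mn Kp_def[abs_def] by (simp add: mult.assoc)
  also have "\<dots> = (\<Sum>\<eta>\<in>multi_of_deg (Suc p). (jc \<eta> * of_real (ev k \<eta> mn + k * (real CARD('a) - 1))) / fact (Suc p) * (jackE k \<eta> w * jackE k \<eta> z))"
    unfolding Yop_sum[OF jackE_holo] jackE_Yop[OF z] by (simp add: mult_ac)
  also have "\<dots> = (\<Sum>\<eta>\<in>multi_of_deg (Suc p). if \<eta> \<in> range up then jc (inv up \<eta>) / fact p * (jackE k \<eta> w * jackE k \<eta> z) else 0)"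
  proof (intro sum.cong refl)
    fix \<eta> :: "'a \<Rightarrow> nat" assume \<eta>: "\<eta> \<in> multi_of_deg (Suc p)"
    have "of_nat (Suc p) \<noteq> (0::complex)" by (simp only: of_nat_eq_0_iff)
    thus "jc \<eta> * of_real (ev k \<eta> mn + k * (real CARD('a) - 1)) / fact (Suc p) * (jackE k \<eta> w * jackE k \<eta> z)
       = (if \<eta> \<in> range up then jc (inv up \<eta>) / fact p * (jackE k \<eta> w * jackE k \<eta> z) else 0)"
      unfolding jc_up[OF \<eta>] fact_Suc by (simp del: of_nat_Suc)
  qed
  also have "\<dots> = (\<Sum>\<xi>\<in>multi_of_deg p. jc \<xi> / fact p * (jackE k (up \<xi>) w * jackE k (up \<xi>) z))"
    by (rule sum_up[symmetric])
  also have "\<dots> = z $ mn * (w $ mn * Kp p (pv cyc w) (pv cyc z))"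
    unfolding jackE_up Kp_def sum_distrib_left by (intro sum.cong) (auto simp: algebra_simps)
  finally show ?thesis unfolding Kp_pv[OF bij_cyc] .
qed

text \<open>Joint permutation invariance of \<open>Kp\<close> carries the first index to any other
  one, after the factor z_mn has been cancelled.\<close>

lemma Kp_T:
  assumes z: "distinct_coords z"
  shows "dunklA k i (Kp (Suc p) w) z = w $ i * Kp p w z"
proof -
  define \<sigma> where "\<sigma> = tr mn i"
  have b: "bij \<sigma>" by (simp add: \<sigma>_def)
  have s: "\<sigma> mn = i" by (simp add: \<sigma>_def)
  have "dunklA k (\<sigma> mn) (\<lambda>z. Kp (Suc p) (pv \<sigma> w) (pv \<sigma> z)) z = dunklA k mn (Kp (Suc p) (pv \<sigma> w)) (pv \<sigma> z)"
    by (rule dunklA_pv[OF b])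
  also have "\<dots> = pv \<sigma> w $ mn * Kp p (pv \<sigma> w) (pv \<sigma> z)"
    by (rule dunklA_cancel[OF Kp_holo holo_n_mult[OF holo_n_const Kp_holo] Kp_T_mn])
       (use z in \<open>simp_all add: distinct_coords_pv[OF b]\<close>)
  finally show ?thesis unfolding Kp_pv[OF b] pv_nth s by simp
qed

lemma Kp_0: "Kp 0 w z = 1"
proof -
  have m: "multi_of_deg 0 = {\<lambda>_::'a. 0::nat}" by (auto simp: multi_of_deg_def mdeg_def)
  have "jc (\<lambda>_::'a. 0) = 1" using jc_sum[of "constv 1 :: (complex,'a) vec" 0] unfolding m by (simp add: jackE_0)
  thus ?thesis unfolding Kp_def m by (simp add: jackE_0)
qed

text \<open>Induction on the degree through Euler's identity. At the point of the orbit where the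
  modulus is largest, the reflected values are bounded by the value itself, so the terms with k
  cancel and only the pairing of w and z times the previous degree is left.\<close>

lemma Kp_bound: "cmod (Kp p w z) \<le> (nrm w * nrm z) ^ p / fact p"
proof (induction p arbitrary: z)
  case (Suc p)
  define f where "f = Kp (Suc p) w"
  have hf: "holo_n f" unfolding f_def by (rule Kp_holo)
  have main: "cmod (f z) \<le> (nrm w * nrm z) ^ Suc p / fact (Suc p)" if z: "distinct_coords z" for z
  proof -
    define P where "P = {\<sigma>::'a \<Rightarrow> 'a. \<sigma> permutes UNIV}"
    have finP: "finite P" unfolding P_def by (rule finite_permutations) simp
    have neP: "id \<in> P" by (auto simp: P_def permutes_id)
    obtain \<sigma> where \<sigma>: "\<sigma> \<in> P" "\<And>\<tau>. \<tau> \<in> P \<Longrightarrow> cmod (f (pv \<tau> z)) \<le> cmod (f (pv \<sigma> z))"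
    proof -
      have "Max ((\<lambda>\<tau>. cmod (f (pv \<tau> z))) ` P) \<in> (\<lambda>\<tau>. cmod (f (pv \<tau> z))) ` P"
        using finP neP by (intro Max_in) auto
      then obtain \<sigma> where "\<sigma> \<in> P" "cmod (f (pv \<sigma> z)) = Max ((\<lambda>\<tau>. cmod (f (pv \<tau> z))) ` P)" by auto
      thus ?thesis using that finP by (metis Max_ge finite_imageI imageI)
    qed
    have b: "bij \<sigma>" using \<sigma>(1) by (simp add: P_def permutes_UNIV_iff_bij)
    define y where "y = pv \<sigma> z"
    have y: "distinct_coords y" using z unfolding y_def distinct_coords_pv[OF b] .
    have sw: "cmod (f (swapv i j y)) \<le> cmod (f y)" for i j
      unfolding y_def swapv_pv pv_pv using \<sigma> by (auto simp: P_def intro!: permutes_compose permutes_swap_id)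
    define c where "c = (\<Sum>i\<in>(UNIV::'a set). \<Sum>j\<in>UNIV-{i}. (1::real))"
    define S where "S = (\<Sum>i\<in>UNIV. \<Sum>j\<in>UNIV-{i}. f (swapv i j y))"
    have "of_nat (Suc p) * f y = (\<Sum>i\<in>UNIV. y $ i * dpart i f y)"
      unfolding f_def homog_poly_euler[OF Kp_homog] ..
    also have "\<dots> = (\<Sum>i\<in>UNIV. y $ i * (w $ i * Kp p w y))
        - of_real k / 2 * (\<Sum>i\<in>UNIV. \<Sum>j\<in>UNIV-{i}. f y - f (swapv i j y))"
      unfolding euler_dunkl[OF y, of f k] unfolding f_def Kp_T[OF y] ..
    also have "(\<Sum>i\<in>UNIV. \<Sum>j\<in>UNIV-{i}. f y - f (swapv i j y)) = of_real c * f y - S"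
      unfolding c_def S_def by (simp add: sum_subtractf)
    also have "(\<Sum>i\<in>UNIV. y $ i * (w $ i * Kp p w y)) = (\<Sum>i\<in>UNIV. w $ i * y $ i) * Kp p w y"
      unfolding sum_distrib_right by (intro sum.cong) (auto simp: mult_ac)
    finally have "of_real (real (Suc p) + k / 2 * c) * f y = (\<Sum>i\<in>UNIV. w $ i * y $ i) * Kp p w y + of_real k / 2 * S"
      by (simp add: algebra_simps)
    hence e: "cmod (of_real (real (Suc p) + k / 2 * c) * f y) = cmod ((\<Sum>i\<in>UNIV. w $ i * y $ i) * Kp p w y + of_real k / 2 * S)"
      by (rule arg_cong)
    have c0: "c \<ge> 0" unfolding c_def by (intro sum_nonneg) auto
    have "(real (Suc p) + k / 2 * c) * cmod (f y) = cmod (of_real (real (Suc p) + k / 2 * c) * f y)"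
      using k c0 unfolding norm_mult norm_of_real by simp
    also have "\<dots> \<le> cmod (\<Sum>i\<in>UNIV. w $ i * y $ i) * cmod (Kp p w y) + k / 2 * cmod S"
      unfolding e using norm_triangle_ineq[of "(\<Sum>i\<in>UNIV. w $ i * y $ i) * Kp p w y" "of_real k / 2 * S"] k
      by (simp add: norm_mult norm_divide)
    also have "cmod S \<le> c * cmod (f y)"
      unfolding S_def c_def sum_distrib_right by (intro sum_norm_le) (simp add: sw)
    also have "cmod (\<Sum>i\<in>UNIV. w $ i * y $ i) * cmod (Kp p w y) \<le> (nrm w * nrm y) * ((nrm w * nrm y) ^ p / fact p)"
      by (intro mult_mono pairing_le Suc.IH) auto
    finally have "(real (Suc p) + k / 2 * c) * cmod (f y) \<le> (nrm w * nrm y) * ((nrm w * nrm y) ^ p / fact p) + k / 2 * (c * cmod (f y))"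
      using k by (simp add: mult_left_mono)
    \<comment> \<open>The term k/2 c |f y| appears on both sides; this is where the maximality of |f
      y| pays off.\<close>
    hence "real (Suc p) * cmod (f y) \<le> (nrm w * nrm y) ^ Suc p / fact p" by (simp add: algebra_simps)
    hence "cmod (f y) \<le> (nrm w * nrm y) ^ Suc p / fact (Suc p)" unfolding fact_Suc by (simp add: field_simps del: of_nat_Suc)
    moreover have "cmod (f z) \<le> cmod (f y)" using \<sigma>(2)[OF neP] unfolding y_def by simp
    moreover have "nrm y = nrm z" unfolding y_def by (rule nrm_pv[OF b])
    ultimately show ?thesis by simp
  qed
  have "cmod (f z) \<le> (nrm w * nrm z) ^ Suc p / fact (Suc p)"
    by (rule distinct_coords_le[where F="\<lambda>z. cmod (f z)" and G="\<lambda>z. (nrm w * nrm z) ^ Suc p / fact (Suc p)"])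
       (use main in \<open>auto intro!: continuous_intros holo_n_continuous[OF hf] continuous_on_nrm simp del: fact_Suc power_Suc\<close>)
  thus ?case by (simp add: f_def)
qed (simp add: Kp_0)

subsection \<open>The Dunkl kernel\<close>

definition Kf :: "(complex,'n::{finite,linorder}) vec \<Rightarrow> (complex,'n) vec \<Rightarrow> complex" where
  "Kf w z = (\<Sum>p. Kp p w z)"

lemma exp_series_summable: "summable (\<lambda>p. x ^ p / fact p :: real)"
  using summable_exp[of x] by (simp add: field_simps)

lemma Kp_summable_norm: "summable (\<lambda>p. cmod (Kp p w z))"
  by (rule summable_comparison_test'[OF exp_series_summable[of "nrm w * nrm z"], of 0]) (simp add: Kp_bound)

lemma Kp_sums: "(\<lambda>p. Kp p w z) sums Kf w z"
  unfolding Kf_def by (intro summable_sums summable_norm_cancel[OF Kp_summable_norm])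

text \<open>Cauchy's estimate on the unit circle in one variable, which enlarges the 1-norm by at
  most 1.\<close>

lemma Kp_dpart_bound: "cmod (dpart i (Kp p w) z) \<le> (nrm w * (nrm z + 1)) ^ p / fact p"
proof -
  have hd: "(\<lambda>t. Kp p w (cu i t z)) holomorphic_on UNIV"
    using holo_n_partial[OF Kp_holo[of p w], of i z] holomorphic_on_open[of UNIV] by blast
  have "cmod ((deriv ^^ 1) (\<lambda>t. Kp p w (cu i t z)) (z $ i)) \<le> fact 1 * ((nrm w * (nrm z + 1)) ^ p / fact p) / 1 ^ 1"
  proof (rule Cauchy_inequality)
    show "(\<lambda>t. Kp p w (cu i t z)) holomorphic_on ball (z $ i) 1" using hd holomorphic_on_subset by blast
    show "continuous_on (cball (z $ i) 1) (\<lambda>t. Kp p w (cu i t z))"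
      using hd holomorphic_on_imp_continuous_on holomorphic_on_subset by blast
    fix u assume "cmod (z $ i - u) = 1"
    hence "nrm (cu i u z) \<le> nrm z + 1" using nrm_cu[of i u z] by (simp add: norm_minus_commute)
    hence "(nrm w * nrm (cu i u z)) ^ p / fact p \<le> (nrm w * (nrm z + 1)) ^ p / fact p"
      by (intro divide_right_mono power_mono mult_left_mono) auto
    thus "cmod (Kp p w (cu i u z)) \<le> (nrm w * (nrm z + 1)) ^ p / fact p"
      using Kp_bound[of p w "cu i u z"] by linarith
  qed simp
  thus ?thesis unfolding dpart_def cu_def[symmetric] by simp
qed

text \<open>Termwise differentiation: on the ball S all partial derivatives are dominated by the
  exponential series \<open>b\<close>, uniformly in the point.\<close>

lemma Kf_has_derivative:
  fixes w z :: "(complex,'n::{finite,linorder}) vec"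
  shows "(Kf w has_derivative (\<lambda>h. \<Sum>i\<in>UNIV. h $ i * (\<Sum>p. dpart i (Kp p w) z))) (at z)"
proof -
  define R where "R = norm z + 1"
  define S where "S = ball (0::(complex,'n) vec) R"
  define b where "b = (\<lambda>p. (nrm w * (real CARD('n) * R + 1)) ^ p / fact p)"
  have bs: "summable b" unfolding b_def by (rule exp_series_summable)
  have db: "cmod (dpart i (Kp p w) x) \<le> b p" if "x \<in> S" for i p x
  proof -
    have "norm x \<le> R" using that by (simp add: S_def)
    hence "nrm x \<le> real CARD('n) * R" using nrm_le_norm[of x] by (meson mult_left_mono of_nat_0_le_iff order_trans)
    hence "(nrm w * (nrm x + 1)) ^ p / fact p \<le> b p" unfolding b_def
      by (intro divide_right_mono power_mono mult_left_mono) auto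
    thus ?thesis using Kp_dpart_bound[of i p w x] by linarith
  qed
  have ds: "summable (\<lambda>p. dpart i (Kp p w) x)" if "x \<in> S" for i x
    by (rule summable_comparison_test'[OF bs, of 0]) (use db[OF that] in auto)
  have "\<exists>g. \<forall>x\<in>S. (\<lambda>p. Kp p w x) sums g x \<and>
      (g has_derivative (\<lambda>h. \<Sum>i\<in>UNIV. h $ i * (\<Sum>p. dpart i (Kp p w) x))) (at x within S)"
  proof (rule has_derivative_series[where f'="\<lambda>p x h. \<Sum>i\<in>UNIV. h $ i * dpart i (Kp p w) x"])
    show "convex S" by (simp add: S_def)
    show "z \<in> S" by (simp add: S_def R_def)
    show "(\<lambda>p. Kp p w z) sums Kf w z" by (rule Kp_sums)
    show "(Kp p w has_derivative (\<lambda>h. \<Sum>i\<in>UNIV. h $ i * dpart i (Kp p w) x)) (at x within S)" for p x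
      using holo_n_has_derivative[OF Kp_holo] has_derivative_at_withinI by blast
    fix e :: real assume e: "e > 0"
    have tail: "cmod ((\<Sum>p<N. dpart i (Kp p w) x) - (\<Sum>p. dpart i (Kp p w) x)) \<le> (\<Sum>p. b (p + N))"
      if "x \<in> S" for i x N
    proof -
      have "(\<Sum>p. dpart i (Kp p w) x) = (\<Sum>p. dpart i (Kp (p + N) w) x) + (\<Sum>p<N. dpart i (Kp p w) x)"
        by (rule suminf_split_initial_segment[OF ds[OF that]])
      hence "cmod ((\<Sum>p<N. dpart i (Kp p w) x) - (\<Sum>p. dpart i (Kp p w) x)) = cmod (\<Sum>p. dpart i (Kp (p + N) w) x)"
        by (simp add: norm_minus_commute)
      also have "\<dots> \<le> (\<Sum>p. b (p + N))"
        by (rule norm_suminf_le) (use db[OF that] summable_ignore_initial_segment[OF bs] in auto)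
      finally show ?thesis .
    qed
    have "(\<lambda>N. \<Sum>p. b (p + N)) \<longlonglongrightarrow> 0" by (rule suminf_exist_split2[OF bs])
    hence "eventually (\<lambda>N. (\<Sum>p. b (p + N)) < e / real CARD('n)) sequentially"
      using e by (intro order_tendstoD(2)) auto
    thus "\<forall>\<^sub>F N in sequentially. \<forall>x\<in>S. \<forall>h. cmod ((\<Sum>p<N. \<Sum>i\<in>UNIV. h $ i * dpart i (Kp p w) x) -
        (\<Sum>i\<in>UNIV. h $ i * (\<Sum>p. dpart i (Kp p w) x))) \<le> e * norm h"
    proof eventually_elim
      case (elim N)
      show ?case
      proof (intro ballI allI)
        fix x :: "(complex,'n) vec" and h :: "(complex,'n) vec" assume x: "x \<in> S"
        have "(\<Sum>p<N. \<Sum>i\<in>UNIV. h $ i * dpart i (Kp p w) x) - (\<Sum>i\<in>UNIV. h $ i * (\<Sum>p. dpart i (Kp p w) x))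
          = (\<Sum>i\<in>UNIV. h $ i * ((\<Sum>p<N. dpart i (Kp p w) x) - (\<Sum>p. dpart i (Kp p w) x)))"
          by (subst sum.swap) (simp add: sum_distrib_left sum_subtractf right_diff_distrib)
        also have "cmod \<dots> \<le> (\<Sum>i\<in>(UNIV::'n set). norm h * (e / real CARD('n)))"
        proof (rule sum_norm_le)
          fix i :: 'n
          show "cmod (h $ i * ((\<Sum>p<N. dpart i (Kp p w) x) - (\<Sum>p. dpart i (Kp p w) x))) \<le> norm h * (e / real CARD('n))"
            unfolding norm_mult using tail[OF x, of i N] elim Finite_Cartesian_Product.norm_nth_le[of h i] e
            by (intro mult_mono) auto
        qed
        also have "\<dots> = e * norm h" by simp
        finally show "cmod ((\<Sum>p<N. \<Sum>i\<in>UNIV. h $ i * dpart i (Kp p w) x) -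
          (\<Sum>i\<in>UNIV. h $ i * (\<Sum>p. dpart i (Kp p w) x))) \<le> e * norm h" .
      qed
    qed
  qed
  then obtain g where g: "\<And>x. x \<in> S \<Longrightarrow> (\<lambda>p. Kp p w x) sums g x"
     "\<And>x. x \<in> S \<Longrightarrow> (g has_derivative (\<lambda>h. \<Sum>i\<in>UNIV. h $ i * (\<Sum>p. dpart i (Kp p w) x))) (at x within S)" by blast
  have gK: "g x = Kf w x" if "x \<in> S" for x using g(1)[OF that] Kp_sums sums_unique2 by blast
  have zS: "z \<in> S" "open S" by (simp_all add: S_def R_def)
  have "(g has_derivative (\<lambda>h. \<Sum>i\<in>UNIV. h $ i * (\<Sum>p. dpart i (Kp p w) z))) (at z)"
    using g(2)[OF zS(1)] at_within_open[OF zS] by simp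
  thus ?thesis
    by (rule has_derivative_transform_within_open[OF _ zS(2,1)]) (simp add: gK)
qed

lemma Kf_holo: "holo_n (Kf w)"
  by (rule holo_nI[OF Kf_has_derivative]) (simp add: sum_distrib_left mult.assoc)

lemma Kf_dpart_sums: "(\<lambda>p. dpart i (Kp p w) z) sums dpart i (Kf w) z"
proof -
  have "dpart i (Kf w) z = (\<Sum>j\<in>UNIV. axis i 1 $ j * (\<Sum>p. dpart j (Kp p w) z))"
    by (rule dpart_eqI[OF Kf_has_derivative]) (simp add: sum_distrib_left mult.assoc)
  also have "\<dots> = (\<Sum>j\<in>UNIV. if j = i then \<Sum>p. dpart j (Kp p w) z else 0)"
    by (intro sum.cong) (auto simp: axis_def)
  also have "\<dots> = (\<Sum>p. dpart i (Kp p w) z)" by simp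
  finally have "dpart i (Kf w) z = (\<Sum>p. dpart i (Kp p w) z)" .
  moreover have "summable (\<lambda>p. dpart i (Kp p w) z)"
    by (rule summable_comparison_test'[OF exp_series_summable[of "nrm w * (nrm z + 1)"], of 0])
       (use Kp_dpart_bound in auto)
  ultimately show ?thesis by (simp add: summable_sums)
qed

text \<open>T_i lowers the degree by one and kills the constant term, so it acts on the series as an
  index shift.\<close>

lemma Kf_T:
  assumes z: "distinct_coords z"
  shows "dunklA k i (Kf w) z = w $ i * Kf w z"
proof -
  have "(\<lambda>p. dunklA k i (Kp p w) z) sums dunklA k i (Kf w) z"
    unfolding dunklA_def
    by (intro sums_add Kf_dpart_sums sums_mult sums_sum sums_divide sums_diff Kp_sums)
  hence "(\<lambda>p. dunklA k i (Kp (Suc p) w) z) sums dunklA k i (Kf w) z"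
  proof -
    have "Kp 0 w = (\<lambda>z. 1)" by (simp add: fun_eq_iff Kp_0)
    hence "dunklA k i (Kp 0 w) z = 0" by simp
    moreover assume "(\<lambda>p. dunklA k i (Kp p w) z) sums dunklA k i (Kf w) z"
    ultimately show ?thesis by (subst sums_Suc_iff) simp
  qed
  hence "(\<lambda>p. w $ i * Kp p w z) sums dunklA k i (Kf w) z" unfolding Kp_T[OF z] .
  moreover have "(\<lambda>p. w $ i * Kp p w z) sums (w $ i * Kf w z)" by (intro sums_mult Kp_sums)
  ultimately show ?thesis by (rule sums_unique2)
qed

lemma Kp_scale_right: "Kp p w (c *s z) = c ^ p * Kp p w z"
  by (rule homog_poly_scale[OF Kp_homog])

lemma Kp_scale_left: "Kp p (c *s w) z = c ^ p * Kp p w z"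
  using Kp_scale_right[of p z c w] by (simp add: Kp_sym)

lemma Kf_0: "Kf w 0 = 1"
proof -
  have "Kp p w 0 = (if p = 0 then 1 else 0)" for p
    using Kp_scale_right[of p w 0 0] by (cases p) (simp_all add: Kp_0)
  hence "Kf w 0 = (\<Sum>p. if p = 0 then 1 else 0)" by (simp add: Kf_def)
  also have "\<dots> = 1" using sums_unique[OF sums_single[of 0 "\<lambda>_. 1::complex"]] by simp
  finally show ?thesis .
qed

lemma dunkl_kernel_eq: "dunkl_kernel_A k = Kf"
proof
  fix w :: "(complex,'n::{finite,linorder}) vec"
  show "dunkl_kernel_A k w = Kf w"
    unfolding dunkl_kernel_A_def
  proof (rule the_equality)
    show "holo_n (Kf w) \<and> Kf w 0 = 1 \<and> (\<forall>i z. distinct_coords z \<longrightarrow> dunklA k i (Kf w) z = w $ i * Kf w z)"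
      using Kf_holo Kf_0 Kf_T by auto
  next
    fix f assume f: "holo_n f \<and> f 0 = 1 \<and> (\<forall>i z. distinct_coords z \<longrightarrow> dunklA k i f z = w $ i * f z)"
    show "f = Kf w"
      by (rule dunkl_eigenfunction_unique[OF k _ Kf_holo _ Kf_T]) (use f Kf_0 in auto)
  qed
qed

lemma Kf_sym: "Kf w z = Kf z w"
  unfolding Kf_def using Kp_sym[of _ w z] by simp

lemma Kf_pv: "bij \<sigma> \<Longrightarrow> Kf (pv \<sigma> w) (pv \<sigma> z) = Kf w z"
  unfolding Kf_def by (simp add: Kp_pv)

lemma Kf_pv_left: "bij \<sigma> \<Longrightarrow> Kf (pv \<sigma> w) z = Kf w (pv (inv \<sigma>) z)"
  using Kf_pv[of \<sigma> w "pv (inv \<sigma>) z"] by (simp add: pv_pv bij_is_inj)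

text \<open>At w = (1,...,1) all \<open>jackE k \<eta> w\<close> are 1 and the degree p part
  collapses to the defining expansion of the power sum.\<close>

lemma Kf_constv: "Kf (constv r) z = exp (r * (\<Sum>i\<in>UNIV. z $ i))"
proof -
  have "Kp p (constv 1) z = (\<Sum>i\<in>UNIV. z $ i) ^ p / fact p" for p
    unfolding Kp_def jc_sum jackE(3) by (simp add: sum_divide_distrib)
  moreover have "(constv r :: (complex,'a) vec) = r *s constv 1" by (simp add: vec_eq_iff constv_def)
  ultimately have "Kp p (constv r) z = (r * (\<Sum>i\<in>UNIV. z $ i)) ^ p /\<^sub>R fact p" for p
    by (simp add: Kp_scale_left power_mult_distrib scaleR_conv_of_real field_simps)
  thus ?thesis unfolding Kf_def exp_def by simp
qed

text \<open>For a real spectral parameter the exponent of the energy bound sees only the real parts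
  of z. This is what makes the kernel bounded on a vertical plane.\<close>

lemma Kf_bound:
  fixes x :: "(real,'n::{finite,linorder}) vec"
  shows "cmod (Kf (cvec x) z) \<le> sqrt (fact CARD('n)) * exp ((\<Sum>i\<in>UNIV. \<bar>x $ i\<bar>) * (\<Sum>i\<in>UNIV. \<bar>Re (z $ i)\<bar>))"
proof (rule distinct_coords_le[where F="\<lambda>z. cmod (Kf (cvec x) z)" and
      G="\<lambda>z. sqrt (fact CARD('n)) * exp ((\<Sum>i\<in>UNIV. \<bar>x $ i\<bar>) * (\<Sum>i\<in>UNIV. \<bar>Re (z $ i)\<bar>))"])
  fix z :: "(complex,'n) vec" assume z: "distinct_coords z"
  have "cmod (Kf (cvec x) z) \<le> sqrt (fact CARD('n)) * cmod (Kf (cvec x) 0) * exp ((\<Sum>i\<in>UNIV. \<bar>x $ i\<bar>) * (\<Sum>i\<in>UNIV. \<bar>Re (z $ i)\<bar>))"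
  proof (rule dunkl_eigenfunction_bound[OF k Kf_holo Kf_T z])
    fix \<sigma> :: "'n \<Rightarrow> 'n"
    have "Re (\<Sum>i\<in>UNIV. cvec x $ i * z $ \<sigma> i) = (\<Sum>i\<in>UNIV. x $ i * Re (z $ \<sigma> i))"
      by (simp add: cvec_def)
    also have "\<dots> \<le> (\<Sum>i\<in>UNIV. \<bar>x $ i\<bar> * (\<Sum>i\<in>UNIV. \<bar>Re (z $ i)\<bar>))"
    proof (rule sum_mono)
      fix i
      have "x $ i * Re (z $ \<sigma> i) \<le> \<bar>x $ i\<bar> * \<bar>Re (z $ \<sigma> i)\<bar>" by (metis abs_ge_self abs_mult)
      also have "\<dots> \<le> \<bar>x $ i\<bar> * (\<Sum>i\<in>UNIV. \<bar>Re (z $ i)\<bar>)"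
        by (intro mult_left_mono member_le_sum[of "\<sigma> i" UNIV "\<lambda>i. \<bar>Re (z $ i)\<bar>"]) auto
      finally show "x $ i * Re (z $ \<sigma> i) \<le> \<bar>x $ i\<bar> * (\<Sum>i\<in>UNIV. \<bar>Re (z $ i)\<bar>)" .
    qed
    finally show "Re (\<Sum>i\<in>UNIV. cvec x $ i * z $ \<sigma> i) \<le> (\<Sum>i\<in>UNIV. \<bar>x $ i\<bar>) * (\<Sum>i\<in>UNIV. \<bar>Re (z $ i)\<bar>)"
      by (simp add: sum_distrib_right)
  qed
  thus "cmod (Kf (cvec x) z) \<le> sqrt (fact CARD('n)) * exp ((\<Sum>i\<in>UNIV. \<bar>x $ i\<bar>) * (\<Sum>i\<in>UNIV. \<bar>Re (z $ i)\<bar>))"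
    by (simp add: Kf_0)
qed (auto intro!: continuous_intros holo_n_continuous[OF Kf_holo])

end

subsection \<open>Lebesgue measure on the coordinate space\<close>

lemma prod_Basis_vec:
  "(\<Prod>b\<in>(Basis :: (real,'n::finite) vec set). g b) = (\<Prod>i\<in>UNIV. g (axis i 1))"
proof -
  have "(Basis :: (real,'n) vec set) = range (\<lambda>i. axis i 1)"
    unfolding Basis_vec_def by auto
  moreover have "inj (\<lambda>i. axis i (1::real) :: (real,'n) vec)" by (auto simp: inj_on_def axis_eq_axis)
  ultimately show ?thesis using prod.reindex[of "\<lambda>i. axis i (1::real) :: (real,'n) vec" UNIV g]
    by (simp add: o_def)
qed

lemma inner_axis_1: "x \<bullet> axis i (1::real) = x $ i"
  by (simp add: inner_axis)

lemma integrable_prod_vec: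
  fixes f :: "real \<Rightarrow> real"
  assumes f: "integrable lborel f" and nn: "\<And>x. 0 \<le> f x"
  shows "integrable lborel (\<lambda>t::(real,'n::finite) vec. \<Prod>i\<in>UNIV. f (t $ i))"
proof (rule integrableI_nonneg)
  have [measurable]: "f \<in> borel_measurable borel" using f by auto
  have [measurable]: "(\<lambda>t::(real,'n) vec. t $ i) \<in> borel_measurable borel" for i
    by (intro borel_measurable_continuous_onI continuous_intros)
  show "(\<lambda>t::(real,'n) vec. \<Prod>i\<in>UNIV. f (t $ i)) \<in> borel_measurable lborel" by measurable
  show "AE t in lborel. 0 \<le> (\<Prod>i\<in>UNIV. f ((t::(real,'n) vec) $ i))" by (auto intro!: prod_nonneg nn)
  have "(\<integral>\<^sup>+t. ennreal (\<Prod>i\<in>UNIV. f ((t::(real,'n) vec) $ i)) \<partial>lborel)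
     = (\<integral>\<^sup>+t. (\<Prod>b\<in>Basis. ennreal (f ((t::(real,'n) vec) \<bullet> b))) \<partial>lborel)"
    unfolding prod_Basis_vec inner_axis_1 by (simp add: prod_ennreal nn)
  also have "\<dots> = (\<Prod>b\<in>(Basis::(real,'n) vec set). (\<integral>\<^sup>+x. ennreal (f x) \<partial>lborel))"
    by (rule nn_integral_lborel_prod) auto
  also have "\<dots> < \<infinity>"
    using f nn by (auto simp: integrable_iff_bounded power_less_top_ennreal)
  finally show "(\<integral>\<^sup>+t. ennreal (\<Prod>i\<in>UNIV. f ((t::(real,'n) vec) $ i)) \<partial>lborel) < \<infinity>" .
qed

lemma measurable_vec_nth [measurable]: "(\<lambda>t::(real,'n::finite) vec. t $ i) \<in> borel_measurable borel"
  by (intro borel_measurable_continuous_onI continuous_intros)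

lemma measurable_pv [measurable]: "(pv \<sigma> :: (real,'n::finite) vec \<Rightarrow> _) \<in> borel_measurable borel"
  by (intro borel_measurable_continuous_onI continuous_intros)

text \<open>Lebesgue measure is determined by its values on boxes, and a permutation only rearranges
  the side lengths.\<close>

lemma lborel_pv:
  assumes "bij \<sigma>"
  shows "distr lborel borel (pv \<sigma> :: (real,'n::finite) vec \<Rightarrow> _) = lborel"
proof (rule lborel_eqI[symmetric])
  fix l u :: "(real,'n) vec"
  assume lu: "\<And>b. b \<in> Basis \<Longrightarrow> l \<bullet> b \<le> u \<bullet> b"
  have lu': "l $ i \<le> u $ i" for i using lu[of "axis i 1"] by (simp add: inner_axis)
  have inv: "\<sigma> (inv \<sigma> i) = i" "inv \<sigma> (\<sigma> i) = i" for i
    using assms by (simp_all add: bij_is_surj surj_f_inv_f bij_is_inj)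
  have vim: "pv \<sigma> -` box l u = box (pv (inv \<sigma>) l) (pv (inv \<sigma>) u)"
    unfolding box_def Basis_vec_def by (auto simp: inner_axis) (metis inv)+
  have "emeasure (distr lborel borel (pv \<sigma>)) (box l u) = emeasure lborel (box (pv (inv \<sigma>) l) (pv (inv \<sigma>) u))"
    by (subst emeasure_distr) (auto simp: vim)
  also have "\<dots> = (\<Prod>b\<in>Basis. (pv (inv \<sigma>) u - pv (inv \<sigma>) l) \<bullet> b)"
    by (rule emeasure_lborel_box) (auto simp: Basis_vec_def inner_axis lu')
  also have "(\<Prod>b\<in>Basis. (pv (inv \<sigma>) u - pv (inv \<sigma>) l) \<bullet> b) = (\<Prod>i\<in>UNIV. (\<lambda>i. u $ i - l $ i) (inv \<sigma> i))"
    unfolding prod_Basis_vec inner_axis_1 by simp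
  also have "\<dots> = (\<Prod>i\<in>UNIV. u $ i - l $ i)"
    by (rule prod.reindex_bij_betw) (use assms bij_imp_bij_inv in auto)
  also have "\<dots> = (\<Prod>b\<in>Basis. (u - l) \<bullet> b)"
    unfolding prod_Basis_vec inner_axis_1 by simp
  finally show "emeasure (distr lborel borel (pv \<sigma>)) (box l u) = (\<Prod>b\<in>Basis. (u - l) \<bullet> b)" .
qed simp

lemma integral_pv:
  fixes f :: "(real,'n::finite) vec \<Rightarrow> complex"
  assumes "bij \<sigma>" "f \<in> borel_measurable borel"
  shows "(\<integral>t. f (pv \<sigma> t) \<partial>lborel) = (\<integral>t. f t \<partial>lborel)"
proof -
  have "(\<integral>t. f t \<partial>lborel) = (\<integral>t. f t \<partial>distr lborel borel (pv \<sigma>))" unfolding lborel_pv[OF assms(1)] ..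
  also have "\<dots> = (\<integral>t. f (pv \<sigma> t) \<partial>lborel)" by (rule integral_distr) (use assms(2) in auto)
  finally show ?thesis ..
qed

lemma integrable_pv:
  fixes f :: "(real,'n::finite) vec \<Rightarrow> complex"
  assumes "bij \<sigma>" "integrable lborel f"
  shows "integrable lborel (\<lambda>t. f (pv \<sigma> t))"
proof -
  have "integrable (distr lborel borel (pv \<sigma>)) f" unfolding lborel_pv[OF assms(1)] by (rule assms(2))
  thus ?thesis by (rule integrable_distr[rotated]) simp
qed

lemma integral_scale_vec:
  fixes f :: "(real,'n::finite) vec \<Rightarrow> complex"
  assumes "f \<in> borel_measurable borel" "c > 0"
  shows "(\<integral>t. f t \<partial>lborel) = of_real (c ^ CARD('n)) * (\<integral>t. f (c *\<^sub>R t) \<partial>lborel)"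
proof -
  have [measurable]: "f \<in> borel_measurable borel" by fact
  have "(\<integral>t. f t \<partial>lborel) = (\<integral>t. f t \<partial>density (distr lborel borel (\<lambda>x::(real,'n) vec. 0 + c *\<^sub>R x)) (\<lambda>_. ennreal (\<bar>c\<bar> ^ DIM((real,'n) vec))))"
    using lborel_affine[of c "0::(real,'n) vec"] assms(2) by (simp add: ennreal_power)
  also have "\<dots> = (\<integral>t. (\<bar>c\<bar> ^ DIM((real,'n) vec)) *\<^sub>R f t \<partial>distr lborel borel (\<lambda>x::(real,'n) vec. 0 + c *\<^sub>R x))"
    by (rule integral_density) auto
  also have "\<dots> = (\<integral>t. (\<bar>c\<bar> ^ DIM((real,'n) vec)) *\<^sub>R f (0 + c *\<^sub>R t) \<partial>lborel)"
    by (rule integral_distr) auto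
  finally show ?thesis using assms(2) by (simp add: scaleR_conv_of_real)
qed

lemma integral_translate_vec:
  fixes f :: "(real,'n::finite) vec \<Rightarrow> complex"
  assumes [measurable]: "f \<in> borel_measurable borel"
  shows "(\<integral>t. f (c + t) \<partial>lborel) = (\<integral>t. f t \<partial>lborel)"
proof -
  have "(\<integral>t. f t \<partial>lborel) = (\<integral>t. f t \<partial>distr lborel borel ((+) c))" unfolding lborel_distr_plus ..
  also have "\<dots> = (\<integral>t. f (c + t) \<partial>lborel)" by (rule integral_distr) auto
  finally show ?thesis ..
qed

lemma AE_distinct:
  "AE t::(real,'n::finite) vec in lborel. \<forall>i j. i \<noteq> j \<longrightarrow> t $ i \<noteq> t $ j"
proof -
  have "AE t::(real,'n) vec in lborel. i \<noteq> j \<longrightarrow> t $ i \<noteq> t $ j" for i j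
  proof (cases "i = j")
    case False
    define a :: "(real,'n) vec" where "a = axis i 1 - axis j 1"
    have at: "a \<bullet> t = t $ i - t $ j" for t
      unfolding a_def by (simp add: inner_diff_left inner_commute[of "axis _ _"] inner_axis)
    have "a $ i = 1" using False by (simp add: a_def axis_def)
    hence "a \<noteq> 0" by auto
    hence "negligible {t. a \<bullet> t = 0}" by (intro negligible_hyperplane) auto
    hence "{t. a \<bullet> t = 0} \<in> null_sets lebesgue" by (simp add: negligible_iff_null_sets)
    moreover have "{t. a \<bullet> t = 0} \<in> sets lborel"
      using closed_hyperplane[of a 0] by simp
    ultimately have "{t. a \<bullet> t = 0} \<in> null_sets lborel" by (simp add: null_sets_completion_iff)
    from AE_not_in[OF this] show ?thesis by eventually_elim (simp add: at)
  qed auto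
  thus ?thesis by (simp add: AE_all_countable)
qed

section \<open>Differentiation under the integral sign\<close>

lemma has_vector_derivative_quotient:
  fixes g :: "real \<Rightarrow> complex"
  shows "(g has_vector_derivative d) (at x) \<longleftrightarrow> ((\<lambda>y. (g y - g x) /\<^sub>R (y - x)) \<longlongrightarrow> d) (at x)"
proof -
  have "(g has_vector_derivative d) (at x) \<longleftrightarrow> ((\<lambda>y. (1 / \<bar>y - x\<bar>) *\<^sub>R (g y - (g x + (y - x) *\<^sub>R d))) \<longlongrightarrow> 0) (at x)"
    unfolding has_vector_derivative_def has_derivative_at2 by (simp add: bounded_linear_scaleR_left)
  also have "\<dots> \<longleftrightarrow> ((\<lambda>y. norm ((1 / \<bar>y - x\<bar>) *\<^sub>R (g y - (g x + (y - x) *\<^sub>R d)))) \<longlongrightarrow> 0) (at x)"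
    by (rule tendsto_norm_zero_iff[symmetric])
  also have "\<dots> \<longleftrightarrow> ((\<lambda>y. norm ((g y - g x) /\<^sub>R (y - x) - d)) \<longlongrightarrow> 0) (at x)"
  proof (rule filterlim_cong[OF refl refl])
    show "\<forall>\<^sub>F y in at x. norm ((1 / \<bar>y - x\<bar>) *\<^sub>R (g y - (g x + (y - x) *\<^sub>R d))) = norm ((g y - g x) /\<^sub>R (y - x) - d)"
      unfolding eventually_at
    proof (intro exI[of _ 1] conjI ballI impI)
      fix y assume y: "y \<noteq> x \<and> dist y x < 1"
      have "(g y - g x) /\<^sub>R (y - x) - d = (1 / (y - x)) *\<^sub>R (g y - (g x + (y - x) *\<^sub>R d))"
        using y by (simp add: scaleR_diff_right scaleR_add_right divide_inverse)
      thus "norm ((1 / \<bar>y - x\<bar>) *\<^sub>R (g y - (g x + (y - x) *\<^sub>R d))) = norm ((g y - g x) /\<^sub>R (y - x) - d)"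
        by simp
    qed simp
  qed
  also have "\<dots> \<longleftrightarrow> ((\<lambda>y. (g y - g x) /\<^sub>R (y - x)) \<longlongrightarrow> d) (at x)"
    by (simp only: tendsto_norm_zero_iff LIM_zero_iff)
  finally show ?thesis .
qed

text \<open>By the mean value inequality \<open>G\<close> also dominates the difference quotients,
  so dominated convergence applies along every sequence tending to \<open>u0\<close>.\<close>

lemma has_vector_derivative_integral:
  fixes f f' :: "real \<Rightarrow> 'a \<Rightarrow> complex"
  assumes e: "e > 0"
    and int: "\<And>u. \<bar>u - u0\<bar> < e \<Longrightarrow> integrable M (f u)"
    and der: "\<And>u t. \<bar>u - u0\<bar> < e \<Longrightarrow> ((\<lambda>u. f u t) has_vector_derivative f' u t) (at u)"
    and bd: "\<And>u t. \<bar>u - u0\<bar> < e \<Longrightarrow> cmod (f' u t) \<le> G t"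
    and G: "integrable M G"
    and meas: "f' u0 \<in> borel_measurable M"
  shows "((\<lambda>u. \<integral>t. f u t \<partial>M) has_vector_derivative (\<integral>t. f' u0 t \<partial>M)) (at u0)"
proof -
  define q where "q = (\<lambda>u t. (f u t - f u0 t) /\<^sub>R (u - u0))"
  have bq: "cmod (q u t) \<le> G t" if u: "\<bar>u - u0\<bar> < e" for u t
  proof (cases "u = u0")
    case True
    have "0 \<le> G t" using bd[OF u, of t] norm_ge_zero order_trans by blast
    thus ?thesis using True by (simp add: q_def)
  next
    case False
    have "norm (f u t - f u0 t) \<le> G t * norm (u - u0)"
    proof (rule differentiable_bound[where S="{u0-e<..<u0+e}" and f'="\<lambda>v h. h *\<^sub>R f' v t"])
      fix v assume "v \<in> {u0-e<..<u0+e}"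
      hence v: "\<bar>v - u0\<bar> < e" by auto
      show "((\<lambda>u. f u t) has_derivative (\<lambda>h. h *\<^sub>R f' v t)) (at v within {u0-e<..<u0+e})"
        using der[OF v, of t] unfolding has_vector_derivative_def by (rule has_derivative_at_withinI)
      show "onorm (\<lambda>h. h *\<^sub>R f' v t) \<le> G t"
        by (rule onorm_le) (use bd[OF v, of t] in \<open>simp add: mult.commute[of "G t"] mult_left_mono\<close>)
    qed (use u e in auto)
    thus ?thesis using False by (simp add: q_def divide_simps)
  qed
  have "((\<lambda>u. \<integral>t. q u t \<partial>M) \<longlongrightarrow> (\<integral>t. f' u0 t \<partial>M)) (at u0)"
    unfolding tendsto_at_iff_sequentially o_def
  proof (intro allI impI)
    fix X :: "nat \<Rightarrow> real"
    assume X: "\<forall>i. X i \<in> UNIV - {u0}" "X \<longlonglongrightarrow> u0"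
    obtain N where N: "\<And>m. m \<ge> N \<Longrightarrow> \<bar>X m - u0\<bar> < e"
      using X(2) e unfolding LIMSEQ_def dist_real_def by blast
    define Y where "Y = (\<lambda>m. X (m + N))"
    have Y: "\<bar>Y m - u0\<bar> < e" "Y m \<noteq> u0" for m using N X(1) by (auto simp: Y_def)
    have Yl: "Y \<longlonglongrightarrow> u0" unfolding Y_def by (rule LIMSEQ_ignore_initial_segment[OF X(2)])
    have "(\<lambda>m. \<integral>t. q (Y m) t \<partial>M) \<longlonglongrightarrow> (\<integral>t. f' u0 t \<partial>M)"
    proof (rule integral_dominated_convergence[OF meas _ G])
      fix m
      show "q (Y m) \<in> borel_measurable M"
        unfolding q_def using int[OF Y(1), THEN borel_measurable_integrable]
          int[of u0, THEN borel_measurable_integrable] e by auto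
      show "AE t in M. cmod (q (Y m) t) \<le> G t" using bq[OF Y(1)] by auto
    next
      show "AE t in M. (\<lambda>m. q (Y m) t) \<longlonglongrightarrow> f' u0 t"
      proof (rule AE_I2)
        fix t
        have "((\<lambda>u. q u t) \<longlongrightarrow> f' u0 t) (at u0)"
          using der[of u0 t] e unfolding has_vector_derivative_quotient q_def by simp
        thus "(\<lambda>m. q (Y m) t) \<longlonglongrightarrow> f' u0 t"
          unfolding tendsto_at_iff_sequentially o_def using Y Yl by auto
      qed
    qed
    thus "(\<lambda>m. \<integral>t. q (X m) t \<partial>M) \<longlonglongrightarrow> (\<integral>t. f' u0 t \<partial>M)"
      unfolding Y_def by (rule LIMSEQ_offset)
  qed
  moreover have "eventually (\<lambda>u. (\<integral>t. q u t \<partial>M) = ((\<integral>t. f u t \<partial>M) - (\<integral>t. f u0 t \<partial>M)) /\<^sub>R (u - u0)) (at u0)"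
    unfolding eventually_at dist_real_def
  proof (intro exI[of _ e] conjI ballI impI e)
    fix u assume "u \<noteq> u0 \<and> \<bar>u - u0\<bar> < e"
    thus "(\<integral>t. q u t \<partial>M) = ((\<integral>t. f u t \<partial>M) - (\<integral>t. f u0 t \<partial>M)) /\<^sub>R (u - u0)"
      unfolding q_def using int[of u] int[of u0] e by simp
  qed
  ultimately have "((\<lambda>u. ((\<integral>t. f u t \<partial>M) - (\<integral>t. f u0 t \<partial>M)) /\<^sub>R (u - u0)) \<longlongrightarrow> (\<integral>t. f' u0 t \<partial>M)) (at u0)"
    by (simp cong: tendsto_cong)
  thus ?thesis unfolding has_vector_derivative_quotient .
qed

text \<open>The integral of F translated along the i-th axis does not depend on the shift; its
  derivative at shift 0, taken under the integral sign, is the integral of F'.\<close>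

lemma integral_partial_zero:
  fixes F F' :: "(real,'n::finite) vec \<Rightarrow> complex"
  assumes F: "integrable lborel F" and F': "F' \<in> borel_measurable borel"
    and der: "\<And>t u. ((\<lambda>u. F (cu i u t)) has_vector_derivative F' (cu i u t)) (at u)"
    and bd: "\<And>t u. \<bar>u\<bar> < 1 \<Longrightarrow> cmod (F' (cu i (t $ i + u) t)) \<le> G t"
    and G: "integrable lborel G"
  shows "(\<integral>t. F' t \<partial>lborel) = 0"
proof -
  have shift: "cu i (t $ i + u) t = u *\<^sub>R axis i 1 + t" for t :: "(real,'n) vec" and u
    by (auto simp: vec_eq_iff axis_def)
  have Fm: "F \<in> borel_measurable borel" using F by auto
  have "((\<lambda>u. \<integral>t. F (cu i (t $ i + u) t) \<partial>lborel) has_vector_derivative (\<integral>t. F' (cu i (t $ i + 0) t) \<partial>lborel)) (at 0)"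
  proof (rule has_vector_derivative_integral[where e=1 and G=G])
    fix u :: real
    have "integrable (distr lborel borel ((+) (u *\<^sub>R axis i 1))) F" unfolding lborel_distr_plus by (rule F)
    hence "integrable lborel (\<lambda>t. F (u *\<^sub>R axis i 1 + t))" by (rule integrable_distr[rotated]) simp
    thus "integrable lborel (\<lambda>t. F (cu i (t $ i + u) t))" unfolding shift .
    fix t
    have "((\<lambda>u. t $ i + u) has_vector_derivative 1) (at u)"
      by (auto intro!: derivative_eq_intros simp: has_real_derivative_iff_has_vector_derivative[symmetric])
    thus "((\<lambda>u. F (cu i (t $ i + u) t)) has_vector_derivative F' (cu i (t $ i + u) t)) (at u)"
      using vector_diff_chain_at[of "\<lambda>u. t $ i + u" 1 u "\<lambda>u. F (cu i u t)", OF _ der[of t "t $ i + u"]]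
      by (simp add: o_def)
  qed (use bd G F' in auto)
  moreover have "(\<integral>t. F (cu i (t $ i + u) t) \<partial>lborel) = (\<integral>t. F t \<partial>lborel)" for u
    unfolding shift by (rule integral_translate_vec[OF Fm])
  ultimately have "((\<lambda>u::real. \<integral>t. F t \<partial>lborel) has_vector_derivative (\<integral>t. F' t \<partial>lborel)) (at 0)" by simp
  moreover have "((\<lambda>u::real. \<integral>t. F t \<partial>lborel) has_vector_derivative 0) (at 0)" by simp
  ultimately show ?thesis by (rule vector_derivative_unique_at)
qed

subsection \<open>The weight on a vertical plane\<close>

definition zeta :: "real \<Rightarrow> (real,'n::finite) vec \<Rightarrow> (complex,'n) vec" where
  "zeta s t = (\<chi> i. complex_of_real s + \<i> * complex_of_real (t $ i))"

definition om :: "real \<Rightarrow> (real,'n::{finite,linorder}) vec \<Rightarrow> real" where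
  "om k t = omegaA k (cvec t)"

text \<open>The common scale for majorants on the plane Re \<zeta> = s: exponents add under
  multiplication, permutations leave it unchanged, and it is integrable for b < -1.\<close>

definition zprod :: "real \<Rightarrow> real \<Rightarrow> (real,'n::finite) vec \<Rightarrow> real" where
  "zprod s b t = (\<Prod>i\<in>UNIV. cmod (zeta s t $ i) powr b)"

text \<open>Smooth for \<open>d \<noteq> 0\<close>, which permits integration by parts before \<open>d\<close> tends to \<open>0\<close>.\<close>
definition omreg :: "real \<Rightarrow> real \<Rightarrow> (real,'n::{finite,linorder}) vec \<Rightarrow> real" where
  "omreg k d t = exp (k / 2 * (\<Sum>a\<in>UNIV. \<Sum>b\<in>UNIV-{a}. ln ((t $ a - t $ b)\<^sup>2 + d\<^sup>2)))"

lemma zeta_nth [simp]: "zeta s t $ i = complex_of_real s + \<i> * complex_of_real (t $ i)"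
  by (simp add: zeta_def)

lemma zeta_pv: "zeta s (pv \<sigma> t) = pv \<sigma> (zeta s t)"
  by (simp add: vec_eq_iff)

lemma zeta_swapv: "zeta s (swapv i j t) = swapv i j (zeta s t)"
  by (simp add: swapv_pv zeta_pv)

lemma zeta_cu: "zeta s (cu i u t) = cu i (complex_of_real s + \<i> * complex_of_real u) (zeta s t)"
  by (simp add: vec_eq_iff)

lemma measurable_zeta [measurable]: "zeta s \<in> borel_measurable borel"
  unfolding zeta_def by (intro borel_measurable_continuous_onI continuous_intros)

lemma omegaA_zeta: "omegaA k (zeta s t) = om k t"
proof -
  have "cmod (zeta s t $ i - zeta s t $ j) = cmod (cvec t $ i - cvec t $ j)" for i j
  proof -
    have "zeta s t $ i - zeta s t $ j = \<i> * (cvec t $ i - cvec t $ j)" by (simp add: cvec_def algebra_simps)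
    thus ?thesis by (simp add: norm_mult)
  qed
  thus ?thesis unfolding om_def omegaA_def by (auto intro!: prod.cong)
qed

lemma om_alt: "om k t = (\<Prod>(i,j)\<in>{(i,j). i < j}. \<bar>t $ i - t $ j\<bar> powr (2 * k))"
proof -
  have "cmod (cvec t $ i - cvec t $ j) = \<bar>t $ i - t $ j\<bar>" for i j
    unfolding cvec_def by (simp flip: of_real_diff)
  thus ?thesis unfolding om_def omegaA_def by (auto intro!: prod.cong)
qed

lemma om_nonneg [simp]: "om k t \<ge> 0"
  unfolding om_alt by (intro prod_nonneg) auto

lemma measurable_om [measurable]: "om k \<in> borel_measurable borel"
  unfolding om_alt[abs_def] by measurable

lemma sum_pairs_sym:
  fixes g :: "'n::{finite,linorder} \<Rightarrow> 'n \<Rightarrow> real"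
  assumes "\<And>a b. g a b = g b a"
  shows "(\<Sum>a\<in>UNIV. \<Sum>b\<in>UNIV-{a}. g a b) = 2 * (\<Sum>(a,b)\<in>{(a,b). a < b}. g a b)"
proof -
  have "(\<Sum>a\<in>UNIV. \<Sum>b\<in>UNIV-{a}. g a b) = (\<Sum>(a,b)\<in>Sigma UNIV (\<lambda>a. UNIV-{a}). g a b)"
    by (rule sum.Sigma) auto
  also have "Sigma UNIV (\<lambda>a::'n. UNIV-{a}) = {(a,b). a < b} \<union> {(a,b). b < a}" by auto
  also have "(\<Sum>(a,b)\<in>\<dots>. g a b) = (\<Sum>(a,b)\<in>{(a,b). a < b}. g a b) + (\<Sum>(a,b)\<in>{(a,b). b < a}. g a b)"
    by (rule sum.union_disjoint) auto
  also have "(\<Sum>(a,b)\<in>{(a,b). b < a}. g a b) = (\<Sum>(a,b)\<in>{(a,b). a < b}. g a b)"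
    by (rule sum.reindex_bij_witness[of _ "\<lambda>(a,b). (b,a)" "\<lambda>(a,b). (b,a)"]) (auto simp: assms)
  finally show ?thesis by simp
qed

text \<open>Only off the reflecting hyperplanes: on them \<open>0 powr _ = 0\<close> makes the left
  side vanish, whereas \<open>ln 0 = 0\<close> keeps the right side positive. They form a null
  set.\<close>

lemma om_eq_omreg_0:
  assumes "\<forall>i j. i \<noteq> j \<longrightarrow> t $ i \<noteq> t $ j"
  shows "om k t = omreg k 0 t"
proof -
  have "om k t = (\<Prod>(i,j)\<in>{(i,j). i < j}. exp (k * ln ((t $ i - t $ j)\<^sup>2)))"
    unfolding om_alt
  proof (intro prod.cong refl, safe)
    fix i j :: 'a assume "i < j"
    hence "t $ i - t $ j \<noteq> 0" using assms by auto
    thus "\<bar>t $ i - t $ j\<bar> powr (2 * k) = exp (k * ln ((t $ i - t $ j)\<^sup>2))"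
      unfolding powr_def by (simp add: ln_realpow[of "\<bar>t $ i - t $ j\<bar>" 2, simplified] algebra_simps)
  qed
  also have "\<dots> = exp (\<Sum>(i,j)\<in>{(i,j). i < j}. k * ln ((t $ i - t $ j)\<^sup>2))"
    by (simp add: exp_sum case_prod_beta)
  also have "(\<Sum>(i,j)\<in>{(i,j). i < j}. k * ln ((t $ i - t $ j)\<^sup>2)) = k * (\<Sum>(i,j)\<in>{(i,j). i < j}. ln ((t $ i - t $ j)\<^sup>2))"
    by (simp add: sum_distrib_left case_prod_beta)
  also have "(\<Sum>(i,j)\<in>{(i,j). i < j}. ln ((t $ i - t $ j)\<^sup>2)) = (\<Sum>a\<in>UNIV. \<Sum>b\<in>UNIV-{a}. ln ((t $ a - t $ b)\<^sup>2)) / 2"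
    by (subst sum_pairs_sym) (simp_all add: power2_commute)
  finally show ?thesis unfolding omreg_def by simp
qed

lemma om_pv:
  assumes "bij \<sigma>"
  shows "AE t in lborel. om k (pv \<sigma> t) = om k t"
  using AE_distinct
proof eventually_elim
  case (elim t)
  have inj: "inj \<sigma>" using assms bij_is_inj by blast
  have e: "\<forall>i j. i \<noteq> j \<longrightarrow> pv \<sigma> t $ i \<noteq> pv \<sigma> t $ j" using elim inj by (simp add: inj_eq)
  have "(\<Sum>a\<in>UNIV. \<Sum>b\<in>UNIV-{a}. ln ((t $ \<sigma> a - t $ \<sigma> b)\<^sup>2)) = (\<Sum>a\<in>UNIV. (\<lambda>a. \<Sum>b\<in>UNIV-{a}. ln ((t $ a - t $ b)\<^sup>2)) (\<sigma> a))"
  proof (rule sum.cong[OF refl])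
    fix a
    have "bij_betw \<sigma> (UNIV - {a}) (UNIV - {\<sigma> a})"
      using assms by (metis bij_betw_DiffI bij_betw_singletonI singletonI bij_betw_def image_insert image_empty bij_is_inj inj_on_subset subset_UNIV empty_subsetI insert_subset)
    thus "(\<Sum>b\<in>UNIV-{a}. ln ((t $ \<sigma> a - t $ \<sigma> b)\<^sup>2)) = (\<Sum>b\<in>UNIV-{\<sigma> a}. ln ((t $ \<sigma> a - t $ b)\<^sup>2))"
      by (rule sum.reindex_bij_betw)
  qed
  also have "\<dots> = (\<Sum>a\<in>UNIV. \<Sum>b\<in>UNIV-{a}. ln ((t $ a - t $ b)\<^sup>2))"
    by (rule sum.reindex_bij_betw[OF assms])
  finally show ?case unfolding om_eq_omreg_0[OF elim] om_eq_omreg_0[OF e] omreg_def by simp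
qed

lemma omreg_swapv: "omreg k d (swapv i j t) = omreg k d t"
proof -
  define \<sigma> where "\<sigma> = tr i j"
  have b: "bij \<sigma>" by (simp add: \<sigma>_def)
  have "(\<Sum>a\<in>UNIV. \<Sum>b\<in>UNIV-{a}. ln ((t $ \<sigma> a - t $ \<sigma> b)\<^sup>2 + d\<^sup>2)) = (\<Sum>a\<in>UNIV. (\<lambda>a. \<Sum>b\<in>UNIV-{a}. ln ((t $ a - t $ b)\<^sup>2 + d\<^sup>2)) (\<sigma> a))"
  proof (rule sum.cong[OF refl])
    fix a
    have "bij_betw \<sigma> (UNIV - {a}) (UNIV - {\<sigma> a})"
      using b by (metis bij_betw_DiffI bij_betw_singletonI singletonI bij_betw_def image_insert image_empty bij_is_inj inj_on_subset subset_UNIV empty_subsetI insert_subset)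
    thus "(\<Sum>b\<in>UNIV-{a}. ln ((t $ \<sigma> a - t $ \<sigma> b)\<^sup>2 + d\<^sup>2)) = (\<Sum>b\<in>UNIV-{\<sigma> a}. ln ((t $ \<sigma> a - t $ b)\<^sup>2 + d\<^sup>2))"
      by (rule sum.reindex_bij_betw)
  qed
  also have "\<dots> = (\<Sum>a\<in>UNIV. \<Sum>b\<in>UNIV-{a}. ln ((t $ a - t $ b)\<^sup>2 + d\<^sup>2))"
    by (rule sum.reindex_bij_betw[OF b])
  finally show ?thesis unfolding omreg_def swapv_pv pv_nth \<sigma>_def by simp
qed

lemma zeta_norm: "cmod (zeta s t $ i) = sqrt (s\<^sup>2 + (t $ i)\<^sup>2)"
  by (simp add: cmod_def)

lemma zeta_ge:
  assumes "s > 0"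
  shows "cmod (zeta s t $ i) \<ge> s" "cmod (zeta s t $ i) \<ge> \<bar>t $ i\<bar>" "cmod (zeta s t $ i) > 0"
proof -
  have "sqrt (s\<^sup>2) \<le> sqrt (s\<^sup>2 + (t $ i)\<^sup>2)" "sqrt ((t $ i)\<^sup>2) \<le> sqrt (s\<^sup>2 + (t $ i)\<^sup>2)" by (simp_all)
  thus "cmod (zeta s t $ i) \<ge> s" "cmod (zeta s t $ i) \<ge> \<bar>t $ i\<bar>" unfolding zeta_norm using assms by simp_all
  thus "cmod (zeta s t $ i) > 0" using assms by linarith
qed

lemma zprod_nonneg [simp]: "zprod s b t \<ge> 0"
  unfolding zprod_def by (intro prod_nonneg) simp

lemma measurable_zprod [measurable]: "zprod s b \<in> borel_measurable borel"
  unfolding zprod_def[abs_def] zeta_norm by measurable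

lemma zprod_pv: "bij \<sigma> \<Longrightarrow> zprod s b (pv \<sigma> t) = zprod s b t"
  unfolding zprod_def zeta_pv pv_nth by (rule prod.reindex_bij_betw)

lemma zprod_mult: "zprod s a t * zprod s b t = zprod s (a + b) t"
  unfolding zprod_def prod.distrib[symmetric] powr_add[symmetric] ..

text \<open>With A, B \<ge> s one has A, B \<le> AB/s and 1 \<le> AB/s^2, so A + B + 1 \<le> c AB;
  this is the origin of c. Because of d \<le> 1 the bound does not depend on d.\<close>

lemma pair_bound:
  fixes t :: "(real,'n::finite) vec"
  assumes s: "s > 0" and d: "0 \<le> d" "d \<le> 1"
  defines "c \<equiv> 1 + 2 / s + 1 / s\<^sup>2"
  shows "(t $ a - t $ b)\<^sup>2 + d\<^sup>2 \<le> (c * (cmod (zeta s t $ a) * cmod (zeta s t $ b)))\<^sup>2"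
proof -
  define A B where "A = cmod (zeta s t $ a)" and "B = cmod (zeta s t $ b)"
  have A: "A \<ge> s" "A \<ge> \<bar>t $ a\<bar>" and B: "B \<ge> s" "B \<ge> \<bar>t $ b\<bar>"
    using zeta_ge[OF s] unfolding A_def B_def by auto
  have AB: "A \<le> A * B / s" "B \<le> A * B / s" "1 \<le> A * B / s\<^sup>2" "0 \<le> A * B"
    using A B s mult_mono[OF A(1) B(1)] by (auto simp: field_simps power2_eq_square)
  have "(t $ a - t $ b)\<^sup>2 + d\<^sup>2 \<le> (A + B)\<^sup>2 + 1\<^sup>2"
  proof (intro add_mono)
    have "\<bar>t $ a - t $ b\<bar> \<le> \<bar>A + B\<bar>" using A B s by linarith
    thus "(t $ a - t $ b)\<^sup>2 \<le> (A + B)\<^sup>2" by (simp only: abs_le_square_iff)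
    show "d\<^sup>2 \<le> 1\<^sup>2" using d by (intro power_mono) auto
  qed
  also have "\<dots> \<le> (A + B + 1)\<^sup>2" using A B s by (simp add: power2_eq_square algebra_simps)
  also have "A + B + 1 \<le> c * (A * B)"
  proof -
    have "c * (A * B) = A * B + A * B / s + A * B / s + A * B / s\<^sup>2" unfolding c_def by (simp add: field_simps)
    thus ?thesis using AB by linarith
  qed
  hence "(A + B + 1)\<^sup>2 \<le> (c * (A * B))\<^sup>2" using A B s by (intro power_mono) auto
  finally show ?thesis unfolding A_def B_def .
qed

text \<open>Each coordinate occurs in n - 1 pairs and contributes the power 2k to each, which gives
  the exponent 2k(n - 1). The same C serves all 0 < d \<le> 1, so the later limit d -> 0 is
  dominated.\<close>

lemma om_bound:
  fixes k s :: real
  assumes k: "k \<ge> 0" and s: "s > 0"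
  obtains C where "C \<ge> 0"
    "\<And>t::(real,'n::{finite,linorder}) vec. om k t \<le> C * zprod s (2 * k * (real CARD('n) - 1)) t"
    "\<And>t::(real,'n) vec. \<And>d. 0 < d \<Longrightarrow> d \<le> 1 \<Longrightarrow> omreg k d t \<le> C * zprod s (2 * k * (real CARD('n) - 1)) t"
proof -
  define c where "c = 1 + 2 / s + 1 / s\<^sup>2"
  have c: "c > 0" using s unfolding c_def by (auto intro!: add_pos_nonneg)
  define n where "n = real CARD('n)"
  define C where "C = exp (k * (n * ((n - 1) * ln c)))"
  have main: "omreg k d t \<le> C * zprod s (2 * k * (n - 1)) t"
    if d: "0 \<le> d" "d \<le> 1" and pos: "\<And>a b. a \<noteq> b \<Longrightarrow> (t $ a - t $ b)\<^sup>2 + d\<^sup>2 > 0" for t :: "(real,'n) vec" and d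
  proof -
    define L where "L = (\<lambda>i. ln (cmod (zeta s t $ i)))"
    have zp: "cmod (zeta s t $ i) > 0" for i by (rule zeta_ge(3)[OF s])
    have lnb: "ln ((t $ a - t $ b)\<^sup>2 + d\<^sup>2) \<le> 2 * (ln c + L a + L b)" if "a \<noteq> b" for a b
    proof -
      have "ln ((t $ a - t $ b)\<^sup>2 + d\<^sup>2) \<le> ln ((c * (cmod (zeta s t $ a) * cmod (zeta s t $ b)))\<^sup>2)"
        using pair_bound[OF s d, of t a b] pos[OF that] c zp unfolding c_def by (intro ln_mono) auto
      also have "\<dots> = 2 * ln (c * (cmod (zeta s t $ a) * cmod (zeta s t $ b)))"
        using c zp by (subst ln_realpow) auto
      also have "ln (c * (cmod (zeta s t $ a) * cmod (zeta s t $ b))) = ln c + L a + L b"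
        unfolding L_def using c zp[of a] zp[of b] by (simp add: ln_mult)
      finally show ?thesis .
    qed
    have cardm: "real (card (UNIV - {a::'n})) = n - 1" for a
      unfolding n_def by (simp add: card_Diff_singleton of_nat_diff Suc_leI)
    have "(\<Sum>a\<in>UNIV. \<Sum>b\<in>UNIV-{a}. ln ((t $ a - t $ b)\<^sup>2 + d\<^sup>2))
        \<le> (\<Sum>a\<in>UNIV. \<Sum>b\<in>UNIV-{a}. 2 * (ln c + L a + L b))"
      by (intro sum_mono lnb) auto
    also have "\<dots> = 2 * (\<Sum>a\<in>(UNIV::'n set). \<Sum>b\<in>UNIV-{a}. ln c) + 2 * (\<Sum>a\<in>(UNIV::'n set). \<Sum>b\<in>UNIV-{a}. L a)
        + 2 * (\<Sum>a\<in>(UNIV::'n set). \<Sum>b\<in>UNIV-{a}. L b)"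
      by (simp only: sum.distrib sum_distrib_left distrib_left)
    also have "(\<Sum>a\<in>(UNIV::'n set). \<Sum>b\<in>UNIV-{a}. L b) = (\<Sum>a\<in>(UNIV::'n set). \<Sum>b\<in>UNIV-{a}. L a)"
      by (rule sum_off_diag_swap)
    also have "(\<Sum>a\<in>(UNIV::'n set). \<Sum>b\<in>UNIV-{a}. L a) = (n - 1) * (\<Sum>a\<in>UNIV. L a)"
      by (simp only: sum_constant cardm sum_distrib_left)
    also have "(\<Sum>a\<in>(UNIV::'n set). \<Sum>b\<in>UNIV-{a}. ln c) = n * ((n - 1) * ln c)"
      by (simp only: sum_constant cardm) (simp add: n_def)
    finally have le: "(\<Sum>a\<in>UNIV. \<Sum>b\<in>UNIV-{a}. ln ((t $ a - t $ b)\<^sup>2 + d\<^sup>2))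
        \<le> 2 * (n * ((n - 1) * ln c)) + 4 * ((n - 1) * (\<Sum>a\<in>UNIV. L a))" by simp
    have "omreg k d t \<le> exp (k / 2 * (2 * (n * ((n - 1) * ln c)) + 4 * ((n - 1) * (\<Sum>a\<in>UNIV. L a))))"
      unfolding omreg_def using k le by (simp add: mult_left_mono)
    also have "k / 2 * (2 * (n * ((n - 1) * ln c)) + 4 * ((n - 1) * (\<Sum>a\<in>UNIV. L a)))
       = k * (n * ((n - 1) * ln c)) + (\<Sum>a\<in>UNIV. 2 * k * (n - 1) * L a)"
    proof -
      have "(\<Sum>a\<in>UNIV. 2 * k * (n - 1) * L a) = 2 * k * (n - 1) * (\<Sum>a\<in>UNIV. L a)"
        by (rule sum_distrib_left[symmetric])
      thus ?thesis by (simp add: algebra_simps)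
    qed
    also have "exp \<dots> = C * (\<Prod>a\<in>UNIV. exp (2 * k * (n - 1) * L a))"
      unfolding C_def by (simp add: exp_add exp_sum)
    also have "(\<Prod>a\<in>UNIV. exp (2 * k * (n - 1) * L a)) = zprod s (2 * k * (n - 1)) t"
      unfolding zprod_def L_def powr_def using zp by (intro prod.cong) (auto simp: less_le)
    finally show ?thesis .
  qed
  show ?thesis
  proof (rule that[of C])
    show "C \<ge> 0" by (simp add: C_def)
    fix t :: "(real,'n) vec"
    show "omreg k d t \<le> C * zprod s (2 * k * (real CARD('n) - 1)) t" if "0 < d" "d \<le> 1" for d
    proof -
      have "0 < (t $ a - t $ b)\<^sup>2 + d\<^sup>2" for a b using that by (intro add_nonneg_pos) auto
      thus ?thesis using main[of d t] that unfolding n_def by auto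
    qed
    show "om k t \<le> C * zprod s (2 * k * (real CARD('n) - 1)) t"
    proof (cases "\<forall>i j. i \<noteq> j \<longrightarrow> t $ i \<noteq> t $ j")
      case True
      thus ?thesis using main[of 0 t] unfolding n_def om_eq_omreg_0[OF True] by auto
    next
      case False
      \<comment> \<open>On a reflecting hyperplane some factor is \<open>0 powr (2 * k)\<close>,
        which is 0 even for k = 0.\<close>
      then obtain i j where ij: "i < j" "t $ i = t $ j" by (metis neqE)
      hence "\<exists>p\<in>{(i,j). i < j}. (case p of (i,j) \<Rightarrow> \<bar>t $ i - t $ j\<bar> powr (2 * k)) = 0"
        by (intro bexI[of _ "(i,j)"]) auto
      hence "om k t = 0" unfolding om_alt by (intro prod_zero) auto
      thus ?thesis by (simp add: C_def)
    qed
  qed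
qed

lemma integrable_zprod:
  assumes s: "s > 0" and b: "b > 1"
  shows "integrable lborel (zprod s (-b) :: (real,'n::finite) vec \<Rightarrow> real)"
proof -
  define f where "f = (\<lambda>t::real. sqrt (s\<^sup>2 + t\<^sup>2) powr (-b))"
  have fm: "f \<in> borel_measurable borel" unfolding f_def by measurable
  have "((\<lambda>t. t powr (-b)) has_integral -(1 powr (-b+1)) / (-b+1)) {1::real..}"
    by (rule has_integral_powr_to_inf) (use b in auto)
  hence "(\<lambda>t::real. t powr (-b)) absolutely_integrable_on {1..}"
    by (intro nonnegative_absolutely_integrable_1) auto
  hence g: "integrable lborel (\<lambda>t::real. indicator {1..} t *\<^sub>R t powr (-b))"
    unfolding set_integrable_def by (subst (asm) integrable_completion) auto
  hence g': "integrable lborel (\<lambda>t::real. indicator {1..} (0 + (-1) * t) *\<^sub>R (0 + (-1) * t) powr (-b))"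
    by (rule lborel_integrable_real_affine) simp
  have c: "integrable lborel (\<lambda>t::real. indicator {-1..1} t *\<^sub>R (s powr (-b)))"
    by (intro integrable_scaleR_left integrable_indicator) auto
  have "integrable lborel f"
  proof (rule Bochner_Integration.integrable_bound)
    show "integrable lborel (\<lambda>t. indicator {1..} t *\<^sub>R t powr (-b) + indicator {1..} (0 + (-1) * t) *\<^sub>R (0 + (-1) * t) powr (-b)
       + indicator {-1..1} t *\<^sub>R (s powr (-b)))" by (intro Bochner_Integration.integrable_add g g' c)
    show "AE t in lborel. norm (f t) \<le> norm (indicator {1..} t *\<^sub>R t powr (-b) + indicator {1..} (0 + (-1) * t) *\<^sub>R (0 + (-1) * t) powr (-b)
       + indicator {-1..1} t *\<^sub>R (s powr (-b)))"
    proof (rule AE_I2)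
      fix t :: real
      have 1: "f t \<le> \<bar>t\<bar> powr (-b)" if "t \<noteq> 0"
      proof -
        have "\<bar>t\<bar> \<le> sqrt (s\<^sup>2 + t\<^sup>2)" using real_sqrt_le_mono[of "t\<^sup>2" "s\<^sup>2 + t\<^sup>2"] by simp
        thus ?thesis unfolding f_def using that b by (intro powr_mono2') auto
      qed
      have 2: "f t \<le> s powr (-b)"
      proof -
        have "s \<le> sqrt (s\<^sup>2 + t\<^sup>2)" using real_sqrt_le_mono[of "s\<^sup>2" "s\<^sup>2 + t\<^sup>2"] s by simp
        thus ?thesis unfolding f_def using s b by (intro powr_mono2') auto
      qed
      have 0: "0 \<le> f t" by (simp add: f_def)
      consider "t \<ge> 1" | "t \<le> -1" | "-1 \<le> t" "t \<le> 1" by linarith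
      hence "f t \<le> indicator {1..} t *\<^sub>R t powr (-b) + indicator {1..} (0 + (-1) * t) *\<^sub>R (0 + (-1) * t) powr (-b)
       + indicator {-1..1} t *\<^sub>R (s powr (-b))"
      proof cases
        case 1 thus ?thesis using \<open>t \<noteq> 0 \<Longrightarrow> f t \<le> \<bar>t\<bar> powr (-b)\<close> powr_ge_zero[of s "-b"]
          by (auto simp: indicator_def intro: add_increasing2)
      next
        case 2 thus ?thesis using \<open>t \<noteq> 0 \<Longrightarrow> f t \<le> \<bar>t\<bar> powr (-b)\<close> powr_ge_zero[of s "-b"]
          by (auto simp: indicator_def intro: add_increasing2)
      next
        case 3 thus ?thesis using \<open>f t \<le> s powr (-b)\<close> by (auto simp: indicator_def intro: add_increasing)
      qed
      thus "norm (f t) \<le> norm (indicator {1..} t *\<^sub>R t powr (-b) + indicator {1..} (0 + (-1) * t) *\<^sub>R (0 + (-1) * t) powr (-b)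
       + indicator {-1..1} t *\<^sub>R (s powr (-b)))" using 0 by simp
    qed
  qed (use fm in auto)
  hence "integrable lborel (\<lambda>t::(real,'n) vec. \<Prod>i\<in>UNIV. f (t $ i))"
    by (rule integrable_prod_vec) (simp add: f_def)
  thus ?thesis unfolding zprod_def[abs_def] zeta_norm f_def .
qed

text \<open>Moving a coordinate by at most 1 changes |\<zeta>_i| at most by the factor 1 + 1/s,
  because |\<zeta>_i| \<ge> s. It makes majorants stable under small translations.\<close>

lemma zprod_shift:
  fixes t t' :: "(real,'n::finite) vec"
  assumes s: "s > 0" and a: "a \<ge> 0" and tt: "\<And>i. \<bar>t' $ i - t $ i\<bar> \<le> 1"
  shows "zprod s (-a) t' \<le> (1 + 1 / s) powr (real CARD('n) * a) * zprod s (-a) t"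
proof -
  have z0: "cmod (zeta s t $ i) > 0" "cmod (zeta s t' $ i) > 0" for i by (rule zeta_ge(3)[OF s])+
  have 1: "cmod (zeta s t' $ i) powr (-a) \<le> (1 + 1 / s) powr a * cmod (zeta s t $ i) powr (-a)" for i
  proof -
    have "zeta s t $ i = zeta s t' $ i + \<i> * complex_of_real (t $ i - t' $ i)" by (simp add: algebra_simps)
    hence "cmod (zeta s t $ i) \<le> cmod (zeta s t' $ i) + cmod (\<i> * complex_of_real (t $ i - t' $ i))"
      by (metis norm_triangle_ineq)
    also have "cmod (\<i> * complex_of_real (t $ i - t' $ i)) = \<bar>t' $ i - t $ i\<bar>"
      by (simp add: norm_mult abs_minus_commute del: of_real_diff)
    also have "\<dots> \<le> 1" by (rule tt)
    also have "1 \<le> cmod (zeta s t' $ i) / s" using zeta_ge(1)[OF s] s by (simp add: field_simps)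
    finally have "cmod (zeta s t $ i) \<le> (1 + 1 / s) * cmod (zeta s t' $ i)" by (simp add: algebra_simps)
    hence "cmod (zeta s t $ i) powr a \<le> (1 + 1 / s) powr a * cmod (zeta s t' $ i) powr a"
      using a s by (subst powr_mult[symmetric]) (auto intro!: powr_mono2)
    thus ?thesis using z0 by (simp add: powr_minus field_simps)
  qed
  have "zprod s (-a) t' \<le> (\<Prod>i\<in>UNIV. (1 + 1 / s) powr a * cmod (zeta s t $ i) powr (-a))"
    unfolding zprod_def by (intro prod_mono conjI 1) auto
  also have "\<dots> = ((1 + 1 / s) powr a) ^ CARD('n) * zprod s (-a) t"
    unfolding zprod_def by (simp add: prod.distrib)
  also have "((1 + 1 / s) powr a) ^ CARD('n) = (1 + 1 / s) powr (real CARD('n) * a)"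
  proof -
    have "1 + 1 / s > 0" using s by (simp add: add_pos_pos)
    thus ?thesis by (subst powr_realpow[symmetric]) (auto simp: powr_powr mult.commute)
  qed
  finally show ?thesis .
qed

subsection \<open>Integration by parts for Dunkl operators\<close>

lemma integrable_zprod_bound:
  fixes f :: "(real,'n::finite) vec \<Rightarrow> complex"
  assumes "s > 0" "b > 1" "f \<in> borel_measurable borel" "\<And>t. cmod (f t) \<le> C * zprod s (-b) t"
  shows "integrable lborel f"
proof (rule Bochner_Integration.integrable_bound)
  show "integrable lborel (\<lambda>t::(real,'n) vec. C * zprod s (-b) t)"
    by (intro integrable_mult_right integrable_zprod assms)
  show "AE t in lborel. norm (f t) \<le> norm (C * zprod s (-b) t)"
    using assms(4) by (auto intro!: AE_I2 order_trans[OF _ abs_ge_self])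
qed (use assms(3) in simp)

lemma swapv_cu: "i \<noteq> j \<Longrightarrow> swapv i j t = cu j (t $ i) (cu i (t $ j) t)"
  by (auto simp: vec_eq_iff swapv_def)

text \<open>If |t_i - t_j| \<le> 1, the mean value inequality is used along a path from t to its
  reflection; otherwise the denominator only helps and the bounds of the two values suffice.\<close>

lemma partial_quotient_bound:
  fixes H :: "(real,'n::finite) vec \<Rightarrow> complex"
  assumes s: "s > 0" and a: "a \<ge> 0" and C: "C \<ge> 0"
    and der: "\<And>j t u. ((\<lambda>u. H (cu j u t)) has_vector_derivative H' j (cu j u t)) (at u)"
    and bH: "\<And>t. cmod (H t) \<le> C * zprod s (-a) t"
    and bH': "\<And>j t. cmod (H' j t) \<le> C * zprod s (-a) t"
    and ij: "i \<noteq> j"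
  shows "cmod ((H t - H (swapv i j t)) / of_real (t $ i - t $ j))
      \<le> 2 * C * (1 + 1 / s) powr (real CARD('n) * a) * zprod s (-a) t"
proof -
  define K where "K = (1 + 1 / s) powr (real CARD('n) * a)"
  have K1: "K \<ge> 1" unfolding K_def using s a by (intro ge_one_powr_ge_zero) auto
  define Z where "Z = zprod s (-a) t"
  have Z0: "Z \<ge> 0" by (simp add: Z_def)
  have mv: "cmod (H (cu l u y) - H (cu l v y)) \<le> C * K * Z * \<bar>u - v\<bar>"
    if uv: "\<And>w. w \<in> closed_segment u v \<Longrightarrow> \<forall>m. \<bar>cu l w y $ m - t $ m\<bar> \<le> 1" for l u v y
  proof -
    have "norm (H (cu l u y) - H (cu l v y)) \<le> (C * K * Z) * norm (u - v)"
    proof (rule differentiable_bound[where S="closed_segment u v" and f="\<lambda>u. H (cu l u y)"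
          and f'="\<lambda>w h. h *\<^sub>R H' l (cu l w y)"])
      fix w assume w: "w \<in> closed_segment u v"
      show "((\<lambda>u. H (cu l u y)) has_derivative (\<lambda>h. h *\<^sub>R H' l (cu l w y))) (at w within closed_segment u v)"
        using der[of l y w] unfolding has_vector_derivative_def by (rule has_derivative_at_withinI)
      have "cmod (H' l (cu l w y)) \<le> C * zprod s (-a) (cu l w y)" by (rule bH')
      also have "\<dots> \<le> C * (K * Z)" unfolding K_def Z_def
        using uv[OF w] C by (intro mult_left_mono zprod_shift s a) auto
      finally have b: "cmod (H' l (cu l w y)) \<le> C * K * Z" by (simp add: mult.assoc)
      show "onorm (\<lambda>h. h *\<^sub>R H' l (cu l w y)) \<le> C * K * Z"
        by (rule onorm_le) (use b in \<open>simp add: mult.commute[of "C * K * Z"] mult_left_mono\<close>)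
    qed auto
    thus ?thesis by simp
  qed
  have "cmod (H t - H (swapv i j t)) \<le> 2 * C * K * Z * \<bar>t $ i - t $ j\<bar>"
  proof (cases "\<bar>t $ i - t $ j\<bar> \<le> 1")
    case True
    \<comment> \<open>The path consists of two axis-parallel segments meeting in y; along both, no
      coordinate moves by more than 1, as \<open>zprod_shift\<close> demands.\<close>
    define y where "y = cu i (t $ j) t"
    have seg: "\<bar>w - t $ i\<bar> \<le> 1" "\<bar>w - t $ j\<bar> \<le> 1" if "w \<in> closed_segment (t $ i) (t $ j)" for w
      using that True by (auto simp: closed_segment_eq_real_ivl split: if_splits)
    have "cmod (H (cu i (t $ i) t) - H (cu i (t $ j) t)) \<le> C * K * Z * \<bar>t $ i - t $ j\<bar>"
      by (rule mv) (auto simp: seg)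
    moreover have "cmod (H (cu j (t $ j) y) - H (cu j (t $ i) y)) \<le> C * K * Z * \<bar>t $ j - t $ i\<bar>"
      by (rule mv) (use True in \<open>auto simp: seg y_def closed_segment_commute abs_minus_commute\<close>)
    moreover have "cu j (t $ j) y = y" "cu j (t $ i) y = swapv i j t"
      using ij by (auto simp: y_def swapv_cu vec_eq_iff)
    ultimately have "cmod (H t - H y) \<le> C * K * Z * \<bar>t $ i - t $ j\<bar>"
       "cmod (H y - H (swapv i j t)) \<le> C * K * Z * \<bar>t $ i - t $ j\<bar>"
      by (simp_all add: y_def abs_minus_commute)
    thus ?thesis using norm_triangle_ineq[of "H t - H y" "H y - H (swapv i j t)"] by simp
  next
    case False
    have "cmod (H t - H (swapv i j t)) \<le> cmod (H t) + cmod (H (swapv i j t))" by (rule norm_triangle_ineq4)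
    also have "\<dots> \<le> C * Z + C * Z"
      using bH[of t] bH[of "swapv i j t"] zprod_pv[of "tr i j" s "-a" t] unfolding Z_def swapv_pv by simp
    also have "\<dots> = 2 * C * Z * 1 * 1" by simp
    also have "\<dots> \<le> 2 * C * Z * K * \<bar>t $ i - t $ j\<bar>"
      using False K1 C Z0 by (intro mult_mono) auto
    finally show ?thesis by (simp add: mult_ac)
  qed
  moreover have "cmod (of_real (t $ i - t $ j)) = \<bar>t $ i - t $ j\<bar>" by (rule norm_of_real)
  moreover have "0 \<le> 2 * C * K * Z" using C K1 Z0 by simp
  ultimately have "cmod ((H t - H (swapv i j t)) / of_real (t $ i - t $ j)) \<le> 2 * C * K * Z"
    unfolding norm_divide by (cases "t $ i - t $ j = 0") (auto simp: divide_le_eq)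
  thus ?thesis unfolding K_def Z_def .
qed

lemma omreg_partial:
  assumes d: "d > 0"
  shows "((\<lambda>u. omreg k d (cu i u t)) has_real_derivative
     omreg k d (cu i u t) * (k * (\<Sum>j\<in>UNIV-{i}. 2 * (u - t $ j) / ((u - t $ j)\<^sup>2 + d\<^sup>2)))) (at u)"
proof -
  define r where "r = (\<lambda>j. 2 * (u - t $ j) / ((u - t $ j)\<^sup>2 + d\<^sup>2))"
  have pos: "x\<^sup>2 + d\<^sup>2 > 0" for x :: real using d by (intro add_nonneg_pos) auto
  have lnd: "((\<lambda>u. ln ((cu i u t $ a - cu i u t $ b)\<^sup>2 + d\<^sup>2)) has_real_derivative
      (if a = i then r b else 0) + (if b = i then r a else 0)) (at u)" if "a \<noteq> b" for a b
  proof -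
    consider "a = i" "b \<noteq> i" | "a \<noteq> i" "b = i" | "a \<noteq> i" "b \<noteq> i" using \<open>a \<noteq> b\<close> by auto
    thus ?thesis
    proof cases
      case 1
      have "((\<lambda>u. ln ((u - t $ b)\<^sup>2 + d\<^sup>2)) has_real_derivative r b) (at u)"
        unfolding r_def by (rule derivative_eq_intros refl | simp add: pos)+
      thus ?thesis using 1 by simp
    next
      case 2
      have "((\<lambda>u. ln ((t $ a - u)\<^sup>2 + d\<^sup>2)) has_real_derivative r a) (at u)"
        unfolding r_def power2_commute[of "t $ a"] by (rule derivative_eq_intros refl | simp add: pos)+
      thus ?thesis using 2 by simp
    next
      case 3 thus ?thesis by simp
    qed
  qed
  have "((\<lambda>u. k / 2 * (\<Sum>a\<in>UNIV. \<Sum>b\<in>UNIV-{a}. ln ((cu i u t $ a - cu i u t $ b)\<^sup>2 + d\<^sup>2))) has_real_derivative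
      k / 2 * (\<Sum>a\<in>UNIV. \<Sum>b\<in>UNIV-{a}. (if a = i then r b else 0) + (if b = i then r a else 0))) (at u)"
    by (intro DERIV_cmult DERIV_sum lnd) auto
  also have "(\<Sum>a\<in>UNIV. \<Sum>b\<in>UNIV-{a}. (if a = i then r b else 0) + (if b = i then r a else 0))
      = 2 * (\<Sum>j\<in>UNIV-{i}. r j)"
  proof -
    have 1: "(\<Sum>a\<in>UNIV. \<Sum>b\<in>UNIV-{a}. if a = i then r b else 0) = (\<Sum>j\<in>UNIV-{i}. r j)"
    proof -
      have "(\<Sum>a\<in>UNIV. \<Sum>b\<in>UNIV-{a}. if a = i then r b else 0) = (\<Sum>a\<in>UNIV. if a = i then \<Sum>b\<in>UNIV-{a}. r b else 0)"
        by (intro sum.cong) auto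
      thus ?thesis by simp
    qed
    have "(\<Sum>a\<in>UNIV. \<Sum>b\<in>UNIV-{a}. if b = i then r a else 0) = (\<Sum>a\<in>UNIV. \<Sum>b\<in>UNIV-{a}. if a = i then r b else 0)"
      by (rule sum_off_diag_swap)
    thus ?thesis using 1 by (simp add: sum.distrib)
  qed
  finally have "((\<lambda>u. k / 2 * (\<Sum>a\<in>UNIV. \<Sum>b\<in>UNIV-{a}. ln ((cu i u t $ a - cu i u t $ b)\<^sup>2 + d\<^sup>2))) has_real_derivative
      k * (\<Sum>j\<in>UNIV-{i}. r j)) (at u)" by simp
  from DERIV_fun_exp[OF this] show ?thesis unfolding omreg_def r_def .
qed

lemma measurable_omreg [measurable]: "omreg k d \<in> borel_measurable borel"
  unfolding omreg_def[abs_def] by measurable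

lemma omreg_nonneg [simp]: "omreg k d t \<ge> 0" by (simp add: omreg_def)

lemma measurable_swapv [measurable]: "(swapv i j :: (real,'n::finite) vec \<Rightarrow> _) \<in> borel_measurable borel"
  unfolding swapv_pv[abs_def] by measurable

context dunkl_mult
begin

text \<open>Formally \<partial>_i \<omega> = 2k sum_j \<omega>/(t_i - t_j). Averaging H/(t_i - t_j)
  with its image under the exchange of t_i and t_j turns 2H/(t_i - t_j) into the difference quotient
  of the Dunkl operator, so the integral of T_i H is that of the total derivative of H \<omega>.
  This is done for \<open>omreg k d\<close> and then d -> 0.\<close>

lemma dunkl_integral_zero:
  fixes H :: "(real,'n::{finite,linorder}) vec \<Rightarrow> complex"
  assumes s: "s > 0" and a: "a > 2 * k * (real CARD('n) - 1) + 1" and C: "C \<ge> 0"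
    and Hm [measurable]: "H \<in> borel_measurable borel" and H'm [measurable]: "H' i \<in> borel_measurable borel"
    and der: "\<And>j t u. ((\<lambda>u. H (cu j u t)) has_vector_derivative H' j (cu j u t)) (at u)"
    and bH: "\<And>t. cmod (H t) \<le> C * zprod s (-a) t"
    and bH': "\<And>j t. cmod (H' j t) \<le> C * zprod s (-a) t"
  shows "(\<integral>t. (H' i t + of_real k * (\<Sum>j\<in>UNIV-{i}. (H t - H (swapv i j t)) / of_real (t $ i - t $ j))) * of_real (om k t) \<partial>lborel) = 0"
proof -
  define mu where "mu = 2 * k * (real CARD('n) - 1)"
  have mu0: "mu \<ge> 0" unfolding mu_def using k by (intro mult_nonneg_nonneg) auto
  define b where "b = a - mu"
  have b: "b > 1" and a0: "a \<ge> 0" using a mu0 unfolding b_def mu_def by auto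
  obtain C1 where C1: "C1 \<ge> 0" "\<And>t::(real,'n) vec. om k t \<le> C1 * zprod s mu t"
    "\<And>t::(real,'n) vec. \<And>d. 0 < d \<Longrightarrow> d \<le> 1 \<Longrightarrow> omreg k d t \<le> C1 * zprod s mu t"
    using om_bound[OF k s] unfolding mu_def by metis
  define q where "q = (\<lambda>j t. (H t - H (swapv i j t)) / of_real (t $ i - t $ j))"
  have qm [measurable]: "q j \<in> borel_measurable borel" for j
    unfolding q_def by measurable
  define K where "K = (1 + 1 / s) powr (real CARD('n) * a)"
  have bq: "cmod (q j t) \<le> (2 * C * K) * zprod s (-a) t" if "j \<in> UNIV - {i}" for j t
    unfolding q_def K_def using partial_quotient_bound[OF s a0 C der bH bH'] that by auto
  have zp: "c * zprod s (-a) t * (C1 * zprod s mu t) = c * C1 * zprod s (-b) t" for c and t :: "(real,'n) vec"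
    using zprod_mult[of s "-a" t mu] unfolding b_def by (simp add: algebra_simps)
  have wb: "cmod (f t * of_real w) \<le> c * C1 * zprod s (-b) t"
    if "cmod (f t) \<le> c * zprod s (-a) t" "0 \<le> w" "w \<le> C1 * zprod s mu t" for f c w and t :: "(real,'n) vec"
  proof -
    have "cmod (f t * of_real w) = cmod (f t) * w" using that by (simp add: norm_mult)
    also have "\<dots> \<le> c * zprod s (-a) t * (C1 * zprod s mu t)"
      using that by (intro mult_mono) (auto intro: order_trans[OF norm_ge_zero])
    finally show ?thesis unfolding zp .
  qed
  have reg: "(\<integral>t. H' i t * of_real (omreg k d t) \<partial>lborel)
     + of_real k * (\<Sum>j\<in>UNIV-{i}. (\<integral>t. q j t * of_real ((t $ i - t $ j)\<^sup>2 / ((t $ i - t $ j)\<^sup>2 + d\<^sup>2)) * of_real (omreg k d t) \<partial>lborel)) = 0"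
    if d: "d > 0" "d \<le> 1" for d
  proof -
    have pos: "x\<^sup>2 + d\<^sup>2 > 0" for x :: real using d by (intro add_nonneg_pos) auto
    \<comment> \<open>The regularised 1/(t_i - t_j): 2k times the sum of the \<rho> j is the
      logarithmic derivative of \<open>omreg k d\<close> in t_i, and each is bounded by 1/d.\<close>
    define \<rho> where "\<rho> = (\<lambda>j t. (t $ i - t $ j) / ((t $ i - t $ j)\<^sup>2 + d\<^sup>2))"
    have \<rho>m [measurable]: "(\<lambda>t::(real,'n) vec. \<rho> j t) \<in> borel_measurable borel" for j unfolding \<rho>_def by measurable
    have \<rho>b: "\<bar>\<rho> j t\<bar> \<le> 1 / d" for j and t :: "(real,'n) vec"
    proof -
      define x where "x = t $ i - t $ j"
      have "0 \<le> (\<bar>x\<bar> - d)\<^sup>2" by simp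
      hence "2 * \<bar>x\<bar> * d \<le> x\<^sup>2 + d\<^sup>2" by (simp add: power2_diff)
      moreover have "0 \<le> \<bar>x\<bar> * d" using d by simp
      ultimately have "\<bar>x\<bar> * d \<le> x\<^sup>2 + d\<^sup>2" by linarith
      thus ?thesis unfolding \<rho>_def x_def[symmetric] using d pos[of x]
        by (simp add: abs_divide divide_simps mult.commute)
    qed
    define F where "F = (\<lambda>t. H t * of_real (omreg k d t))"
    define F' where "F' = (\<lambda>t. H' i t * of_real (omreg k d t)
       + of_real (2 * k) * (\<Sum>j\<in>UNIV-{i}. H t * of_real (\<rho> j t) * of_real (omreg k d t)))"
    have om1: "0 \<le> omreg k d t" "omreg k d t \<le> C1 * zprod s mu t" for t :: "(real,'n) vec"
      using C1(3) d by auto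
    have bF: "cmod (F t) \<le> C * C1 * zprod s (-b) t" for t
      unfolding F_def by (rule wb[of H, OF bH om1])
    have bH\<rho>: "cmod (H t * of_real (\<rho> j t)) \<le> C / d * zprod s (-a) t" for j t
    proof -
      have "cmod (H t * of_real (\<rho> j t)) = cmod (H t) * \<bar>\<rho> j t\<bar>" by (simp add: norm_mult)
      also have "\<dots> \<le> C * zprod s (-a) t * (1 / d)" using bH \<rho>b by (intro mult_mono) (auto simp: C)
      finally show ?thesis by simp
    qed
    have bF1: "cmod (H' i t * of_real (omreg k d t)) \<le> C * C1 * zprod s (-b) t" for t
      by (rule wb[of "H' i", OF bH' om1])
    have bF2: "cmod (H t * of_real (\<rho> j t) * of_real (omreg k d t)) \<le> C / d * C1 * zprod s (-b) t" for j t
      by (rule wb[of "\<lambda>t. H t * of_real (\<rho> j t)", OF bH\<rho> om1])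
    define B where "B = C * C1 + 2 * k * (\<Sum>j\<in>UNIV-{i}. C / d * C1)"
    have bF': "cmod (F' t) \<le> B * zprod s (-b) t" for t
    proof -
      have "cmod (\<Sum>j\<in>UNIV-{i}. H t * of_real (\<rho> j t) * of_real (omreg k d t)) \<le> (\<Sum>j\<in>UNIV-{i}. C / d * C1 * zprod s (-b) t)"
        by (intro sum_norm_le bF2)
      hence "cmod (of_real (2 * k) * (\<Sum>j\<in>UNIV-{i}. H t * of_real (\<rho> j t) * of_real (omreg k d t)))
         \<le> 2 * k * (\<Sum>j\<in>UNIV-{i}. C / d * C1 * zprod s (-b) t)"
        unfolding norm_mult norm_of_real using k by (intro mult_mono) auto
      hence "cmod (F' t) \<le> C * C1 * zprod s (-b) t + 2 * k * (\<Sum>j\<in>UNIV-{i}. C / d * C1 * zprod s (-b) t)"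
        unfolding F'_def using bF1[of t] norm_triangle_mono by blast
      thus ?thesis unfolding B_def by (simp only: distrib_right sum_distrib_right mult.assoc)
    qed
    have B0: "B \<ge> 0" unfolding B_def using C C1 k d by (intro add_nonneg_nonneg mult_nonneg_nonneg sum_nonneg) auto
    have iF1: "integrable lborel (\<lambda>t. H' i t * of_real (omreg k d t))"
      by (rule integrable_zprod_bound[OF s b _ bF1]) measurable
    have iF2: "integrable lborel (\<lambda>t. H t * of_real (\<rho> j t) * of_real (omreg k d t))" for j
      by (rule integrable_zprod_bound[OF s b _ bF2]) measurable
    have e1: "(\<integral>t. F' t \<partial>lborel) = 0"
    proof (rule integral_partial_zero[where F=F and i=i and G="\<lambda>t. B * ((1 + 1 / s) powr (real CARD('n) * b) * zprod s (-b) t)"])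
      show "integrable lborel F" unfolding F_def
        by (rule integrable_zprod_bound[OF s b _ bF[unfolded F_def]]) measurable
      show "F' \<in> borel_measurable borel" unfolding F'_def by measurable
      show "integrable lborel (\<lambda>t::(real,'n) vec. B * ((1 + 1 / s) powr (real CARD('n) * b) * zprod s (-b) t))"
        by (intro integrable_mult_right integrable_zprod s b)
      fix t :: "(real,'n) vec" and u :: real
      have "((\<lambda>u. of_real (omreg k d (cu i u t)) :: complex) has_vector_derivative
          of_real (omreg k d (cu i u t) * (k * (\<Sum>j\<in>UNIV-{i}. 2 * (u - t $ j) / ((u - t $ j)\<^sup>2 + d\<^sup>2))))) (at u)"
        by (rule has_vector_derivative_of_real[OF omreg_partial[OF d(1)]])
      from has_vector_derivative_mult[OF der[of i t u] this]
      have "((\<lambda>u. F (cu i u t)) has_vector_derivative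
         H (cu i u t) * of_real (omreg k d (cu i u t) * (k * (\<Sum>j\<in>UNIV-{i}. 2 * (u - t $ j) / ((u - t $ j)\<^sup>2 + d\<^sup>2))))
         + H' i (cu i u t) * of_real (omreg k d (cu i u t))) (at u)"
        unfolding F_def .
      also have "(\<Sum>j\<in>UNIV-{i}. 2 * (u - t $ j) / ((u - t $ j)\<^sup>2 + d\<^sup>2)) = 2 * (\<Sum>j\<in>UNIV-{i}. \<rho> j (cu i u t))"
        unfolding \<rho>_def sum_distrib_left by (intro sum.cong) auto
      also have "H (cu i u t) * of_real (omreg k d (cu i u t) * (k * (2 * (\<Sum>j\<in>UNIV-{i}. \<rho> j (cu i u t)))))
         + H' i (cu i u t) * of_real (omreg k d (cu i u t)) = F' (cu i u t)"
        unfolding F'_def by (simp add: sum_distrib_left sum_distrib_right mult_ac)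
      finally show "((\<lambda>u. F (cu i u t)) has_vector_derivative F' (cu i u t)) (at u)" .
      assume u: "\<bar>u\<bar> < 1"
      have "cmod (F' (cu i (t $ i + u) t)) \<le> B * zprod s (-b) (cu i (t $ i + u) t)" by (rule bF')
      also have "\<dots> \<le> B * ((1 + 1 / s) powr (real CARD('n) * b) * zprod s (-b) t)"
        using u b by (intro mult_left_mono[OF _ B0] zprod_shift s) auto
      finally show "cmod (F' (cu i (t $ i + u) t)) \<le> B * ((1 + 1 / s) powr (real CARD('n) * b) * zprod s (-b) t)" .
    qed
    have e2: "(\<integral>t. F' t \<partial>lborel) = (\<integral>t. H' i t * of_real (omreg k d t) \<partial>lborel)
        + of_real (2 * k) * (\<Sum>j\<in>UNIV-{i}. (\<integral>t. H t * of_real (\<rho> j t) * of_real (omreg k d t) \<partial>lborel))"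
      unfolding F'_def using iF1 iF2 by (simp add: Bochner_Integration.integral_sum)
    \<comment> \<open>\<rho> j is odd and the weight even under the exchange. The factor x^2/(x^2 +
      d^2) accounts for \<open>q j\<close> containing the unregularised denominator; it tends to 1
      for x \<noteq> 0.\<close>
    have e3: "2 * (\<integral>t. H t * of_real (\<rho> j t) * of_real (omreg k d t) \<partial>lborel)
       = (\<integral>t. q j t * of_real ((t $ i - t $ j)\<^sup>2 / ((t $ i - t $ j)\<^sup>2 + d\<^sup>2)) * of_real (omreg k d t) \<partial>lborel)" for j
    proof -
      define f where "f = (\<lambda>t. H t * of_real (\<rho> j t) * of_real (omreg k d t))"
      have fm: "f \<in> borel_measurable borel" unfolding f_def by measurable
      have fi: "integrable lborel f" unfolding f_def by (rule iF2)
      have "(\<integral>t. f (pv (tr i j) t) \<partial>lborel) = (\<integral>t. f t \<partial>lborel)" by (rule integral_pv[OF _ fm]) simp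
      moreover have fi': "integrable lborel (\<lambda>t. f (pv (tr i j) t))" by (rule integrable_pv[OF _ fi]) simp
      ultimately have "2 * (\<integral>t. f t \<partial>lborel) = (\<integral>t. f t + f (pv (tr i j) t) \<partial>lborel)"
        using fi by simp
      also have "\<dots> = (\<integral>t. q j t * of_real ((t $ i - t $ j)\<^sup>2 / ((t $ i - t $ j)\<^sup>2 + d\<^sup>2)) * of_real (omreg k d t) \<partial>lborel)"
      proof (rule Bochner_Integration.integral_cong[OF refl])
        fix t :: "(real,'n) vec"
        have "\<rho> j (swapv i j t) = - \<rho> j t" unfolding \<rho>_def
          by (simp add: power2_commute[of "t $ j"] minus_divide_left)
        hence "f t + f (pv (tr i j) t) = (H t - H (swapv i j t)) * of_real (\<rho> j t) * of_real (omreg k d t)"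
          unfolding f_def swapv_pv[symmetric] omreg_swapv by (simp add: algebra_simps)
        also have "(H t - H (swapv i j t)) * of_real (\<rho> j t) = q j t * of_real ((t $ i - t $ j)\<^sup>2 / ((t $ i - t $ j)\<^sup>2 + d\<^sup>2))"
        proof (cases "t $ i = t $ j")
          case False
          hence "complex_of_real (t $ i) - complex_of_real (t $ j) \<noteq> 0" by simp
          thus ?thesis unfolding q_def \<rho>_def by (simp add: power2_eq_square)
        qed (simp add: \<rho>_def)
        finally show "f t + f (pv (tr i j) t) = q j t * of_real ((t $ i - t $ j)\<^sup>2 / ((t $ i - t $ j)\<^sup>2 + d\<^sup>2)) * of_real (omreg k d t)" .
      qed
      finally show ?thesis unfolding f_def .
    qed
    have "(\<Sum>j\<in>UNIV-{i}. (\<integral>t. q j t * of_real ((t $ i - t $ j)\<^sup>2 / ((t $ i - t $ j)\<^sup>2 + d\<^sup>2)) * of_real (omreg k d t) \<partial>lborel))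
       = 2 * (\<Sum>j\<in>UNIV-{i}. (\<integral>t. H t * of_real (\<rho> j t) * of_real (omreg k d t) \<partial>lborel))"
      unfolding e3[symmetric] by (rule sum_distrib_left[symmetric])
    moreover have "complex_of_real (2 * k) * X = of_real k * (2 * X)" for X by simp
    ultimately show ?thesis using e1 e2 by (simp only:)
  qed
  define dm where "dm = (\<lambda>m::nat. 1 / real (Suc m))"
  have dm: "dm m > 0" "dm m \<le> 1" for m unfolding dm_def by auto
  have dml: "dm \<longlonglongrightarrow> 0" unfolding dm_def by (rule LIMSEQ_Suc[OF lim_1_over_n])
  have oml: "AE t::(real,'n) vec in lborel. (\<lambda>m. omreg k (dm m) t) \<longlonglongrightarrow> om k t"
    using AE_distinct
  proof eventually_elim
    case (elim t)
    have "(\<lambda>m. omreg k (dm m) t) \<longlonglongrightarrow> omreg k 0 t"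
      unfolding omreg_def using elim by (intro tendsto_intros dml) auto
    thus ?case unfolding om_eq_omreg_0[OF elim] .
  qed
  have lim1: "(\<lambda>m. \<integral>t. H' i t * of_real (omreg k (dm m) t) \<partial>lborel) \<longlonglongrightarrow> (\<integral>t. H' i t * of_real (om k t) \<partial>lborel)"
  proof (rule integral_dominated_convergence[where w="\<lambda>t. C * C1 * zprod s (-b) t"])
    show "integrable lborel (\<lambda>t::(real,'n) vec. C * C1 * zprod s (-b) t)" by (intro integrable_mult_right integrable_zprod s b)
    show "AE t in lborel. (\<lambda>m. H' i t * of_real (omreg k (dm m) t)) \<longlonglongrightarrow> H' i t * of_real (om k t)"
      using oml by eventually_elim (intro tendsto_intros)
    show "AE t in lborel. cmod (H' i t * of_real (omreg k (dm m) t)) \<le> C * C1 * zprod s (-b) t" for m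
      by (rule AE_I2, rule wb[of "H' i", OF bH']) (use C1(3) dm in auto)
  qed measurable
  have lim2: "(\<lambda>m. \<integral>t. q j t * of_real ((t $ i - t $ j)\<^sup>2 / ((t $ i - t $ j)\<^sup>2 + (dm m)\<^sup>2)) * of_real (omreg k (dm m) t) \<partial>lborel)
      \<longlonglongrightarrow> (\<integral>t. q j t * of_real (om k t) \<partial>lborel)" if j: "j \<in> UNIV - {i}" for j
  proof (rule integral_dominated_convergence[where w="\<lambda>t. 2 * C * K * C1 * zprod s (-b) t"])
    show "integrable lborel (\<lambda>t::(real,'n) vec. 2 * C * K * C1 * zprod s (-b) t)" by (intro integrable_mult_right integrable_zprod s b)
    show "AE t in lborel. (\<lambda>m. q j t * of_real ((t $ i - t $ j)\<^sup>2 / ((t $ i - t $ j)\<^sup>2 + (dm m)\<^sup>2)) * of_real (omreg k (dm m) t))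
        \<longlonglongrightarrow> q j t * of_real (om k t)"
      using oml AE_distinct
    proof eventually_elim
      case (elim t)
      hence ne: "(t $ i - t $ j)\<^sup>2 + 0\<^sup>2 \<noteq> 0" using j by auto
      have "(\<lambda>m. q j t * of_real ((t $ i - t $ j)\<^sup>2 / ((t $ i - t $ j)\<^sup>2 + (dm m)\<^sup>2)) * of_real (omreg k (dm m) t))
         \<longlonglongrightarrow> q j t * of_real ((t $ i - t $ j)\<^sup>2 / ((t $ i - t $ j)\<^sup>2 + 0\<^sup>2)) * of_real (om k t)"
        using elim(1) ne by (intro tendsto_intros dml) auto
      thus ?case using ne by simp
    qed
    show "AE t in lborel. cmod (q j t * of_real ((t $ i - t $ j)\<^sup>2 / ((t $ i - t $ j)\<^sup>2 + (dm m)\<^sup>2)) * of_real (omreg k (dm m) t))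
        \<le> 2 * C * K * C1 * zprod s (-b) t" for m
    proof (rule AE_I2, rule wb[of "\<lambda>t. q j t * of_real ((t $ i - t $ j)\<^sup>2 / ((t $ i - t $ j)\<^sup>2 + (dm m)\<^sup>2))"])
      fix t
      have p: "(t $ i - t $ j)\<^sup>2 + (dm m)\<^sup>2 > 0" using dm[of m] by (intro add_nonneg_pos) auto
      have "cmod (q j t * of_real ((t $ i - t $ j)\<^sup>2 / ((t $ i - t $ j)\<^sup>2 + (dm m)\<^sup>2)))
         = cmod (q j t) * ((t $ i - t $ j)\<^sup>2 / ((t $ i - t $ j)\<^sup>2 + (dm m)\<^sup>2))"
        unfolding norm_mult norm_of_real using p by (subst abs_of_nonneg) auto
      also have "\<dots> \<le> cmod (q j t) * 1" using p by (intro mult_left_mono) auto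
      also have "\<dots> \<le> 2 * C * K * zprod s (-a) t" using bq[OF j, of t] by simp
      finally show "cmod (q j t * of_real ((t $ i - t $ j)\<^sup>2 / ((t $ i - t $ j)\<^sup>2 + (dm m)\<^sup>2))) \<le> 2 * C * K * zprod s (-a) t" .
    qed (use C1(3) dm in auto)
  qed measurable
  have "(\<lambda>m. (\<integral>t. H' i t * of_real (omreg k (dm m) t) \<partial>lborel)
     + of_real k * (\<Sum>j\<in>UNIV-{i}. (\<integral>t. q j t * of_real ((t $ i - t $ j)\<^sup>2 / ((t $ i - t $ j)\<^sup>2 + (dm m)\<^sup>2)) * of_real (omreg k (dm m) t) \<partial>lborel)))
     \<longlonglongrightarrow> (\<integral>t. H' i t * of_real (om k t) \<partial>lborel) + of_real k * (\<Sum>j\<in>UNIV-{i}. (\<integral>t. q j t * of_real (om k t) \<partial>lborel))"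
    by (intro tendsto_intros lim1 lim2)
  hence "(\<integral>t. H' i t * of_real (om k t) \<partial>lborel) + of_real k * (\<Sum>j\<in>UNIV-{i}. (\<integral>t. q j t * of_real (om k t) \<partial>lborel)) = 0"
    unfolding reg[OF dm] by (simp add: LIMSEQ_const_iff)
  moreover have "integrable lborel (\<lambda>t. H' i t * of_real (om k t))"
    by (rule integrable_zprod_bound[OF s b, where C="C * C1"], measurable, rule wb[of "H' i", OF bH']) (use C1(2) in auto)
  moreover have "integrable lborel (\<lambda>t. q j t * of_real (om k t))" if "j \<in> UNIV - {i}" for j
    by (rule integrable_zprod_bound[OF s b, where C="2 * C * K * C1"], measurable, rule wb[of "q j", OF bq[OF that]]) (use C1(2) in auto)
  moreover have "(H' i t + of_real k * (\<Sum>j\<in>UNIV-{i}. (H t - H (swapv i j t)) / of_real (t $ i - t $ j))) * of_real (om k t)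
      = H' i t * of_real (om k t) + of_real k * (\<Sum>j\<in>UNIV-{i}. q j t * of_real (om k t))" for t
    unfolding q_def by (simp only: distrib_right sum_distrib_right mult.assoc)
  moreover have "(\<integral>t. H' i t * of_real (om k t) + of_real k * (\<Sum>j\<in>UNIV-{i}. q j t * of_real (om k t)) \<partial>lborel)
      = (\<integral>t. H' i t * of_real (om k t) \<partial>lborel) + of_real k * (\<Sum>j\<in>UNIV-{i}. (\<integral>t. q j t * of_real (om k t) \<partial>lborel))"
    if "integrable lborel (\<lambda>t. H' i t * of_real (om k t))"
      "\<And>j. j \<in> UNIV - {i} \<Longrightarrow> integrable lborel (\<lambda>t. q j t * of_real (om k t))"
  proof -
    have "integrable lborel (\<lambda>t. of_real k * (\<Sum>j\<in>UNIV-{i}. q j t * of_real (om k t)))"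
      by (intro integrable_mult_right Bochner_Integration.integrable_sum that(2))
    moreover have "(\<integral>t. (\<Sum>j\<in>UNIV-{i}. q j t * of_real (om k t)) \<partial>lborel) = (\<Sum>j\<in>UNIV-{i}. (\<integral>t. q j t * of_real (om k t) \<partial>lborel))"
      by (rule Bochner_Integration.integral_sum[OF that(2)])
    ultimately show ?thesis using that(1) by simp
  qed
  ultimately show ?thesis by simp
qed

text \<open>The product rule for T_i has the defect -k sum_j (f - s_ij f)(g - s_ij g)/(t_i - t_j).
  Each defect term is odd under s_ij and so integrates to 0 against the symmetric weight;
  \<open>dunkl_integral_zero\<close> for the product f g does the rest.\<close>

lemma dunkl_integration_by_parts:
  fixes f g :: "(real,'n::{finite,linorder}) vec \<Rightarrow> complex"
  assumes s: "s > 0" and a: "a > 2 * k * (real CARD('n) - 1) + 1" and C: "A \<ge> 0" "C \<ge> 0"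
    and fm [measurable]: "f \<in> borel_measurable borel" "\<And>j. f' j \<in> borel_measurable borel"
    and gm [measurable]: "g \<in> borel_measurable borel" "\<And>j. g' j \<in> borel_measurable borel"
    and derf: "\<And>j t u. ((\<lambda>u. f (cu j u t)) has_vector_derivative f' j (cu j u t)) (at u)"
    and derg: "\<And>j t u. ((\<lambda>u. g (cu j u t)) has_vector_derivative g' j (cu j u t)) (at u)"
    and bf: "\<And>t. cmod (f t) \<le> A" "\<And>j t. cmod (f' j t) \<le> A"
    and bg: "\<And>t. cmod (g t) \<le> C * zprod s (-a) t" "\<And>j t. cmod (g' j t) \<le> C * zprod s (-a) t"
    and Df: "\<And>t. \<forall>i j. i \<noteq> j \<longrightarrow> t $ i \<noteq> t $ j \<Longrightarrow>
       f' i t + of_real k * (\<Sum>j\<in>UNIV-{i}. (f t - f (swapv i j t)) / of_real (t $ i - t $ j)) = \<alpha> * f t"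
    and Dg: "\<And>t. \<forall>i j. i \<noteq> j \<longrightarrow> t $ i \<noteq> t $ j \<Longrightarrow>
       g' i t + of_real k * (\<Sum>j\<in>UNIV-{i}. (g t - g (swapv i j t)) / of_real (t $ i - t $ j)) = h t"
    and h: "h \<in> borel_measurable borel" "\<And>t. cmod (h t) \<le> C * zprod s (-a) t"
  shows "\<alpha> * (\<integral>t. f t * g t * of_real (om k t) \<partial>lborel) = - (\<integral>t. f t * h t * of_real (om k t) \<partial>lborel)"
proof -
  have [measurable]: "h \<in> borel_measurable borel" by (rule h(1))
  define mu where "mu = 2 * k * (real CARD('n) - 1)"
  have mu0: "mu \<ge> 0" unfolding mu_def using k by (intro mult_nonneg_nonneg) auto
  define b where "b = a - mu"
  have b: "b > 1" and a0: "a \<ge> 0" using a mu0 unfolding b_def mu_def by auto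
  obtain C1 where C1: "C1 \<ge> 0" "\<And>t::(real,'n) vec. om k t \<le> C1 * zprod s mu t"
    using om_bound[OF k s] unfolding mu_def by metis
  have zp: "c * zprod s (-a) t * (C1 * zprod s mu t) = c * C1 * zprod s (-b) t" for c and t :: "(real,'n) vec"
    using zprod_mult[of s "-a" t mu] unfolding b_def by (simp add: algebra_simps)
  have int: "integrable lborel (\<lambda>t. F t * of_real (om k t))"
    if "F \<in> borel_measurable borel" "\<And>t. cmod (F t) \<le> c * zprod s (-a) t" for F :: "(real,'n) vec \<Rightarrow> complex" and c
  proof (rule integrable_zprod_bound[OF s b, where C="c * C1"])
    show "(\<lambda>t. F t * of_real (om k t)) \<in> borel_measurable borel" using that(1) by measurable
    fix t :: "(real,'n) vec"
    have "cmod (F t * of_real (om k t)) = cmod (F t) * om k t" by (simp add: norm_mult)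
    also have "\<dots> \<le> c * zprod s (-a) t * (C1 * zprod s mu t)"
      using that(2) C1(2) by (intro mult_mono) (auto intro: order_trans[OF norm_ge_zero])
    finally show "cmod (F t * of_real (om k t)) \<le> c * C1 * zprod s (-b) t" unfolding zp .
  qed
  \<comment> \<open>The defect of the product rule: an even numerator over an odd denominator. Its
    bound uses the mean value estimate for f and the decay of g.\<close>
  define R where "R = (\<lambda>j t. (f t - f (swapv i j t)) * (g t - g (swapv i j t)) / of_real (t $ i - t $ j))"
  have bfq: "cmod ((f t - f (swapv i j t)) / of_real (t $ i - t $ j)) \<le> 2 * A" if "j \<in> UNIV - {i}" for j t
  proof -
    have z0: "zprod s 0 t = 1" for t :: "(real,'n) vec"
      unfolding zprod_def using zeta_ge(3)[OF s] by (intro prod.neutral) (auto simp: less_imp_neq[THEN not_sym])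
    have "cmod ((f t - f (swapv i j t)) / of_real (t $ i - t $ j))
      \<le> 2 * A * (1 + 1 / s) powr (real CARD('n) * 0) * zprod s (-0) t"
      by (rule partial_quotient_bound[OF s _ C(1) derf]) (use bf that z0 in auto)
    moreover have "1 + 1 / s > 0" using s by (simp add: add_pos_pos)
    ultimately show ?thesis by (simp add: z0)
  qed
  have bR: "cmod (R j t) \<le> 4 * A * C * zprod s (-a) t" if j: "j \<in> UNIV - {i}" for j t
  proof -
    have "cmod (g t - g (swapv i j t)) \<le> cmod (g t) + cmod (g (swapv i j t))" by (rule norm_triangle_ineq4)
    also have "\<dots> \<le> 2 * C * zprod s (-a) t"
      using bg(1)[of t] bg(1)[of "swapv i j t"] zprod_pv[of "tr i j" s "-a" t] unfolding swapv_pv by simp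
    finally have 1: "cmod (g t - g (swapv i j t)) \<le> 2 * C * zprod s (-a) t" .
    have "R j t = (f t - f (swapv i j t)) / of_real (t $ i - t $ j) * (g t - g (swapv i j t))" by (simp add: R_def)
    hence "cmod (R j t) = cmod ((f t - f (swapv i j t)) / of_real (t $ i - t $ j)) * cmod (g t - g (swapv i j t))"
      by (simp only: norm_mult)
    also have "\<dots> \<le> (2 * A) * (2 * C * zprod s (-a) t)"
      using C by (intro mult_mono bfq[OF j] 1) auto
    finally show ?thesis by simp
  qed
  have Rm [measurable]: "R j \<in> borel_measurable borel" for j unfolding R_def by measurable
  have iR: "integrable lborel (\<lambda>t. R j t * of_real (om k t))" if "j \<in> UNIV - {i}" for j
    by (rule int[OF Rm bR[OF that]])
  have R0: "(\<integral>t. R j t * of_real (om k t) \<partial>lborel) = 0" if "j \<in> UNIV - {i}" for j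
  proof -
    have bij_tr: "bij (tr i j)" by simp
    have "(\<integral>t. R j t * of_real (om k t) \<partial>lborel) = (\<integral>t. (\<lambda>t. R j t * of_real (om k t)) (pv (tr i j) t) \<partial>lborel)"
      by (rule integral_pv[symmetric]) (simp, measurable)
    also have "\<dots> = (\<integral>t. - (R j t * of_real (om k t)) \<partial>lborel)"
    proof (rule integral_cong_AE)
      show "AE t in lborel. R j (pv (tr i j) t) * of_real (om k (pv (tr i j) t)) = - (R j t * of_real (om k t))"
        using om_pv[OF bij_tr, of k]
      proof eventually_elim
        case (elim t)
        have "R j (swapv i j t) = - R j t"
        proof -
          have "R j (swapv i j t) = (f (swapv i j t) - f t) * (g (swapv i j t) - g t) / of_real (t $ j - t $ i)"
            unfolding R_def swapv_nth swapv_swapv ..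
          also have "complex_of_real (t $ j - t $ i) = - of_real (t $ i - t $ j)" by simp
          also have "(f (swapv i j t) - f t) * (g (swapv i j t) - g t) = (f t - f (swapv i j t)) * (g t - g (swapv i j t))"
            by (simp add: algebra_simps)
          finally show ?thesis unfolding R_def by (simp only: divide_minus_right)
        qed
        thus ?case unfolding elim swapv_pv by simp
      qed
    qed measurable
    finally show ?thesis by (simp add: iR[OF that])
  qed
  define H where "H = (\<lambda>t. f t * g t)"
  define H' where "H' = (\<lambda>j t. f t * g' j t + f' j t * g t)"
  have "(\<integral>t. (H' i t + of_real k * (\<Sum>j\<in>UNIV-{i}. (H t - H (swapv i j t)) / of_real (t $ i - t $ j))) * of_real (om k t) \<partial>lborel) = 0"
  proof (rule dunkl_integral_zero[OF s a, of "2 * A * C"])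
    show "H \<in> borel_measurable borel" "H' i \<in> borel_measurable borel" unfolding H_def H'_def by measurable
    show "((\<lambda>u. H (cu j u t)) has_vector_derivative H' j (cu j u t)) (at u)" for j t u
      unfolding H_def H'_def by (rule has_vector_derivative_mult[OF derf derg])
    have p: "cmod (x * y) \<le> A * C * zprod s (-a) t" if "cmod x \<le> A" "cmod y \<le> C * zprod s (-a) t" for x y and t :: "(real,'n) vec"
    proof -
      have "cmod (x * y) \<le> A * (C * zprod s (-a) t)"
        unfolding norm_mult using that C by (intro mult_mono) auto
      thus ?thesis by (simp add: mult.assoc)
    qed
    have nn: "0 \<le> A * C * zprod s (-a) t" for t :: "(real,'n) vec" using C by simp
    show "cmod (H t) \<le> 2 * A * C * zprod s (-a) t" for t
      using p[OF bf(1) bg(1), of t t] nn[of t] unfolding H_def by simp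
    show "cmod (H' j t) \<le> 2 * A * C * zprod s (-a) t" for j t
    proof -
      have "cmod (H' j t) \<le> cmod (f t * g' j t) + cmod (f' j t * g t)" unfolding H'_def by (rule norm_triangle_ineq)
      thus ?thesis using p[OF bf(1)[of t] bg(2)[of j t]] p[OF bf(2)[of j t] bg(1)[of t]] by simp
    qed
  qed (use C in auto)
  moreover have "(\<integral>t. (H' i t + of_real k * (\<Sum>j\<in>UNIV-{i}. (H t - H (swapv i j t)) / of_real (t $ i - t $ j))) * of_real (om k t) \<partial>lborel)
     = (\<integral>t. \<alpha> * (f t * g t * of_real (om k t)) + f t * h t * of_real (om k t) - of_real k * (\<Sum>j\<in>UNIV-{i}. R j t * of_real (om k t)) \<partial>lborel)"
  proof (rule integral_cong_AE)
    show "AE t in lborel. (H' i t + of_real k * (\<Sum>j\<in>UNIV-{i}. (H t - H (swapv i j t)) / of_real (t $ i - t $ j))) * of_real (om k t)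
      = \<alpha> * (f t * g t * of_real (om k t)) + f t * h t * of_real (om k t) - of_real k * (\<Sum>j\<in>UNIV-{i}. R j t * of_real (om k t))"
      using AE_distinct
    proof eventually_elim
      case (elim t)
      define Sf where "Sf = (\<Sum>j\<in>UNIV-{i}. (f t - f (swapv i j t)) / of_real (t $ i - t $ j))"
      define Sg where "Sg = (\<Sum>j\<in>UNIV-{i}. (g t - g (swapv i j t)) / of_real (t $ i - t $ j))"
      have "(\<Sum>j\<in>UNIV-{i}. (H t - H (swapv i j t)) / of_real (t $ i - t $ j)) = Sf * g t + f t * Sg - (\<Sum>j\<in>UNIV-{i}. R j t)"
        unfolding Sf_def Sg_def R_def H_def sum_distrib_right sum_distrib_left sum.distrib[symmetric] sum_subtractf[symmetric]
      proof (rule sum.cong[OF refl])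
        fix j
        show "(f t * g t - f (swapv i j t) * g (swapv i j t)) / of_real (t $ i - t $ j)
          = (f t - f (swapv i j t)) / of_real (t $ i - t $ j) * g t + f t * ((g t - g (swapv i j t)) / of_real (t $ i - t $ j))
            - (f t - f (swapv i j t)) * (g t - g (swapv i j t)) / of_real (t $ i - t $ j)"
          unfolding times_divide_eq_left times_divide_eq_right add_divide_distrib[symmetric] diff_divide_distrib[symmetric]
          by (rule arg_cong2[of _ _ _ _ "(/)"]) (simp_all add: algebra_simps)
      qed
      moreover have "f' i t + of_real k * Sf = \<alpha> * f t" unfolding Sf_def by (rule Df[OF elim])
      moreover have "g' i t + of_real k * Sg = h t" unfolding Sg_def by (rule Dg[OF elim])
      ultimately have "H' i t + of_real k * (\<Sum>j\<in>UNIV-{i}. (H t - H (swapv i j t)) / of_real (t $ i - t $ j))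
          = \<alpha> * f t * g t + f t * h t - of_real k * (\<Sum>j\<in>UNIV-{i}. R j t)"
      proof -
        assume a: "(\<Sum>j\<in>UNIV-{i}. (H t - H (swapv i j t)) / of_real (t $ i - t $ j)) = Sf * g t + f t * Sg - (\<Sum>j\<in>UNIV-{i}. R j t)"
          "f' i t + of_real k * Sf = \<alpha> * f t" "g' i t + of_real k * Sg = h t"
        have "H' i t + of_real k * (\<Sum>j\<in>UNIV-{i}. (H t - H (swapv i j t)) / of_real (t $ i - t $ j))
          = (f' i t + of_real k * Sf) * g t + f t * (g' i t + of_real k * Sg) - of_real k * (\<Sum>j\<in>UNIV-{i}. R j t)"
          unfolding a(1) H'_def by (simp add: algebra_simps)
        thus ?thesis unfolding a(2,3) .
      qed
      moreover have "(\<Sum>j\<in>UNIV-{i}. R j t * of_real (om k t)) = (\<Sum>j\<in>UNIV-{i}. R j t) * of_real (om k t)"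
        by (rule sum_distrib_right[symmetric])
      ultimately show ?case by (simp only: left_diff_distrib distrib_right mult.assoc)
    qed
  qed (unfold H_def H'_def, measurable)
  moreover have ifg: "integrable lborel (\<lambda>t. f t * g t * of_real (om k t))"
  proof (rule int)
    fix t show "cmod (f t * g t) \<le> A * C * zprod s (-a) t"
      unfolding norm_mult mult.assoc by (intro mult_mono bf bg C norm_ge_zero)
  qed measurable
  moreover have ifh: "integrable lborel (\<lambda>t. f t * h t * of_real (om k t))"
  proof (rule int)
    fix t show "cmod (f t * h t) \<le> A * C * zprod s (-a) t"
      unfolding norm_mult mult.assoc by (intro mult_mono bf h C norm_ge_zero)
  qed measurable
  moreover have "(\<integral>t. \<alpha> * (f t * g t * of_real (om k t)) + f t * h t * of_real (om k t) - of_real k * (\<Sum>j\<in>UNIV-{i}. R j t * of_real (om k t)) \<partial>lborel)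
     = \<alpha> * (\<integral>t. f t * g t * of_real (om k t) \<partial>lborel) + (\<integral>t. f t * h t * of_real (om k t) \<partial>lborel)
       - of_real k * (\<Sum>j\<in>UNIV-{i}. (\<integral>t. R j t * of_real (om k t) \<partial>lborel))"
  proof -
    have "integrable lborel (\<lambda>t. of_real k * (\<Sum>j\<in>UNIV-{i}. R j t * of_real (om k t)))"
      by (intro integrable_mult_right Bochner_Integration.integrable_sum iR)
    moreover have "(\<integral>t. (\<Sum>j\<in>UNIV-{i}. R j t * of_real (om k t)) \<partial>lborel) = (\<Sum>j\<in>UNIV-{i}. (\<integral>t. R j t * of_real (om k t) \<partial>lborel))"
      by (rule Bochner_Integration.integral_sum[OF iR])
    ultimately show ?thesis using ifg ifh by simp
  qed
  ultimately have "\<alpha> * (\<integral>t. f t * g t * of_real (om k t) \<partial>lborel) + (\<integral>t. f t * h t * of_real (om k t) \<partial>lborel) = 0"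
    using R0 by simp
  thus ?thesis by (simp add: eq_neg_iff_add_eq_0)
qed

end

subsection \<open>Boundedness and measurability of entire functions\<close>

lemma holo_n_bounded:
  fixes f :: "(complex,'n::finite) vec \<Rightarrow> complex"
  assumes f: "holo_n f"
  obtains B where "B \<ge> 0" "\<And>z. (\<And>i. cmod (z $ i) \<le> R) \<Longrightarrow> cmod (f z) \<le> B"
    "\<And>z i. (\<And>i. cmod (z $ i) \<le> R) \<Longrightarrow> cmod (dpart i f z) \<le> B"
proof -
  define S where "S = {z::(complex,'n) vec. \<forall>i. cmod (z $ i) \<le> R + 1}"
  have "closed S" unfolding S_def by (intro closed_Collect_all closed_Collect_le continuous_intros)
  moreover have "bounded S"
    unfolding bounded_iff
  proof (intro exI ballI)
    fix z assume z: "z \<in> S"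
    have "norm z \<le> (\<Sum>i\<in>UNIV. cmod (z $ i))" unfolding norm_vec_def by (rule L2_set_le_sum) auto
    also have "\<dots> \<le> (\<Sum>i\<in>(UNIV::'n set). R + 1)" using z by (intro sum_mono) (auto simp: S_def)
    finally show "norm z \<le> (\<Sum>i\<in>(UNIV::'n set). R + 1)" .
  qed
  ultimately have "compact S" by (simp add: compact_eq_bounded_closed)
  hence "bounded (f ` S)" using compact_continuous_image[OF holo_n_continuous[OF f]] compact_imp_bounded by blast
  then obtain B where B: "\<And>z. z \<in> S \<Longrightarrow> cmod (f z) \<le> B" unfolding bounded_iff by auto
  show ?thesis
  proof (rule that[of "\<bar>B\<bar>"])
    fix z :: "(complex,'n) vec" assume z: "\<And>i. cmod (z $ i) \<le> R"
    have "z \<in> S" using z unfolding S_def by (auto intro: add_increasing2)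
    thus "cmod (f z) \<le> \<bar>B\<bar>" using B[of z] by simp
    fix i
    have hd: "(\<lambda>t. f (cu i t z)) holomorphic_on UNIV"
      using holo_n_partial[OF f, of i z] holomorphic_on_open[of UNIV] by blast
    have "cmod ((deriv ^^ 1) (\<lambda>t. f (cu i t z)) (z $ i)) \<le> fact 1 * \<bar>B\<bar> / 1 ^ 1"
    proof (rule Cauchy_inequality)
      show "(\<lambda>t. f (cu i t z)) holomorphic_on ball (z $ i) 1" using hd holomorphic_on_subset by blast
      show "continuous_on (cball (z $ i) 1) (\<lambda>t. f (cu i t z))"
        using hd holomorphic_on_imp_continuous_on holomorphic_on_subset by blast
      fix u assume "cmod (z $ i - u) = 1"
      hence "cmod u \<le> R + 1" using z[of i] norm_triangle_ineq2[of u "z $ i"] by (simp add: norm_minus_commute)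
      hence "cu i u z \<in> S" using z unfolding S_def by (auto intro: add_increasing2)
      thus "cmod (f (cu i u z)) \<le> \<bar>B\<bar>" using B[of "cu i u z"] by simp
    qed simp
    thus "cmod (dpart i f z) \<le> \<bar>B\<bar>" unfolding dpart_def cu_def[symmetric] by simp
  qed simp
qed

lemma holo_n_measurable: "holo_n f \<Longrightarrow> f \<in> borel_measurable borel"
  by (intro borel_measurable_continuous_onI holo_n_continuous)

text \<open>A pointwise limit of the difference quotients with increment 1/(m + 1), which are
  continuous.\<close>

lemma dpart_measurable:
  fixes f :: "(complex,'n::finite) vec \<Rightarrow> complex"
  assumes f: "holo_n f"
  shows "dpart i f \<in> borel_measurable borel"
proof (rule borel_measurable_LIMSEQ_metric)
  fix m :: nat
  define e where "e = complex_of_real (1 / real (Suc m))"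
  have e0: "e \<noteq> 0" unfolding e_def by (simp only: of_real_eq_0_iff) simp
  have "continuous_on UNIV (\<lambda>z. (f (z + e *s axis i 1) - f z) / e)"
    by (intro continuous_intros continuous_on_compose2[OF holo_n_continuous[OF f, of UNIV]] holo_n_continuous[OF f])
       (auto simp: e0 vector_scalar_mult_def intro!: continuous_intros)
  moreover have "z + e *s axis i 1 = cu i (z $ i + e) z" for z by (simp add: cu_conv)
  ultimately show "(\<lambda>z. (f (cu i (z $ i + e) z) - f z) / e) \<in> borel_measurable borel"
    by (simp add: borel_measurable_continuous_onI)
next
  fix z :: "(complex,'n) vec"
  have d: "(\<lambda>y. (f (cu i y z) - f (cu i (z $ i) z)) / (y - z $ i)) \<midarrow>z $ i\<rightarrow> dpart i f z"
    using holo_n_partial[OF f, of i z "z $ i"] unfolding has_field_derivative_iff by simp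
  define X where "X = (\<lambda>m. z $ i + complex_of_real (1 / real (Suc m)))"
  have Xl: "X \<longlonglongrightarrow> z $ i"
  proof -
    have "(\<lambda>m. z $ i + complex_of_real (1 / real (Suc m))) \<longlonglongrightarrow> z $ i + complex_of_real 0"
      by (intro tendsto_intros LIMSEQ_Suc[OF lim_1_over_n])
    thus ?thesis by (simp add: X_def)
  qed
  have Xn: "X m \<in> UNIV - {z $ i}" for m
  proof -
    have "complex_of_real (1 / real (Suc m)) \<noteq> 0" by (simp only: of_real_eq_0_iff) simp
    thus ?thesis unfolding X_def by (simp only: Diff_iff UNIV_I singleton_iff add_cancel_right_right) simp
  qed
  have "(\<lambda>m. (f (cu i (X m) z) - f (cu i (z $ i) z)) / (X m - z $ i)) \<longlonglongrightarrow> dpart i f z"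
    using d[unfolded tendsto_at_iff_sequentially o_def, rule_format, OF Xn Xl] .
  hence "(\<lambda>m. (f (cu i (z $ i + complex_of_real (1 / real (Suc m))) z) - f (cu i (z $ i) z))
      / (z $ i + complex_of_real (1 / real (Suc m)) - z $ i)) \<longlonglongrightarrow> dpart i f z"
    unfolding X_def .
  thus "(\<lambda>m. (f (cu i (z $ i + complex_of_real (1 / real (Suc m))) z) - f z) / complex_of_real (1 / real (Suc m)))
      \<longlonglongrightarrow> dpart i f z" by simp
qed

section \<open>Estimates and derivatives on the plane Re \<zeta> = s\<close>

lemma cinvv_nth [simp]: "cinvv z $ i = 1 / z $ i" by (simp add: cinvv_def)

lemma zeta_nz: "s > 0 \<Longrightarrow> zeta s t $ i \<noteq> 0"
  using zeta_ge(3)[of s t i] by auto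

lemma zeta_Re: "Re (zeta s t $ i) = s" by simp

lemma measurable_cinvv_zeta [measurable]:
  assumes "s > 0" shows "(\<lambda>t. cinvv (zeta s t)) \<in> borel_measurable borel"
proof (intro borel_measurable_continuous_onI)
  show "continuous_on UNIV (\<lambda>t. cinvv (zeta s t))" unfolding cinvv_def zeta_def
    by (intro continuous_intros) (use zeta_nz[OF assms] in \<open>auto simp: zeta_def\<close>)
qed

lemma zeta_not_nonpos: "s > 0 \<Longrightarrow> zeta s t $ i \<notin> \<real>\<^sub>\<le>\<^sub>0"
  by (auto simp: complex_nonpos_Reals_iff)

lemma measurable_Delta_zeta:
  assumes "s > 0" shows "(\<lambda>t. Delta_pow (zeta s t) a) \<in> borel_measurable borel"
proof (intro borel_measurable_continuous_onI)
  show "continuous_on UNIV (\<lambda>t. Delta_pow (zeta s t) a)" unfolding Delta_pow_def zeta_def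
    by (intro continuous_intros) (use zeta_not_nonpos[OF assms] assms in \<open>auto simp: zeta_def complex_eq_iff\<close>)
qed

text \<open>For complex \<nu> the principal power also depends on the argument, which is at most
  \<pi> in modulus; this costs the factor exp(\<pi> |Im \<nu>|) per coordinate.\<close>

lemma Delta_zeta_bound:
  assumes "s > 0"
  shows "cmod (Delta_pow (zeta s t) (-\<nu>)) \<le> exp (pi * \<bar>Im \<nu>\<bar>) ^ CARD('n) * zprod s (- Re \<nu>) (t :: (real,'n::finite) vec)"
proof -
  have "cmod (Delta_pow (zeta s t) (-\<nu>)) = (\<Prod>i\<in>UNIV. cmod (zeta s t $ i powr (-\<nu>)))"
    unfolding Delta_pow_def by (rule prod_norm[symmetric])
  also have "\<dots> \<le> (\<Prod>i\<in>(UNIV::'n set). exp (pi * \<bar>Im \<nu>\<bar>) * cmod (zeta s t $ i) powr (- Re \<nu>))"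
  proof (intro prod_mono conjI norm_ge_zero)
    fix i
    define w where "w = zeta s t $ i"
    have w0: "w \<noteq> 0" unfolding w_def by (rule zeta_nz[OF assms])
    have "cmod (w powr (-\<nu>)) = exp (Re ((-\<nu>) * Ln w))" using w0 by (simp add: powr_def norm_exp_eq_Re)
    also have "Re ((-\<nu>) * Ln w) = - Re \<nu> * ln (cmod w) + Im \<nu> * Im (Ln w)" using w0 by (simp add: Re_Ln)
    also have "Im \<nu> * Im (Ln w) \<le> \<bar>Im \<nu>\<bar> * \<bar>Im (Ln w)\<bar>" by (metis abs_ge_self abs_mult)
    also have "\<dots> \<le> \<bar>Im \<nu>\<bar> * pi"
    proof -
      have "\<bar>Im (Ln w)\<bar> \<le> pi" using mpi_less_Im_Ln[OF w0] Im_Ln_le_pi[OF w0] by linarith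
      thus ?thesis by (intro mult_left_mono) auto
    qed
    finally have "cmod (w powr (-\<nu>)) \<le> exp (- Re \<nu> * ln (cmod w) + \<bar>Im \<nu>\<bar> * pi)" by simp
    also have "\<dots> = exp (pi * \<bar>Im \<nu>\<bar>) * cmod w powr (- Re \<nu>)"
      using w0 by (simp add: powr_def exp_add[symmetric] mult.commute)
    finally show "cmod (zeta s t $ i powr (-\<nu>)) \<le> exp (pi * \<bar>Im \<nu>\<bar>) * cmod (zeta s t $ i) powr (- Re \<nu>)"
      unfolding w_def .
  qed
  finally show ?thesis by (simp add: prod.distrib zprod_def)
qed

lemma zeta_partial:
  "((\<lambda>u. complex_of_real s + \<i> * complex_of_real u) has_vector_derivative \<i>) (at u)"
proof -
  have "((\<lambda>u. complex_of_real u) has_vector_derivative of_real 1) (at u)"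
    by (rule has_vector_derivative_of_real) (rule DERIV_ident)
  from has_vector_derivative_add[OF has_vector_derivative_const[of "complex_of_real s"] has_vector_derivative_mult_right[OF this, of \<i>]]
  show ?thesis by simp
qed

lemma holo_zeta_partial:
  assumes f: "holo_n f"
  shows "((\<lambda>u. f (zeta s (cu j u t))) has_vector_derivative \<i> * dpart j f (zeta s (cu j u t))) (at u)"
  using field_vector_diff_chain_at[OF zeta_partial[of s u] holo_n_partial[OF f, of j "zeta s t"]]
  unfolding zeta_cu by (simp add: o_def)

lemma Delta_zeta_partial:
  fixes t :: "(real,'n::finite) vec"
  assumes s: "s > 0"
  shows "((\<lambda>u. Delta_pow (zeta s (cu j u t)) a) has_vector_derivative
    a * \<i> / zeta s (cu j u t) $ j * Delta_pow (zeta s (cu j u t)) a) (at u)"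
proof -
  define c where "c = (\<Prod>l\<in>UNIV-{j}. zeta s t $ l powr a)"
  have D: "Delta_pow (zeta s (cu j u t)) a = (of_real s + \<i> * of_real u) powr a * c" for u
    unfolding Delta_pow_def c_def by (subst prod.remove[of _ j]) auto
  define w where "w = complex_of_real s + \<i> * complex_of_real u"
  have w: "w \<notin> \<real>\<^sub>\<le>\<^sub>0" "w \<noteq> 0" using s by (auto simp: w_def complex_nonpos_Reals_iff complex_eq_iff)
  have "((\<lambda>z. z powr a) has_field_derivative a * w powr (a - 1)) (at w)"
    by (rule has_field_derivative_powr[OF w(1)])
  hence "((\<lambda>z. z powr a) has_field_derivative a * w powr a / w) (at w)"
    using w(2) by (simp add: powr_diff)
  from field_vector_diff_chain_at[OF zeta_partial[of s u] this[unfolded w_def]]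
  have "((\<lambda>u. (of_real s + \<i> * of_real u) powr a) has_vector_derivative \<i> * (a * w powr a / w)) (at u)"
    by (simp add: o_def w_def)
  from has_vector_derivative_mult_left[OF this, of c]
  show ?thesis unfolding D by (simp add: w_def mult_ac)
qed

lemma cinvv_zeta_cu: "cinvv (zeta s (cu j u t)) = cu j (1 / (of_real s + \<i> * of_real u)) (cinvv (zeta s t))"
  by (simp add: vec_eq_iff)

lemma holo_cinvv_partial:
  fixes t :: "(real,'n::finite) vec"
  assumes s: "s > 0" and q: "holo_n q"
  shows "((\<lambda>u. q (cinvv (zeta s (cu j u t)))) has_vector_derivative
    - \<i> / (zeta s (cu j u t) $ j)\<^sup>2 * dpart j q (cinvv (zeta s (cu j u t)))) (at u)"
proof -
  define w where "w = complex_of_real s + \<i> * complex_of_real u"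
  have w: "w \<noteq> 0" using s by (auto simp: w_def complex_eq_iff)
  have "((\<lambda>z. 1 / z) has_field_derivative - 1 / w\<^sup>2) (at w)"
    using w by (auto intro!: derivative_eq_intros simp: power2_eq_square)
  from field_vector_diff_chain_at[OF zeta_partial[of s u] this[unfolded w_def]]
  have "((\<lambda>u. 1 / (of_real s + \<i> * of_real u)) has_vector_derivative \<i> * (- 1 / w\<^sup>2)) (at u)"
    by (simp add: o_def w_def)
  from field_vector_diff_chain_at[OF this holo_n_partial[OF q, of j "cinvv (zeta s t)"]]
  show ?thesis unfolding cinvv_zeta_cu by (simp add: o_def w_def)
qed

lemma cinvv_zeta_le:
  assumes "s > 0" shows "cmod (cinvv (zeta s t) $ i) \<le> 1 / s"
  using zeta_ge[OF assms, of t i] assms by (simp add: norm_divide frac_le del: zeta_nth)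

lemma cinvv_pv: "cinvv (pv \<sigma> z) = pv \<sigma> (cinvv z)"
  by (simp add: vec_eq_iff)

lemma Delta_pow_pv: "bij \<sigma> \<Longrightarrow> Delta_pow (pv \<sigma> z) a = Delta_pow z a"
  unfolding Delta_pow_def pv_nth by (rule prod.reindex_bij_betw)

lemma cvec_pv: "cvec (pv \<sigma> x) = pv \<sigma> (cvec x)"
  by (simp add: vec_eq_iff cvec_def)

lemma cvec_nth [simp]: "cvec x $ i = complex_of_real (x $ i)"
  by (simp add: cvec_def)

context dunkl_mult
begin

text \<open>The summand 1 in A leaves room for the unit circle of Cauchy's estimate, which changes a
  single coordinate. Thus A bounds the kernel and its partial derivatives simultaneously.\<close>

lemma Kf_zeta_bounds:
  fixes x :: "(real,'n::{finite,linorder}) vec"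
  assumes s: "s > 0"
  defines "A \<equiv> sqrt (fact CARD('n)) * exp ((\<Sum>i\<in>UNIV. \<bar>x $ i\<bar>) * (real CARD('n) * s + 1))"
  shows "cmod (Kf (cvec x) (zeta s t)) \<le> sqrt (fact CARD('n)) * exp ((\<Sum>i\<in>UNIV. \<bar>x $ i\<bar>) * (real CARD('n) * s))"
    and "cmod (Kf (cvec x) (zeta s t)) \<le> A"
    and "cmod (\<i> * dpart j (Kf (cvec x)) (zeta s t)) \<le> A"
proof -
  define X where "X = (\<Sum>i\<in>UNIV. \<bar>x $ i\<bar>)"
  have X0: "X \<ge> 0" unfolding X_def by (simp add: sum_nonneg)
  have b: "cmod (Kf (cvec x) z) \<le> A" if "(\<Sum>i\<in>UNIV. \<bar>Re (z $ i)\<bar>) \<le> real CARD('n) * s + 1" for z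
  proof -
    have "cmod (Kf (cvec x) z) \<le> sqrt (fact CARD('n)) * exp (X * (\<Sum>i\<in>UNIV. \<bar>Re (z $ i)\<bar>))"
      unfolding X_def by (rule Kf_bound)
    also have "\<dots> \<le> A" unfolding A_def X_def[symmetric]
      using that X0 by (intro mult_left_mono) (auto intro: mult_left_mono)
    finally show ?thesis .
  qed
  have Re: "(\<Sum>i\<in>UNIV. \<bar>Re (zeta s t $ i)\<bar>) = real CARD('n) * s" unfolding zeta_Re using s by simp
  show "cmod (Kf (cvec x) (zeta s t)) \<le> sqrt (fact CARD('n)) * exp ((\<Sum>i\<in>UNIV. \<bar>x $ i\<bar>) * (real CARD('n) * s))"
    using Kf_bound[of x "zeta s t"] unfolding Re .
  show "cmod (Kf (cvec x) (zeta s t)) \<le> A" by (rule b) (use s in simp)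
  define z where "z = zeta s t"
  have hd: "(\<lambda>t. Kf (cvec x) (cu j t z)) holomorphic_on UNIV"
    using holo_n_partial[OF Kf_holo[of "cvec x"], of j z] holomorphic_on_open[of UNIV] by blast
  have "cmod ((deriv ^^ 1) (\<lambda>t. Kf (cvec x) (cu j t z)) (z $ j)) \<le> fact 1 * A / 1 ^ 1"
  proof (rule Cauchy_inequality)
    show "(\<lambda>t. Kf (cvec x) (cu j t z)) holomorphic_on ball (z $ j) 1" using hd holomorphic_on_subset by blast
    show "continuous_on (cball (z $ j) 1) (\<lambda>t. Kf (cvec x) (cu j t z))"
      using hd holomorphic_on_imp_continuous_on holomorphic_on_subset by blast
    fix u assume u: "cmod (z $ j - u) = 1"
    have "\<bar>Re u\<bar> \<le> s + 1"
    proof -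
      have "\<bar>Re (z $ j - u)\<bar> \<le> 1" using abs_Re_le_cmod[of "z $ j - u"] u by simp
      thus ?thesis using s by (auto simp: z_def)
    qed
    hence "(\<Sum>i\<in>UNIV. \<bar>Re (cu j u z $ i)\<bar>) \<le> (\<Sum>i\<in>UNIV. s + (if i = j then 1 else 0))"
      using s by (intro sum_mono) (auto simp: z_def)
    also have "\<dots> = real CARD('n) * s + 1" by (simp add: sum.distrib)
    finally show "cmod (Kf (cvec x) (cu j u z)) \<le> A" by (rule b)
  qed simp
  thus "cmod (\<i> * dpart j (Kf (cvec x)) (zeta s t)) \<le> A"
    unfolding dpart_def cu_def[symmetric] z_def by (simp add: norm_mult)
qed

text \<open>The inverse Laplace transform, up to a constant, of \<open>q(1/\<zeta>) \<Delta>(\<zeta>)\<^bsup>-\<nu>\<^esup>\<close>, at \<open>x\<close>.\<close>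
definition Phi :: "real \<Rightarrow> complex \<Rightarrow> ((complex,'n::{finite,linorder}) vec \<Rightarrow> complex) \<Rightarrow> (real,'n) vec \<Rightarrow> complex" where
  "Phi s \<nu> q x = (\<integral>t. Kf (cvec x) (zeta s t) * (q (cinvv (zeta s t)) * Delta_pow (zeta s t) (-\<nu>)) * of_real (om k t) \<partial>lborel)"

lemma om_zprod_bound:
  fixes s a :: real
  assumes s: "s > 0" and a: "a > 2 * k * (real CARD('n::{finite,linorder}) - 1) + 1"
  obtains C b where "C \<ge> 0" "b > 1" "\<And>t::(real,'n) vec. zprod s (-a) t * om k t \<le> C * zprod s (-b) t"
proof -
  define mu where "mu = 2 * k * (real CARD('n) - 1)"
  obtain C1 where C1: "C1 \<ge> 0" "\<And>t::(real,'n) vec. om k t \<le> C1 * zprod s mu t"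
    using om_bound[OF k s] unfolding mu_def by metis
  show ?thesis
  proof (rule that[of C1 "a - mu"])
    show "a - mu > 1" using a by (simp add: mu_def)
    fix t :: "(real,'n) vec"
    have "zprod s (-a) t * om k t \<le> zprod s (-a) t * (C1 * zprod s mu t)"
      by (intro mult_left_mono C1) auto
    also have "\<dots> = C1 * zprod s (- (a - mu)) t" using zprod_mult[of s "-a" t mu] by (simp add: algebra_simps)
    finally show "zprod s (-a) t * om k t \<le> C1 * zprod s (- (a - mu)) t" .
  qed (rule C1)
qed

lemma integrable_om_bound:
  fixes F :: "(real,'n::{finite,linorder}) vec \<Rightarrow> complex"
  assumes s: "s > 0" and a: "a > 2 * k * (real CARD('n) - 1) + 1"
    and F: "F \<in> borel_measurable borel" and bF: "\<And>t. cmod (F t) \<le> c * zprod s (-a) t" and c: "c \<ge> 0"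
  shows "integrable lborel (\<lambda>t. F t * of_real (om k t))"
proof -
  obtain C b where C: "C \<ge> 0" "b > 1" "\<And>t::(real,'n) vec. zprod s (-a) t * om k t \<le> C * zprod s (-b) t"
    using om_zprod_bound[OF s a] by metis
  show ?thesis
  proof (rule integrable_zprod_bound[OF s C(2), where C="c * C"])
    show "(\<lambda>t. F t * of_real (om k t)) \<in> borel_measurable borel" using F by measurable
    fix t
    have "cmod (F t * of_real (om k t)) = cmod (F t) * om k t" by (simp add: norm_mult)
    also have "\<dots> \<le> c * zprod s (-a) t * om k t" by (intro mult_right_mono bF) simp
    also have "\<dots> \<le> c * (C * zprod s (-b) t)" unfolding mult.assoc by (intro mult_left_mono C c)
    finally show "cmod (F t * of_real (om k t)) \<le> c * C * zprod s (-b) t" by simp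
  qed
qed

lemma integrable_om_zprod:
  assumes s: "s > 0" and a: "a > 2 * k * (real CARD('n::{finite,linorder}) - 1) + 1"
  shows "integrable lborel (\<lambda>t::(real,'n) vec. zprod s (-a) t * om k t)"
proof -
  have "integrable lborel (\<lambda>t::(real,'n) vec. complex_of_real (zprod s (-a) t) * of_real (om k t))"
    by (rule integrable_om_bound[OF s a, of _ 1]) auto
  hence "integrable lborel (\<lambda>t::(real,'n) vec. Re (complex_of_real (zprod s (-a) t) * of_real (om k t)))"
    by (rule integrable_Re)
  thus ?thesis by simp
qed

lemma measurable_Kf_zeta: "(\<lambda>t. Kf w (zeta s t)) \<in> borel_measurable borel"
  by (rule measurable_compose[OF measurable_zeta holo_n_measurable[OF Kf_holo]])

lemma Phi_integrand:
  fixes q :: "(complex,'n::{finite,linorder}) vec \<Rightarrow> complex"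
  assumes s: "s > 0" and nu: "Re \<nu> > 2 * k * (real CARD('n) - 1) + 1" and q: "holo_n q"
  shows "integrable lborel (\<lambda>t. Kf (cvec x) (zeta s t) * (q (cinvv (zeta s t)) * Delta_pow (zeta s t) (-\<nu>)) * of_real (om k t))"
proof -
  obtain B where B: "B \<ge> 0" "\<And>z. (\<And>i. cmod (z $ i) \<le> 1 / s) \<Longrightarrow> cmod (q z) \<le> B"
    using holo_n_bounded[OF q, of "1 / s"] by metis
  define A where "A = sqrt (fact CARD('n)) * exp ((\<Sum>i\<in>UNIV. \<bar>x $ i\<bar>) * (real CARD('n) * s + 1))"
  have A0: "A \<ge> 0" by (simp add: A_def)
  define E where "E = exp (pi * \<bar>Im \<nu>\<bar>) ^ CARD('n)"
  have [measurable]: "(\<lambda>t. Delta_pow (zeta s t) (-\<nu>)) \<in> borel_measurable borel" by (rule measurable_Delta_zeta[OF s])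
  have [measurable]: "(\<lambda>t. q (cinvv (zeta s t))) \<in> borel_measurable borel"
    by (rule measurable_compose[OF measurable_cinvv_zeta[OF s] holo_n_measurable[OF q]])
  have [measurable]: "(\<lambda>t. Kf (cvec x) (zeta s t)) \<in> borel_measurable borel" by (rule measurable_Kf_zeta)
  show ?thesis
  proof (rule integrable_om_bound[OF s nu, of _ "A * (B * E)"])
    fix t
    have "cmod (Kf (cvec x) (zeta s t) * (q (cinvv (zeta s t)) * Delta_pow (zeta s t) (-\<nu>)))
       \<le> A * (B * (E * zprod s (- Re \<nu>) t))"
      unfolding norm_mult E_def using Kf_zeta_bounds(2)[OF s, of x t] B A0 cinvv_zeta_le[OF s] Delta_zeta_bound[OF s, of t \<nu>]
      by (intro mult_mono) (auto simp: A_def simp del: cinvv_nth)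
    thus "cmod (Kf (cvec x) (zeta s t) * (q (cinvv (zeta s t)) * Delta_pow (zeta s t) (-\<nu>)))
       \<le> A * (B * E) * zprod s (- Re \<nu>) t" by (simp add: mult.assoc)
  qed (use A0 B in \<open>auto simp: E_def\<close>)
qed

section \<open>The transform \<open>Phi\<close>: linearity, equivariance and the raising
  relation\<close>

lemma Phi_sum:
  fixes q :: "'i \<Rightarrow> (complex,'n::{finite,linorder}) vec \<Rightarrow> complex"
  assumes s: "s > 0" and nu: "Re \<nu> > 2 * k * (real CARD('n) - 1) + 1" and q: "\<And>i. i \<in> I \<Longrightarrow> holo_n (q i)"
  shows "Phi s \<nu> (\<lambda>z. \<Sum>i\<in>I. c i * q i z) x = (\<Sum>i\<in>I. c i * Phi s \<nu> (q i) x)"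
proof -
  have "Phi s \<nu> (\<lambda>z. \<Sum>i\<in>I. c i * q i z) x = (\<integral>t. (\<Sum>i\<in>I. c i * (Kf (cvec x) (zeta s t) * (q i (cinvv (zeta s t)) * Delta_pow (zeta s t) (-\<nu>)) * of_real (om k t))) \<partial>lborel)"
    unfolding Phi_def by (rule Bochner_Integration.integral_cong[OF refl])
      (simp add: sum_distrib_left sum_distrib_right mult_ac)
  also have "\<dots> = (\<Sum>i\<in>I. (\<integral>t. c i * (Kf (cvec x) (zeta s t) * (q i (cinvv (zeta s t)) * Delta_pow (zeta s t) (-\<nu>)) * of_real (om k t)) \<partial>lborel))"
    by (rule Bochner_Integration.integral_sum) (intro integrable_mult_right Phi_integrand[OF s nu q])
  finally show ?thesis unfolding Phi_def by simp
qed

lemma Phi_lin2: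
  fixes p q :: "(complex,'n::{finite,linorder}) vec \<Rightarrow> complex"
  assumes s: "s > 0" and nu: "Re \<nu> > 2 * k * (real CARD('n) - 1) + 1" and "holo_n p" "holo_n q"
  shows "Phi s \<nu> (\<lambda>z. a * p z + b * q z) x = a * Phi s \<nu> p x + b * Phi s \<nu> q x"
  using Phi_sum[OF s nu, of "{True,False}" "\<lambda>i. if i then p else q" "\<lambda>i. if i then a else b"] assms by simp

text \<open>Substitute the permutation in the integration variable; kernel, \<Delta> and weight are
  invariant, so it is passed on to q.\<close>

lemma Phi_pv:
  fixes q :: "(complex,'n::{finite,linorder}) vec \<Rightarrow> complex"
  assumes s: "s > 0" and q: "holo_n q" and b: "bij \<sigma>"
  shows "Phi s \<nu> q (pv \<sigma> x) = Phi s \<nu> (\<lambda>z. q (pv \<sigma> z)) x"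
proof -
  define F where "F = (\<lambda>t. Kf (cvec (pv \<sigma> x)) (zeta s t) * (q (cinvv (zeta s t)) * Delta_pow (zeta s t) (-\<nu>)) * of_real (om k t))"
  have [measurable]: "(\<lambda>t. Delta_pow (zeta s t) (-\<nu>)) \<in> borel_measurable borel" by (rule measurable_Delta_zeta[OF s])
  have qm: "(\<lambda>t. q' (cinvv (zeta s t))) \<in> borel_measurable borel" if "holo_n q'" for q'
    by (rule measurable_compose[OF measurable_cinvv_zeta[OF s] holo_n_measurable[OF that]])
  note [measurable] = qm[OF q] qm[OF holo_n_pv[OF q]]
  have [measurable]: "(\<lambda>t. Kf w (zeta s t)) \<in> borel_measurable borel" for w by (rule measurable_Kf_zeta)
  have Fm [measurable]: "F \<in> borel_measurable borel" unfolding F_def by measurable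
  have "Phi s \<nu> q (pv \<sigma> x) = (\<integral>t. F (pv \<sigma> t) \<partial>lborel)"
    unfolding Phi_def F_def[symmetric] by (rule integral_pv[OF b Fm, symmetric])
  also have "\<dots> = Phi s \<nu> (\<lambda>z. q (pv \<sigma> z)) x"
    unfolding Phi_def
  proof (rule integral_cong_AE)
    show "AE t in lborel. F (pv \<sigma> t) = Kf (cvec x) (zeta s t) * (q (pv \<sigma> (cinvv (zeta s t))) * Delta_pow (zeta s t) (-\<nu>)) * of_real (om k t)"
      using om_pv[OF b, of k]
    proof eventually_elim
      case (elim t)
      show ?case unfolding F_def elim zeta_pv cvec_pv cinvv_pv Kf_pv[OF b] Delta_pow_pv[OF b] ..
    qed
  qed measurable
  finally show ?thesis .
qed

text \<open>Every other index lies below \<open>mx\<close>, so the reflections in \<open>Yop\<close>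
  run over all j \<noteq> mx. In this form the eigenvalue equation occurs in the computation of T_mx
  in the variable 1/\<zeta>.\<close>

lemma jackE_dunkl_mx:
  fixes z :: "(complex,'n::{finite,linorder}) vec"
  assumes "distinct_coords z"
  shows "z $ mx * dunklA k mx (jackE k \<eta>) z + of_real k * (\<Sum>j\<in>UNIV-{mx}. jackE k \<eta> (swapv mx j z))
    = of_real (ev k \<eta> mx + k * (real CARD('n) - 1)) * jackE k \<eta> z"
proof -
  have "{j. j < mx} = UNIV - {mx::'n}" using le_mx by (auto simp: order_less_le)
  thus ?thesis using jackE_Yop[OF assms, of mx \<eta>] unfolding Yop_def by simp
qed

text \<open>Integration by parts with f = E(x, \<zeta>) and g = q(1/\<zeta>)
  \<Delta>(\<zeta>)^(-\<nu>). In the variable y = 1/\<zeta>, T_mx g becomes -y_mx \<Delta>^(-\<nu>)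
  times an operator on q which is \<nu> plus the one diagonalised by q.\<close>

lemma Phi_raise:
  fixes x :: "(real,'n::{finite,linorder}) vec"
  assumes s: "s > 0" and nu: "Re \<nu> > 2 * k * (real CARD('n) - 1) + 1"
  shows "of_real (x $ mx) * Phi s \<nu> (jackE k \<eta>) x
     = (\<nu> + of_real (ev k \<eta> mx)) * Phi s \<nu> (\<lambda>z. z $ mx * jackE k \<eta> z) x"
proof -
  define q where "q = jackE k \<eta>"
  have q: "holo_n q" unfolding q_def by (rule jackE_holo)
  obtain B where B: "B \<ge> 0" "\<And>z. (\<And>i. cmod (z $ i) \<le> 1 / s) \<Longrightarrow> cmod (q z) \<le> B"
    "\<And>z i. (\<And>i. cmod (z $ i) \<le> 1 / s) \<Longrightarrow> cmod (dpart i q z) \<le> B"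
    using holo_n_bounded[OF q, of "1 / s"] by metis
  define A where "A = sqrt (fact CARD('n)) * exp ((\<Sum>i\<in>UNIV. \<bar>x $ i\<bar>) * (real CARD('n) * s + 1))"
  have A0: "A \<ge> 0" by (simp add: A_def)
  define E where "E = exp (pi * \<bar>Im \<nu>\<bar>) ^ CARD('n)"
  have E0: "E \<ge> 0" by (simp add: E_def)
  define D where "D = (\<lambda>t::(real,'n) vec. Delta_pow (zeta s t) (-\<nu>))"
  define y where "y = (\<lambda>t::(real,'n) vec. cinvv (zeta s t))"
  define f where "f = (\<lambda>t. Kf (cvec x) (zeta s t))"
  define f' where "f' = (\<lambda>j t. \<i> * dpart j (Kf (cvec x)) (zeta s t))"
  define g where "g = (\<lambda>t. q (y t) * D t)"
  define g' where "g' = (\<lambda>j t. q (y t) * (- \<nu> * \<i> / zeta s t $ j * D t) + - \<i> / (zeta s t $ j)\<^sup>2 * dpart j q (y t) * D t)"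
  define e where "e = \<nu> + of_real (ev k \<eta> mx)"
  define h where "h = (\<lambda>t. - \<i> * e * (y t $ mx * q (y t) * D t))"
  define C where "C = B * E * (1 + cmod \<nu> / s + (1 / s)\<^sup>2 + cmod e / s)"
  have Dm [measurable]: "D \<in> borel_measurable borel" unfolding D_def by (rule measurable_Delta_zeta[OF s])
  have ym: "(\<lambda>t. F (y t)) \<in> borel_measurable borel" if "F \<in> borel_measurable borel" for F :: "(complex,'n) vec \<Rightarrow> complex"
    unfolding y_def by (rule measurable_compose[OF measurable_cinvv_zeta[OF s] that])
  have zm: "(\<lambda>t. F (zeta s t)) \<in> borel_measurable borel" if "F \<in> borel_measurable borel" for F :: "(complex,'n) vec \<Rightarrow> complex"
    by (rule measurable_compose[OF measurable_zeta that])
  have nm: "(\<lambda>z::(complex,'n) vec. z $ i) \<in> borel_measurable borel" for i by (rule holo_n_measurable) auto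
  note [measurable] = ym[OF holo_n_measurable[OF q]] ym[OF dpart_measurable[OF q]] zm[OF nm] ym[OF nm]
  have zge: "cmod (zeta s t $ j) \<ge> s" for t j by (rule zeta_ge(1)[OF s])
  have yle: "cmod (y t $ j) \<le> 1 / s" for t j unfolding y_def by (rule cinvv_zeta_le[OF s])
  have yz: "y t $ j = 1 / zeta s t $ j" for t j by (simp add: y_def)
  have bD: "cmod (D t) \<le> E * zprod s (- Re \<nu>) t" for t unfolding D_def E_def by (rule Delta_zeta_bound[OF s])
  have bq: "cmod (q (y t)) \<le> B" "cmod (dpart j q (y t)) \<le> B" for t j using B yle by blast+
  have gen: "cmod (u * v * D t) \<le> c * B * E * zprod s (- Re \<nu>) t"
    if "cmod u \<le> c" "cmod v \<le> B" for u v c t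
  proof -
    have "c \<ge> 0" using that(1) norm_ge_zero order_trans by blast
    have "cmod (u * v * D t) \<le> c * B * (E * zprod s (- Re \<nu>) t)"
      unfolding norm_mult using that bD B(1) \<open>c \<ge> 0\<close> by (intro mult_mono) auto
    thus ?thesis by (simp add: mult.assoc)
  qed
  have ih: "\<i> * of_real (x $ mx) * (\<integral>t. f t * g t * of_real (om k t) \<partial>lborel) = - (\<integral>t. f t * h t * of_real (om k t) \<partial>lborel)"
  proof (rule dunkl_integration_by_parts[OF s nu A0, of C f f' g g' mx])
    show "C \<ge> 0" unfolding C_def using B E0 s by (intro mult_nonneg_nonneg add_nonneg_nonneg) auto
    show "f \<in> borel_measurable borel" unfolding f_def by (rule measurable_Kf_zeta)
    show "f' j \<in> borel_measurable borel" for j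
      unfolding f'_def by (intro borel_measurable_times borel_measurable_const zm dpart_measurable Kf_holo)
    show "g \<in> borel_measurable borel" unfolding g_def by measurable
    show "g' j \<in> borel_measurable borel" for j unfolding g'_def by measurable
    show "h \<in> borel_measurable borel" unfolding h_def by measurable
    show "((\<lambda>u. f (cu j u t)) has_vector_derivative f' j (cu j u t)) (at u)" for j t u
      unfolding f_def f'_def by (rule holo_zeta_partial[OF Kf_holo])
    show "((\<lambda>u. g (cu j u t)) has_vector_derivative g' j (cu j u t)) (at u)" for j t u
      unfolding g_def g'_def D_def y_def
      by (rule has_vector_derivative_mult[OF holo_cinvv_partial[OF s q] Delta_zeta_partial[OF s]])
    show "cmod (f t) \<le> A" for t unfolding f_def A_def by (rule Kf_zeta_bounds(2)[OF s])
    show "cmod (f' j t) \<le> A" for j t unfolding f'_def A_def by (rule Kf_zeta_bounds(3)[OF s])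
    have cs: "c * B * E * zprod s (- Re \<nu>) t \<le> C * zprod s (- Re \<nu>) t"
      if "c \<le> 1 + cmod \<nu> / s + (1 / s)\<^sup>2 + cmod e / s" for c and t :: "(real,'n) vec"
    proof -
      have "c * (B * E) \<le> C" unfolding C_def using that B E0 by (subst mult.commute) (intro mult_left_mono, auto)
      thus ?thesis by (intro mult_right_mono) (auto simp: mult.assoc)
    qed
    have nn: "0 \<le> cmod \<nu> / s" "0 \<le> cmod e / s" "0 \<le> (1 / s)\<^sup>2" using s by auto
    show "cmod (g t) \<le> C * zprod s (- Re \<nu>) t" for t
      using gen[of 1 1 "q (y t)" t] bq(1)[of t] cs[of 1 t] nn unfolding g_def by simp
    show "cmod (g' j t) \<le> C * zprod s (- Re \<nu>) t" for j t
    proof -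
      have n1: "cmod (- \<nu> * \<i> * y t $ j) \<le> cmod \<nu> / s"
        using yle[of t j] mult_left_mono[of "cmod (y t $ j)" "1 / s" "cmod \<nu>"] by (simp add: norm_mult)
      have n2: "cmod (- \<i> * (y t $ j)\<^sup>2) \<le> (1 / s)\<^sup>2"
        using power_mono[OF yle[of t j], of 2] by (simp add: norm_mult norm_power del: power_one_over)
      have "g' j t = (- \<nu> * \<i> * y t $ j) * q (y t) * D t + (- \<i> * (y t $ j)\<^sup>2) * dpart j q (y t) * D t"
        unfolding g'_def yz by (simp add: power2_eq_square)
      hence "cmod (g' j t) \<le> cmod ((- \<nu> * \<i> * y t $ j) * q (y t) * D t) + cmod ((- \<i> * (y t $ j)\<^sup>2) * dpart j q (y t) * D t)"
        using norm_triangle_ineq by metis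
      also have "\<dots> \<le> cmod \<nu> / s * B * E * zprod s (- Re \<nu>) t + (1 / s)\<^sup>2 * B * E * zprod s (- Re \<nu>) t"
        by (intro add_mono gen n1 n2 bq)
      also have "\<dots> = (cmod \<nu> / s + (1 / s)\<^sup>2) * B * E * zprod s (- Re \<nu>) t" by (simp only: distrib_right)
      also have "\<dots> \<le> C * zprod s (- Re \<nu>) t" using nn by (intro cs) auto
      finally show ?thesis .
    qed
    show "cmod (h t) \<le> C * zprod s (- Re \<nu>) t" for t
    proof -
      have n1: "cmod (- \<i> * e * y t $ mx) \<le> cmod e / s"
        using yle[of t mx] mult_left_mono[of "cmod (y t $ mx)" "1 / s" "cmod e"] by (simp add: norm_mult)
      have "h t = (- \<i> * e * y t $ mx) * q (y t) * D t" unfolding h_def by (simp add: mult.assoc)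
      hence "cmod (h t) \<le> cmod e / s * B * E * zprod s (- Re \<nu>) t" using gen[OF n1 bq(1)[of t], of t] by metis
      also have "\<dots> \<le> C * zprod s (- Re \<nu>) t" using nn by (intro cs) auto
      finally show ?thesis .
    qed
    fix t :: "(real,'n) vec" assume t: "\<forall>i j. i \<noteq> j \<longrightarrow> t $ i \<noteq> t $ j"
    have zd: "distinct_coords (zeta s t)" using t unfolding distinct_coords_def by auto
    \<comment> \<open>Differences of \<zeta> are i times differences of t, which matches the factor
      i of d/dt: the Dunkl operator in t is i times the one in \<zeta>.\<close>
    have zdiff: "zeta s t $ mx - zeta s t $ j = \<i> * of_real (t $ mx - t $ j)" for j by (simp add: algebra_simps)
    have idiv: "a / of_real (t $ mx - t $ j) = \<i> * (a / (zeta s t $ mx - zeta s t $ j))" for a j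
      unfolding zdiff by (simp add: divide_simps)
    have "f' mx t + of_real k * (\<Sum>j\<in>UNIV-{mx}. (f t - f (swapv mx j t)) / of_real (t $ mx - t $ j))
       = \<i> * dunklA k mx (Kf (cvec x)) (zeta s t)"
      unfolding f_def f'_def dunklA_def zeta_swapv idiv sum_distrib_left[symmetric] by (simp add: distrib_left)
    also have "\<dots> = \<i> * of_real (x $ mx) * f t" unfolding Kf_T[OF zd] f_def by simp
    finally show "f' mx t + of_real k * (\<Sum>j\<in>UNIV-{mx}. (f t - f (swapv mx j t)) / of_real (t $ mx - t $ j))
       = \<i> * of_real (x $ mx) * f t" .
    have znz: "zeta s t $ j \<noteq> 0" for j by (rule zeta_nz[OF s])
    define Y where "Y = y t"
    have Yd: "distinct_coords Y" unfolding Y_def distinct_coords_def yz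
      using zd znz unfolding distinct_coords_def by (metis divide_cancel_left one_neq_zero)
    have Dsw: "D (swapv i j t) = D t" for i j
      unfolding D_def zeta_swapv unfolding swapv_pv by (rule Delta_pow_pv) simp
    have ysw: "y (swapv i j t) = swapv i j Y" for i j
      unfolding y_def Y_def zeta_swapv unfolding swapv_pv cinvv_pv ..
    have quot: "(g t - g (swapv mx j t)) / of_real (t $ mx - t $ j)
        = - \<i> * D t * Y $ mx * (Y $ mx * ((q Y - q (swapv mx j Y)) / (Y $ mx - Y $ j)) - (q Y - q (swapv mx j Y)))"
      if j: "j \<in> UNIV - {mx}" for j
    proof -
      have Yne: "Y $ mx - Y $ j \<noteq> 0" "Y $ mx \<noteq> 0" "Y $ j \<noteq> 0"
        using Yd j znz unfolding distinct_coords_def Y_def yz by auto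
      have zinv: "zeta s t $ i = 1 / Y $ i" for i unfolding Y_def yz by simp
      have "zeta s t $ mx - zeta s t $ j = - (Y $ mx - Y $ j) / (Y $ mx * Y $ j)"
        unfolding zinv using Yne by (simp add: field_simps)
      hence "(g t - g (swapv mx j t)) / of_real (t $ mx - t $ j)
         = \<i> * ((q Y - q (swapv mx j Y)) * D t / (- (Y $ mx - Y $ j) / (Y $ mx * Y $ j)))"
        unfolding idiv g_def Dsw ysw Y_def[symmetric] by (simp add: left_diff_distrib)
      also have "\<dots> = - \<i> * D t * ((q Y - q (swapv mx j Y)) * (Y $ mx * Y $ j) / (Y $ mx - Y $ j))"
      proof -
        have alg: "\<i> * (a * d / (- w / p)) = - \<i> * d * (a * p / w)" if "p \<noteq> 0" "w \<noteq> 0" for a d p w :: complex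
          using that by (simp add: field_simps)
        show ?thesis by (rule alg) (use Yne in auto)
      qed
      \<comment> \<open>Y_mx Y_j = Y_mx^2 - Y_mx (Y_mx - Y_j): the first term gives the Dunkl
        quotient in Y, the second a plain difference without denominator.\<close>
      also have "(q Y - q (swapv mx j Y)) * (Y $ mx * Y $ j) / (Y $ mx - Y $ j)
         = Y $ mx * (Y $ mx * ((q Y - q (swapv mx j Y)) / (Y $ mx - Y $ j)) - (q Y - q (swapv mx j Y)))"
        using Yne(1) by (simp add: divide_simps) (simp add: algebra_simps)
      finally show ?thesis by (simp add: mult.assoc)
    qed
    define S where "S = (\<Sum>j\<in>UNIV-{mx}. (q Y - q (swapv mx j Y)) / (Y $ mx - Y $ j))"
    define S1 where "S1 = (\<Sum>j\<in>UNIV-{mx}. q (swapv mx j Y))"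
    have card1: "(\<Sum>j\<in>UNIV-{mx::'n}. (1::complex)) = of_real (real CARD('n) - 1)"
      by (simp add: card_Diff_singleton of_nat_diff Suc_leI)
    have "(\<Sum>j\<in>UNIV-{mx}. (g t - g (swapv mx j t)) / of_real (t $ mx - t $ j))
        = (\<Sum>j\<in>UNIV-{mx}. - \<i> * D t * Y $ mx * (Y $ mx * ((q Y - q (swapv mx j Y)) / (Y $ mx - Y $ j)) - (q Y * 1 - q (swapv mx j Y))))"
      using quot by (intro sum.cong) auto
    also have "\<dots> = - \<i> * D t * Y $ mx * (Y $ mx * S - (q Y * of_real (real CARD('n) - 1) - S1))"
      unfolding S_def S1_def card1[symmetric] by (simp only: sum_distrib_left[symmetric] sum_subtractf)
    finally have sg: "(\<Sum>j\<in>UNIV-{mx}. (g t - g (swapv mx j t)) / of_real (t $ mx - t $ j))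
        = - \<i> * D t * Y $ mx * (Y $ mx * S - (q Y * of_real (real CARD('n) - 1) - S1))" .
    have jack: "Y $ mx * (dpart mx q Y + of_real k * S) + of_real k * S1
        = of_real (ev k \<eta> mx + k * (real CARD('n) - 1)) * q Y"
      using jackE_dunkl_mx[OF Yd, of \<eta>] unfolding dunklA_def q_def[symmetric] S_def S1_def .
    have g'mx: "g' mx t = - \<i> * D t * Y $ mx * (\<nu> * q Y + Y $ mx * dpart mx q Y)"
      unfolding g'_def Y_def[symmetric] using yz[of t mx] unfolding Y_def[symmetric] by (simp add: power2_eq_square algebra_simps)
    \<comment> \<open>The n - 1 plain copies of q Y cancel the constant k(n - 1) in the eigenvalue,
      so that exactly \<nu> + \<open>ev k \<eta> mx\<close> is left.\<close>
    have "g' mx t + of_real k * (\<Sum>j\<in>UNIV-{mx}. (g t - g (swapv mx j t)) / of_real (t $ mx - t $ j))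
       = - \<i> * D t * Y $ mx * (\<nu> * q Y + (Y $ mx * (dpart mx q Y + of_real k * S) + of_real k * S1)
            - of_real (k * (real CARD('n) - 1)) * q Y)"
      unfolding sg g'mx by (simp add: algebra_simps)
    also have "\<dots> = h t" unfolding jack h_def e_def Y_def[symmetric] by (simp add: algebra_simps)
    finally show "g' mx t + of_real k * (\<Sum>j\<in>UNIV-{mx}. (g t - g (swapv mx j t)) / of_real (t $ mx - t $ j)) = h t" .
  qed
  have 1: "(\<integral>t. f t * g t * of_real (om k t) \<partial>lborel) = Phi s \<nu> (jackE k \<eta>) x"
    unfolding Phi_def f_def g_def y_def D_def q_def ..
  have "(\<integral>t. f t * h t * of_real (om k t) \<partial>lborel)
     = (\<integral>t. (- \<i> * e) * (Kf (cvec x) (zeta s t) * ((y t $ mx * q (y t)) * D t) * of_real (om k t)) \<partial>lborel)"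
    unfolding f_def h_def by (intro Bochner_Integration.integral_cong refl) (simp only: mult_ac)
  also have "\<dots> = - \<i> * e * Phi s \<nu> (\<lambda>z. z $ mx * jackE k \<eta> z) x"
    unfolding Phi_def y_def q_def D_def by (rule integral_mult_right_zero)
  finally have "\<i> * (of_real (x $ mx) * Phi s \<nu> (jackE k \<eta>) x) = \<i> * (e * Phi s \<nu> (\<lambda>z. z $ mx * jackE k \<eta> z) x)"
    using ih unfolding 1 by (simp add: mult.assoc)
  thus ?thesis unfolding e_def by simp
qed

section \<open>Gamma products and the transform of a Jack polynomial\<close>

lemma ev_lower:
  fixes \<eta> :: "'n::{finite,linorder} \<Rightarrow> nat"
  shows "ev k \<eta> i \<ge> - k * (real CARD('n) - 1)"
proof -
  have "i \<notin> {j. prec \<eta> j i}" by simp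
  hence "card {j. prec \<eta> j i} < card (UNIV :: 'n set)" by (intro psubset_card_mono finite_class.finite_UNIV) blast
  hence "real (card {j. prec \<eta> j i}) \<le> real CARD('n) - 1" by linarith
  hence "k * real (card {j. prec \<eta> j i}) \<le> k * (real CARD('n) - 1)" using k by (rule mult_left_mono)
  thus ?thesis unfolding ev_def by simp
qed

lemma nu_ev_pos:
  fixes \<eta> :: "'n::{finite,linorder} \<Rightarrow> nat"
  assumes nu: "Re \<nu> > 2 * k * (real CARD('n) - 1) + 1"
  shows "Re (\<nu> + of_real (ev k \<eta> i)) > 0"
proof -
  have "0 \<le> k * (real CARD('n) - 1)" using k by (intro mult_nonneg_nonneg) auto
  thus ?thesis using nu ev_lower[of \<eta> i] by simp
qed

text \<open>The entries of \<open>ev k \<eta>\<close> are the numbers \<lambda>_j - k(j - 1),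
  \<lambda> = \<eta>_+, in another order. Hence \<open>Rg \<nu> \<eta>\<close> divided by its value
  at \<eta> = 0 is [\<nu>]_\<lambda>, without any sorting.\<close>

definition Rg :: "complex \<Rightarrow> ('n::{finite,linorder} \<Rightarrow> nat) \<Rightarrow> complex" where
  "Rg \<nu> \<eta> = (\<Prod>i\<in>UNIV. Gamma (\<nu> + of_real (ev k \<eta> i)))"

lemma Gamma_Re_pos_nz: "Re z > 0 \<Longrightarrow> Gamma z \<noteq> 0" for z :: complex
  by (auto simp: Gamma_eq_zero_iff elim!: nonpos_Ints_cases)

lemma Rg_nz:
  fixes \<eta> :: "'n::{finite,linorder} \<Rightarrow> nat"
  assumes nu: "Re \<nu> > 2 * k * (real CARD('n) - 1) + 1"
  shows "Rg \<nu> \<eta> \<noteq> 0"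
  unfolding Rg_def using Gamma_Re_pos_nz[OF nu_ev_pos[OF nu]] by simp

text \<open>For \<open>up\<close>, equivariance under \<open>cyc\<close> moves the raised factor to
  the last coordinate, where \<open>Phi_raise\<close> applies; its factor c = \<nu> + e_mx is
  absorbed by \<Gamma>(c + 1) = c \<Gamma>(c). For \<open>swap\<close>, the new polynomial is a
  combination of the old one and its reflection, \<Phi> is equivariant, and \<open>Rg\<close> is
  unchanged because \<open>ev\<close> is merely permuted.\<close>

lemma Phi_jackE:
  fixes x :: "(real,'n::{finite,linorder}) vec"
  assumes s: "s > 0" and nu: "Re \<nu> > 2 * k * (real CARD('n) - 1) + 1"
  shows "Rg \<nu> \<eta> * Phi s \<nu> (jackE k \<eta>) x = Rg \<nu> (\<lambda>_::'n. 0) * jackE k \<eta> (cvec x) * Phi s \<nu> (\<lambda>_. 1) x"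
proof (induction \<eta> arbitrary: x rule: composition_induct)
  case zero
  have "jackE k (\<lambda>_::'n. 0) = (\<lambda>_. 1)" by (simp add: fun_eq_iff jackE_0)
  thus ?case by simp
next
  case (up \<xi>)
  define c where "c = \<nu> + of_real (ev k \<xi> mx)"
  have "Re c > 0" unfolding c_def by (rule nu_ev_pos[OF nu])
  hence cnz: "c \<noteq> 0" by auto
  have R: "Rg \<nu> (up \<xi>) = c * Rg \<nu> \<xi>"
  proof -
    have "Rg \<nu> (up \<xi>) = (\<Prod>l\<in>UNIV. Gamma (\<nu> + of_real (ev k (up \<xi>) (cyc l))))"
      unfolding Rg_def by (rule prod.reindex_bij_betw[OF bij_cyc, symmetric])
    also have "\<dots> = Gamma (c + 1) * (\<Prod>l\<in>UNIV-{mx}. Gamma (\<nu> + of_real (ev k \<xi> l)))"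
      unfolding ev_up by (subst prod.remove[of _ mx]) (auto simp: c_def add.assoc)
    also have "Gamma (c + 1) = c * Gamma c"
      by (rule Gamma_plus1) (use \<open>Re c > 0\<close> in \<open>auto elim!: nonpos_Ints_cases\<close>)
    finally show ?thesis unfolding Rg_def by (subst (2) prod.remove[of _ mx]) (auto simp: c_def)
  qed
  define x' where "x' = pv cyc x"
  have "jackE k (up \<xi>) = (\<lambda>z. (\<lambda>z. z $ mx * jackE k \<xi> z) (pv cyc z))"
    by (simp add: fun_eq_iff jackE_up)
  hence "Phi s \<nu> (jackE k (up \<xi>)) x = Phi s \<nu> (\<lambda>z. z $ mx * jackE k \<xi> z) x'"
    unfolding x'_def using Phi_pv[OF s holo_n_mult[OF holo_n_nth jackE_holo] bij_cyc, of \<nu> mx \<xi> x] by simp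
  hence "c * Phi s \<nu> (jackE k (up \<xi>)) x = of_real (x' $ mx) * Phi s \<nu> (jackE k \<xi>) x'"
    unfolding c_def Phi_raise[OF s nu] by simp
  hence "Rg \<nu> (up \<xi>) * Phi s \<nu> (jackE k (up \<xi>)) x = of_real (x' $ mx) * (Rg \<nu> \<xi> * Phi s \<nu> (jackE k \<xi>) x')"
    unfolding R by (simp add: mult_ac)
  also have "\<dots> = of_real (x' $ mx) * (Rg \<nu> (\<lambda>_::'n. 0) * jackE k \<xi> (cvec x') * Phi s \<nu> (\<lambda>_. 1) x')"
    unfolding up ..
  also have "Phi s \<nu> (\<lambda>_. 1) x' = Phi s \<nu> (\<lambda>_. 1) x"
    unfolding x'_def by (rule Phi_pv[OF s holo_n_const bij_cyc])
  finally show ?case unfolding jackE_up x'_def cvec_pv by (simp add: mult_ac)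
next
  case (swap a b \<xi>)
  have ab: "a < b" "\<xi> a \<noteq> \<xi> b" using swap by (auto simp: adj_def)
  define \<gamma> where "\<gamma> = gam a b \<xi>"
  have nz: "1 + \<gamma> \<noteq> 0" unfolding \<gamma>_def using ab by (rule gam_nz)
  have J: "(1 + \<gamma>) * jackE k (\<xi> \<circ> tr a b) z = 1 * jackE k \<xi> (swapv a b z) + \<gamma> * jackE k \<xi> z" for z
    using jackE_swap[OF swap(1), of \<xi> z] unfolding \<gamma>_def by (simp add: algebra_simps)
  have R: "Rg \<nu> (\<xi> \<circ> tr a b) = Rg \<nu> \<xi>"
    unfolding Rg_def ev_tr[of a b \<xi>, OF swap(1) ab(2)] by (rule prod.reindex_bij_betw) simp
  have hs: "holo_n (\<lambda>z. jackE k \<xi> (swapv a b z))" unfolding swapv_pv by (intro holo_n_pv jackE_holo)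
  have "(1 + \<gamma>) * Phi s \<nu> (jackE k (\<xi> \<circ> tr a b)) x = Phi s \<nu> (\<lambda>z. (1 + \<gamma>) * jackE k (\<xi> \<circ> tr a b) z + 0 * 1) x"
    by (subst Phi_lin2[OF s nu jackE_holo holo_n_const]) simp
  also have "\<dots> = Phi s \<nu> (\<lambda>z. 1 * jackE k \<xi> (swapv a b z) + \<gamma> * jackE k \<xi> z) x" unfolding J by simp
  also have "\<dots> = Phi s \<nu> (\<lambda>z. jackE k \<xi> (swapv a b z)) x + \<gamma> * Phi s \<nu> (jackE k \<xi>) x"
    by (subst Phi_lin2[OF s nu hs jackE_holo]) simp
  also have "Phi s \<nu> (\<lambda>z. jackE k \<xi> (swapv a b z)) x = Phi s \<nu> (jackE k \<xi>) (swapv a b x)"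
    unfolding swapv_pv by (rule Phi_pv[OF s jackE_holo, symmetric]) simp
  finally have X: "(1 + \<gamma>) * Phi s \<nu> (jackE k (\<xi> \<circ> tr a b)) x
     = Phi s \<nu> (jackE k \<xi>) (swapv a b x) + \<gamma> * Phi s \<nu> (jackE k \<xi>) x" .
  have "(1 + \<gamma>) * (Rg \<nu> (\<xi> \<circ> tr a b) * Phi s \<nu> (jackE k (\<xi> \<circ> tr a b)) x)
     = Rg \<nu> \<xi> * ((1 + \<gamma>) * Phi s \<nu> (jackE k (\<xi> \<circ> tr a b)) x)"
    unfolding R by (rule mult.left_commute)
  hence "(1 + \<gamma>) * (Rg \<nu> (\<xi> \<circ> tr a b) * Phi s \<nu> (jackE k (\<xi> \<circ> tr a b)) x)
     = Rg \<nu> \<xi> * Phi s \<nu> (jackE k \<xi>) (swapv a b x) + \<gamma> * (Rg \<nu> \<xi> * Phi s \<nu> (jackE k \<xi>) x)"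
    unfolding X by (simp only: distrib_left mult.left_commute)
  also have "\<dots> = Rg \<nu> (\<lambda>_::'n. 0) * jackE k \<xi> (cvec (swapv a b x)) * Phi s \<nu> (\<lambda>_. 1) (swapv a b x)
      + \<gamma> * (Rg \<nu> (\<lambda>_::'n. 0) * jackE k \<xi> (cvec x) * Phi s \<nu> (\<lambda>_. 1) x)"
    unfolding swap.IH ..
  also have "Phi s \<nu> (\<lambda>_. 1) (swapv a b x) = Phi s \<nu> (\<lambda>_. 1) x"
    unfolding swapv_pv by (rule Phi_pv[OF s holo_n_const]) simp
  also have "cvec (swapv a b x) = swapv a b (cvec x)" unfolding swapv_pv cvec_pv ..
  also have "Rg \<nu> (\<lambda>_::'n. 0) * jackE k \<xi> (swapv a b (cvec x)) * Phi s \<nu> (\<lambda>_. 1) x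
      + \<gamma> * (Rg \<nu> (\<lambda>_::'n. 0) * jackE k \<xi> (cvec x) * Phi s \<nu> (\<lambda>_. 1) x)
     = Rg \<nu> (\<lambda>_::'n. 0) * Phi s \<nu> (\<lambda>_. 1) x * (1 * jackE k \<xi> (swapv a b (cvec x)) + \<gamma> * jackE k \<xi> (cvec x))"
    by (simp add: algebra_simps)
  also have "\<dots> = (1 + \<gamma>) * (Rg \<nu> (\<lambda>_::'n. 0) * jackE k (\<xi> \<circ> tr a b) (cvec x) * Phi s \<nu> (\<lambda>_. 1) x)"
    unfolding J[symmetric] by (simp add: mult_ac)
  finally show ?case using nz by (simp only: mult_cancel_left simp_thms)
qed

end

subsection \<open>The inverse Laplace integral of the constant function\<close>

lemma cvec_cu: "cvec (cu i u x) = cu i (complex_of_real u) (cvec x)"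
  by (simp add: vec_eq_iff)

lemma cvec_swapv: "cvec (swapv i j x) = swapv i j (cvec x)"
  unfolding swapv_pv by (rule cvec_pv)

lemma tendsto_cvec: "X \<longlonglongrightarrow> x \<Longrightarrow> (\<lambda>m. cvec (X m :: (real,'n::finite) vec)) \<longlonglongrightarrow> cvec x"
  unfolding cvec_def by (intro vec_tendstoI) (auto intro!: tendsto_intros)

lemma powr_real_partial:
  assumes "u > 0"
  shows "((\<lambda>u. complex_of_real u powr c) has_vector_derivative c * complex_of_real u powr c / of_real u) (at u)"
proof -
  have n: "complex_of_real u \<notin> \<real>\<^sub>\<le>\<^sub>0" "complex_of_real u \<noteq> 0" using assms by auto
  have "((\<lambda>z. z powr c) has_field_derivative c * of_real u powr (c - 1)) (at (complex_of_real u))"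
    by (rule has_field_derivative_powr[OF n(1)])
  hence d: "((\<lambda>z. z powr c) has_field_derivative c * of_real u powr c / of_real u) (at (complex_of_real u))"
    using n(2) by (simp add: powr_diff)
  have "((\<lambda>u. complex_of_real u) has_vector_derivative of_real 1) (at u)"
    by (rule has_vector_derivative_of_real) (rule DERIV_ident)
  from field_vector_diff_chain_at[OF this d] show ?thesis by (simp add: o_def)
qed

context dunkl_mult
begin

text \<open>Continuity in x, used to reach points with coinciding coordinates, where the derivative
  formula below is not stated.\<close>

lemma Phi_tendsto:
  fixes X :: "nat \<Rightarrow> (real,'n::{finite,linorder}) vec"
  assumes s: "s > 0" and nu: "Re \<nu> > 2 * k * (real CARD('n) - 1) + 1" and q: "holo_n q" and X: "X \<longlonglongrightarrow> x"
  shows "(\<lambda>m. Phi s \<nu> q (X m)) \<longlonglongrightarrow> Phi s \<nu> q x"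
proof -
  obtain B where B: "B \<ge> 0" "\<And>z. (\<And>i. cmod (z $ i) \<le> 1 / s) \<Longrightarrow> cmod (q z) \<le> B"
    using holo_n_bounded[OF q, of "1 / s"] by metis
  have "(\<lambda>m. \<Sum>i\<in>UNIV. \<bar>X m $ i\<bar>) \<longlonglongrightarrow> (\<Sum>i\<in>UNIV. \<bar>x $ i\<bar>)"
    by (intro tendsto_intros X)
  hence "convergent (\<lambda>m. \<Sum>i\<in>UNIV. \<bar>X m $ i\<bar>)" by (rule convergentI)
  then obtain N where N: "\<And>m. (\<Sum>i\<in>UNIV. \<bar>X m $ i\<bar>) \<le> N"
    using convergent_imp_Bseq BseqE by (metis abs_le_D1 real_norm_def)
  have bq: "cmod (q (cinvv (zeta s t))) \<le> B" for t by (rule B(2)) (rule cinvv_zeta_le[OF s])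
  define A where "A = sqrt (fact CARD('n)) * exp (N * (real CARD('n) * s))"
  have A: "cmod (Kf (cvec (X m)) (zeta s t)) \<le> A" for m t
  proof -
    have "cmod (Kf (cvec (X m)) (zeta s t)) \<le> sqrt (fact CARD('n)) * exp ((\<Sum>i\<in>UNIV. \<bar>X m $ i\<bar>) * (real CARD('n) * s))"
      by (rule Kf_zeta_bounds(1)[OF s])
    also have "\<dots> \<le> A" unfolding A_def using N[of m] s by (intro mult_left_mono) (auto intro!: mult_right_mono)
    finally show ?thesis .
  qed
  have A0: "A \<ge> 0" by (simp add: A_def)
  define E where "E = exp (pi * \<bar>Im \<nu>\<bar>) ^ CARD('n)"
  have E0: "E \<ge> 0" by (simp add: E_def)
  show ?thesis unfolding Phi_def
  proof (rule integral_dominated_convergence[where w="\<lambda>t. A * B * E * (zprod s (- Re \<nu>) t * om k t)"])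
    show "(\<lambda>t. Kf (cvec x) (zeta s t) * (q (cinvv (zeta s t)) * Delta_pow (zeta s t) (-\<nu>)) * of_real (om k t)) \<in> borel_measurable lborel"
      by (rule borel_measurable_integrable[OF Phi_integrand[OF s nu q]])
    show "(\<lambda>t. Kf (cvec (X m)) (zeta s t) * (q (cinvv (zeta s t)) * Delta_pow (zeta s t) (-\<nu>)) * of_real (om k t)) \<in> borel_measurable lborel" for m
      by (rule borel_measurable_integrable[OF Phi_integrand[OF s nu q]])
    show "integrable lborel (\<lambda>t::(real,'n) vec. A * B * E * (zprod s (- Re \<nu>) t * om k t))"
      by (intro integrable_mult_right integrable_om_zprod s nu)
    show "AE t in lborel. (\<lambda>m. Kf (cvec (X m)) (zeta s t) * (q (cinvv (zeta s t)) * Delta_pow (zeta s t) (-\<nu>)) * of_real (om k t))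
       \<longlonglongrightarrow> Kf (cvec x) (zeta s t) * (q (cinvv (zeta s t)) * Delta_pow (zeta s t) (-\<nu>)) * of_real (om k t)"
    proof (rule AE_I2)
      fix t :: "(real,'n) vec"
      have "(\<lambda>m. Kf (zeta s t) (cvec (X m))) \<longlonglongrightarrow> Kf (zeta s t) (cvec x)"
        by (rule continuous_on_tendsto_compose[OF holo_n_continuous[OF Kf_holo, of UNIV] tendsto_cvec[OF X]]) auto
      thus "(\<lambda>m. Kf (cvec (X m)) (zeta s t) * (q (cinvv (zeta s t)) * Delta_pow (zeta s t) (-\<nu>)) * of_real (om k t))
       \<longlonglongrightarrow> Kf (cvec x) (zeta s t) * (q (cinvv (zeta s t)) * Delta_pow (zeta s t) (-\<nu>)) * of_real (om k t)"
        unfolding Kf_sym[of _ "zeta s t"] by (intro tendsto_intros)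
    qed
    show "AE t in lborel. cmod (Kf (cvec (X m)) (zeta s t) * (q (cinvv (zeta s t)) * Delta_pow (zeta s t) (-\<nu>)) * of_real (om k t))
        \<le> A * B * E * (zprod s (- Re \<nu>) t * om k t)" for m
    proof (rule AE_I2)
      fix t :: "(real,'n) vec"
      have "cmod (Kf (cvec (X m)) (zeta s t) * (q (cinvv (zeta s t)) * Delta_pow (zeta s t) (-\<nu>))) \<le> A * (B * (E * zprod s (- Re \<nu>) t))"
        unfolding norm_mult E_def by (intro mult_mono A bq Delta_zeta_bound s A0 B(1) mult_nonneg_nonneg norm_ge_zero)
      hence "cmod (Kf (cvec (X m)) (zeta s t) * (q (cinvv (zeta s t)) * Delta_pow (zeta s t) (-\<nu>))) * om k t
         \<le> A * (B * (E * zprod s (- Re \<nu>) t)) * om k t" by (rule mult_right_mono) simp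
      thus "cmod (Kf (cvec (X m)) (zeta s t) * (q (cinvv (zeta s t)) * Delta_pow (zeta s t) (-\<nu>)) * of_real (om k t))
        \<le> A * B * E * (zprod s (- Re \<nu>) t * om k t)" by (simp add: norm_mult mult.assoc)
    qed
  qed
qed

lemma Phi_mx_1:
  fixes x :: "(real,'n::{finite,linorder}) vec"
  assumes s: "s > 0" and nu: "Re \<nu> > 2 * k * (real CARD('n) - 1) + 1"
  shows "Phi s \<nu> (\<lambda>z. z $ mx) x = of_real (x $ mx) * Phi s \<nu> (\<lambda>_. 1) x / \<nu>"
proof -
  have J: "jackE k (\<lambda>_::'n. 0) = (\<lambda>_. 1)" by (simp add: fun_eq_iff jackE_0)
  have e: "ev k (\<lambda>_::'n. 0) mx = 0" unfolding ev_def prec_def by simp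
  have "0 \<le> k * (real CARD('n) - 1)" using k by (intro mult_nonneg_nonneg) auto
  hence "Re \<nu> > 0" using nu by simp
  hence "\<nu> \<noteq> 0" by auto
  thus ?thesis using Phi_raise[OF s nu, of x "\<lambda>_. 0"] unfolding J e by (simp add: field_simps)
qed

lemma Phi_sym: "s > 0 \<Longrightarrow> Phi s \<nu> (\<lambda>_. 1) (swapv i j x) = Phi s \<nu> (\<lambda>_. 1) x"
  unfolding swapv_pv by (rule Phi_pv[OF _ holo_n_const]) simp_all

text \<open>As a function of x the kernel satisfies T_mx E = \<zeta>_mx E, and this factor cancels
  q(1/\<zeta>) = 1/\<zeta>_mx. The reflection part of T_mx has been moved to the right-hand
  side.\<close>

lemma Phi_mx_deriv:
  fixes x :: "(real,'n::{finite,linorder}) vec"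
  assumes s: "s > 0" and nu: "Re \<nu> > 2 * k * (real CARD('n) - 1) + 1"
    and x: "\<forall>i j. i \<noteq> j \<longrightarrow> x $ i \<noteq> x $ j"
  shows "((\<lambda>u. Phi s \<nu> (\<lambda>z. z $ mx) (cu mx u x)) has_vector_derivative
     (Phi s \<nu> (\<lambda>_. 1) x - of_real k * (\<Sum>j\<in>UNIV-{mx}. (Phi s \<nu> (\<lambda>z. z $ mx) x - Phi s \<nu> (\<lambda>z. z $ mx) (swapv mx j x)) / of_real (x $ mx - x $ j))))
     (at (x $ mx))"
proof -
  define u0 where "u0 = x $ mx"
  have "finite ((\<lambda>j. \<bar>u0 - x $ j\<bar>) ` (UNIV - {mx}))" by simp
  \<comment> \<open>At most half the distance to the nearest other coordinate: for |u - u0| < e the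
    point keeps the distance e from the hyperplanes, so the reflection quotients stay below
    2A/e.\<close>
  obtain e where e: "e > 0" "e \<le> 1" "\<And>j. j \<noteq> mx \<Longrightarrow> 2 * e \<le> \<bar>u0 - x $ j\<bar>"
  proof -
    define M where "M = Min (insert 2 ((\<lambda>j. \<bar>u0 - x $ j\<bar>) ` (UNIV - {mx})))"
    have "M > 0" unfolding M_def using x by (subst Min_gr_iff) (auto simp: u0_def)
    moreover have "M \<le> 2" "\<And>j. j \<noteq> mx \<Longrightarrow> M \<le> \<bar>u0 - x $ j\<bar>" unfolding M_def by (auto intro!: Min_le)
    ultimately show ?thesis using that[of "M / 2"] by auto
  qed
  define X where "X = (\<Sum>i\<in>UNIV. \<bar>x $ i\<bar>) + 1"
  define A where "A = sqrt (fact CARD('n)) * exp (X * (real CARD('n) * s))"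
  have A0: "A \<ge> 0" by (simp add: A_def)
  have A: "cmod (Kf (cvec y) (zeta s t)) \<le> A" if "(\<Sum>i\<in>UNIV. \<bar>y $ i\<bar>) \<le> X" for y :: "(real,'n) vec" and t
  proof -
    have "cmod (Kf (cvec y) (zeta s t)) \<le> sqrt (fact CARD('n)) * exp ((\<Sum>i\<in>UNIV. \<bar>y $ i\<bar>) * (real CARD('n) * s))"
      by (rule Kf_zeta_bounds(1)[OF s])
    also have "\<dots> \<le> A" unfolding A_def using that s by (intro mult_left_mono) (auto intro!: mult_right_mono)
    finally show ?thesis .
  qed
  define E where "E = exp (pi * \<bar>Im \<nu>\<bar>) ^ CARD('n)"
  have E0: "E \<ge> 0" by (simp add: E_def)
  define D where "D = (\<lambda>t::(real,'n) vec. Delta_pow (zeta s t) (-\<nu>))"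
  have bD: "cmod (D t) \<le> E * zprod s (- Re \<nu>) t" for t unfolding D_def E_def by (rule Delta_zeta_bound[OF s])
  define f where "f = (\<lambda>u t. Kf (cvec (cu mx u x)) (zeta s t) * (cinvv (zeta s t) $ mx * D t) * of_real (om k t))"
  define f' where "f' = (\<lambda>u t. dpart mx (Kf (zeta s t)) (cvec (cu mx u x)) * (cinvv (zeta s t) $ mx * D t) * of_real (om k t))"
  define B where "B = A + 1 / s * (k * (\<Sum>j\<in>UNIV-{mx::'n}. 2 * A / e))"
  have zi: "cmod (cinvv (zeta s t) $ mx) \<le> 1 / s" for t :: "(real,'n) vec" by (rule cinvv_zeta_le[OF s])
  have znz: "zeta s t $ mx \<noteq> 0" for t :: "(real,'n) vec" by (rule zeta_nz[OF s])
  have dK: "dpart mx (Kf (zeta s t)) (cvec y) = zeta s t $ mx * Kf (cvec y) (zeta s t)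
      - of_real k * (\<Sum>j\<in>UNIV-{mx}. (Kf (cvec y) (zeta s t) - Kf (cvec (swapv mx j y)) (zeta s t)) / of_real (y $ mx - y $ j))"
    if "\<forall>i j. i \<noteq> j \<longrightarrow> y $ i \<noteq> y $ j" for y t
  proof -
    have "distinct_coords (cvec y)" using that unfolding distinct_coords_def by simp
    from Kf_T[OF this, of mx "zeta s t"] show ?thesis
      unfolding dunklA_def cvec_swapv[symmetric] Kf_sym[of "zeta s t"] by (simp add: eq_diff_eq del: zeta_nth)
  qed
  have main: "((\<lambda>u. \<integral>t. f u t \<partial>lborel) has_vector_derivative (\<integral>t. f' u0 t \<partial>lborel)) (at u0)"
  proof (rule has_vector_derivative_integral[OF e(1), where G="\<lambda>t. B * E * (zprod s (- Re \<nu>) t * om k t)"])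
    show "integrable lborel (f u)" for u
      using Phi_integrand[OF s nu holo_n_nth[of mx], of "cu mx u x"] unfolding f_def D_def .
    show "integrable lborel (\<lambda>t::(real,'n) vec. B * E * (zprod s (- Re \<nu>) t * om k t))"
      by (intro integrable_mult_right integrable_om_zprod s nu)
    show "((\<lambda>u. f u t) has_vector_derivative f' u t) (at u)" for u t
    proof -
      have "((\<lambda>u. complex_of_real u) has_vector_derivative of_real 1) (at u)"
        by (rule has_vector_derivative_of_real) (rule DERIV_ident)
      from field_vector_diff_chain_at[OF this holo_n_partial[OF Kf_holo[of "zeta s t"], of mx "cvec x"]]
      have "((\<lambda>u. Kf (cvec (cu mx u x)) (zeta s t)) has_vector_derivative dpart mx (Kf (zeta s t)) (cvec (cu mx u x))) (at u)"
        unfolding cvec_cu Kf_sym[of _ "zeta s t"] by (simp add: o_def)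
      thus ?thesis unfolding f_def f'_def by (intro has_vector_derivative_mult_left)
    qed
    have yd: "\<forall>i j. i \<noteq> j \<longrightarrow> cu mx u x $ i \<noteq> cu mx u x $ j" if u: "\<bar>u - u0\<bar> < e" for u
    proof -
      have "u \<noteq> x $ j" if "j \<noteq> mx" for j using u e(1) e(3)[OF that] by auto
      thus ?thesis using x by auto
    qed
    show "cmod (f' u t) \<le> B * E * (zprod s (- Re \<nu>) t * om k t)" if u: "\<bar>u - u0\<bar> < e" for u t
    proof -
      define y where "y = cu mx u x"
      have "(\<Sum>i\<in>UNIV. \<bar>y $ i\<bar>) \<le> (\<Sum>i\<in>UNIV. \<bar>x $ i\<bar> + (if i = mx then 1 else 0))"
        unfolding y_def using u e(2) by (intro sum_mono) (auto simp: u0_def)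
      hence yX: "(\<Sum>i\<in>UNIV. \<bar>y $ i\<bar>) \<le> X" unfolding X_def by (simp add: sum.distrib)
      have swX: "(\<Sum>i\<in>UNIV. \<bar>swapv mx j y $ i\<bar>) \<le> X" for j
        using yX sum.reindex_bij_betw[of "tr mx j" UNIV UNIV "\<lambda>i. \<bar>y $ i\<bar>"] unfolding swapv_pv by simp
      define S where "S = (\<Sum>j\<in>UNIV-{mx}. (Kf (cvec y) (zeta s t) - Kf (cvec (swapv mx j y)) (zeta s t)) / of_real (y $ mx - y $ j))"
      have "cmod S \<le> (\<Sum>j\<in>UNIV-{mx::'n}. 2 * A / e)" unfolding S_def
      proof (rule sum_norm_le)
        fix j :: 'n assume j: "j \<in> UNIV - {mx}"
        have "e \<le> \<bar>y $ mx - y $ j\<bar>" using u e(3)[of j] j unfolding y_def by auto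
        moreover have "cmod (Kf (cvec y) (zeta s t) - Kf (cvec (swapv mx j y)) (zeta s t)) \<le> 2 * A"
          using A[OF yX, of t] A[OF swX, of j t] norm_triangle_ineq4[of "Kf (cvec y) (zeta s t)" "Kf (cvec (swapv mx j y)) (zeta s t)"] by linarith
        ultimately show "cmod ((Kf (cvec y) (zeta s t) - Kf (cvec (swapv mx j y)) (zeta s t)) / of_real (y $ mx - y $ j)) \<le> 2 * A / e"
          unfolding norm_divide norm_of_real using e(1) A0 by (intro frac_le) auto
      qed
      hence "k * cmod S \<le> k * (\<Sum>j\<in>UNIV-{mx::'n}. 2 * A / e)" by (rule mult_left_mono[OF _ k])
      hence "cmod (of_real k * S) \<le> k * (\<Sum>j\<in>UNIV-{mx::'n}. 2 * A / e)"
        using k by (simp only: norm_mult norm_of_real abs_of_nonneg)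
      moreover have "dpart mx (Kf (zeta s t)) (cvec y) * cinvv (zeta s t) $ mx = Kf (cvec y) (zeta s t) - cinvv (zeta s t) $ mx * (of_real k * S)"
        unfolding dK[OF yd[OF u, folded y_def]] S_def[symmetric] cinvv_nth using znz[of t] by (simp add: field_simps del: zeta_nth)
      ultimately have bB: "cmod (dpart mx (Kf (zeta s t)) (cvec y) * cinvv (zeta s t) $ mx) \<le> B"
        using A[OF yX, of t] mult_mono[OF zi[of t], of "cmod (of_real k * S)" "k * (\<Sum>j\<in>UNIV-{mx::'n}. 2 * A / e)"] s
          norm_triangle_ineq4[of "Kf (cvec y) (zeta s t)" "cinvv (zeta s t) $ mx * (of_real k * S)"]
        unfolding B_def norm_mult[of "cinvv (zeta s t) $ mx"] by (simp del: cinvv_nth)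
      have "0 \<le> B" by (rule order_trans[OF norm_ge_zero bB])
      hence "cmod (dpart mx (Kf (zeta s t)) (cvec y) * cinvv (zeta s t) $ mx) * cmod (D t) * om k t \<le> B * (E * zprod s (- Re \<nu>) t) * om k t"
        using E0 by (intro mult_mono bB bD) auto
      moreover have "cmod (f' u t) = cmod (dpart mx (Kf (zeta s t)) (cvec y) * cinvv (zeta s t) $ mx) * cmod (D t) * om k t"
        unfolding f'_def y_def by (simp add: norm_mult mult.assoc del: cinvv_nth)
      ultimately show ?thesis by (simp add: mult.assoc)
    qed
    show "f' u0 \<in> borel_measurable lborel"
    proof -
      have [measurable]: "(\<lambda>t. Kf w (zeta s t)) \<in> borel_measurable borel" for w by (rule measurable_Kf_zeta)
      have [measurable]: "D \<in> borel_measurable borel" unfolding D_def by (rule measurable_Delta_zeta[OF s])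
      have nm: "(\<lambda>z::(complex,'n) vec. z $ i) \<in> borel_measurable borel" for i by (rule holo_n_measurable) auto
      note [measurable] = measurable_compose[OF measurable_zeta nm] measurable_compose[OF measurable_cinvv_zeta[OF s] nm]
      have yd0: "\<forall>i j. i \<noteq> j \<longrightarrow> cu mx u0 x $ i \<noteq> cu mx u0 x $ j" by (rule yd) (use e(1) in simp)
      show ?thesis unfolding f'_def dK[OF yd0] by measurable
    qed
  qed
  have cx: "cu mx u0 x = x" by (simp add: u0_def)
  define F where "F = (\<lambda>q y t. Kf (cvec y) (zeta s t) * (q (cinvv (zeta s t)) * D t) * of_real (om k t))"
  have Fi: "integrable lborel (F q y)" if "holo_n q" for q y
    unfolding F_def D_def by (rule Phi_integrand[OF s nu that])
  have FP: "(\<integral>t. F q y t \<partial>lborel) = Phi s \<nu> q y" for q y unfolding F_def D_def Phi_def ..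
  have "f' u0 t = F (\<lambda>_. 1) x t - of_real k * (\<Sum>j\<in>UNIV-{mx}. (F (\<lambda>z. z $ mx) x t - F (\<lambda>z. z $ mx) (swapv mx j x) t) / of_real (x $ mx - x $ j))" for t
  proof -
    have "(\<Sum>j\<in>UNIV-{mx}. (F (\<lambda>z. z $ mx) x t - F (\<lambda>z. z $ mx) (swapv mx j x) t) / of_real (x $ mx - x $ j))
      = (\<Sum>j\<in>UNIV-{mx}. (Kf (cvec x) (zeta s t) - Kf (cvec (swapv mx j x)) (zeta s t)) / of_real (x $ mx - x $ j)) * (cinvv (zeta s t) $ mx * D t * of_real (om k t))"
      unfolding F_def sum_distrib_right by (intro sum.cong refl) (simp add: left_diff_distrib diff_divide_distrib mult.assoc del: cinvv_nth of_real_diff)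
    moreover have "zeta s t $ mx * cinvv (zeta s t) $ mx = 1" using znz[of t] by (simp del: zeta_nth)
    hence "zeta s t $ mx * Kf (cvec x) (zeta s t) * (cinvv (zeta s t) $ mx * D t * of_real (om k t)) = F (\<lambda>_. 1) x t"
      unfolding F_def by (simp add: mult_ac del: cinvv_nth zeta_nth)
    ultimately show ?thesis
      unfolding f'_def cx dK[OF x] by (simp add: left_diff_distrib mult.assoc del: cinvv_nth zeta_nth)
  qed
  hence "(\<integral>t. f' u0 t \<partial>lborel) = (\<integral>t. F (\<lambda>_. 1) x t - of_real k * (\<Sum>j\<in>UNIV-{mx}. (F (\<lambda>z. z $ mx) x t - F (\<lambda>z. z $ mx) (swapv mx j x) t) / of_real (x $ mx - x $ j)) \<partial>lborel)"
    by simp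
  also have "\<dots> = Phi s \<nu> (\<lambda>_. 1) x - of_real k * (\<Sum>j\<in>UNIV-{mx}. (Phi s \<nu> (\<lambda>z. z $ mx) x - Phi s \<nu> (\<lambda>z. z $ mx) (swapv mx j x)) / of_real (x $ mx - x $ j))"
  proof -
    have i2: "integrable lborel (\<lambda>t. (F (\<lambda>z. z $ mx) x t - F (\<lambda>z. z $ mx) (swapv mx j x) t) / of_real (x $ mx - x $ j))" for j
      by (intro integrable_divide_zero Bochner_Integration.integrable_diff Fi holo_n_nth)
    have i3: "integrable lborel (\<lambda>t. of_real k * (\<Sum>j\<in>UNIV-{mx}. (F (\<lambda>z. z $ mx) x t - F (\<lambda>z. z $ mx) (swapv mx j x) t) / of_real (x $ mx - x $ j)))"
      by (intro integrable_mult_right Bochner_Integration.integrable_sum i2)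
    have iq: "(\<integral>t. (F (\<lambda>z. z $ mx) x t - F (\<lambda>z. z $ mx) (swapv mx j x) t) / of_real (x $ mx - x $ j) \<partial>lborel)
      = (Phi s \<nu> (\<lambda>z. z $ mx) x - Phi s \<nu> (\<lambda>z. z $ mx) (swapv mx j x)) / of_real (x $ mx - x $ j)" for j
      unfolding FP[symmetric] using Fi[OF holo_n_nth] by (simp del: of_real_diff)
    have "(\<integral>t. of_real k * (\<Sum>j\<in>UNIV-{mx}. (F (\<lambda>z. z $ mx) x t - F (\<lambda>z. z $ mx) (swapv mx j x) t) / of_real (x $ mx - x $ j)) \<partial>lborel)
      = of_real k * (\<integral>t. (\<Sum>j\<in>UNIV-{mx}. (F (\<lambda>z. z $ mx) x t - F (\<lambda>z. z $ mx) (swapv mx j x) t) / of_real (x $ mx - x $ j)) \<partial>lborel)"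
      by (rule integral_mult_right_zero)
    also have "(\<integral>t. (\<Sum>j\<in>UNIV-{mx}. (F (\<lambda>z. z $ mx) x t - F (\<lambda>z. z $ mx) (swapv mx j x) t) / of_real (x $ mx - x $ j)) \<partial>lborel)
      = (\<Sum>j\<in>UNIV-{mx}. (\<integral>t. (F (\<lambda>z. z $ mx) x t - F (\<lambda>z. z $ mx) (swapv mx j x) t) / of_real (x $ mx - x $ j) \<partial>lborel))"
      by (rule Bochner_Integration.integral_sum[OF i2])
    finally show ?thesis
      unfolding Bochner_Integration.integral_diff[OF Fi[OF holo_n_const] i3] iq FP by (rule arg_cong)
  qed
  finally show ?thesis using main unfolding u0_def f_def D_def Phi_def[symmetric] by (simp only: Phi_def)
qed

text \<open>Since \<Phi>_1 is symmetric and \<Phi> of z_mx is x_mx \<Phi>_1/\<nu>, each quotient in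
  \<open>Phi_mx_deriv\<close> collapses to \<Phi>_1/\<nu>. What remains is u F' = c F in the last
  coordinate, with F = u \<Phi>_1/\<nu>; hence \<Phi>_1 is proportional to u^(c-1).\<close>

lemma Phi_1_coordinate:
  fixes x :: "(real,'n::{finite,linorder}) vec"
  assumes s: "s > 0" and nu: "Re \<nu> > 2 * k * (real CARD('n) - 1) + 1"
    and x: "\<forall>i j. i \<noteq> j \<longrightarrow> x $ i \<noteq> x $ j" and uv: "u > 0" "v > 0"
  defines "c \<equiv> \<nu> - of_real (k * (real CARD('n) - 1))"
  shows "Phi s \<nu> (\<lambda>_. 1) (cu mx u x) * of_real u powr (1 - c) = Phi s \<nu> (\<lambda>_. 1) (cu mx v x) * of_real v powr (1 - c)"
proof -
  define \<psi> where "\<psi> = (\<lambda>u. Phi s \<nu> (\<lambda>z. z $ mx) (cu mx u x) * of_real u powr (- c))"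
  have "0 \<le> k * (real CARD('n) - 1)" using k by (intro mult_nonneg_nonneg) auto
  hence "Re \<nu> > 0" using nu by simp
  hence nz: "\<nu> \<noteq> 0" by auto
  have ps: "\<psi> u = Phi s \<nu> (\<lambda>_. 1) (cu mx u x) * of_real u powr (1 - c) / \<nu>" if "u > 0" for u
  proof -
    have "complex_of_real u * of_real u powr (-c) = of_real u powr (1 - c)"
      using that by (simp add: powr_diff powr_minus field_simps)
    thus ?thesis unfolding \<psi>_def Phi_mx_1[OF s nu] by (simp add: mult_ac)
  qed
  define K where "K = (\<lambda>j. x $ j) ` (UNIV - {mx})"
  have "\<psi> u = \<psi> v"
  \<comment> \<open>The derivative is known only off the finite set K, where u meets another
    coordinate; continuity bridges the gaps.\<close>
  proof (rule has_derivative_zero_unique_strong_convex[of "{0<..}" K \<psi> v "\<psi> v" u])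
    show "continuous_on {0<..} \<psi>"
      unfolding continuous_on_sequentially
    proof (intro allI ballI impI)
      fix U and a :: real assume a: "a \<in> {0<..}" and U: "(\<forall>n. U n \<in> {0<..}) \<and> U \<longlonglongrightarrow> a"
      have "(\<lambda>m. cu mx (U m) x) \<longlonglongrightarrow> cu mx a x"
        unfolding cu_def using U by (intro vec_tendstoI) auto
      moreover have "complex_of_real a \<notin> \<real>\<^sub>\<le>\<^sub>0" using a by auto
      ultimately show "(\<psi> \<circ> U) \<longlonglongrightarrow> \<psi> a"
        unfolding \<psi>_def o_def using U a by (intro tendsto_mult Phi_tendsto[OF s nu holo_n_nth] tendsto_powr_complex tendsto_intros) auto
    qed
    fix w assume w: "w \<in> {0<..} - K"
    define y where "y = cu mx w x"
    have y: "\<forall>i j. i \<noteq> j \<longrightarrow> y $ i \<noteq> y $ j" using x w unfolding y_def K_def by auto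
    have ymx: "y $ mx = w" by (simp add: y_def)
    define P where "P = Phi s \<nu> (\<lambda>_. 1) y"
    have quot: "(Phi s \<nu> (\<lambda>z. z $ mx) y - Phi s \<nu> (\<lambda>z. z $ mx) (swapv mx j y)) / of_real (y $ mx - y $ j) = P / \<nu>"
      if "j \<in> UNIV - {mx}" for j
    proof -
      have ne: "complex_of_real (y $ mx - y $ j) \<noteq> 0" using y that by auto
      have "Phi s \<nu> (\<lambda>z. z $ mx) y - Phi s \<nu> (\<lambda>z. z $ mx) (swapv mx j y) = of_real (y $ mx - y $ j) * (P / \<nu>)"
        unfolding Phi_mx_1[OF s nu] Phi_sym[OF s] P_def by (simp add: diff_divide_distrib left_diff_distrib)
      thus ?thesis using ne by (simp del: of_real_diff)
    qed
    have card1: "(\<Sum>j\<in>UNIV-{mx::'n}. P / \<nu>) = of_real (real CARD('n) - 1) * (P / \<nu>)"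
      by (simp add: card_Diff_singleton of_nat_diff Suc_leI)
    have "(\<Sum>j\<in>UNIV-{mx}. (Phi s \<nu> (\<lambda>z. z $ mx) y - Phi s \<nu> (\<lambda>z. z $ mx) (swapv mx j y)) / of_real (y $ mx - y $ j))
        = of_real (real CARD('n) - 1) * (P / \<nu>)"
      unfolding card1[symmetric] by (intro sum.cong refl quot)
    hence "((\<lambda>u. Phi s \<nu> (\<lambda>z. z $ mx) (cu mx u x)) has_vector_derivative
        (P - of_real k * (of_real (real CARD('n) - 1) * (P / \<nu>)))) (at w)"
      using Phi_mx_deriv[OF s nu y] unfolding ymx P_def[symmetric] unfolding y_def by simp
    moreover have "P - of_real k * (of_real (real CARD('n) - 1) * (P / \<nu>)) = c * P / \<nu>"
      unfolding c_def using nz by (simp add: field_simps)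
    ultimately have d1: "((\<lambda>u. Phi s \<nu> (\<lambda>z. z $ mx) (cu mx u x)) has_vector_derivative c * P / \<nu>) (at w)" by simp
    have w0: "w > 0" using w by simp
    have "(\<psi> has_vector_derivative (Phi s \<nu> (\<lambda>z. z $ mx) (cu mx w x) * (- c * of_real w powr (-c) / of_real w)
        + c * P / \<nu> * of_real w powr (-c))) (at w)"
      unfolding \<psi>_def by (rule has_vector_derivative_mult[OF d1 powr_real_partial[OF w0]])
    also have "Phi s \<nu> (\<lambda>z. z $ mx) (cu mx w x) * (- c * of_real w powr (-c) / of_real w)
        + c * P / \<nu> * of_real w powr (-c) = 0"
      unfolding y_def[symmetric] Phi_mx_1[OF s nu] P_def[symmetric] ymx using w0 by simp
    finally have "(\<psi> has_vector_derivative 0) (at w)" .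
    thus "(\<psi> has_derivative (\<lambda>h. 0)) (at w within {0<..})"
      unfolding has_vector_derivative_def by (simp add: has_derivative_at_withinI)
  qed (use uv in \<open>auto simp: K_def\<close>)
  thus ?thesis unfolding ps[OF uv(1)] ps[OF uv(2)] using nz by simp
qed

text \<open>The quotient G of both sides is unchanged when the last coordinate moves, by symmetry
  when any coordinate moves, and by continuity also at points with equal coordinates.\<close>

lemma Phi_1_formula:
  fixes x :: "(real,'n::{finite,linorder}) vec"
  assumes s: "s > 0" and nu: "Re \<nu> > 2 * k * (real CARD('n) - 1) + 1" and x: "\<forall>i. x $ i > 0"
  shows "Phi s \<nu> (\<lambda>_. 1) x = Phi s \<nu> (\<lambda>_. 1) (constv 1 :: (real,'n) vec)
     * Delta_pow (cvec x) (\<nu> - of_real (k * (real CARD('n) - 1)) - 1)"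
proof -
  define c where "c = \<nu> - of_real (k * (real CARD('n) - 1))"
  define G where "G = (\<lambda>x::(real,'n) vec. Phi s \<nu> (\<lambda>_. 1) x * Delta_pow (cvec x) (1 - c))"
  have Gpv: "G (pv \<sigma> y) = G y" if "bij \<sigma>" for \<sigma> y
    unfolding G_def cvec_pv Delta_pow_pv[OF that] Phi_pv[OF s holo_n_const that] ..
  have Gmx: "G (cu mx v y) = G y" if y: "\<forall>i j. i \<noteq> j \<longrightarrow> y $ i \<noteq> y $ j" "\<forall>i. y $ i > 0" and v: "v > 0" for y v
  proof -
    have D: "Delta_pow (cvec (cu mx v y)) (1 - c) = of_real v powr (1 - c) * (\<Prod>l\<in>UNIV-{mx}. cvec y $ l powr (1 - c))" for v
      unfolding Delta_pow_def by (subst prod.remove[of _ mx]) auto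
    have "G (cu mx v y) = G (cu mx (y $ mx) y)"
      unfolding G_def D mult.assoc[symmetric]
      by (simp only: Phi_1_coordinate[OF s nu y(1) v y(2)[rule_format, of mx], folded c_def])
    thus ?thesis by simp
  qed
  have Gi: "G (cu i v y) = G y" if y: "\<forall>i j. i \<noteq> j \<longrightarrow> y $ i \<noteq> y $ j" "\<forall>i. y $ i > 0" and v: "v > 0" for y v i
  proof -
    define \<sigma> where "\<sigma> = tr i mx"
    have b: "bij \<sigma>" by (simp add: \<sigma>_def)
    have inj: "inj \<sigma>" using b bij_is_inj by blast
    have "cu i v y = pv \<sigma> (cu mx v (pv \<sigma> y))"
      using pv_cu[OF inj, of i v "pv \<sigma> y"] by (simp add: \<sigma>_def pv_pv)
    hence "G (cu i v y) = G (cu mx v (pv \<sigma> y))" by (simp add: Gpv[OF b])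
    also have "\<dots> = G (pv \<sigma> y)" by (rule Gmx) (use y v inj in \<open>auto simp: inj_eq\<close>)
    finally show ?thesis by (simp add: Gpv[OF b])
  qed
  have Glim: "(\<lambda>m. G (Y m)) \<longlonglongrightarrow> G y" if "Y \<longlonglongrightarrow> y" "\<forall>i. y $ i > 0" for Y y
  proof -
    have "complex_of_real (y $ i) \<notin> \<real>\<^sub>\<le>\<^sub>0" for i
      using that(2)[rule_format, of i] by (simp add: complex_nonpos_Reals_iff)
    thus ?thesis unfolding G_def Delta_pow_def
      by (intro tendsto_mult Phi_tendsto[OF s nu holo_n_const that(1)] tendsto_prod tendsto_powr_complex tendsto_const
            tendsto_vec_nth tendsto_cvec that(1)) auto
  qed
  have Gall: "G (cu i v y) = G y" if y: "\<forall>i. y $ i > 0" and v: "v > 0" for y v i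
  proof -
    obtain Y where Y: "Y \<longlonglongrightarrow> y" "\<And>m i j. i \<noteq> j \<Longrightarrow> Y m $ i \<noteq> Y m $ j"
      using distinct_dense[of y] by blast
    have "eventually (\<lambda>m. \<forall>i. Y m $ i > 0) sequentially"
      using y order_tendstoD(1)[OF tendsto_vec_nth[OF Y(1)]] by (simp add: eventually_all_finite)
    hence ev: "eventually (\<lambda>m. G (cu i v (Y m)) = G (Y m)) sequentially"
      by eventually_elim (rule Gi, use Y(2) v in auto)
    have "(\<lambda>m. cu i v (Y m)) \<longlonglongrightarrow> cu i v y"
      unfolding cu_def by (intro vec_tendstoI) (auto intro: tendsto_vec_nth[OF Y(1)])
    hence "(\<lambda>m. G (cu i v (Y m))) \<longlonglongrightarrow> G (cu i v y)" by (rule Glim) (use y v in auto)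
    hence "(\<lambda>m. G (Y m)) \<longlonglongrightarrow> G (cu i v y)" using tendsto_cong[OF ev] by blast
    moreover have "(\<lambda>m. G (Y m)) \<longlonglongrightarrow> G y" by (rule Glim[OF Y(1) y])
    ultimately show ?thesis by (rule LIMSEQ_unique)
  qed
  \<comment> \<open>Coordinates are set to 1 one after another. The intermediate points have equal
    coordinates, which is why \<open>Gall\<close> and not \<open>Gi\<close> is called.\<close>
  have "G (\<chi> i. if i \<in> S then 1 else x $ i) = G x" for S
  proof (induction S rule: infinite_finite_induct)
    case (insert j S)
    have "(\<chi> i. if i \<in> insert j S then 1 else x $ i) = cu j 1 (\<chi> i. if i \<in> S then 1 else x $ i)"
      by (simp add: vec_eq_iff)
    thus ?case using Gall[of "\<chi> i. if i \<in> S then 1 else x $ i" 1 j] x insert by simp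
  qed auto
  from this[of UNIV] have "G (constv 1) = G x" by (simp add: constv_def)
  moreover have "G (constv 1) = Phi s \<nu> (\<lambda>_. 1) (constv 1 :: (real,'n) vec)"
    unfolding G_def Delta_pow_def by (simp add: constv_def)
  ultimately have e: "Phi s \<nu> (\<lambda>_. 1) (constv 1 :: (real,'n) vec) = Phi s \<nu> (\<lambda>_. 1) x * Delta_pow (cvec x) (1 - c)"
    unfolding G_def by simp
  have "Delta_pow (cvec x) (1 - c) * Delta_pow (cvec x) (c - 1) = 1"
    unfolding Delta_pow_def prod.distrib[symmetric]
  proof (intro prod.neutral ballI)
    fix i
    have "x $ i \<noteq> 0" using x by (metis less_irrefl)
    thus "cvec x $ i powr (1 - c) * cvec x $ i powr (c - 1) = 1" by (simp add: powr_add[symmetric])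
  qed
  thus ?thesis unfolding e c_def by (simp add: mult.assoc)
qed

end

subsection \<open>Stirling's formula\<close>

text \<open>The increments of S are O(1/m^2), so S converges; Wallis' product, expressed by S(n) and
  S(2n), identifies the limit.\<close>

lemma ln_fact_asymp:
  "(\<lambda>m. ln (fact m) - (real m + 1/2) * ln (real m) + real m) \<longlonglongrightarrow> ln (2 * pi) / 2"
proof -
  define S where "S = (\<lambda>m::nat. ln (fact m :: real) - (real m + 1/2) * ln (real m) + real m)"
  have "summable (\<lambda>n. norm (1 / real n ^ 2))"
    using inverse_power_summable[of 2, where 'a=real] by (simp add: field_simps)
  moreover have "(\<lambda>m::nat. 1 - (real m + 1/2) * ln (1 + 1 / real m)) \<in> O(\<lambda>m. 1 / real m ^ 2)"
    by real_asymp
  ultimately have "summable (\<lambda>m::nat. 1 - (real m + 1/2) * ln (1 + 1 / real m))"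
    by (rule summable_comparison_test_bigo)
  hence "summable (\<lambda>m::nat. 1 - (real (Suc m) + 1/2) * ln (1 + 1 / real (Suc m)))"
    by (subst summable_Suc_iff)
  moreover have "1 - (real (Suc m) + 1/2) * ln (1 + 1 / real (Suc m)) = S (Suc (Suc m)) - S (Suc m)" for m
  proof -
    have "1 + 1 / real (Suc m) = real (Suc (Suc m)) / real (Suc m)" by (simp add: field_simps)
    hence l: "ln (1 + 1 / real (Suc m)) = ln (real (Suc (Suc m))) - ln (real (Suc m))"
      by (simp only: ln_divide_pos of_nat_0_less_iff zero_less_Suc)
    have "ln (fact (Suc (Suc m)) :: real) = ln (real (Suc (Suc m))) + ln (fact (Suc m))"
      by (subst fact_Suc) (simp only: ln_mult_pos of_nat_0_less_iff zero_less_Suc fact_gt_zero)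
    thus ?thesis unfolding S_def l by (simp add: algebra_simps)
  qed
  ultimately have "summable (\<lambda>m. S (Suc (Suc m)) - S (Suc m))" by simp
  hence "(\<lambda>n. \<Sum>m<n. S (Suc (Suc m)) - S (Suc m)) \<longlonglongrightarrow> (\<Sum>m. S (Suc (Suc m)) - S (Suc m))"
    by (rule summable_LIMSEQ)
  moreover have "(\<Sum>m<n. S (Suc (Suc m)) - S (Suc m)) = S (Suc n) - S (Suc 0)" for n
    by (rule sum_lessThan_telescope)
  ultimately have "(\<lambda>n. S (Suc n) - S (Suc 0) + S (Suc 0)) \<longlonglongrightarrow> (\<Sum>m. S (Suc (Suc m)) - S (Suc m)) + S (Suc 0)"
    by (intro tendsto_add) auto
  then obtain L where "(\<lambda>n. S (Suc n)) \<longlonglongrightarrow> L" by auto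
  hence L: "S \<longlonglongrightarrow> L" by (rule LIMSEQ_imp_Suc)
  \<comment> \<open>The partial Wallis product in closed form. Its logarithm is 4 S(n) - 2 S(2n) up
    to elementary terms, so the limit L satisfies 2L - 2 ln 2 = ln(\<pi>/2).\<close>
  have prod: "(\<Prod>j=1..n. (4 * real j ^ 2) / (4 * real j ^ 2 - 1)) = 2 ^ (4 * n) * fact n ^ 4 / (fact (2 * n) ^ 2 * (2 * real n + 1))" for n
  proof (induction n)
    case (Suc n)
    define a where "a = real n"
    have a: "a \<ge> 0" by (simp add: a_def)
    have f2: "fact (2 * Suc n) = (2 * a + 2) * (2 * a + 1) * (fact (2 * n) :: real)"
      by (simp add: a_def algebra_simps)
    have f1: "fact (Suc n) = (a + 1) * (fact n :: real)" by (simp add: a_def algebra_simps)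
    have nz: "fact (2 * n) \<noteq> (0::real)" "2 * a + 1 \<noteq> 0" "2 * a + 3 \<noteq> 0" "a + 1 \<noteq> 0" using a by auto
    have "(\<Prod>j=1..Suc n. (4 * real j ^ 2) / (4 * real j ^ 2 - 1))
      = 2 ^ (4 * n) * fact n ^ 4 / (fact (2 * n) ^ 2 * (2 * a + 1)) * ((4 * (a + 1) ^ 2) / (4 * (a + 1) ^ 2 - 1))"
      using Suc by (simp add: a_def add.commute)
    also have "4 * (a + 1) ^ 2 - 1 = (2 * a + 1) * (2 * a + 3)" by (simp add: power2_eq_square algebra_simps)
    also have "2 ^ (4 * n) * fact n ^ 4 / (fact (2 * n) ^ 2 * (2 * a + 1)) * ((4 * (a + 1) ^ 2) / ((2 * a + 1) * (2 * a + 3)))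
       = 2 ^ (4 * Suc n) * fact (Suc n) ^ 4 / (fact (2 * Suc n) ^ 2 * (2 * real (Suc n) + 1))"
    proof -
      have r: "2 * real (Suc n) + 1 = 2 * a + 3" by (simp add: a_def)
      have p: "(2::real) ^ (4 * Suc n) = 16 * 2 ^ (4 * n)" by (simp add: power_add)
      have e: "2 * a + 2 = 2 * (a + 1)" by simp
      have "P * F ^ 4 / (G ^ 2 * x) * ((4 * b ^ 2) / (x * y)) = 16 * P * (b * F) ^ 4 / ((2 * b * x * G) ^ 2 * y)"
        if "G \<noteq> 0" "x \<noteq> 0" "y \<noteq> 0" "b \<noteq> 0" for P F G x y b :: real
        using that by (simp add: divide_simps) (simp add: power2_eq_square power4_eq_xxxx algebra_simps)
      from this[OF nz(1,2,3,4), of "2 ^ (4 * n)" "fact n"] show ?thesis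
        unfolding f1 f2 r p e by simp
    qed
    finally show ?case .
  qed simp
  have W: "(\<lambda>n. ln (2 ^ (4 * n) * fact n ^ 4 / (fact (2 * n) ^ 2 * (2 * real n + 1)))) \<longlonglongrightarrow> ln (pi / 2)"
    using wallis unfolding prod by (intro tendsto_ln) auto
  have "eventually (\<lambda>n. ln (2 ^ (4 * n) * fact n ^ 4 / (fact (2 * n) ^ 2 * (2 * real n + 1)))
      = 4 * S n - 2 * S (2 * n) - ln 2 + ln (real n) - ln (2 * real n + 1)) sequentially"
    using eventually_gt_at_top[of 0]
  proof eventually_elim
    case (elim n)
    have "ln (2 ^ (4 * n) * fact n ^ 4 / (fact (2 * n) ^ 2 * (2 * real n + 1)))
       = 4 * real n * ln 2 + 4 * ln (fact n) - (2 * ln (fact (2 * n)) + ln (2 * real n + 1))"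
      using elim by (simp add: ln_div ln_mult ln_realpow)
    moreover have "ln (2 * real n) = ln 2 + ln (real n)" using elim by (simp add: ln_mult)
    ultimately show ?case unfolding S_def by (simp add: algebra_simps)
  qed
  from tendsto_cong[THEN iffD1, OF this W]
  have "(\<lambda>n. 4 * S n - 2 * S (2 * n) - ln 2 + ln (real n) - ln (2 * real n + 1)) \<longlonglongrightarrow> ln (pi / 2)" .
  moreover have "(\<lambda>n. 4 * S n - 2 * S (2 * n) - ln 2 + (ln (real n) - ln (2 * real n + 1))) \<longlonglongrightarrow> 4 * L - 2 * L - ln 2 + (- ln 2)"
  proof (intro tendsto_intros L)
    show "(\<lambda>n. S (2 * n)) \<longlonglongrightarrow> L"
      using LIMSEQ_subseq_LIMSEQ[OF L, of "\<lambda>n. 2 * n"] by (simp add: strict_mono_def o_def)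
    show "(\<lambda>n. ln (real n) - ln (2 * real n + 1)) \<longlonglongrightarrow> - ln 2" by real_asymp
  qed
  ultimately have "ln (pi / 2) = 4 * L - 2 * L - ln 2 + (- ln 2)"
    by (intro LIMSEQ_unique[of _ "ln (pi / 2)"]) (simp_all add: add_diff_eq)
  moreover have "ln (pi / 2) = ln pi - ln 2" "ln (2 * pi) = ln 2 + ln pi" by (simp_all add: ln_div ln_mult)
  ultimately have "L = ln (2 * pi) / 2" by simp
  thus ?thesis using L unfolding S_def by (simp only:)
qed

text \<open>Gamma(z + m) is the Pochhammer symbol times Gamma z, and Euler's limit compares the
  Pochhammer symbol with (m - 1)! m^z; the factorial is then replaced by
  \<open>ln_fact_asymp\<close>.\<close>

lemma Gamma_shift_asymp:
  fixes z :: complex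
  assumes "Re z > 0"
  shows "(\<lambda>m. Gamma (z + of_nat m) / exp ((z + of_nat m - 1/2) * of_real (ln (real m)) - of_nat m)) \<longlonglongrightarrow> of_real (sqrt (2 * pi))"
proof -
  have z: "z \<notin> \<int>\<^sub>\<le>\<^sub>0" using assms by (auto elim!: nonpos_Ints_cases)
  have Gz: "Gamma z \<noteq> 0" using z by (simp add: Gamma_eq_zero_iff)
  have "(\<lambda>m. Gamma z / Gamma_series' z m) \<longlonglongrightarrow> Gamma z / Gamma z"
    by (intro tendsto_divide tendsto_const Gamma_series'_LIMSEQ Gz)
  moreover have "(\<lambda>m. complex_of_real (exp (ln (fact m) - (real m + 1/2) * ln (real m) + real m))) \<longlonglongrightarrow> of_real (exp (ln (2 * pi) / 2))"
    by (intro tendsto_intros ln_fact_asymp)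
  ultimately have "(\<lambda>m. Gamma z / Gamma_series' z m * complex_of_real (exp (ln (fact m) - (real m + 1/2) * ln (real m) + real m)))
      \<longlonglongrightarrow> Gamma z / Gamma z * of_real (exp (ln (2 * pi) / 2))"
    by (rule tendsto_mult)
  also have "exp (ln (2 * pi) / 2) = sqrt (2 * pi)"
    by (simp add: powr_half_sqrt[symmetric] powr_def)
  also have "Gamma z / Gamma z * complex_of_real (sqrt (2 * pi)) = of_real (sqrt (2 * pi))" using Gz by simp
  finally have lim: "(\<lambda>m. Gamma z / Gamma_series' z m * complex_of_real (exp (ln (fact m) - (real m + 1/2) * ln (real m) + real m)))
      \<longlonglongrightarrow> of_real (sqrt (2 * pi))" .
  have ev: "eventually (\<lambda>m. Gamma z / Gamma_series' z m * complex_of_real (exp (ln (fact m) - (real m + 1/2) * ln (real m) + real m))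
      = Gamma (z + of_nat m) / exp ((z + of_nat m - 1/2) * of_real (ln (real m)) - of_nat m)) sequentially"
    using eventually_gt_at_top[of 0]
  proof eventually_elim
    case (elim m)
    define l where "l = ln (real m)"
    have f: "fact m = real m * (fact (m - 1) :: real)" using elim by (cases m) auto
    have lf: "ln (fact m :: real) = l + ln (fact (m - 1))"
      unfolding f l_def using elim by (subst ln_mult_pos) auto
    have "exp (ln (fact m) - (real m + 1/2) * l + real m) = fact (m - 1) * exp (- ((real m - 1/2) * l - real m))"
      unfolding lf by (simp add: exp_add[symmetric] exp_diff algebra_simps exp_minus field_simps)
    hence e1: "complex_of_real (exp (ln (fact m) - (real m + 1/2) * l + real m)) = fact (m - 1) * exp (- ((of_nat m - 1/2) * of_real l - of_nat m))"
      by (simp add: exp_of_real[symmetric])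
    have G: "Gamma (z + of_nat m) = pochhammer z m * Gamma z"
      using pochhammer_Gamma[OF z, of m] Gz by simp
    have "Gamma z / Gamma_series' z m = pochhammer z m * Gamma z / (fact (m - 1) * exp (z * of_real l))"
      unfolding Gamma_series'_def l_def by simp
    hence "Gamma z / Gamma_series' z m * complex_of_real (exp (ln (fact m) - (real m + 1/2) * l + real m))
       = Gamma (z + of_nat m) * (exp (- ((of_nat m - 1/2) * of_real l - of_nat m)) / exp (z * of_real l))"
      unfolding e1 G by simp
    also have "exp (- ((of_nat m - 1/2) * of_real l - of_nat m)) / exp (z * of_real l)
       = 1 / exp ((z + of_nat m - 1/2) * of_real l - of_nat m)"
      unfolding exp_minus[symmetric] inverse_eq_divide[symmetric] exp_diff[symmetric]
      by (simp add: algebra_simps exp_minus[symmetric])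
    finally show ?case unfolding l_def by simp
  qed
  show ?thesis using tendsto_cong[THEN iffD1, OF ev lim] .
qed

subsection \<open>A Gaussian limit\<close>

text \<open>The logarithmic series from the cubic term on is dominated by |z|^3 times a geometric
  series of ratio 1/2, whose sum is the constant 2.\<close>

lemma Ln_quadratic_bound:
  assumes z: "cmod z \<le> 1 / 2"
  shows "cmod (Ln (1 + z) - z + z\<^sup>2 / 2) \<le> 2 * cmod z ^ 3"
proof -
  have z1: "cmod z < 1" using z by simp
  define f where "f = (\<lambda>n. - ((-z)^n) / of_nat n)"
  have "f sums Ln (1 + z)" unfolding f_def using Ln_series'[OF z1] .
  hence "(\<lambda>n. f (n + 3)) sums (Ln (1 + z) - (\<Sum>n<3. f n))" by (rule sums_split_initial_segment)
  also have "(\<Sum>n<3. f n) = z - z\<^sup>2 / 2"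
    by (simp add: f_def numeral_3_eq_3 power2_eq_square)
  finally have s: "(\<lambda>n. f (n + 3)) sums (Ln (1 + z) - z + z\<^sup>2 / 2)" by (simp add: algebra_simps)
  have "cmod (f (n + 3)) \<le> cmod z ^ 3 * (1 / 2) ^ n" for n
  proof -
    have "cmod (f (n + 3)) = cmod z ^ (n + 3) / real (n + 3)"
      unfolding f_def norm_divide norm_minus_cancel norm_power norm_of_nat ..
    also have "\<dots> \<le> cmod z ^ (n + 3) / 1" by (intro divide_left_mono) auto
    also have "\<dots> = cmod z ^ 3 * cmod z ^ n" by (simp add: power_add mult.commute)
    also have "\<dots> \<le> cmod z ^ 3 * (1 / 2) ^ n" using z by (intro mult_left_mono power_mono) auto
    finally show ?thesis .
  qed
  moreover have "summable (\<lambda>n. cmod z ^ 3 * (1 / 2) ^ n)" by (intro summable_mult summable_geometric) simp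
  ultimately have "cmod (\<Sum>n. f (n + 3)) \<le> (\<Sum>n. cmod z ^ 3 * (1 / 2) ^ n)" by (rule norm_suminf_le)
  also have "\<dots> = cmod z ^ 3 * (\<Sum>n. (1 / 2) ^ n)" by (rule suminf_mult) (simp add: summable_geometric)
  also have "(\<Sum>n. (1 / 2 :: real) ^ n) = 2" by (subst suminf_geometric) auto
  finally show ?thesis using sums_unique[OF s] by (simp add: mult.commute)
qed

text \<open>\<open>m Ln (1 + i u / sqrt m) = i u sqrt m + u\<^sup>2 / 2 + O(1 / sqrt m)\<close>.\<close>
lemma gaussian_factor_limit:
  fixes u :: real and \<nu> :: complex
  shows "(\<lambda>m. exp (\<i> * of_real (sqrt (real m) * u) - (\<nu> + of_nat m) * Ln (1 + \<i> * of_real (u / sqrt (real m)))))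
     \<longlonglongrightarrow> of_real (exp (- u\<^sup>2 / 2))"
proof -
  define z where "z = (\<lambda>m::nat. \<i> * complex_of_real (u / sqrt (real m)))"
  have "(\<lambda>m::nat. u / sqrt (real m)) \<longlonglongrightarrow> 0" by real_asymp
  hence "(\<lambda>m. \<i> * complex_of_real (u / sqrt (real m))) \<longlonglongrightarrow> \<i> * of_real 0" by (intro tendsto_intros)
  hence zl: "z \<longlonglongrightarrow> 0" by (simp add: z_def)
  have "(\<lambda>m. Ln (1 + z m)) \<longlonglongrightarrow> Ln (1 + 0)" by (intro tendsto_intros zl) simp
  hence Ll: "(\<lambda>m. Ln (1 + z m)) \<longlonglongrightarrow> 0" by simp
  have R: "(\<lambda>m. of_nat m * (Ln (1 + z m) - z m + (z m)\<^sup>2 / 2)) \<longlonglongrightarrow> 0"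
  proof (rule Lim_null_comparison)
    have "eventually (\<lambda>m. cmod (z m) < 1 / 2) sequentially"
      using tendstoD[OF zl, of "1/2"] by (simp add: dist_norm)
    thus "eventually (\<lambda>m. cmod (of_nat m * (Ln (1 + z m) - z m + (z m)\<^sup>2 / 2)) \<le> real m * (2 * cmod (z m) ^ 3)) sequentially"
    proof eventually_elim
      case (elim m)
      hence "cmod (Ln (1 + z m) - z m + (z m)\<^sup>2 / 2) \<le> 2 * cmod (z m) ^ 3" by (intro Ln_quadratic_bound) simp
      thus ?case by (simp add: norm_mult mult_left_mono)
    qed
    have "cmod (z m) = \<bar>u\<bar> / sqrt (real m)" for m by (simp add: z_def norm_mult norm_divide)
    moreover have "(\<lambda>m::nat. real m * (2 * (\<bar>u\<bar> / sqrt (real m)) ^ 3)) \<longlonglongrightarrow> 0"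
    proof -
      have "(\<lambda>m::nat. real m * (2 * (1 / sqrt (real m)) ^ 3)) \<longlonglongrightarrow> 0" by real_asymp
      hence "(\<lambda>m::nat. \<bar>u\<bar> ^ 3 * (real m * (2 * (1 / sqrt (real m)) ^ 3))) \<longlonglongrightarrow> \<bar>u\<bar> ^ 3 * 0"
        by (rule tendsto_mult_left)
      thus ?thesis by (simp add: power_divide mult_ac)
    qed
    ultimately show "(\<lambda>m. real m * (2 * cmod (z m) ^ 3)) \<longlonglongrightarrow> 0" by simp
  qed
  have "(\<lambda>m. - of_real (u\<^sup>2) / 2 - \<nu> * Ln (1 + z m) - of_nat m * (Ln (1 + z m) - z m + (z m)\<^sup>2 / 2)) \<longlonglongrightarrow> - of_real (u\<^sup>2) / 2 - \<nu> * 0 - 0"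
    by (rule tendsto_diff[OF tendsto_diff[OF tendsto_const tendsto_mult_left[OF Ll]] R])
  hence E: "(\<lambda>m. exp (- of_real (u\<^sup>2) / 2 - \<nu> * Ln (1 + z m) - of_nat m * (Ln (1 + z m) - z m + (z m)\<^sup>2 / 2))) \<longlonglongrightarrow> exp (- of_real (u\<^sup>2) / 2 - \<nu> * 0 - 0)"
    by (rule tendsto_exp)
  have E2: "exp (- of_real (u\<^sup>2) / 2 - \<nu> * 0 - 0) = complex_of_real (exp (- u\<^sup>2 / 2))"
    by (simp add: exp_of_real[symmetric])
  have "eventually (\<lambda>m. exp (- of_real (u\<^sup>2) / 2 - \<nu> * Ln (1 + z m) - of_nat m * (Ln (1 + z m) - z m + (z m)\<^sup>2 / 2))
      = exp (\<i> * of_real (sqrt (real m) * u) - (\<nu> + of_nat m) * Ln (1 + \<i> * of_real (u / sqrt (real m))))) sequentially"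
    using eventually_gt_at_top[of 0]
  proof eventually_elim
    case (elim m)
    have sq: "sqrt (real m) * sqrt (real m) = real m" by simp
    have s0: "sqrt (real m) \<noteq> 0" using elim by simp
    define r where "r = u / sqrt (real m)"
    have zr: "z m = \<i> * of_real r" by (simp add: z_def r_def)
    have "real m * r = sqrt (real m) * u" using s0 sq by (simp add: r_def field_simps)
    from arg_cong[OF this, of complex_of_real]
    have 1: "of_nat m * z m = \<i> * of_real (sqrt (real m) * u)" unfolding zr by simp
    have "real m * r\<^sup>2 = u\<^sup>2" using elim by (simp add: r_def power_divide)
    from arg_cong[OF this, of complex_of_real]
    have 2: "of_nat m * (z m)\<^sup>2 = - of_real (u\<^sup>2)" unfolding zr by (simp add: power_mult_distrib)
    have "- of_real (u\<^sup>2) / 2 - \<nu> * Ln (1 + z m) - of_nat m * (Ln (1 + z m) - z m + (z m)\<^sup>2 / 2)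
      = - of_real (u\<^sup>2) / 2 - of_nat m * (z m)\<^sup>2 / 2 + of_nat m * z m - (\<nu> + of_nat m) * Ln (1 + z m)"
      by (simp add: algebra_simps)
    thus ?case unfolding 1 2 unfolding z_def by simp
  qed
  from Lim_transform_eventually[OF E this] show ?thesis unfolding E2 .
qed

text \<open>A majorant uniform in m. Its polynomial decay of order M suffices for the dominated
  limit once M exceeds the growth of the weight.\<close>

lemma gaussian_factor_bound:
  fixes u :: real and \<nu> :: complex and M m :: nat
  assumes M: "M > 0" "m \<ge> M" and nu: "Re \<nu> \<ge> 0"
  shows "cmod (exp (\<i> * of_real (sqrt (real m) * u) - (\<nu> + of_nat m) * Ln (1 + \<i> * of_real (u / sqrt (real m)))))
     \<le> exp (pi * \<bar>Im \<nu>\<bar>) * sqrt (2 * real M) ^ M * sqrt (2 * real M + u\<^sup>2) powr (- real M)"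
proof -
  have m0: "m > 0" using M by simp
  define w where "w = 1 + \<i> * complex_of_real (u / sqrt (real m))"
  have w0: "w \<noteq> 0" by (auto simp: w_def complex_eq_iff)
  have wn: "(cmod w)\<^sup>2 = 1 + u\<^sup>2 / real m"
    unfolding w_def cmod_power2 using m0 by (simp add: power_divide)
  have w1: "cmod w \<ge> 1"
  proof -
    have "1\<^sup>2 \<le> (cmod w)\<^sup>2" unfolding wn by simp
    thus ?thesis by (rule power2_le_imp_le) simp
  qed
  \<comment> \<open>Since m \<ge> M, the quotient satisfies q M \<le> m \<le> 2 q M. Bernoulli's
    inequality gives (1 + x/m)^q \<ge> 1 + x/(2M), and the M-th power is at most (1 + x/m)^m =
    |w|^(2m).\<close>
  define q where "q = m div M"
  have q1: "q \<ge> 1" unfolding q_def using M by (simp add: div_greater_zero_iff Suc_leI)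
  have qM: "q * M \<le> m" unfolding q_def by simp
  have mq: "m < (q + 1) * M" 
  proof -
    have "m = q * M + m mod M" unfolding q_def by simp
    moreover have "m mod M < M" using M(1) by simp
    ultimately show ?thesis unfolding add_mult_distrib by linarith
  qed
  have mq2: "m \<le> 2 * q * M" using mq q1 mult_le_mono1[of "q + 1" "2 * q" M] by linarith
  define x where "x = u\<^sup>2"
  have x0: "x \<ge> 0" by (simp add: x_def)
  have "1 + x / (2 * real M) \<le> 1 + real q * (x / real m)"
  proof -
    have "real m \<le> 2 * real q * real M" using mq2 by (metis of_nat_le_iff of_nat_mult of_nat_numeral)
    hence "x * real m \<le> x * (2 * real q * real M)" using x0 by (rule mult_left_mono)
    thus ?thesis using m0 M(1) by (simp add: field_simps)
  qed
  also have "\<dots> \<le> (1 + x / real m) ^ q" by (rule Bernoulli_inequality) (use x0 in \<open>simp add: order_trans[of _ 0]\<close>)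
  finally have "(1 + x / (2 * real M)) ^ M \<le> ((1 + x / real m) ^ q) ^ M"
    using x0 by (intro power_mono) auto
  also have "\<dots> = (1 + x / real m) ^ (q * M)" by (simp add: power_mult)
  also have "\<dots> \<le> (1 + x / real m) ^ m" using x0 qM by (intro power_increasing) auto
  finally have "(1 + x / (2 * real M)) ^ M \<le> ((cmod w) ^ m)\<^sup>2" unfolding wn[symmetric] x_def by (simp add: power_mult[symmetric] mult.commute)
  moreover have "(1 + x / (2 * real M)) ^ M = (sqrt (1 + x / (2 * real M)) ^ M)\<^sup>2"
  proof -
    have "(sqrt y ^ M)\<^sup>2 = y ^ M" if "y \<ge> 0" for y
    proof -
      have "(sqrt y ^ M)\<^sup>2 = ((sqrt y)\<^sup>2) ^ M" unfolding power_mult[symmetric] mult.commute[of M 2] ..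
      thus ?thesis using that by simp
    qed
    thus ?thesis using x0 by simp
  qed
  ultimately have "(sqrt (1 + x / (2 * real M)) ^ M)\<^sup>2 \<le> (cmod w ^ m)\<^sup>2" by (simp only:)
  hence pw: "sqrt (1 + x / (2 * real M)) ^ M \<le> cmod w ^ m" by (rule power2_le_imp_le) simp
  define r where "r = sqrt (1 + x / (2 * real M))"
  have r0: "r > 0" unfolding r_def using x0 by (simp add: add_pos_nonneg)
  have "Re (\<i> * of_real (sqrt (real m) * u) - (\<nu> + of_nat m) * Ln w) = - (Re \<nu> + real m) * ln (cmod w) + Im \<nu> * Im (Ln w)"
    using w0 by (simp add: Re_Ln algebra_simps)
  also have "\<dots> \<le> - real m * ln (cmod w) + \<bar>Im \<nu>\<bar> * pi"
  proof -
    have "Im \<nu> * Im (Ln w) \<le> \<bar>Im \<nu>\<bar> * \<bar>Im (Ln w)\<bar>" by (metis abs_ge_self abs_mult)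
    also have "\<dots> \<le> \<bar>Im \<nu>\<bar> * pi"
    proof -
      have "\<bar>Im (Ln w)\<bar> \<le> pi" using mpi_less_Im_Ln[OF w0] Im_Ln_le_pi[OF w0] by linarith
      thus ?thesis by (intro mult_left_mono) auto
    qed
    finally have "Im \<nu> * Im (Ln w) \<le> \<bar>Im \<nu>\<bar> * pi" .
    moreover have "0 \<le> Re \<nu> * ln (cmod w)" using nu w1 by simp
    ultimately show ?thesis by (simp add: algebra_simps)
  qed
  finally have "cmod (exp (\<i> * of_real (sqrt (real m) * u) - (\<nu> + of_nat m) * Ln w)) \<le> exp (\<bar>Im \<nu>\<bar> * pi + - (real m * ln (cmod w)))"
    by (simp add: norm_exp_eq_Re)
  also have "\<dots> = exp (pi * \<bar>Im \<nu>\<bar>) * inverse (cmod w ^ m)"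
    unfolding exp_add exp_minus using w0 by (simp add: exp_of_nat_mult mult.commute)
  also have "\<dots> \<le> exp (pi * \<bar>Im \<nu>\<bar>) * inverse (r ^ M)"
    using pw r0 unfolding r_def[symmetric] by (intro mult_left_mono le_imp_inverse_le) auto
  also have "inverse (r ^ M) = sqrt (2 * real M) ^ M * sqrt (2 * real M + u\<^sup>2) powr (- real M)"
  proof -
    have "r = sqrt (2 * real M + u\<^sup>2) / sqrt (2 * real M)"
      unfolding r_def x_def using M(1) by (simp add: real_sqrt_divide[symmetric] field_simps)
    moreover have "sqrt (2 * real M + u\<^sup>2) > 0" using M(1) by (simp add: add_pos_nonneg)
    ultimately show ?thesis by (simp add: powr_minus powr_realpow divide_inverse power_mult_distrib power_inverse mult.commute)
  qed
  finally show ?thesis unfolding w_def by (simp add: mult.assoc)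
qed

subsection \<open>The normalising constant\<close>

lemma card_pairs:
  "2 * real (card {(i::'n::{finite,linorder},j). i < j}) = real CARD('n) * (real CARD('n) - 1)"
proof -
  have "(\<Sum>a\<in>(UNIV::'n set). \<Sum>b\<in>UNIV-{a}. 1::real) = (\<Sum>a\<in>(UNIV::'n set). real CARD('n) - 1)"
    by (intro sum.cong) (simp_all add: card_Diff_singleton of_nat_diff Suc_leI)
  thus ?thesis using sum_pairs_sym[of "\<lambda>_ _::'n. 1"] by (simp add: case_prod_unfold)
qed

lemma om_scale:
  fixes t :: "(real,'n::{finite,linorder}) vec"
  assumes "c > 0"
  shows "om k (c *\<^sub>R t) = exp (ln c * (k * (real CARD('n) * (real CARD('n) - 1)))) * om k t"
proof -
  define P where "P = {(i::'n,j). i < j}"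
  have "om k (c *\<^sub>R t) = (\<Prod>(i,j)\<in>P. c powr (2 * k) * \<bar>t $ i - t $ j\<bar> powr (2 * k))"
    unfolding om_alt P_def[symmetric] using assms
    by (intro prod.cong) (auto simp: abs_mult powr_mult right_diff_distrib[symmetric])
  also have "\<dots> = (c powr (2 * k)) ^ card P * om k t"
    unfolding om_alt P_def[symmetric] by (simp add: prod.distrib case_prod_unfold)
  also have "(c powr (2 * k)) ^ card P = exp (ln c * (k * (2 * real (card P))))"
    using assms by (simp add: powr_def exp_of_nat_mult[symmetric] mult_ac)
  finally show ?thesis unfolding P_def card_pairs .
qed

lemma Delta_pow_scale:
  fixes z :: "(complex,'n::finite) vec"
  assumes r: "r > 0" and z: "\<And>i. z $ i \<noteq> 0"
  shows "Delta_pow (of_real r *s z) a = exp (of_nat CARD('n) * (a * of_real (ln r))) * Delta_pow z a"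
proof -
  have "Delta_pow (of_real r *s z) a = (\<Prod>i\<in>(UNIV::'n set). exp (a * of_real (ln r)) * z $ i powr a)"
    unfolding Delta_pow_def using r z
    by (intro prod.cong) (auto simp: powr_def Ln_times_of_real exp_add[symmetric] algebra_simps Ln_of_real)
  also have "\<dots> = exp (a * of_real (ln r)) ^ CARD('n) * Delta_pow z a"
    unfolding Delta_pow_def by (simp add: prod.distrib)
  finally show ?thesis by (simp add: exp_of_nat_mult)
qed

lemma cvec_constv: "cvec (constv r) = constv (of_real r)"
  by (simp add: vec_eq_iff constv_def)

context dunkl_mult
begin

lemma sum_ev_zero:
  "(\<Sum>i\<in>UNIV. ev k (\<lambda>_::'n::{finite,linorder}. 0) i) = - (k * (real CARD('n) * (real CARD('n) - 1)) / 2)"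
proof -
  have "(\<Sum>i\<in>(UNIV::'n set). card {j. i < j}) = card (Sigma (UNIV::'n set) (\<lambda>i. {j. i < j}))"
    by (rule card_SigmaI[symmetric]) auto
  also have "Sigma (UNIV::'n set) (\<lambda>i. {j. i < j}) = {(i,j). i < j}" by auto
  finally have "(\<Sum>i\<in>(UNIV::'n set). real (card {j. i < j})) = real (card {(i::'n,j). i < j})"
    by (metis of_nat_sum)
  moreover have "(\<Sum>i\<in>UNIV. ev k (\<lambda>_::'n. 0) i) = - k * (\<Sum>i\<in>(UNIV::'n set). real (card {j. i < j}))"
    unfolding ev_def prec_def by (simp add: sum_distrib_left sum_negf)
  ultimately show ?thesis using card_pairs[where 'n='n] by simp
qed

text \<open>The product of all coordinates is symmetric and satisfies z_i \<partial>_i D = D, so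
  every \<open>Yop\<close> acts on it by the eigenvalue for 0 plus 1.\<close>

lemma jackE_one: "jackE k (\<lambda>_::'n::{finite,linorder}. 1) z = (\<Prod>i\<in>UNIV. z $ i)"
proof -
  define D where "D = (\<lambda>z::(complex,'n) vec. \<Prod>i\<in>UNIV. z $ i)"
  have Dm: "D = mono_n (\<lambda>_. 1)" by (simp add: D_def mono_n_def fun_eq_iff)
  have h: "homog_poly (mdeg (\<lambda>_::'n. 1)) D" unfolding Dm by (rule homog_poly_mono)
  have Ds: "D (swapv i j z) = D z" for i j z
    unfolding swapv_pv D_def pv_nth by (rule prod.reindex_bij_betw) simp
  have dp: "z $ i * dpart i D z = D z" for i z
  proof -
    have "(\<lambda>t. D (cu i t z)) = (\<lambda>t. (\<Prod>l\<in>UNIV-{i}. z $ l) * t)"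
    proof
      fix t
      have "D (cu i t z) = t * (\<Prod>l\<in>UNIV-{i}. cu i t z $ l)"
        unfolding D_def by (subst prod.remove[of _ i]) auto
      also have "(\<Prod>l\<in>UNIV-{i}. cu i t z $ l) = (\<Prod>l\<in>UNIV-{i}. z $ l)" by (intro prod.cong) auto
      finally show "D (cu i t z) = (\<Prod>l\<in>UNIV-{i}. z $ l) * t" by simp
    qed
    hence "dpart i D z = (\<Prod>l\<in>UNIV-{i}. z $ l)"
      unfolding dpart_def cu_def[symmetric] by simp
    thus ?thesis unfolding D_def by (subst (2) prod.remove[of _ i]) auto
  qed
  have "eigf k (ev k (\<lambda>_::'n. 1)) D"
    unfolding eigf_def
  proof (intro conjI allI impI)
    show "holo_n D" using h homog_poly_holo by blast
    fix i :: 'n and z :: "(complex,'n) vec"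
    have "real CARD('n) - 1 = real (card {j. j < i}) + real (card {j. i < j})"
      using arg_cong[OF card_less_greater[of i], of real] by simp
    moreover have "dunklA k i D z = dpart i D z" unfolding dunklA_def Ds by simp
    ultimately show "Yop k i D z = of_real (ev k (\<lambda>_. 1) i + k * (real CARD('n) - 1)) * D z"
      unfolding Yop_def ev_def prec_def using dp[of z i] by (simp add: Ds algebra_simps)
  qed
  from eigf_unique[OF h this, of z] show ?thesis by (simp add: D_def constv_def)
qed

lemma Phi_Delta:
  fixes x :: "(real,'n::{finite,linorder}) vec"
  assumes s: "s > 0"
  shows "Phi s \<nu> (\<lambda>z. \<Prod>i\<in>UNIV. z $ i) x = Phi s (\<nu> + 1) (\<lambda>_. 1) x"
proof -
  have "(\<Prod>i\<in>UNIV. cinvv (zeta s t) $ i) * Delta_pow (zeta s t) (- \<nu>) = 1 * Delta_pow (zeta s t) (- (\<nu> + 1))" for t :: "(real,'n) vec"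
    unfolding Delta_pow_def prod.distrib[symmetric] mult_1_left
  proof (intro prod.cong refl)
    fix i
    define a where "a = zeta s t $ i"
    have "a powr (- \<nu> - 1) = a powr (-\<nu>) / a powr 1" using zeta_nz[OF s, of t i] by (intro powr_diff)
    moreover have "a powr 1 = a" using zeta_nz[OF s, of t i] by (simp add: a_def powr_def)
    ultimately show "cinvv (zeta s t) $ i * zeta s t $ i powr (-\<nu>) = zeta s t $ i powr (- (\<nu> + 1))"
      by (simp add: a_def[symmetric] del: zeta_nth)
  qed
  thus ?thesis unfolding Phi_def by (simp only:)
qed

section \<open>The constant \<open>phi0\<close>: shift in \<nu>, scaling, independence of s\<close>

definition phi0 :: "'n::{finite,linorder} itself \<Rightarrow> real \<Rightarrow> complex \<Rightarrow> complex" where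
  "phi0 _ s \<nu> = Phi s \<nu> (\<lambda>_. 1) (constv 1 :: (real,'n) vec)"

text \<open>This is \<open>Phi_jackE\<close> for the composition (1,...,1): its polynomial at
  1/\<zeta> is \<Delta>(\<zeta>)^(-1), which raises \<nu> by 1, and all entries of \<open>ev\<close>
  go up by 1.\<close>

lemma phi0_shift:
  assumes s: "s > 0" and nu: "Re \<nu> > 2 * k * (real CARD('n::{finite,linorder}) - 1) + 1"
  shows "Rg (\<nu> + 1) (\<lambda>_::'n. 0) * phi0 TYPE('n) s (\<nu> + 1) = Rg \<nu> (\<lambda>_::'n. 0) * phi0 TYPE('n) s \<nu>"
proof -
  have "ev k (\<lambda>_::'n. 1) i = 1 + ev k (\<lambda>_. 0) i" for i
    unfolding ev_def prec_def by simp
  hence "Rg \<nu> (\<lambda>_::'n. 1) = Rg (\<nu> + 1) (\<lambda>_::'n. 0)" unfolding Rg_def by (simp add: add.assoc)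
  moreover have "Phi s \<nu> (jackE k (\<lambda>_. 1)) (constv 1 :: (real,'n) vec) = phi0 TYPE('n) s (\<nu> + 1)"
    unfolding phi0_def Phi_Delta[OF s, symmetric] jackE_one[abs_def] ..
  moreover have "jackE k (\<lambda>_. 1) (cvec (constv 1 :: (real,'n) vec)) = 1"
    unfolding cvec_constv using jackE(3) by simp
  ultimately show ?thesis using Phi_jackE[OF s nu, of "\<lambda>_. 1" "constv 1"] by (simp add: phi0_def)
qed

lemma phi0_shift_nat:
  assumes s: "s > 0" and nu: "Re \<nu> > 2 * k * (real CARD('n::{finite,linorder}) - 1) + 1"
  shows "Rg (\<nu> + of_nat m) (\<lambda>_::'n. 0) * phi0 TYPE('n) s (\<nu> + of_nat m) = Rg \<nu> (\<lambda>_::'n. 0) * phi0 TYPE('n) s \<nu>"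
proof (induction m)
  case (Suc m)
  have "Re (\<nu> + of_nat m) > 2 * k * (real CARD('n) - 1) + 1" using nu by simp
  from phi0_shift[OF s this] show ?case using Suc by (simp add: add_ac)
qed simp

text \<open>Substitution t -> r t: the Jacobian gives r^n, the weight r^(kn(n-1)), \<Delta> gives
  r^(-n\<nu>), and the scale inside the exponential kernel passes to x = (r,...,r).\<close>

lemma phi0_rescale:
  assumes s: "s > 0" and r: "r > 0"
  defines "N \<equiv> real CARD('n::{finite,linorder})"
  shows "phi0 TYPE('n) (r * s) \<nu> = exp (of_real (ln r) * (of_real (N + k * (N * (N - 1))) - of_real N * \<nu>))
     * Phi s \<nu> (\<lambda>_. 1) (constv r :: (real,'n) vec)"
proof -
  define F where "F = (\<lambda>t::(real,'n) vec. Kf (cvec (constv 1)) (zeta (r * s) t) * (1 * Delta_pow (zeta (r * s) t) (-\<nu>)) * of_real (om k t))"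
  have rs: "r * s > 0" using r s by simp
  have [measurable]: "(\<lambda>t::(real,'n) vec. Delta_pow (zeta (r * s) t) (-\<nu>)) \<in> borel_measurable borel"
    "(\<lambda>t::(real,'n) vec. Kf (cvec (constv 1)) (zeta (r * s) t)) \<in> borel_measurable borel"
    by (rule measurable_Delta_zeta[OF rs]) (rule measurable_Kf_zeta)
  have Fm: "F \<in> borel_measurable borel" unfolding F_def by measurable
  define G where "G = (\<lambda>t::(real,'n) vec. Kf (cvec (constv r)) (zeta s t) * (1 * Delta_pow (zeta s t) (-\<nu>)) * of_real (om k t))"
  define c where "c = exp (of_nat CARD('n) * (- \<nu> * of_real (ln r))) * of_real (exp (ln r * (k * (N * (N - 1)))))"
  have "F (r *\<^sub>R t) = c * G t" for t
  proof -
    have z: "zeta (r * s) (r *\<^sub>R t) = of_real r *s zeta s t" by (simp add: vec_eq_iff algebra_simps)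
    have "Kf (cvec (constv 1)) (of_real r *s zeta s t) = Kf (cvec (constv r)) (zeta s t)"
      unfolding cvec_constv Kf_constv by (simp add: sum_distrib_left)
    thus ?thesis
      unfolding F_def G_def c_def z Delta_pow_scale[OF r zeta_nz[OF s]] om_scale[OF r] N_def by simp
  qed
  hence "phi0 TYPE('n) (r * s) \<nu> = of_real (r ^ CARD('n)) * (\<integral>t. c * G t \<partial>lborel)"
    unfolding phi0_def Phi_def F_def[symmetric] using integral_scale_vec[OF Fm r] by simp
  also have "\<dots> = of_real (r ^ CARD('n)) * c * Phi s \<nu> (\<lambda>_. 1) (constv r :: (real,'n) vec)"
    unfolding Phi_def G_def[symmetric] by simp
  also have "of_real (r ^ CARD('n)) * c = exp (of_real (ln r) * (of_real (N + k * (N * (N - 1))) - of_real N * \<nu>))"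
  proof -
    have "r ^ CARD('n) = exp (N * ln r)" unfolding N_def using r by (simp add: exp_of_nat_mult)
    thus ?thesis unfolding c_def by (simp add: exp_of_real[symmetric] exp_add[symmetric] N_def algebra_simps)
  qed
  finally show ?thesis .
qed

text \<open>The power of r from the rescaling and the one from \<open>Phi_1_formula\<close> at x =
  (r,...,r) are inverse to each other.\<close>

lemma phi0_indep:
  assumes s: "s > 0" "s' > 0" and nu: "Re \<nu> > 2 * k * (real CARD('n::{finite,linorder}) - 1) + 1"
  shows "phi0 TYPE('n) s' \<nu> = phi0 TYPE('n) s \<nu>"
proof -
  define r where "r = s' / s"
  define N where "N = real CARD('n)"
  have r: "r > 0" "s' = r * s" using s by (auto simp: r_def)
  have "Delta_pow (cvec (constv r :: (real,'n) vec)) a = exp (of_real N * (a * of_real (ln r)))" for a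
  proof -
    have "cvec (constv r :: (real,'n) vec) = of_real r *s constv 1" by (simp add: vec_eq_iff constv_def)
    moreover have "Delta_pow (constv 1 :: (complex,'n) vec) a = 1" by (simp add: Delta_pow_def constv_def)
    ultimately show ?thesis using Delta_pow_scale[OF r(1), of "constv 1 :: (complex,'n) vec" a]
      by (simp add: constv_def N_def)
  qed
  moreover have "\<forall>i. (constv r :: (real,'n) vec) $ i > 0" using r by (simp add: constv_def)
  ultimately have "Phi s \<nu> (\<lambda>_. 1) (constv r :: (real,'n) vec)
     = phi0 TYPE('n) s \<nu> * exp (of_real N * ((\<nu> - of_real (k * (N - 1)) - 1) * of_real (ln r)))"
    using Phi_1_formula[OF s(1) nu, of "constv r"] unfolding phi0_def N_def by simp
  moreover have "of_real (ln r) * (of_real (N + k * (N * (N - 1))) - of_real N * \<nu>)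
     = - (of_real N * ((\<nu> - of_real (k * (N - 1)) - 1) * of_real (ln r)))"
    by (simp add: algebra_simps)
  ultimately show ?thesis unfolding r(2) phi0_rescale[OF s(1) r(1)] N_def[symmetric]
    by (simp add: exp_minus)
qed

text \<open>The factor contributed by one coordinate to \<open>E\<^sup>A(\<one>, \<zeta>) \<Delta>(\<zeta>)\<^bsup>-\<nu>-m\<^esup>\<close> at \<open>\<zeta> = m + i \<surd>m u\<close>, up to powers
  of \<open>m\<close> and \<open>e\<close>.\<close>
definition gaussian_factor :: "complex \<Rightarrow> nat \<Rightarrow> real \<Rightarrow> complex" where
  "gaussian_factor \<nu> m u = exp (\<i> * of_real (sqrt (real m) * u) - (\<nu> + of_nat m) * Ln (1 + \<i> * of_real (u / sqrt (real m))))"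

lemma measurable_gaussian_factor [measurable]: "gaussian_factor \<nu> m \<in> borel_measurable borel"
  unfolding gaussian_factor_def divide_inverse
proof (intro borel_measurable_continuous_onI continuous_intros)
  fix u :: real
  show "1 + \<i> * complex_of_real (u * inverse (sqrt (real m))) \<notin> \<real>\<^sub>\<le>\<^sub>0"
    unfolding complex_nonpos_Reals_iff by simp
qed

lemma phi0_gaussian:
  assumes m: "m > 0"
  defines "N \<equiv> real CARD('n::{finite,linorder})"
  shows "phi0 TYPE('n) (real m) (\<nu> + of_nat m)
    = exp (of_real (ln (real m)) * (of_real (N / 2 + k * (N * (N - 1)) / 2) - of_real N * (\<nu> + of_nat m)) + of_real N * of_nat m)
     * (\<integral>u. (\<Prod>i\<in>UNIV. gaussian_factor \<nu> m (u $ i)) * of_real (om k u) \<partial>(lborel :: (real,'n) vec measure))"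
proof -
  define r where "r = sqrt (real m)"
  have r: "r > 0" "r * r = real m" "ln r = ln (real m) / 2" using m by (simp_all add: r_def ln_sqrt)
  define \<mu> where "\<mu> = \<nu> + of_nat m"
  define c where "c = exp (of_nat m - \<mu> * of_real (ln r))"
  have f: "exp (of_real r * zeta r u $ i) * zeta r u $ i powr (-\<mu>) = c * gaussian_factor \<nu> m (u $ i)" for u :: "(real,'n) vec" and i
  proof -
    define w where "w = 1 + \<i> * complex_of_real (u $ i / r)"
    have w: "zeta r u $ i = of_real r * w" "w \<noteq> 0" using r(1) by (simp_all add: w_def field_simps complex_eq_iff)
    have "of_real r * zeta r u $ i = complex_of_real (r * r) + \<i> * of_real (r * u $ i)" by (simp add: algebra_simps)
    hence e: "of_real r * zeta r u $ i = of_nat m + \<i> * of_real (r * u $ i)" unfolding r(2) by simp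
    have "zeta r u $ i powr (-\<mu>) = exp (- \<mu> * (of_real (ln r) + Ln w))"
      using w r(1) by (simp add: powr_def Ln_times_of_real Ln_of_real)
    hence "exp (of_real r * zeta r u $ i) * zeta r u $ i powr (-\<mu>)
       = exp ((of_nat m - \<mu> * of_real (ln r)) + (\<i> * of_real (r * u $ i) - \<mu> * Ln w))"
      unfolding e by (simp add: exp_add[symmetric] algebra_simps del: zeta_nth)
    also have "\<dots> = c * exp (\<i> * of_real (r * u $ i) - \<mu> * Ln w)" unfolding c_def by (rule exp_add)
    also have "exp (\<i> * of_real (r * u $ i) - \<mu> * Ln w) = gaussian_factor \<nu> m (u $ i)"
      unfolding gaussian_factor_def w_def r_def \<mu>_def ..
    finally show ?thesis .
  qed
  \<comment> \<open>Rescaling is used with plane and factor both equal to r = sqrt m: since r (r + i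
    u) = m + i r u, the linear term of the exponential is exactly the one in
    \<open>gaussian_factor\<close>.\<close>
  have "Phi r \<mu> (\<lambda>_. 1) (constv r :: (real,'n) vec) = (\<integral>u. c ^ CARD('n) * ((\<Prod>i\<in>UNIV. gaussian_factor \<nu> m (u $ i)) * of_real (om k u)) \<partial>(lborel :: (real,'n) vec measure))"
    unfolding Phi_def
  proof (rule Bochner_Integration.integral_cong[OF refl])
    fix u :: "(real,'n) vec"
    have "Kf (cvec (constv r)) (zeta r u) * (1 * Delta_pow (zeta r u) (-\<mu>)) = (\<Prod>i\<in>UNIV. c * gaussian_factor \<nu> m (u $ i))"
      unfolding cvec_constv Kf_constv f[symmetric] Delta_pow_def
      by (simp add: sum_distrib_left exp_sum prod.distrib del: zeta_nth)
    thus "Kf (cvec (constv r)) (zeta r u) * (1 * Delta_pow (zeta r u) (-\<mu>)) * of_real (om k u)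
      = c ^ CARD('n) * ((\<Prod>i\<in>UNIV. gaussian_factor \<nu> m (u $ i)) * of_real (om k u))"
      by (simp add: prod.distrib)
  qed
  hence P: "Phi r \<mu> (\<lambda>_. 1) (constv r :: (real,'n) vec) = c ^ CARD('n) * (\<integral>u. (\<Prod>i\<in>UNIV. gaussian_factor \<nu> m (u $ i)) * of_real (om k u) \<partial>(lborel :: (real,'n) vec measure))"
    by simp
  have "phi0 TYPE('n) (real m) \<mu> = exp (of_real (ln r) * (of_real (N + k * (N * (N - 1))) - of_real N * \<mu>)) * Phi r \<mu> (\<lambda>_. 1) (constv r :: (real,'n) vec)"
    using phi0_rescale[OF r(1) r(1), of \<mu>, where 'n='n] unfolding r(2) N_def .
  also have "\<dots> = exp (of_real (ln r) * (of_real (N + k * (N * (N - 1))) - of_real N * \<mu>)) * c ^ CARD('n)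
     * (\<integral>u. (\<Prod>i\<in>UNIV. gaussian_factor \<nu> m (u $ i)) * of_real (om k u) \<partial>(lborel :: (real,'n) vec measure))"
    unfolding P by (simp only: mult.assoc)
  also have "exp (of_real (ln r) * (of_real (N + k * (N * (N - 1))) - of_real N * \<mu>)) * c ^ CARD('n)
     = exp (of_real (ln r) * (of_real (N + k * (N * (N - 1))) - of_real N * \<mu>) + of_real N * (of_nat m - \<mu> * of_real (ln r)))"
    unfolding exp_add c_def N_def by (simp add: exp_of_nat_mult)
  also have "of_real (ln r) * (of_real (N + k * (N * (N - 1))) - of_real N * \<mu>) + of_real N * (of_nat m - \<mu> * of_real (ln r))
     = of_real (ln (real m)) * (of_real (N / 2 + k * (N * (N - 1)) / 2) - of_real N * \<mu>) + of_real N * of_nat m"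
    unfolding r(3) by (simp add: field_simps)
  finally show ?thesis unfolding \<mu>_def .
qed

text \<open>One dominated limit yields both claims: the pointwise limit of the integrands is the
  Gaussian times the weight, which is thereby integrable.\<close>

lemma gaussian_limit:
  assumes nu: "Re \<nu> \<ge> 0"
  shows "integrable lborel (\<lambda>u::(real,'n::{finite,linorder}) vec. exp (- (norm u)\<^sup>2 / 2) * om k u)"
    and "(\<lambda>m. \<integral>u. (\<Prod>i\<in>UNIV. gaussian_factor \<nu> m (u $ i)) * of_real (om k u) \<partial>(lborel :: (real,'n) vec measure)) \<longlonglongrightarrow> of_real (cA k TYPE('n))"
proof -
  obtain M :: nat where M: "real M > 2 * k * (real CARD('n) - 1) + 1" using reals_Archimedean2 by blast
  have "0 \<le> k * (real CARD('n) - 1)" using k by (intro mult_nonneg_nonneg) auto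
  hence M0: "M > 0" using M by (cases M) auto
  \<comment> \<open>With this \<sigma> the bound of \<open>gaussian_factor_bound\<close> is a
    multiple of |\<sigma> + i u|^(-M), so the product over the coordinates is a
    \<open>zprod\<close>, integrable against the weight by the choice of M.\<close>
  define \<sigma> where "\<sigma> = sqrt (2 * real M)"
  have \<sigma>: "\<sigma> > 0" "\<sigma>\<^sup>2 = 2 * real M" using M0 by (simp_all add: \<sigma>_def)
  define B where "B = exp (pi * \<bar>Im \<nu>\<bar>) * \<sigma> ^ M"
  define F where "F = (\<lambda>m (u::(real,'n) vec). (\<Prod>i\<in>UNIV. gaussian_factor \<nu> (m + M) (u $ i)) * complex_of_real (om k u))"
  define g where "g = (\<lambda>u::(real,'n) vec. (\<Prod>i\<in>UNIV. complex_of_real (exp (- (u $ i)\<^sup>2 / 2))) * complex_of_real (om k u))"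
  have gm: "g \<in> borel_measurable lborel" unfolding g_def by measurable
  have Fm: "F m \<in> borel_measurable lborel" for m unfolding F_def by measurable
  have w: "integrable lborel (\<lambda>u::(real,'n) vec. B ^ CARD('n) * (zprod \<sigma> (- real M) u * om k u))"
    by (intro integrable_mult_right integrable_om_zprod \<sigma> M)
  have lim: "AE u in lborel. (\<lambda>m. F m u) \<longlonglongrightarrow> g u"
  proof (rule AE_I2)
    fix u :: "(real,'n) vec"
    have "(\<lambda>m. gaussian_factor \<nu> (m + M) v) \<longlonglongrightarrow> of_real (exp (- v\<^sup>2 / 2))" for v
      using LIMSEQ_ignore_initial_segment[OF gaussian_factor_limit[of v \<nu>], of M] unfolding gaussian_factor_def by simp
    thus "(\<lambda>m. F m u) \<longlonglongrightarrow> g u" unfolding F_def g_def by (intro tendsto_intros) simp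
  qed
  have bd: "AE u in lborel. norm (F m u) \<le> B ^ CARD('n) * (zprod \<sigma> (- real M) u * om k u)" for m
  proof (rule AE_I2)
    fix u :: "(real,'n) vec"
    have "norm (\<Prod>i\<in>UNIV. gaussian_factor \<nu> (m + M) (u $ i)) = (\<Prod>i\<in>UNIV. norm (gaussian_factor \<nu> (m + M) (u $ i)))"
      by (rule prod_norm[symmetric])
    also have "\<dots> \<le> (\<Prod>i\<in>UNIV. B * cmod (zeta \<sigma> u $ i) powr (- real M))"
    proof (intro prod_mono conjI norm_ge_zero)
      fix i
      show "norm (gaussian_factor \<nu> (m + M) (u $ i)) \<le> B * cmod (zeta \<sigma> u $ i) powr (- real M)"
        unfolding zeta_norm \<sigma>(2) B_def unfolding \<sigma>_def gaussian_factor_def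
        by (rule gaussian_factor_bound[OF M0 _ nu]) simp
    qed
    also have "\<dots> = B ^ CARD('n) * zprod \<sigma> (- real M) u" by (simp add: prod.distrib zprod_def)
    finally show "norm (F m u) \<le> B ^ CARD('n) * (zprod \<sigma> (- real M) u * om k u)"
      unfolding F_def norm_mult mult.assoc[symmetric] by (simp add: mult_right_mono)
  qed
  have g: "g u = of_real (exp (- (norm u)\<^sup>2 / 2) * om k u)" for u
  proof -
    have "(norm u)\<^sup>2 = (\<Sum>i\<in>UNIV. (u $ i)\<^sup>2)"
      unfolding power2_norm_eq_inner inner_vec_def by (simp add: power2_eq_square)
    hence "exp (- (norm u)\<^sup>2 / 2) = (\<Prod>i\<in>UNIV. exp (- (u $ i)\<^sup>2 / 2))"
      by (simp add: exp_sum[symmetric] sum_divide_distrib sum_negf)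
    thus ?thesis unfolding g_def by simp
  qed
  have "integrable lborel g" by (rule integrable_dominated_convergence[OF gm Fm w lim bd])
  hence "integrable lborel (\<lambda>u. Re (g u))" by (rule integrable_Re)
  thus "integrable lborel (\<lambda>u::(real,'n) vec. exp (- (norm u)\<^sup>2 / 2) * om k u)" unfolding g by simp
  have "(\<lambda>m. integral\<^sup>L lborel (F m)) \<longlonglongrightarrow> integral\<^sup>L lborel g"
    by (rule integral_dominated_convergence[OF gm Fm w lim bd])
  moreover have "integral\<^sup>L lborel g = of_real (cA k TYPE('n))"
    unfolding g cA_def om_def by (rule integral_complex_of_real)
  ultimately have "(\<lambda>m. integral\<^sup>L lborel (F m)) \<longlonglongrightarrow> of_real (cA k TYPE('n))" by simp
  thus "(\<lambda>m. \<integral>u. (\<Prod>i\<in>UNIV. gaussian_factor \<nu> m (u $ i)) * of_real (om k u) \<partial>(lborel :: (real,'n) vec measure)) \<longlonglongrightarrow> of_real (cA k TYPE('n))"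
    unfolding F_def by (rule LIMSEQ_offset[where k=M])
qed

lemma cA_pos: "cA k TYPE('n::{finite,linorder}) > 0"
proof -
  define g where "g = (\<lambda>u::(real,'n) vec. exp (- (norm u)\<^sup>2 / 2) * om k u)"
  have int: "integrable lborel g" unfolding g_def by (rule gaussian_limit(1)[of 0]) simp
  have c: "cA k TYPE('n) = integral\<^sup>L lborel g" unfolding cA_def g_def om_def ..
  have nn: "AE u in lborel. 0 \<le> g u" unfolding g_def by simp
  have "integral\<^sup>L lborel g \<noteq> 0"
  proof
    assume "integral\<^sup>L lborel g = 0"
    hence "AE u in lborel. g u = 0" using integral_nonneg_eq_0_iff_AE[OF int nn] by simp
    hence "AE u in (lborel :: (real,'n) vec measure). False"
      using AE_distinct
    proof eventually_elim
      case (elim u)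
      have "g u > 0" unfolding g_def om_eq_omreg_0[OF elim(2)] omreg_def by simp
      thus ?case using elim by simp
    qed
    hence "emeasure (lborel :: (real,'n) vec measure) (space lborel) = 0"
      unfolding eventually_False ae_filter_eq_bot_iff .
    thus False by simp
  qed
  moreover have "integral\<^sup>L lborel g \<ge> 0" by (rule integral_nonneg_AE[OF nn])
  ultimately show ?thesis unfolding c by simp
qed

text \<open>By \<open>phi0_shift_nat\<close> and \<open>phi0_indep\<close> the left side may be
  evaluated at \<nu> + m on the plane s = m for every m > 0; being constant in m, it equals the
  limit of these expressions.\<close>

lemma phi0_value:
  assumes s: "s > 0" and nu: "Re \<nu> > 2 * k * (real CARD('n::{finite,linorder}) - 1) + 1"
  shows "Rg \<nu> (\<lambda>_::'n. 0) * phi0 TYPE('n) s \<nu> = of_real (sqrt (2 * pi)) ^ CARD('n) * of_real (cA k TYPE('n))"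
proof -
  define N where "N = real CARD('n)"
  define e where "e = ev k (\<lambda>_::'n. 0)"
  define g where "g = (\<lambda>m i. Gamma (\<nu> + of_real (e i) + of_nat m) / exp ((\<nu> + of_real (e i) + of_nat m - 1/2) * of_real (ln (real m)) - of_nat m))"
  define I where "I = (\<lambda>m. \<integral>u. (\<Prod>i\<in>UNIV. gaussian_factor \<nu> m (u $ i)) * of_real (om k u) \<partial>(lborel :: (real,'n) vec measure))"
  have "0 \<le> k * (real CARD('n) - 1)" using k by (intro mult_nonneg_nonneg) auto
  hence nu0: "Re \<nu> \<ge> 0" using nu by simp
  have "(\<lambda>m. (\<Prod>i\<in>UNIV. g m i) * I m) \<longlonglongrightarrow> (\<Prod>i\<in>(UNIV::'n set). of_real (sqrt (2 * pi))) * of_real (cA k TYPE('n))"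
    unfolding I_def
    by (intro tendsto_mult tendsto_prod gaussian_limit(2) nu0)
       (simp only: g_def, rule Gamma_shift_asymp, unfold e_def, rule nu_ev_pos[OF nu])
  moreover have "eventually (\<lambda>m. (\<Prod>i\<in>UNIV. g m i) * I m = Rg \<nu> (\<lambda>_::'n. 0) * phi0 TYPE('n) s \<nu>) sequentially"
    using eventually_gt_at_top[of 0]
  proof eventually_elim
    case (elim m)
    define l where "l = complex_of_real (ln (real m))"
    have m: "real m > 0" using elim by simp
    have num: "Re (\<nu> + of_nat m) > 2 * k * (real CARD('n) - 1) + 1" using nu by simp
    \<comment> \<open>The Stirling exponents add up to -E by \<open>sum_ev_zero\<close>, while the
      rescaled integral carries exp E. Hence the normalised Gamma factors times I m give exactly
      \<open>Rg\<close> times \<open>phi0\<close>.\<close>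
    define E where "E = l * (of_real (N / 2 + k * (N * (N - 1)) / 2) - of_real N * (\<nu> + of_nat m)) + of_real N * of_nat m"
    have "(\<Prod>i\<in>UNIV. g m i) = Rg (\<nu> + of_nat m) (\<lambda>_::'n. 0) / exp (\<Sum>i\<in>UNIV. (\<nu> + of_real (e i) + of_nat m - 1/2) * l - of_nat m)"
      unfolding g_def Rg_def l_def e_def by (simp add: prod_dividef exp_sum add_ac)
    also have "(\<Sum>i\<in>UNIV. (\<nu> + of_real (e i) + of_nat m - 1/2) * l - of_nat m)
      = (\<Sum>i\<in>(UNIV::'n set). (\<nu> + of_nat m - 1/2) * l - of_nat m) + of_real (\<Sum>i\<in>UNIV. e i) * l"
    proof -
      have "(\<nu> + of_real (e i) + of_nat m - 1/2) * l - of_nat m = ((\<nu> + of_nat m - 1/2) * l - of_nat m) + of_real (e i) * l" for i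
        by (simp add: algebra_simps)
      thus ?thesis by (simp only: of_real_sum sum_distrib_right sum.distrib)
    qed
    also have "(\<Sum>i\<in>UNIV. e i) = - (k * (N * (N - 1)) / 2)" unfolding e_def N_def by (rule sum_ev_zero)
    also have "(\<Sum>i\<in>(UNIV::'n set). (\<nu> + of_nat m - 1/2) * l - of_nat m) + of_real (- (k * (N * (N - 1)) / 2)) * l = - E"
      unfolding E_def N_def by (simp add: algebra_simps)
    finally have "(\<Prod>i\<in>UNIV. g m i) = Rg (\<nu> + of_nat m) (\<lambda>_::'n. 0) * exp E"
      by (simp add: exp_minus divide_inverse)
    moreover have "phi0 TYPE('n) s (\<nu> + of_nat m) = exp E * I m"
      unfolding phi0_indep[OF m s num] phi0_gaussian[OF elim] E_def l_def I_def N_def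
      using phi0_indep[OF m s num] phi0_gaussian[OF elim, where 'n='n] by simp
    ultimately show ?case using phi0_shift_nat[OF s nu, of m] by (simp add: mult.assoc)
  qed
  ultimately have "(\<lambda>m::nat. Rg \<nu> (\<lambda>_::'n. 0) * phi0 TYPE('n) s \<nu>) \<longlonglongrightarrow> (\<Prod>i\<in>(UNIV::'n set). of_real (sqrt (2 * pi))) * of_real (cA k TYPE('n))"
    by (rule Lim_transform_eventually)
  thus ?thesis by (simp add: LIMSEQ_const_iff)
qed

end

subsection \<open>Partitions\<close>

text \<open>The position of \<eta>_i in the sorted list \<open>part \<eta>\<close>, counted from 0;
  the tie rule of \<open>prec\<close> makes it a bijection.\<close>

definition rank_of :: "('n::{finite,linorder} \<Rightarrow> nat) \<Rightarrow> 'n \<Rightarrow> nat" where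
  "rank_of \<eta> i = card {j. prec \<eta> j i}"

lemma rank_of_less_iff: "rank_of \<eta> i < rank_of \<eta> j \<longleftrightarrow> prec \<eta> i j"
  unfolding rank_of_def by (metis less_irrefl not_less_iff_gr_or_eq prec_card prec_total)

lemma bij_rank_of: "bij_betw (rank_of \<eta>) UNIV {..<CARD('n)}" for \<eta> :: "'n::{finite,linorder} \<Rightarrow> nat"
proof -
  have inj: "inj (rank_of \<eta>)" by (rule injI) (metis less_irrefl prec_total rank_of_less_iff)
  have "rank_of \<eta> i < CARD('n)" for i
  proof -
    have "i \<notin> {j. prec \<eta> j i}" by simp
    thus ?thesis unfolding rank_of_def by (intro psubset_card_mono finite_class.finite_UNIV) blast
  qed
  hence "rank_of \<eta> ` UNIV \<subseteq> {..<CARD('n)}" by auto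
  moreover have "card (rank_of \<eta> ` UNIV) = card {..<CARD('n)}" using inj by (simp add: card_image)
  ultimately have "rank_of \<eta> ` UNIV = {..<CARD('n)}" by (intro card_subset_eq) auto
  thus ?thesis using inj by (simp add: bij_betw_def)
qed

lemma length_part [simp]: "length (part (\<eta> :: 'n::{finite,linorder} \<Rightarrow> nat)) = CARD('n)"
  by (simp add: part_def)

lemma mset_sorted_UNIV: "mset (sorted_list_of_set (UNIV :: 'n::{finite,linorder} set)) = mset_set UNIV"
  using mset_set_set[OF distinct_sorted_list_of_set[of "UNIV :: 'n set"]] by simp

text \<open>Listing the entries in the order of their ranks gives a decreasing list with the same
  multiset, and sorting is unique.\<close>

lemma part_rank_of: "part \<eta> ! rank_of \<eta> i = \<eta> i"
proof -
  define N where "N = CARD('a)"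
  define f where "f = inv_into UNIV (rank_of \<eta>)"
  have rf: "rank_of \<eta> (f m) = m" if "m < N" for m
    using bij_betw_inv_into_right[OF bij_rank_of[of \<eta>]] that by (simp add: f_def N_def)
  have fr: "f (rank_of \<eta> i) = i" for i
    using bij_betw_inv_into_left[OF bij_rank_of[of \<eta>]] by (simp add: f_def)
  define R where "R = map (\<lambda>m. \<eta> (f m)) [0..<N]"
  have "sorted (rev R)"
    unfolding sorted_rev_iff_nth_mono
  proof (intro allI impI)
    fix i j assume ij: "i \<le> j" "j < length R"
    show "R ! j \<le> R ! i"
    proof (cases "i = j")
      case False
      hence "rank_of \<eta> (f i) < rank_of \<eta> (f j)" using ij by (simp add: rf R_def)
      hence "prec \<eta> (f i) (f j)" by (simp add: rank_of_less_iff)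
      thus ?thesis using ij False unfolding prec_def by (auto simp: R_def)
    qed simp
  qed
  moreover have "mset (rev R) = mset (map \<eta> (sorted_list_of_set (UNIV :: 'a set)))"
  proof -
    have "bij_betw f {..<N} UNIV" unfolding f_def N_def by (rule bij_betw_inv_into[OF bij_rank_of])
    hence "image_mset f (mset_set {..<N}) = mset_set UNIV"
      by (simp add: image_mset_mset_set bij_betw_def)
    hence "image_mset \<eta> (mset_set UNIV) = image_mset \<eta> (image_mset f (mset_set {..<N}))" by simp
    thus ?thesis
      unfolding R_def by (simp add: mset_map mset_sorted_UNIV multiset.map_comp o_def mset_upt atLeast0LessThan)
  qed
  ultimately have "sort (map \<eta> (sorted_list_of_set (UNIV :: 'a set))) = rev R"
    by (intro properties_for_sort) auto
  hence "part \<eta> = R" by (simp add: part_def)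
  moreover have "rank_of \<eta> i < N" using bij_rank_of[of \<eta>] unfolding N_def bij_betw_def by auto
  ultimately show ?thesis by (simp add: R_def fr)
qed

lemma part_comp:
  assumes "bij \<sigma>"
  shows "part (\<eta> \<circ> \<sigma>) = part \<eta>"
proof -
  have "image_mset \<sigma> (mset_set UNIV) = mset_set UNIV"
    using assms by (simp add: image_mset_mset_set bij_def)
  hence "mset (map (\<eta> \<circ> \<sigma>) (sorted_list_of_set UNIV)) = mset (map \<eta> (sorted_list_of_set UNIV))"
    by (simp add: mset_map mset_sorted_UNIV multiset.map_comp[symmetric])
  hence "sort (map (\<eta> \<circ> \<sigma>) (sorted_list_of_set UNIV)) = sort (map \<eta> (sorted_list_of_set UNIV))"
    by (intro properties_for_sort) auto
  thus ?thesis by (simp add: part_def)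
qed

lemma part_eqE:
  fixes \<eta> \<xi> :: "'n::{finite,linorder} \<Rightarrow> nat"
  assumes "part \<eta> = part \<xi>"
  obtains \<sigma> where "bij \<sigma>" "\<xi> = \<eta> \<circ> \<sigma>"
proof
  define f where "f = inv_into UNIV (rank_of \<eta>)"
  have b: "bij_betw f {..<CARD('n)} UNIV" unfolding f_def by (rule bij_betw_inv_into[OF bij_rank_of])
  show "bij (f \<circ> rank_of \<xi>)" by (rule bij_betw_trans[OF bij_rank_of b])
  show "\<xi> = \<eta> \<circ> (f \<circ> rank_of \<xi>)"
  proof
    fix i
    have "rank_of \<xi> i < CARD('n)" using bij_rank_of[of \<xi>] unfolding bij_betw_def by auto
    hence "rank_of \<eta> (f (rank_of \<xi> i)) = rank_of \<xi> i"
      using bij_betw_inv_into_right[OF bij_rank_of[of \<eta>]] by (simp add: f_def)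
    thus "\<xi> i = (\<eta> \<circ> (f \<circ> rank_of \<xi>)) i"
      using part_rank_of[of \<eta> "f (rank_of \<xi> i)"] part_rank_of[of \<xi> i] assms by simp
  qed
qed

lemma part_mdeg:
  fixes \<eta> \<xi> :: "'n::{finite,linorder} \<Rightarrow> nat"
  shows "part \<eta> = part \<xi> \<Longrightarrow> mdeg \<eta> = mdeg \<xi>"
  by (erule part_eqE) (simp add: mdeg_perm)

lemma sum_part:
  fixes g :: "('n::{finite,linorder} \<Rightarrow> nat) \<Rightarrow> complex"
  shows "(\<Sum>lm\<in>partitions_of TYPE('n) p. \<Sum>\<eta>\<in>{\<eta>. part \<eta> = lm}. g \<eta>) = (\<Sum>\<eta>\<in>multi_of_deg p. g \<eta>)"
proof -
  have "{\<eta> :: 'n \<Rightarrow> nat. part \<eta> = lm} = {\<eta>. \<eta> \<in> multi_of_deg p \<and> part \<eta> = lm}" if "lm \<in> part ` (multi_of_deg p :: ('n \<Rightarrow> nat) set)" for lm :: "nat list"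
    using that part_mdeg by (fastforce simp: multi_of_deg_def)
  hence "(\<Sum>lm\<in>partitions_of TYPE('n) p. \<Sum>\<eta>\<in>{\<eta>. part \<eta> = lm}. g \<eta>)
     = (\<Sum>lm\<in>part ` (multi_of_deg p :: ('n \<Rightarrow> nat) set). \<Sum>\<eta>\<in>{\<eta>. \<eta> \<in> multi_of_deg p \<and> part \<eta> = lm}. g \<eta>)"
    unfolding partitions_of_def by (intro sum.cong) auto
  also have "\<dots> = (\<Sum>\<eta>\<in>multi_of_deg p. g \<eta>)"
    by (rule sum.image_gen[symmetric]) simp
  finally show ?thesis .
qed

context dunkl_mult
begin

lemma gamma_n_rank_of:
  fixes \<eta> :: "'n::{finite,linorder} \<Rightarrow> nat"
  shows "gamma_n k TYPE('n) zs = of_real (cA k TYPE('n) * (2 * pi) powr (- real CARD('n) / 2)) *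
     (\<Prod>i\<in>UNIV. Gamma (zs ! rank_of \<eta> i - of_real (k * real (rank_of \<eta> i))))"
  unfolding gamma_n_def
  by (subst prod.reindex_bij_betw[OF bij_rank_of[of \<eta>], of "\<lambda>j. Gamma (zs ! j - of_real (k * real j))"]) simp

lemma rank_of_less: "rank_of \<eta> i < CARD('n)" for i :: "'n::{finite,linorder}"
  using bij_rank_of[of \<eta>] unfolding bij_betw_def by auto

text \<open>The entry at position \<open>rank_of \<eta> i\<close> is \<eta>_i, and its shift is k
  times this 0-based position; so the Gamma argument is \<nu> +
  \<open>ev k \<eta> i\<close>.\<close>

lemma gamma_n_part:
  fixes \<eta> :: "'n::{finite,linorder} \<Rightarrow> nat"
  shows "gamma_n k TYPE('n) (map (\<lambda>l. \<nu> + of_nat l) (part \<eta>)) = of_real (cA k TYPE('n) * (2 * pi) powr (- real CARD('n) / 2)) * Rg \<nu> \<eta>"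
  unfolding gamma_n_rank_of[of _ \<eta>] Rg_def using rank_of_less[of \<eta>]
  by (simp add: part_rank_of ev_def rank_of_def[symmetric] add_diff_eq)

lemma gamma_n1_eq:
  "gamma_n1 k TYPE('n::{finite,linorder}) \<nu> = of_real (cA k TYPE('n) * (2 * pi) powr (- real CARD('n) / 2)) * Rg \<nu> (\<lambda>_::'n. 0)"
  unfolding gamma_n1_def gamma_n_rank_of[of _ "\<lambda>_::'n. 0"] Rg_def using rank_of_less[of "\<lambda>_::'n. 0"]
  by (simp add: ev_def rank_of_def[symmetric])

lemma gpoch_eq:
  "gpoch k TYPE('n::{finite,linorder}) \<nu> (part (\<eta> :: 'n \<Rightarrow> nat)) = Rg \<nu> \<eta> / Rg \<nu> (\<lambda>_::'n. 0)"
proof -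
  have "complex_of_real (cA k TYPE('n) * (2 * pi) powr (- real CARD('n) / 2)) \<noteq> 0"
    using cA_pos[where 'n='n] by simp
  thus ?thesis unfolding gpoch_def gamma_n_part gamma_n1_eq by simp
qed

subsection \<open>The non-symmetric case\<close>

text \<open>The degree p part with L_\<eta> = \<open>jc \<eta>\<close> times
  \<open>jackE k \<eta>\<close> inserted. One \<open>jc\<close> cancels against L_\<eta>(1); with
  x/0 = 0 the identity jc^2/jc = jc holds for jc = 0 as well.\<close>

definition scrE_term :: "complex \<Rightarrow> (complex,'n::{finite,linorder}) vec \<Rightarrow> (complex,'n) vec \<Rightarrow> nat \<Rightarrow> complex" where
  "scrE_term \<nu> w z p = (\<Sum>\<eta>\<in>multi_of_deg p. (-1) ^ p * (Rg \<nu> (\<lambda>_::'n. 0) / Rg \<nu> \<eta>) * (jc \<eta> / fact p * (jackE k \<eta> w * jackE k \<eta> z)))"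

lemma scrE_scrE_term: "scrE k \<nu> w z = (\<Sum>p. scrE_term \<nu> w z p)"
  unfolding scrE_def scrE_term_def gpoch_eq nsjack_eq
  by (intro suminf_cong sum.cong refl) (simp add: jackE(3) mult_ac)

definition laplace_integrand :: "real \<Rightarrow> complex \<Rightarrow> (complex,'n::{finite,linorder}) vec \<Rightarrow> (real,'n) vec \<Rightarrow> (real,'n) vec \<Rightarrow> complex" where
  "laplace_integrand s \<nu> w x t = Kf (cvec x) (zeta s t) * Kf w (- cinvv (zeta s t)) * Delta_pow (zeta s t) (- \<nu>) * of_real (om k t)"

lemma phi0_nz:
  assumes s: "s > 0" and nu: "Re \<nu> > 2 * k * (real CARD('n::{finite,linorder}) - 1) + 1"
  shows "phi0 TYPE('n) s \<nu> \<noteq> 0"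
  using phi0_value[OF s nu] cA_pos[where 'n='n] by auto

lemma Phi_1_nz:
  fixes x :: "(real,'n::{finite,linorder}) vec"
  assumes s: "s > 0" and nu: "Re \<nu> > 2 * k * (real CARD('n) - 1) + 1" and x: "\<forall>i. x $ i > 0"
  shows "Phi s \<nu> (\<lambda>_. 1) x \<noteq> 0"
proof -
  have "x $ i \<noteq> 0" for i using x by (metis less_irrefl)
  hence "Delta_pow (cvec x) a \<noteq> 0" for a by (simp add: Delta_pow_def)
  thus ?thesis using phi0_nz[OF s nu] Phi_1_formula[OF s nu x] by (simp add: phi0_def)
qed

text \<open>On the plane |1/\<zeta>_i| \<le> 1/s, so by \<open>Kp_bound\<close> the degree p term is
  at most c^p/p! times the integrand for q = 1, and sum and integral may be exchanged. The form
  \<open>sums\<close> also provides the convergence of the series.\<close>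

lemma laplace_integrand_integral:
  fixes x :: "(real,'n::{finite,linorder}) vec"
  assumes s: "s > 0" and nu: "Re \<nu> > 2 * k * (real CARD('n) - 1) + 1" and x: "\<forall>i. x $ i > 0"
  shows "integrable lborel (laplace_integrand s \<nu> w x)"
    and "scrE_term \<nu> w (cvec x) sums ((\<integral>t. laplace_integrand s \<nu> w x t \<partial>lborel) / Phi s \<nu> (\<lambda>_. 1) x)"
proof -
  define A where "A = (\<lambda>p t. (-1) ^ p * (Kf (cvec x) (zeta s t) * (Kp p w (cinvv (zeta s t)) * Delta_pow (zeta s t) (-\<nu>)) * of_real (om k t)))"
  define g where "g = (\<lambda>t. Kf (cvec x) (zeta s t) * (1 * Delta_pow (zeta s t) (-\<nu>)) * complex_of_real (om k t))"
  define c where "c = nrm w * (real CARD('n) * (1 / s))"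
  have gi: "integrable lborel g" unfolding g_def by (rule Phi_integrand[OF s nu]) blast
  have Ai: "integrable lborel (A p)" for p
    unfolding A_def by (intro integrable_mult_right Phi_integrand[OF s nu] Kp_holo)
  have Ab: "norm (A p t) \<le> c ^ p / fact p * norm (g t)" for p t
  proof -
    have "nrm (cinvv (zeta s t)) \<le> (\<Sum>i\<in>(UNIV::'n set). 1 / s)"
      unfolding nrm_def by (intro sum_mono cinvv_zeta_le s)
    hence "nrm w * nrm (cinvv (zeta s t)) \<le> c" unfolding c_def by (intro mult_left_mono) auto
    hence "(nrm w * nrm (cinvv (zeta s t))) ^ p / fact p \<le> c ^ p / fact p"
      by (intro divide_right_mono power_mono) auto
    hence "cmod (Kp p w (cinvv (zeta s t))) \<le> c ^ p / fact p" using Kp_bound order_trans by blast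
    hence "cmod (Kp p w (cinvv (zeta s t))) * norm (g t) \<le> c ^ p / fact p * norm (g t)" by (rule mult_right_mono) simp
    thus ?thesis unfolding A_def g_def by (simp add: norm_mult norm_power mult_ac)
  qed
  have As: "AE t in lborel. summable (\<lambda>p. norm (A p t))"
  proof (rule AE_I2)
    fix t
    show "summable (\<lambda>p. norm (A p t))"
      by (rule summable_comparison_test'[OF summable_mult2[OF exp_series_summable[of c], of "norm (g t)"], of 0]) (use Ab[of _ t] in simp)
  qed
  have Ins: "summable (\<lambda>p. \<integral>t. norm (A p t) \<partial>lborel)"
  proof (rule summable_comparison_test'[of _ 0])
    show "summable (\<lambda>p. c ^ p / fact p * (\<integral>t. norm (g t) \<partial>lborel))"
      by (intro summable_mult2 exp_series_summable)
    fix p :: nat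
    have "(\<integral>t. norm (A p t) \<partial>lborel) \<le> (\<integral>t. c ^ p / fact p * norm (g t) \<partial>lborel)"
      by (intro integral_mono integrable_norm Ai integrable_mult_right gi Ab)
    thus "norm (\<integral>t. norm (A p t) \<partial>lborel) \<le> c ^ p / fact p * (\<integral>t. norm (g t) \<partial>lborel)" by simp
  qed
  have AL: "(\<lambda>p. A p t) sums laplace_integrand s \<nu> w x t" for t
  proof -
    have n: "- cinvv (zeta s t) = (-1) *s cinvv (zeta s t)" by (simp add: vec_eq_iff)
    have "(\<lambda>p. (-1) ^ p * Kp p w (cinvv (zeta s t))) sums Kf w (- cinvv (zeta s t))"
      unfolding n Kp_scale_right[symmetric] by (rule Kp_sums)
    from sums_mult[OF this, of "Kf (cvec x) (zeta s t) * Delta_pow (zeta s t) (-\<nu>) * of_real (om k t)"]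
    show ?thesis unfolding A_def laplace_integrand_def by (simp add: mult_ac)
  qed
  hence L: "laplace_integrand s \<nu> w x = (\<lambda>t. \<Sum>p. A p t)" by (auto simp: sums_iff)
  show "integrable lborel (laplace_integrand s \<nu> w x)" unfolding L by (rule integrable_suminf[OF Ai As Ins])
  have "(\<lambda>p. integral\<^sup>L lborel (A p)) sums (\<integral>t. laplace_integrand s \<nu> w x t \<partial>lborel)"
    unfolding L by (rule sums_integral[OF Ai As Ins])
  moreover have "integral\<^sup>L lborel (A p) = scrE_term \<nu> w (cvec x) p * Phi s \<nu> (\<lambda>_. 1) x" for p
  proof -
    have P: "Phi s \<nu> (jackE k \<eta>) x = Rg \<nu> (\<lambda>_::'n. 0) / Rg \<nu> \<eta> * jackE k \<eta> (cvec x) * Phi s \<nu> (\<lambda>_. 1) x" for \<eta> :: "'n \<Rightarrow> nat"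
      using Phi_jackE[OF s nu, of \<eta> x] Rg_nz[OF nu, of \<eta>] by (simp add: field_simps)
    have "integral\<^sup>L lborel (A p) = (-1) ^ p * Phi s \<nu> (Kp p w) x" unfolding A_def Phi_def by simp
    also have "Kp p w = (\<lambda>z. \<Sum>\<eta>\<in>multi_of_deg p. (jc \<eta> / fact p * jackE k \<eta> w) * jackE k \<eta> z)"
      by (simp add: Kp_def fun_eq_iff mult.assoc)
    also have "Phi s \<nu> \<dots> x = (\<Sum>\<eta>\<in>multi_of_deg p. (jc \<eta> / fact p * jackE k \<eta> w) * Phi s \<nu> (jackE k \<eta>) x)"
      by (intro Phi_sum s nu jackE_holo)
    finally show ?thesis unfolding P scrE_term_def by (simp add: sum_distrib_left sum_distrib_right mult_ac)
  qed
  ultimately have "(\<lambda>p. scrE_term \<nu> w (cvec x) p * Phi s \<nu> (\<lambda>_. 1) x) sums (\<integral>t. laplace_integrand s \<nu> w x t \<partial>lborel)" by simp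
  from sums_divide[OF this, of "Phi s \<nu> (\<lambda>_. 1) x"]
  show "scrE_term \<nu> w (cvec x) sums ((\<integral>t. laplace_integrand s \<nu> w x t \<partial>lborel) / Phi s \<nu> (\<lambda>_. 1) x)"
    using Phi_1_nz[OF s nu x] by simp
qed

text \<open>Gamma_n(\<nu>) contributes c_A (2\<pi>)^(-n/2) times the Gamma product, \<Phi>_1 at
  (1,...,1) contributes c_A (2\<pi>)^(n/2) divided by it; this accounts for c_A^2.\<close>

lemma constant_factor:
  fixes x :: "(real,'n::{finite,linorder}) vec"
  assumes s: "s > 0" and nu: "Re \<nu> > 2 * k * (real CARD('n) - 1) + 1" and x: "\<forall>i. x $ i > 0"
  shows "gamma_n1 k TYPE('n) \<nu> / of_real ((cA k TYPE('n))\<^sup>2) * Phi s \<nu> (\<lambda>_. 1) x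
    = Delta_pow (cvec x) (\<nu> - of_real (k * (real CARD('n) - 1)) - 1)"
proof -
  define c where "c = complex_of_real (cA k TYPE('n))"
  define P where "P = (2 * pi) powr (- real CARD('n) / 2)"
  have c0: "c \<noteq> 0" using cA_pos[where 'n='n] by (simp add: c_def)
  have "P * sqrt (2 * pi) ^ CARD('n) = 1"
  proof -
    have "sqrt (2 * pi) ^ CARD('n) = (2 * pi) powr (real CARD('n) / 2)"
      by (simp add: powr_half_sqrt[symmetric] powr_realpow[symmetric] powr_powr)
    thus ?thesis unfolding P_def by (simp add: powr_add[symmetric])
  qed
  hence P: "complex_of_real P * of_real (sqrt (2 * pi)) ^ CARD('n) = 1"
    by (metis of_real_1 of_real_mult of_real_power)
  have "gamma_n1 k TYPE('n) \<nu> / of_real ((cA k TYPE('n))\<^sup>2) * phi0 TYPE('n) s \<nu>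
     = (c * of_real P) / c\<^sup>2 * (Rg \<nu> (\<lambda>_::'n. 0) * phi0 TYPE('n) s \<nu>)"
    unfolding gamma_n1_eq c_def P_def by simp
  also have "\<dots> = (c * of_real P) / c\<^sup>2 * (of_real (sqrt (2 * pi)) ^ CARD('n) * c)"
    unfolding phi0_value[OF s nu] c_def ..
  also have "\<dots> = complex_of_real P * of_real (sqrt (2 * pi)) ^ CARD('n)"
    using c0 by (simp add: power2_eq_square)
  finally have "gamma_n1 k TYPE('n) \<nu> / of_real ((cA k TYPE('n))\<^sup>2) * phi0 TYPE('n) s \<nu> = 1" unfolding P .
  thus ?thesis unfolding Phi_1_formula[OF s nu x] phi0_def mult.assoc[symmetric] by (simp only: mult_1_left)
qed

subsection \<open>The symmetric case\<close>

text \<open>The symmetrised Jack polynomial. It has the value 1 at (1,...,1), and by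
  \<open>jack_average_part\<close> it depends only on the partition.\<close>

definition jack_average :: "('n::{finite,linorder} \<Rightarrow> nat) \<Rightarrow> (complex,'n) vec \<Rightarrow> complex" where
  "jack_average \<eta> z = (\<Sum>\<sigma>\<in>{\<sigma>. \<sigma> permutes UNIV}. jackE k \<eta> (pv \<sigma> z)) / of_nat (fact CARD('n))"

lemma sum_permutes_swap:
  "(\<Sum>\<sigma>\<in>{\<sigma>. \<sigma> permutes UNIV}. f (\<sigma> \<circ> tr a b)) = (\<Sum>\<sigma>\<in>{\<sigma>. \<sigma> permutes UNIV}. f \<sigma>)"
  by (rule sum.reindex_bij_witness[of _ "\<lambda>\<sigma>. \<sigma> \<circ> tr a b" "\<lambda>\<sigma>. \<sigma> \<circ> tr a b"])
     (auto simp: comp_assoc permutes_UNIV_iff_bij intro: bij_comp)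

text \<open>Averaging does not see the reflection in \<open>jackE_swap\<close>; the nonzero factor 1
  + \<gamma> can then be cancelled.\<close>

lemma jack_average_adj:
  assumes ab: "adj a b"
  shows "jack_average (\<eta> \<circ> tr a b) z = jack_average \<eta> z"
proof (cases "\<eta> a = \<eta> b")
  case True
  have "\<eta> \<circ> tr a b = \<eta>" using True by (auto simp: fun_eq_iff Transposition.transpose_def)
  thus ?thesis by simp
next
  case False
  define S where "S = (\<lambda>\<xi>. \<Sum>\<sigma>\<in>{\<sigma>. \<sigma> permutes UNIV}. jackE k \<xi> (pv \<sigma> z))"
  have "S \<eta> = (\<Sum>\<sigma>\<in>{\<sigma>. \<sigma> permutes UNIV}. jackE k \<eta> (pv (\<sigma> \<circ> tr a b) z))"
    unfolding S_def by (rule sum_permutes_swap[symmetric])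
  also have "\<dots> = (\<Sum>\<sigma>\<in>{\<sigma>. \<sigma> permutes UNIV}. jackE k \<eta> (swapv a b (pv \<sigma> z)))"
    by (simp add: swapv_pv pv_pv)
  also have "\<dots> = - gam a b \<eta> * S \<eta> + (1 + gam a b \<eta>) * S (\<eta> \<circ> tr a b)"
    unfolding jackE_swap[OF ab] S_def by (simp add: sum.distrib sum_distrib_left sum_subtractf sum_negf)
  finally have "(1 + gam a b \<eta>) * S (\<eta> \<circ> tr a b) = (1 + gam a b \<eta>) * S \<eta>" by (simp add: algebra_simps)
  hence "S (\<eta> \<circ> tr a b) = S \<eta>" using gam_nz[OF _ False] ab by (simp add: adj_def)
  thus ?thesis unfolding jack_average_def S_def by simp
qed

lemma jack_average_part:
  fixes \<eta> \<xi> :: "'n::{finite,linorder} \<Rightarrow> nat"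
  assumes "part \<eta> = part \<xi>"
  shows "jack_average \<eta> z = jack_average \<xi> z"
proof -
  obtain \<sigma> where \<sigma>: "bij \<sigma>" "\<xi> = \<eta> \<circ> \<sigma>" using part_eqE[OF assms] by blast
  have "\<sigma> permutes UNIV" using \<sigma>(1) by (simp add: permutes_UNIV_iff_bij)
  hence "\<forall>\<eta>. jack_average (\<eta> \<circ> \<sigma>) z = jack_average \<eta> z"
  proof (induction rule: adj_generate)
    case id
    show ?case by simp
  next
    case (adj a b)
    thus ?case by (simp add: jack_average_adj del: o_apply)
  next
    case (comp \<sigma> \<tau>)
    thus ?case by (metis comp_assoc)
  qed
  thus ?thesis unfolding \<sigma>(2) by simp
qed

text \<open>The sum of the L_\<eta> over one orbit, as candidate for C_\<lambda>. Its symmetry rests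
  on the relation \<open>jc_swap\<close> between the coefficients.\<close>

definition sym_jack :: "nat list \<Rightarrow> (complex,'n::{finite,linorder}) vec \<Rightarrow> complex" where
  "sym_jack lm z = (\<Sum>\<eta>\<in>{\<eta>. part \<eta> = lm}. jc \<eta> * jackE k \<eta> z)"

lemma sym_jack_swapv:
  fixes z :: "(complex,'n::{finite,linorder}) vec"
  assumes ab: "adj a b"
  shows "sym_jack lm (swapv a b z) = sym_jack lm z"
proof -
  define h where "h = (\<lambda>\<eta>. jc \<eta> * (1 + gam a b \<eta>))"
  have h: "h (\<eta> \<circ> tr a b) = h \<eta>" for \<eta> using jc_swap[OF ab, of \<eta>] by (simp add: h_def)
  have "sym_jack lm (swapv a b z) = (\<Sum>\<eta>\<in>{\<eta>. part \<eta> = lm}. - jc \<eta> * gam a b \<eta> * jackE k \<eta> z) + (\<Sum>\<eta>\<in>{\<eta>. part \<eta> = lm}. h (\<eta> \<circ> tr a b) * jackE k (\<eta> \<circ> tr a b) z)"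
    unfolding sym_jack_def jackE_swap[OF ab] h unfolding h_def sum.distrib[symmetric]
    by (intro sum.cong refl) (simp add: algebra_simps)
  also have "(\<Sum>\<eta>\<in>{\<eta>. part \<eta> = lm}. h (\<eta> \<circ> tr a b) * jackE k (\<eta> \<circ> tr a b) z) = (\<Sum>\<eta>\<in>{\<eta>. part \<eta> = lm}. h \<eta> * jackE k \<eta> z)"
    by (rule sum.reindex_bij_witness[of _ "\<lambda>\<eta>. \<eta> \<circ> tr a b" "\<lambda>\<eta>. \<eta> \<circ> tr a b"])
       (auto simp: comp_assoc part_comp)
  finally show ?thesis unfolding sym_jack_def h_def sum.distrib[symmetric] by (simp add: algebra_simps)
qed

lemma sym_jack_pv:
  fixes z :: "(complex,'n::{finite,linorder}) vec"
  assumes "\<sigma> permutes UNIV"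
  shows "sym_jack lm (pv \<sigma> z) = sym_jack lm z"
proof -
  have "\<forall>z. sym_jack lm (pv \<sigma> z) = sym_jack lm z"
    using assms
  proof (induction rule: adj_generate)
    case id
    show ?case by simp
  next
    case (adj a b)
    thus ?case by (simp add: sym_jack_swapv swapv_pv[symmetric])
  next
    case (comp \<sigma> \<tau>)
    thus ?case by (metis pv_pv)
  qed
  thus ?thesis by blast
qed

lemma sym_jack_sum: "(\<Sum>lm\<in>partitions_of TYPE('n) p. sym_jack lm z) = (\<Sum>i\<in>UNIV. z $ i) ^ p"
  for z :: "(complex,'n::{finite,linorder}) vec"
  unfolding sym_jack_def sum_part jc_sum ..

text \<open>For uniqueness, write a competitor with coefficients a. Summed over all partitions it
  expands the power of the coordinate sum, so independence forces a jc = jc; only this product, not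
  a itself, enters the polynomial.\<close>

lemma sjack_eq: "sjack k TYPE('n::{finite,linorder}) = sym_jack"
  unfolding sjack_def
proof (rule the_equality)
  show "(\<forall>lm. (\<forall>\<sigma> z. \<sigma> permutes (UNIV :: 'n set) \<longrightarrow> sym_jack lm (permv \<sigma> z) = sym_jack lm z) \<and>
          (\<exists>a. sym_jack lm = (\<lambda>z::(complex,'n) vec. \<Sum>\<eta>\<in>{\<eta>. part \<eta> = lm}. a \<eta> * nsjack k \<eta> z))) \<and>
      (\<forall>p (z::(complex,'n) vec). (\<Sum>lm\<in>partitions_of TYPE('n) p. sym_jack lm z) = (\<Sum>i\<in>UNIV. z $ i) ^ p)"
  proof (intro conjI allI impI)
    fix lm \<sigma> and z :: "(complex,'n) vec" assume "\<sigma> permutes (UNIV :: 'n set)"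
    thus "sym_jack lm (permv \<sigma> z) = sym_jack lm z" unfolding permv_pv by (intro sym_jack_pv permutes_inv)
  next
    fix lm show "\<exists>a. sym_jack lm = (\<lambda>z::(complex,'n) vec. \<Sum>\<eta>\<in>{\<eta>. part \<eta> = lm}. a \<eta> * nsjack k \<eta> z)"
      unfolding sym_jack_def[abs_def] nsjack_eq by (intro exI[of _ "\<lambda>_. 1"]) simp
  qed (rule sym_jack_sum)
next
  fix C :: "nat list \<Rightarrow> (complex,'n) vec \<Rightarrow> complex"
  assume C: "(\<forall>lm. (\<forall>\<sigma> z. \<sigma> permutes (UNIV :: 'n set) \<longrightarrow> C lm (permv \<sigma> z) = C lm z) \<and>
          (\<exists>a. C lm = (\<lambda>z. \<Sum>\<eta>\<in>{\<eta>. part \<eta> = lm}. a \<eta> * nsjack k \<eta> z))) \<and>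
      (\<forall>p z. (\<Sum>lm\<in>partitions_of TYPE('n) p. C lm z) = (\<Sum>i\<in>UNIV. z $ i) ^ p)"
  hence "\<forall>lm. \<exists>a. C lm = (\<lambda>z. \<Sum>\<eta>\<in>{\<eta>. part \<eta> = lm}. a \<eta> * nsjack k \<eta> z)" by blast
  then obtain a where "\<And>lm. C lm = (\<lambda>z. \<Sum>\<eta>\<in>{\<eta>. part \<eta> = lm}. a lm \<eta> * nsjack k \<eta> z)"
    by (auto dest!: choice)
  hence a: "C lm = (\<lambda>z. \<Sum>\<eta>\<in>{\<eta>. part \<eta> = lm}. a (part \<eta>) \<eta> * jc \<eta> * jackE k \<eta> z)" for lm
    unfolding nsjack_eq by (auto simp: mult.assoc intro!: sum.cong)
  have aj: "a (part \<eta>) \<eta> * jc \<eta> = jc \<eta>" for \<eta> :: "'n \<Rightarrow> nat"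
  proof (rule jackE_coeff_unique[OF finite_multi_of_deg[of "mdeg \<eta>"], where c="\<lambda>\<eta>. a (part \<eta>) \<eta> * jc \<eta>" and d=jc])
    fix z :: "(complex,'n) vec"
    have "(\<Sum>\<eta>\<in>multi_of_deg (mdeg \<eta>). a (part \<eta>) \<eta> * jc \<eta> * jackE k \<eta> z) = (\<Sum>lm\<in>partitions_of TYPE('n) (mdeg \<eta>). C lm z)"
      unfolding a by (rule sum_part[symmetric])
    also have "\<dots> = (\<Sum>i\<in>UNIV. z $ i) ^ mdeg \<eta>" using C by blast
    finally show "(\<Sum>\<eta>\<in>multi_of_deg (mdeg \<eta>). a (part \<eta>) \<eta> * jc \<eta> * jackE k \<eta> z) = (\<Sum>\<eta>\<in>multi_of_deg (mdeg \<eta>). jc \<eta> * jackE k \<eta> z)"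
      unfolding jc_sum .
  qed (simp add: multi_of_deg_def)
  show "C = sym_jack"
  proof (intro ext)
    fix lm z show "C lm z = sym_jack lm z" unfolding a sym_jack_def aj ..
  qed
qed

text \<open>A symmetric polynomial equals its own average, which may be taken term by term.\<close>

lemma sym_jack_jack_average:
  fixes z :: "(complex,'n::{finite,linorder}) vec"
  shows "sym_jack lm z = (\<Sum>\<eta>\<in>{\<eta>. part \<eta> = lm}. jc \<eta> * jack_average \<eta> z)"
proof -
  define S where "S = {\<sigma>. \<sigma> permutes (UNIV :: 'n set)}"
  have cS: "card S = fact CARD('n)" unfolding S_def by (rule card_permutations) auto
  define X where "X = (\<lambda>\<eta>. \<Sum>\<sigma>\<in>S. jackE k \<eta> (pv \<sigma> z))"
  have "of_nat (fact CARD('n)) * sym_jack lm z = (\<Sum>\<sigma>\<in>S. sym_jack lm (pv \<sigma> z))"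
    using cS by (simp add: sym_jack_pv S_def)
  also have "\<dots> = (\<Sum>\<eta>\<in>{\<eta>. part \<eta> = lm}. jc \<eta> * X \<eta>)"
    unfolding sym_jack_def X_def sum_distrib_left by (rule sum.swap)
  also have "\<dots> = of_nat (fact CARD('n)) * (\<Sum>\<eta>\<in>{\<eta>. part \<eta> = lm}. jc \<eta> * jack_average \<eta> z)"
    unfolding sum_distrib_left by (intro sum.cong refl) (simp add: jack_average_def S_def X_def)
  finally show ?thesis by simp
qed

text \<open>All \<^term>\<open>jack_average \<eta>\<close> with \<^term>\<open>part \<eta> = lm\<close> coincide, so that the symmetric Jack polynomial is
  \<^term>\<open>sym_jack lm (constv 1)\<close> times their common value. Hence a vanishing denominator does no harm.\<close>
lemma sym_jack_product:
  fixes z w :: "(complex,'n::{finite,linorder}) vec"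
  shows "sym_jack lm w * sym_jack lm z / (c * sym_jack lm (constv 1 :: (complex,'n) vec))
     = (\<Sum>\<eta>\<in>{\<eta> :: 'n \<Rightarrow> nat. part \<eta> = lm}. jc \<eta> / c * (jack_average \<eta> w * jack_average \<eta> z))"
proof (cases "\<exists>\<xi> :: 'n \<Rightarrow> nat. part \<xi> = lm")
  case True
  then obtain \<xi> :: "'n \<Rightarrow> nat" where \<xi>: "part \<xi> = lm" ..
  have q: "jack_average \<eta> z = jack_average \<xi> z" if "part \<eta> = lm" for \<eta> :: "'n \<Rightarrow> nat" and z
    using jack_average_part[of \<eta> \<xi> z] that \<xi> by simp
  define J where "J = (\<Sum>\<eta>\<in>{\<eta> :: 'n \<Rightarrow> nat. part \<eta> = lm}. jc \<eta>)"
  have s: "sym_jack lm z = J * jack_average \<xi> z" for z :: "(complex,'n) vec"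
    unfolding sym_jack_jack_average J_def sum_distrib_right by (intro sum.cong) (auto simp: q)
  have c1: "sym_jack lm (constv 1 :: (complex,'n) vec) = J" unfolding sym_jack_def jackE(3) J_def by simp
  have "(\<Sum>\<eta>\<in>{\<eta> :: 'n \<Rightarrow> nat. part \<eta> = lm}. jc \<eta> / c * (jack_average \<eta> w * jack_average \<eta> z)) = J / c * (jack_average \<xi> w * jack_average \<xi> z)"
    unfolding J_def sum_divide_distrib sum_distrib_right by (intro sum.cong) (auto simp: q)
  thus ?thesis unfolding c1 unfolding s by simp
next
  case False
  hence e: "{\<eta> :: 'n \<Rightarrow> nat. part \<eta> = lm} = {}" by blast
  show ?thesis unfolding sym_jack_def e by simp
qed

text \<open>Permuting w and z independently turns each product of two Jack polynomials into a
  product of two averages; grouping by partitions and \<open>sym_jack_product\<close> then give the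
  symmetric series. The sums L may depend on both permutations.\<close>

lemma scrJ_average:
  fixes w z :: "(complex,'n::{finite,linorder}) vec"
  assumes "\<And>\<sigma> \<tau>. \<sigma> permutes (UNIV :: 'n set) \<Longrightarrow> \<tau> permutes (UNIV :: 'n set) \<Longrightarrow> scrE_term \<nu> (pv \<tau> w) (pv \<sigma> z) sums L \<sigma> \<tau>"
  shows "scrJ k \<nu> w z = (\<Sum>\<sigma>\<in>{\<sigma>. \<sigma> permutes UNIV}. \<Sum>\<tau>\<in>{\<tau>. \<tau> permutes UNIV}. L \<sigma> \<tau>) / (of_nat (fact CARD('n)))\<^sup>2"
proof -
  define S where "S = {\<sigma>. \<sigma> permutes (UNIV :: 'n set)}"
  define F where "F = (of_nat (fact CARD('n)) :: complex)"
  have "(\<lambda>p. (\<Sum>\<sigma>\<in>S. \<Sum>\<tau>\<in>S. scrE_term \<nu> (pv \<tau> w) (pv \<sigma> z) p) / F\<^sup>2) sums ((\<Sum>\<sigma>\<in>S. \<Sum>\<tau>\<in>S. L \<sigma> \<tau>) / F\<^sup>2)"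
    by (intro sums_divide sums_sum assms) (auto simp: S_def)
  moreover have "(\<Sum>\<sigma>\<in>S. \<Sum>\<tau>\<in>S. scrE_term \<nu> (pv \<tau> w) (pv \<sigma> z) p) / F\<^sup>2
     = (\<Sum>lm\<in>partitions_of TYPE('n) p. (-1) ^ p / gpoch k TYPE('n) \<nu> lm *
      (sjack k TYPE('n) lm w * sjack k TYPE('n) lm z / (of_nat (fact p) * sjack k TYPE('n) lm (constv 1))))" for p
  proof -
    have j: "(\<Sum>\<sigma>\<in>S. jackE k \<eta> (pv \<sigma> z)) = F * jack_average \<eta> z" for \<eta> and z :: "(complex,'n) vec"
      unfolding jack_average_def S_def F_def by simp
    define cf where "cf = (\<lambda>\<eta>::'n\<Rightarrow>nat. (-1) ^ p * (Rg \<nu> (\<lambda>_::'n. 0) / Rg \<nu> \<eta>) * (jc \<eta> / fact p))"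
    have "(\<Sum>\<sigma>\<in>S. \<Sum>\<tau>\<in>S. scrE_term \<nu> (pv \<tau> w) (pv \<sigma> z) p)
       = (\<Sum>\<sigma>\<in>S. \<Sum>\<tau>\<in>S. \<Sum>\<eta>\<in>multi_of_deg p. cf \<eta> * (jackE k \<eta> (pv \<tau> w) * jackE k \<eta> (pv \<sigma> z)))"
      unfolding scrE_term_def cf_def by (simp add: mult.assoc)
    also have "\<dots> = (\<Sum>\<sigma>\<in>S. \<Sum>\<eta>\<in>multi_of_deg p. \<Sum>\<tau>\<in>S. cf \<eta> * (jackE k \<eta> (pv \<tau> w) * jackE k \<eta> (pv \<sigma> z)))"
      by (intro sum.cong refl sum.swap)
    also have "\<dots> = (\<Sum>\<eta>\<in>multi_of_deg p. \<Sum>\<sigma>\<in>S. \<Sum>\<tau>\<in>S. cf \<eta> * (jackE k \<eta> (pv \<tau> w) * jackE k \<eta> (pv \<sigma> z)))"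
      by (rule sum.swap)
    also have "\<dots> = (\<Sum>\<eta>\<in>multi_of_deg p. cf \<eta> * ((\<Sum>\<sigma>\<in>S. jackE k \<eta> (pv \<sigma> z)) * (\<Sum>\<tau>\<in>S. jackE k \<eta> (pv \<tau> w))))"
      unfolding sum_product unfolding sum_distrib_left by (intro sum.cong refl) simp
    also have "\<dots> = (\<Sum>\<eta>\<in>multi_of_deg p. (-1) ^ p / gpoch k TYPE('n) \<nu> (part \<eta>) * (jc \<eta> / of_nat (fact p) * (jack_average \<eta> w * jack_average \<eta> z))) * F\<^sup>2"
      unfolding j sum_distrib_right gpoch_eq cf_def by (intro sum.cong refl) (simp add: power2_eq_square)
    finally have "(\<Sum>\<sigma>\<in>S. \<Sum>\<tau>\<in>S. scrE_term \<nu> (pv \<tau> w) (pv \<sigma> z) p) / F\<^sup>2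
      = (\<Sum>\<eta>\<in>multi_of_deg p. (-1) ^ p / gpoch k TYPE('n) \<nu> (part \<eta>) * (jc \<eta> / of_nat (fact p) * (jack_average \<eta> w * jack_average \<eta> z)))"
      by (simp add: F_def)
    also have "\<dots> = (\<Sum>lm\<in>partitions_of TYPE('n) p. \<Sum>\<eta>\<in>{\<eta>. part \<eta> = lm}. (-1) ^ p / gpoch k TYPE('n) \<nu> (part \<eta>) * (jc \<eta> / of_nat (fact p) * (jack_average \<eta> w * jack_average \<eta> z)))"
      by (rule sum_part[symmetric])
    also have "\<dots> = (\<Sum>lm\<in>partitions_of TYPE('n) p. (-1) ^ p / gpoch k TYPE('n) \<nu> lm * (\<Sum>\<eta>\<in>{\<eta>. part \<eta> = lm}. jc \<eta> / of_nat (fact p) * (jack_average \<eta> w * jack_average \<eta> z)))"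
      by (simp add: sum_distrib_left)
    finally show ?thesis unfolding sjack_eq sym_jack_product .
  qed
  ultimately show ?thesis unfolding scrJ_def S_def F_def by (simp add: sums_iff)
qed

subsection \<open>Laplace inversion\<close>

lemma line_integral_laplace_integrand:
  fixes w :: "(complex,'n::{finite,linorder}) vec"
  shows "line_integral_n s (\<lambda>\<zeta>. dunkl_kernel_A k (cvec x) \<zeta> * dunkl_kernel_A k w (- cinvv \<zeta>)
               * Delta_pow \<zeta> (- \<nu>) * complex_of_real (omegaA k \<zeta>)) = \<i> ^ CARD('n) * (\<integral>t. laplace_integrand s \<nu> w x t \<partial>lborel)"
  unfolding line_integral_n_def zeta_def[symmetric] dunkl_kernel_eq omegaA_zeta laplace_integrand_def ..

text \<open>Equivariance moves the permutations from \<zeta> to the parameter. In the integral they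
  then act on x and w only, and the non-symmetric result applies to every pair of permuted
  arguments.\<close>

lemma bessel_eq: "bessel_A k lam z = (\<Sum>\<sigma>\<in>{\<sigma>. \<sigma> permutes (UNIV :: 'n set)}. Kf (pv \<sigma> lam) z) / of_nat (fact CARD('n))"
  for z :: "(complex,'n::{finite,linorder}) vec"
  unfolding bessel_A_def dunkl_kernel_eq permv_pv
  by (intro arg_cong2[of _ _ _ _ "(/)"] sum.cong refl) (simp add: Kf_pv_left permutes_UNIV_iff_bij)

lemma line_integral_bessel:
  fixes w :: "(complex,'n::{finite,linorder}) vec"
  assumes s: "s > 0" and nu: "Re \<nu> > 2 * k * (real CARD('n) - 1) + 1" and x: "\<forall>i. x $ i > 0"
  shows "line_integral_n s (\<lambda>\<zeta>. bessel_A k (cvec x) \<zeta> * bessel_A k w (- cinvv \<zeta>)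
               * Delta_pow \<zeta> (- \<nu>) * complex_of_real (omegaA k \<zeta>))
     = \<i> ^ CARD('n) * ((\<Sum>\<sigma>\<in>{\<sigma>. \<sigma> permutes UNIV}. \<Sum>\<tau>\<in>{\<tau>. \<tau> permutes UNIV}. \<integral>t. laplace_integrand s \<nu> (pv \<tau> w) (pv \<sigma> x) t \<partial>lborel) / (of_nat (fact CARD('n)))\<^sup>2)"
proof -
  define S where "S = {\<sigma>. \<sigma> permutes (UNIV :: 'n set)}"
  define F where "F = (of_nat (fact CARD('n)) :: complex)"
  have xp: "\<forall>i. pv \<sigma> x $ i > 0" for \<sigma> using x by simp
  have "bessel_A k (cvec x) (zeta s t) * bessel_A k w (- cinvv (zeta s t)) * Delta_pow (zeta s t) (- \<nu>) * complex_of_real (om k t)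
     = (\<Sum>\<sigma>\<in>S. \<Sum>\<tau>\<in>S. laplace_integrand s \<nu> (pv \<tau> w) (pv \<sigma> x) t) / F\<^sup>2" for t
  proof -
    have e: "A / F * (B / F) * d * c = (A * B * d * c) / F\<^sup>2" for A B c d by (simp add: power2_eq_square)
    show ?thesis
      unfolding bessel_eq laplace_integrand_def S_def[symmetric] F_def[symmetric] cvec_pv e
      unfolding sum_product unfolding sum_distrib_right ..
  qed
  hence "line_integral_n s (\<lambda>\<zeta>. bessel_A k (cvec x) \<zeta> * bessel_A k w (- cinvv \<zeta>)
               * Delta_pow \<zeta> (- \<nu>) * complex_of_real (omegaA k \<zeta>))
     = \<i> ^ CARD('n) * (\<integral>t. (\<Sum>\<sigma>\<in>S. \<Sum>\<tau>\<in>S. laplace_integrand s \<nu> (pv \<tau> w) (pv \<sigma> x) t) / F\<^sup>2 \<partial>lborel)"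
    unfolding line_integral_n_def zeta_def[symmetric] omegaA_zeta by simp
  also have "(\<integral>t. (\<Sum>\<sigma>\<in>S. \<Sum>\<tau>\<in>S. laplace_integrand s \<nu> (pv \<tau> w) (pv \<sigma> x) t) / F\<^sup>2 \<partial>lborel)
     = (\<integral>t. (\<Sum>\<sigma>\<in>S. \<Sum>\<tau>\<in>S. laplace_integrand s \<nu> (pv \<tau> w) (pv \<sigma> x) t) \<partial>lborel) / F\<^sup>2"
    by (rule integral_divide_zero)
  also have "(\<integral>t. (\<Sum>\<sigma>\<in>S. \<Sum>\<tau>\<in>S. laplace_integrand s \<nu> (pv \<tau> w) (pv \<sigma> x) t) \<partial>lborel) = (\<Sum>\<sigma>\<in>S. \<Sum>\<tau>\<in>S. \<integral>t. laplace_integrand s \<nu> (pv \<tau> w) (pv \<sigma> x) t \<partial>lborel)"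
  proof -
    have i: "integrable lborel (laplace_integrand s \<nu> (pv \<tau> w) (pv \<sigma> x))" for \<sigma> \<tau>
      by (rule laplace_integrand_integral(1)[OF s nu xp])
    have "(\<integral>t. (\<Sum>\<sigma>\<in>S. \<Sum>\<tau>\<in>S. laplace_integrand s \<nu> (pv \<tau> w) (pv \<sigma> x) t) \<partial>lborel) = (\<Sum>\<sigma>\<in>S. \<integral>t. (\<Sum>\<tau>\<in>S. laplace_integrand s \<nu> (pv \<tau> w) (pv \<sigma> x) t) \<partial>lborel)"
      by (intro Bochner_Integration.integral_sum Bochner_Integration.integrable_sum i)
    also have "\<dots> = (\<Sum>\<sigma>\<in>S. \<Sum>\<tau>\<in>S. \<integral>t. laplace_integrand s \<nu> (pv \<tau> w) (pv \<sigma> x) t \<partial>lborel)"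
      by (intro sum.cong refl Bochner_Integration.integral_sum i)
    finally show ?thesis .
  qed
  finally show ?thesis unfolding S_def F_def .
qed

lemma laplace_inversion:
  fixes w :: "(complex,'n::{finite,linorder}) vec"
  assumes s: "s > 0" and nu: "Re \<nu> > 2 * k * (real CARD('n) - 1) + 1" and x: "\<forall>i. x $ i > 0"
  shows "scrE k \<nu> w (cvec x) * Delta_pow (cvec x) (\<nu> - of_real (k * (real CARD('n) - 1)) - 1)
          = gamma_n1 k TYPE('n) \<nu> / (of_real ((cA k TYPE('n))\<^sup>2) * \<i> ^ CARD('n)) *
            line_integral_n s (\<lambda>\<zeta>. dunkl_kernel_A k (cvec x) \<zeta> * dunkl_kernel_A k w (- cinvv \<zeta>)
               * Delta_pow \<zeta> (- \<nu>) * of_real (omegaA k \<zeta>))"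
    and "scrJ k \<nu> w (cvec x) * Delta_pow (cvec x) (\<nu> - of_real (k * (real CARD('n) - 1)) - 1)
          = gamma_n1 k TYPE('n) \<nu> / (of_real ((cA k TYPE('n))\<^sup>2) * \<i> ^ CARD('n)) *
            line_integral_n s (\<lambda>\<zeta>. bessel_A k (cvec x) \<zeta> * bessel_A k w (- cinvv \<zeta>)
               * Delta_pow \<zeta> (- \<nu>) * of_real (omegaA k \<zeta>))"
proof -
  define \<Phi> where "\<Phi> = Phi s \<nu> (\<lambda>_. 1) x"
  define I where "I = (\<lambda>(w :: (complex,'n) vec) x. \<integral>t. laplace_integrand s \<nu> w x t \<partial>lborel)"
  have \<Phi>0: "\<Phi> \<noteq> 0" unfolding \<Phi>_def by (rule Phi_1_nz[OF s nu x])
  \<comment> \<open>By \<open>constant_factor\<close> the prefactor times \<Phi> is the power of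
    \<Delta>. It remains to recognise each integral as the respective series times \<Phi>.\<close>
  have fin: "A * Delta_pow (cvec x) (\<nu> - of_real (k * (real CARD('n) - 1)) - 1)
     = gamma_n1 k TYPE('n) \<nu> / (of_real ((cA k TYPE('n))\<^sup>2) * \<i> ^ CARD('n)) * (\<i> ^ CARD('n) * (A * \<Phi>))" for A
    unfolding constant_factor[OF s nu x, symmetric] \<Phi>_def by simp
  have "scrE k \<nu> w (cvec x) = I w x / \<Phi>"
    unfolding scrE_scrE_term I_def \<Phi>_def using laplace_integrand_integral(2)[OF s nu x, of w] by (simp add: sums_iff)
  thus "scrE k \<nu> w (cvec x) * Delta_pow (cvec x) (\<nu> - of_real (k * (real CARD('n) - 1)) - 1)
          = gamma_n1 k TYPE('n) \<nu> / (of_real ((cA k TYPE('n))\<^sup>2) * \<i> ^ CARD('n)) *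
            line_integral_n s (\<lambda>\<zeta>. dunkl_kernel_A k (cvec x) \<zeta> * dunkl_kernel_A k w (- cinvv \<zeta>)
               * Delta_pow \<zeta> (- \<nu>) * of_real (omegaA k \<zeta>))"
    unfolding line_integral_laplace_integrand fin using \<Phi>0 by (simp add: I_def)
  have xp: "\<forall>i. pv \<sigma> x $ i > 0" for \<sigma> using x by simp
  have "Phi s \<nu> (\<lambda>_. 1) (pv \<sigma> x) = \<Phi>" if "\<sigma> permutes UNIV" for \<sigma>
    unfolding \<Phi>_def using Phi_pv[OF s holo_n_const, of \<sigma>] that by (simp add: permutes_UNIV_iff_bij)
  hence t: "scrE_term \<nu> (pv \<tau> w) (pv \<sigma> (cvec x)) sums (I (pv \<tau> w) (pv \<sigma> x) / \<Phi>)" if "\<sigma> permutes UNIV" for \<sigma> \<tau>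
    unfolding cvec_pv[symmetric] I_def using laplace_integrand_integral(2)[OF s nu xp[of \<sigma>], of "pv \<tau> w"] that by simp
  have "scrJ k \<nu> w (cvec x) = (\<Sum>\<sigma>\<in>{\<sigma>. \<sigma> permutes UNIV}. \<Sum>\<tau>\<in>{\<tau>. \<tau> permutes UNIV}. I (pv \<tau> w) (pv \<sigma> x) / \<Phi>) / (of_nat (fact CARD('n)))\<^sup>2"
    by (rule scrJ_average) (rule t)
  also have "\<dots> = (\<Sum>\<sigma>\<in>{\<sigma>. \<sigma> permutes UNIV}. \<Sum>\<tau>\<in>{\<tau>. \<tau> permutes UNIV}. I (pv \<tau> w) (pv \<sigma> x)) / (of_nat (fact CARD('n)))\<^sup>2 / \<Phi>"
    by (simp add: sum_divide_distrib mult.commute)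
  finally show "scrJ k \<nu> w (cvec x) * Delta_pow (cvec x) (\<nu> - of_real (k * (real CARD('n) - 1)) - 1)
          = gamma_n1 k TYPE('n) \<nu> / (of_real ((cA k TYPE('n))\<^sup>2) * \<i> ^ CARD('n)) *
            line_integral_n s (\<lambda>\<zeta>. bessel_A k (cvec x) \<zeta> * bessel_A k w (- cinvv \<zeta>)
               * Delta_pow \<zeta> (- \<nu>) * of_real (omegaA k \<zeta>))"
    unfolding line_integral_bessel[OF s nu x] fin using \<Phi>0 by (simp add: I_def)
qed

end

theorem theorem4p5:
  fixes k :: real and \<nu> :: complex and w :: "(complex, 'n::{finite,linorder}) vec"
    and x :: "(real, 'n) vec" and s :: real
  assumes "k \<ge> 0"
    and "Re \<nu> > 2 * (k * (real CARD('n) - 1)) + 1"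
    and "\<forall>i. x $ i > 0"
    and "s > 0"
  shows "(scrE k \<nu> w (cvec x) * Delta_pow (cvec x) (\<nu> - complex_of_real (k * (real CARD('n) - 1)) - 1)
          = gamma_n1 k TYPE('n) \<nu> / (complex_of_real ((cA k TYPE('n))\<^sup>2) * \<i> ^ CARD('n)) *
            line_integral_n s (\<lambda>\<zeta>. dunkl_kernel_A k (cvec x) \<zeta> * dunkl_kernel_A k w (- cinvv \<zeta>)
               * Delta_pow \<zeta> (- \<nu>) * complex_of_real (omegaA k \<zeta>))) \<and>
         (scrJ k \<nu> w (cvec x) * Delta_pow (cvec x) (\<nu> - complex_of_real (k * (real CARD('n) - 1)) - 1)
          = gamma_n1 k TYPE('n) \<nu> / (complex_of_real ((cA k TYPE('n))\<^sup>2) * \<i> ^ CARD('n)) *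
            line_integral_n s (\<lambda>\<zeta>. bessel_A k (cvec x) \<zeta> * bessel_A k w (- cinvv \<zeta>)
               * Delta_pow \<zeta> (- \<nu>) * complex_of_real (omegaA k \<zeta>)))"
proof -
  interpret dunkl_mult k by unfold_locales (rule assms(1))
  have "Re \<nu> > 2 * k * (real CARD('n) - 1) + 1" using assms(2) by (simp only: mult.assoc)
  from laplace_inversion[OF assms(4) this assms(3)] show ?thesis by (rule conjI)
qed

end
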